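(* Let $G$ be a transitive subgroup of $\mathrm{Homeo}(\mathbb{S}^1)$ which contains a non-constant continuous path. Then one of the following mutually exclusive possibilities holds: (1) $G$ is conjugate to $\mathrm{SO}(2,\mathbb{R})$ in $\mathrm{Homeo}(\mathbb{S}^1)$. (2) $G$ is conjugate to $\mathrm{PSL}(2,\mathbb{R})$ in $\mathrm{Homeo}(\mathbb{S}^1)$. (3) For every $f\in\mathrm{Homeo}(\mathbb{S}^1)$ and each finite set of points $x_1,\dots,x_n\in\mathbb{S}^1$ there exists $g\in G$ such that $g(x_i)=f(x_i)$ for each $i$. (4) $G$ is a cyclic cover, of some order $k>1$, of a conjugate of $\mathrm{PSL}(2,\mathbb{R})$ in $\mathrm{Homeo}(\mathbb{S}^1)$, and hence $G$ is conjugate in $\mathrm{Homeo}(\mathbb{S}^1)$ to $\mathrm{PSL}_k(2,\mathbb{R})$ for some $k>1$. (5) $G$ is a cyclic cover, of some order $k>1$, of a subgroup $H$ of $\mathrm{Homeo}(\mathbb{S}^1)$ satisfying condition (3) (with $H$ in place of $G$).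
   Context: $\mathrm{Homeo}(\mathbb{S}^1)$ is the group of orientation-preserving homeomorphisms of the circle with the uniform topology, induced by the metric $d(g_1,g_2)=\sup_{x}\max\{d_{\mathbb{S}^1}(g_1(x),g_2(x)),d_{\mathbb{S}^1}(g_1^{-1}(x),g_2^{-1}(x))\}$; subgroups carry the subspace topology. A subgroup $G$ is transitive if for all $x,y\in\mathbb{S}^1$ there is $f\in G$ with $f(x)=y$. A continuous path in $G$ is a continuous map $[0,1]\to G$. $\mathrm{SO}(2,\mathbb{R})$ is the group of rotations of $\mathbb{S}^1$ and $\mathrm{PSL}(2,\mathbb{R})$ the group of (orientation-preserving) Möbius transformations of $\mathbb{S}^1$ (those preserving the unit disc, restricted to the circle). A subgroup $G<\mathrm{Homeo}(\mathbb{S}^1)$ is a cyclic cover of order $k$ of a subgroup $H<\mathrm{Homeo}(\mathbb{S}^1)$ if there is $R\in\mathrm{Homeo}(\mathbb{S}^1)$, conjugate in $\mathrm{Homeo}(\mathbb{S}^1)$ to a rotation of finite order $k$, such that $R\circ g=g\circ R$ for every $g\in G$ and, with $\Gamma=\langle R\rangle$, the group of homeomorphisms of $\mathbb{S}^1/\Gamma\cong\mathbb{S}^1$ induced by the elements of $G$ is $H$ (for some orientation-preserving identification $\mathbb{S}^1/\Gamma\cong\mathbb{S}^1$). $\mathrm{PSL}_k(2,\mathbb{R})$ is the $k$-fold cyclic cover of $\mathrm{PSL}(2,\mathbb{R})$: the group of all $h\in\mathrm{Homeo}(\mathbb{S}^1)$ for which there is $g\in\mathrm{PSL}(2,\mathbb{R})$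 with $p_k\circ h=g\circ p_k$, where $p_k(z)=z^k$ on $\mathbb{S}^1\subset\mathbb{C}$. *)

theory Defs
  imports "HOL-Analysis.Analysis" "HOL-Algebra.Group_Action" "HOL-Algebra.Multiplicative_Group"
    "HOL-Algebra.Generated_Groups"
begin

abbreviation S1 :: "complex set" where
  "S1 \<equiv> sphere 0 1"

text \<open>A continuous self-map of the circle preserves orientation if it lifts, through the
  universal covering map \<^const>\<open>cis\<close>, to a strictly increasing continuous function on the line.
  The definition does not ask for injectivity: it is also used for covering maps of degree at
  least one.\<close>

definition orientation_preserving :: "(complex \<Rightarrow> complex) \<Rightarrow> bool" where
  "orientation_preserving f \<longleftrightarrow>
     (\<exists>F :: real \<Rightarrow> real. continuous_on UNIV F \<and> strict_mono F \<and> (\<forall>t. f (cis t) = cis (F t)))"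

text \<open>Homeomorphisms of the circle are extensional functions (undefined off the circle), so that
  equality of group elements is equality on the circle. Multiplication is composition.\<close>

definition HomeoS1 :: "(complex \<Rightarrow> complex) monoid" where
  "HomeoS1 = BijGroup S1
     \<lparr>carrier := {f \<in> Bij S1. (\<exists>g. homeomorphism S1 S1 f g) \<and> orientation_preserving f}\<rparr>"

lemma orientation_preserving_lift_surj:
  assumes cont: "continuous_on UNIV (F :: real \<Rightarrow> real)" and mono: "strict_mono F"
    and lift: "\<And>t. f (cis t) = cis (F t)"
  shows "surj F"
proof -
  have step: "F (t + 2 * pi) \<ge> F t + 2 * pi" for t
  proof -
    have "cis (t + 2 * pi) = cis t"
      by (simp add: cis_mult [symmetric])
    hence "cis (F (t + 2 * pi)) = cis (F t)"
      using lift by metis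
    hence "cos (F (t + 2 * pi)) = cos (F t) \<and> sin (F (t + 2 * pi)) = sin (F t)"
      by (simp add: complex_eq_iff)
    then obtain n :: int where n: "F (t + 2 * pi) = F t + 2 * pi * n"
      by (metis sin_cos_eq_iff)
    have "F t < F (t + 2 * pi)"
      using mono by (simp add: strict_mono_def)
    hence "0 < pi * real_of_int n"
      using n by linarith
    hence "n \<ge> 1"
      by (simp add: zero_less_mult_iff)
    hence "2 * pi * 1 \<le> 2 * pi * real_of_int n"
      by (intro mult_left_mono) auto
    thus ?thesis
      using n by linarith
  qed
  have up: "F (2 * pi * real m) \<ge> F 0 + 2 * pi * real m" for m
  proof (induction m)
    case (Suc m)
    show ?case
      using step [of "2 * pi * real m"] Suc by (simp add: algebra_simps)
  qed simp
  have down: "F (- (2 * pi * real m)) \<le> F 0 - 2 * pi * real m" for m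
  proof (induction m)
    case (Suc m)
    show ?case
      using step [of "- (2 * pi * real (Suc m))"] Suc by (simp add: algebra_simps)
  qed simp
  have "\<exists>x. F x = y" for y
  proof -
    obtain m :: nat where m: "real m \<ge> \<bar>y - F 0\<bar>"
      using real_arch_simple by blast
    have "1 * real m \<le> 2 * pi * real m"
      using pi_ge_two by (intro mult_right_mono) auto
    hence "F (- (2 * pi * real m)) \<le> y" "y \<le> F (2 * pi * real m)"
      using up [of m] down [of m] m by linarith+
    moreover have "- (2 * pi * real m) \<le> 2 * pi * real m"
      by simp
    ultimately show ?thesis
      using IVT' [of F _ y] continuous_on_subset [OF cont] by blast
  qed
  thus ?thesis
    by (metis surjI)
qed

lemma cis_in_S1 [simp]: "cis t \<in> S1"
  by simp

lemma group_HomeoS1: "group HomeoS1"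
proof -
  let ?H = "{f \<in> Bij S1. (\<exists>g. homeomorphism S1 S1 f g) \<and> orientation_preserving f}"
  interpret B: group "BijGroup S1"
    by (rule group_BijGroup)
  have "subgroup ?H (BijGroup S1)"
  proof (rule B.subgroupI)
    show "?H \<subseteq> carrier (BijGroup S1)"
      by (auto simp: BijGroup_def)
    have "(\<lambda>x\<in>S1. x) \<in> ?H"
    proof -
      have "homeomorphism S1 S1 (\<lambda>x\<in>S1. x) (\<lambda>x. x)"
        by (rule homeomorphism_cong [OF homeomorphism_ident]) auto
      moreover have "orientation_preserving (\<lambda>x\<in>S1. x)"
        unfolding orientation_preserving_def
        by (rule exI [of _ "\<lambda>x. x"]) (auto simp: strict_mono_def)
      ultimately show ?thesis
        using id_Bij by blast
    qed
    thus "?H \<noteq> {}"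
      by blast
  next
    fix f assume f: "f \<in> ?H"
    then obtain g F where g: "homeomorphism S1 S1 f g"
      and F: "continuous_on UNIV F" "strict_mono F" "\<And>t. f (cis t) = cis (F t)"
      unfolding orientation_preserving_def by blast
    have B: "f \<in> Bij S1"
      using f by blast
    let ?i = "\<lambda>x\<in>S1. inv_into S1 f x"
    have inv: "inv\<^bsub>BijGroup S1\<^esub> f = ?i"
      using B by (rule inv_BijGroup)
    have bij: "bij_betw f S1 S1"
      using B by (simp add: Bij_def)
    have eq: "inv_into S1 f x = g x" if "x \<in> S1" for x
      using that g bij unfolding homeomorphism_def bij_betw_def
      by (metis imageI inv_into_f_f)
    have h: "homeomorphism S1 S1 ?i f"
    proof -
      have "homeomorphism S1 S1 g f"
        using g by (rule homeomorphism_symD)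
      thus ?thesis
        by (rule homeomorphism_cong) (auto simp: eq)
    qed
    have "surj F"
      using F orientation_preserving_lift_surj by blast
    have injF: "inj F"
      using F(2) by (rule strict_mono_imp_inj_on)
    have invF: "F (inv_into UNIV F s) = s" for s
      using \<open>surj F\<close> by (rule surj_f_inv_f)
    have smi: "strict_mono (inv_into UNIV F)"
      by (rule strict_monoI) (metis invF F(2) strict_mono_less)
    have coni: "continuous_on UNIV (inv_into UNIV F)"
    proof -
      have "mono (inv_into UNIV F)" using smi by (rule strict_mono_mono)
      moreover have "range (inv_into UNIV F) = UNIV"
        using injF by (rule inj_imp_surj_inv)
      ultimately show ?thesis
        using continuous_onI_mono [of "inv_into UNIV F" UNIV] by (simp add: mono_def)
    qed
    have "?i (cis s) = cis (inv_into UNIV F s)" for s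
    proof -
      have "f (cis (inv_into UNIV F s)) = cis s"
        using F(3) invF by simp
      hence "inv_into S1 f (cis s) = cis (inv_into UNIV F s)"
        using bij by (metis bij_betw_def cis_in_S1 inv_into_f_f)
      thus ?thesis by simp
    qed
    hence "orientation_preserving ?i"
      unfolding orientation_preserving_def using smi coni by blast
    thus "inv\<^bsub>BijGroup S1\<^esub> f \<in> ?H"
      using h restrict_inv_into_Bij [OF B] unfolding inv by blast
  next
    fix f g assume f: "f \<in> ?H" and g: "g \<in> ?H"
    have mult: "f \<otimes>\<^bsub>BijGroup S1\<^esub> g = compose S1 f g"
      using f g by (simp add: BijGroup_def)
    obtain f' g' where "homeomorphism S1 S1 f f'" "homeomorphism S1 S1 g g'"
      using f g by blast
    hence "homeomorphism S1 S1 (f \<circ> g) (g' \<circ> f')"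
      by (metis homeomorphism_compose)
    hence hom: "homeomorphism S1 S1 (compose S1 f g) (g' \<circ> f')"
      by (rule homeomorphism_cong) (auto simp: compose_def)
    obtain F G where F: "continuous_on UNIV F" "strict_mono F" "\<And>t. f (cis t) = cis (F t)"
      and G: "continuous_on UNIV G" "strict_mono G" "\<And>t. g (cis t) = cis (G t)"
      using f g unfolding orientation_preserving_def by blast
    have "continuous_on UNIV (\<lambda>t. F (G t))"
      using F(1) G(1) by (metis continuous_on_compose2 subset_UNIV)
    moreover have "strict_mono (\<lambda>t. F (G t))"
      using F(2) G(2) by (simp add: strict_mono_def)
    ultimately have "orientation_preserving (compose S1 f g)"
      unfolding orientation_preserving_def
      by (intro exI [of _ "\<lambda>t. F (G t)"]) (simp add: compose_def F(3) G(3))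
    thus "f \<otimes>\<^bsub>BijGroup S1\<^esub> g \<in> ?H"
      using hom compose_Bij f g unfolding mult by blast
  qed
  thus ?thesis
    unfolding HomeoS1_def by (rule B.subgroup_imp_group)
qed

text \<open>Off the group the metric is set to zero, because \<^locale>\<open>Metric_space\<close> demands
  non-negativity on the whole type; this does not affect the topology.\<close>

definition homeo_dist :: "(complex \<Rightarrow> complex) \<Rightarrow> (complex \<Rightarrow> complex) \<Rightarrow> real" where
  "homeo_dist f g =
     (if f \<in> carrier HomeoS1 \<and> g \<in> carrier HomeoS1
      then SUP x\<in>S1. max (dist (f x) (g x)) (dist (inv_into S1 f x) (inv_into S1 g x))
      else 0)"

lemma carrier_HomeoS1_D:
  assumes "f \<in> carrier HomeoS1"
  shows "f \<in> extensional S1" "bij_betw f S1 S1"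
    "\<And>x. x \<in> S1 \<Longrightarrow> f x \<in> S1" "\<And>x. x \<in> S1 \<Longrightarrow> inv_into S1 f x \<in> S1"
proof -
  have B: "f \<in> Bij S1"
    using assms by (simp add: HomeoS1_def)
  show "f \<in> extensional S1" and b: "bij_betw f S1 S1"
    using B by (simp_all add: Bij_def)
  show "\<And>x. x \<in> S1 \<Longrightarrow> f x \<in> S1" "\<And>x. x \<in> S1 \<Longrightarrow> inv_into S1 f x \<in> S1"
    using b Bij_inv_into_mem [OF B] by (auto simp: bij_betw_def)
qed

lemma Metric_space_HomeoS1: "Metric_space (carrier HomeoS1) homeo_dist"
proof -
  let ?C = "carrier HomeoS1"
  let ?m = "\<lambda>f g x. max (dist (f x) (g x)) (dist (inv_into S1 f x) (inv_into S1 g x))"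
  have S1: "(1::complex) \<in> S1"
    by simp
  have two: "dist a b \<le> 2" if "a \<in> S1" "b \<in> S1" for a b :: complex
    using that norm_triangle_ineq4 [of a b] by (simp add: dist_norm)
  have bdd: "bdd_above (?m f g ` S1)" if "f \<in> ?C" "g \<in> ?C" for f g
  proof (rule bdd_aboveI2)
    fix x :: complex assume "x \<in> S1"
    hence "dist (f x) (g x) \<le> 2" "dist (inv_into S1 f x) (inv_into S1 g x) \<le> 2"
      using carrier_HomeoS1_D(3,4) that by (blast intro: two)+
    thus "?m f g x \<le> 2"
      by simp
  qed
  have d: "homeo_dist f g = (SUP x\<in>S1. ?m f g x)" if "f \<in> ?C" "g \<in> ?C" for f g
    using that by (simp add: homeo_dist_def)
  have le: "?m f g x \<le> homeo_dist f g" if "f \<in> ?C" "g \<in> ?C" "x \<in> S1" for f g x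
    unfolding d [OF that(1,2)] by (rule cSUP_upper [OF that(3) bdd [OF that(1,2)]])
  show ?thesis
  proof
    fix f g
    show "0 \<le> homeo_dist f g"
    proof (cases "f \<in> ?C \<and> g \<in> ?C")
      case True
      have "0 \<le> ?m f g 1"
        by (simp add: le_max_iff_disj)
      thus ?thesis
        using le [of f g 1] True S1 by linarith
    qed (auto simp: homeo_dist_def)
    show "homeo_dist f g = homeo_dist g f"
      by (simp add: homeo_dist_def dist_commute conj_commute)
  next
    fix f g assume C: "f \<in> ?C" "g \<in> ?C"
    show "homeo_dist f g = 0 \<longleftrightarrow> f = g"
    proof
      assume z: "homeo_dist f g = 0"
      have "f x = g x" if "x \<in> S1" for x
        using le [OF C that] z by (simp add: max_def split: if_splits)
      thus "f = g"
        using carrier_HomeoS1_D(1) C by (metis extensionalityI)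
    next
      assume "f = g"
      moreover have "S1 \<noteq> ({} :: complex set)"
        using S1 by blast
      ultimately show "homeo_dist f g = 0"
        using d [OF C] by simp
    qed
  next
    fix f g h assume C: "f \<in> ?C" "g \<in> ?C" "h \<in> ?C"
    have "?m f h x \<le> homeo_dist f g + homeo_dist g h" if "x \<in> S1" for x
      using le [OF C(1,2) that] le [OF C(2,3) that]
        dist_triangle [of "f x" "h x" "g x"]
        dist_triangle [of "inv_into S1 f x" "inv_into S1 h x" "inv_into S1 g x"]
      by linarith
    thus "homeo_dist f h \<le> homeo_dist f g + homeo_dist g h"
      unfolding d [OF C(1,3)] using S1 by (intro cSUP_least) auto
  qed
qed

definition HomeoS1_topology :: "(complex \<Rightarrow> complex) topology" where
  "HomeoS1_topology = Metric_space.mtopology (carrier HomeoS1) homeo_dist"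

definition circle_transitive :: "(complex \<Rightarrow> complex) set \<Rightarrow> bool" where
  "circle_transitive G \<longleftrightarrow> (\<forall>x\<in>S1. \<forall>y\<in>S1. \<exists>f\<in>G. f x = y)"

definition has_nonconstant_path :: "(complex \<Rightarrow> complex) set \<Rightarrow> bool" where
  "has_nonconstant_path G \<longleftrightarrow>
     (\<exists>\<gamma>. pathin (subtopology HomeoS1_topology G) \<gamma> \<and> (\<exists>s\<in>{0..1}. \<exists>t\<in>{0..1}. \<gamma> s \<noteq> \<gamma> t))"

definition conj_HomeoS1 ::
  "(complex \<Rightarrow> complex) set \<Rightarrow> (complex \<Rightarrow> complex) set \<Rightarrow> bool" where
  "conj_HomeoS1 G H \<longleftrightarrow>
     (\<exists>c\<in>carrier HomeoS1. G = c <#\<^bsub>HomeoS1\<^esub> H #>\<^bsub>HomeoS1\<^esub> (inv\<^bsub>HomeoS1\<^esub> c))"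

definition SO2R :: "(complex \<Rightarrow> complex) set" where
  "SO2R = {(\<lambda>z\<in>S1. u * z) | u. u \<in> S1}"

text \<open>Division by zero cannot produce spurious elements here: a Moebius transformation with a pole
  in the closed disc is unbounded on the open disc, whatever its value at the pole, so it
  does not satisfy the image condition.\<close>

definition PSL2R :: "(complex \<Rightarrow> complex) set" where
  "PSL2R = {(\<lambda>z\<in>S1. (a * z + b) / (c * z + d)) | a b c d.
     a * d - b * c \<noteq> 0 \<and> (\<lambda>z. (a * z + b) / (c * z + d)) ` ball 0 1 = ball 0 1}"

definition PSLk2R :: "nat \<Rightarrow> (complex \<Rightarrow> complex) set" where
  "PSLk2R k = {h \<in> carrier HomeoS1. \<exists>g\<in>PSL2R. \<forall>z\<in>S1. h z ^ k = g (z ^ k)}"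

abbreviation circle_orbit :: "(complex \<Rightarrow> complex) set \<Rightarrow> complex \<Rightarrow> complex set" where
  "circle_orbit \<Gamma> \<equiv> orbit (HomeoS1\<lparr>carrier := \<Gamma>\<rparr>) (\<lambda>\<gamma>. \<gamma>)"

abbreviation circle_orbits :: "(complex \<Rightarrow> complex) set \<Rightarrow> complex set set" where
  "circle_orbits \<Gamma> \<equiv> orbits (HomeoS1\<lparr>carrier := \<Gamma>\<rparr>) S1 (\<lambda>\<gamma>. \<gamma>)"

definition orbit_space :: "(complex \<Rightarrow> complex) set \<Rightarrow> complex set topology" where
  "orbit_space \<Gamma> = topology (\<lambda>U. U \<subseteq> circle_orbits \<Gamma> \<and>
     openin (top_of_set S1) {x \<in> S1. circle_orbit \<Gamma> x \<in> U})"

lemma openin_orbit_space: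
  "openin (orbit_space \<Gamma>) U \<longleftrightarrow>
     U \<subseteq> circle_orbits \<Gamma> \<and> openin (top_of_set S1) {x \<in> S1. circle_orbit \<Gamma> x \<in> U}"
proof -
  let ?P = "\<lambda>U. U \<subseteq> circle_orbits \<Gamma> \<and>
     openin (top_of_set S1) {x \<in> S1. circle_orbit \<Gamma> x \<in> U}"
  have "istopology ?P"
    unfolding istopology_def
  proof (intro conjI allI impI)
    fix U V assume U: "?P U" and V: "?P V"
    have eq: "{x \<in> S1. circle_orbit \<Gamma> x \<in> U \<inter> V} =
        {x \<in> S1. circle_orbit \<Gamma> x \<in> U} \<inter> {x \<in> S1. circle_orbit \<Gamma> x \<in> V}"
      by blast
    show "openin (top_of_set S1) {x \<in> S1. circle_orbit \<Gamma> x \<in> U \<inter> V}"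
      unfolding eq using U V by (blast intro: openin_Int)
    show "U \<inter> V \<subseteq> circle_orbits \<Gamma>"
      using U by blast
  next
    fix \<U> assume U: "\<forall>U\<in>\<U>. ?P U"
    have eq: "{x \<in> S1. circle_orbit \<Gamma> x \<in> \<Union>\<U>} = (\<Union>U\<in>\<U>. {x \<in> S1. circle_orbit \<Gamma> x \<in> U})"
      by blast
    show "openin (top_of_set S1) {x \<in> S1. circle_orbit \<Gamma> x \<in> \<Union>\<U>}"
      unfolding eq using U by (blast intro: openin_Union)
    show "\<Union>\<U> \<subseteq> circle_orbits \<Gamma>"
      using U by blast
  qed
  thus ?thesis
    by (simp add: orbit_space_def topology_inverse')
qed

text \<open>\<open>\<phi>\<close> identifies the orbit space with the circle; it preserves orientation iff its composite
  with the projection (a covering map) does. An element \<open>g\<close> commuting with \<open>R\<close> induces the map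
  \<open>A \<mapsto> g ` A\<close> on orbits.\<close>

definition cyclic_cover ::
  "nat \<Rightarrow> (complex \<Rightarrow> complex) set \<Rightarrow> (complex \<Rightarrow> complex) set \<Rightarrow> bool" where
  "cyclic_cover k G H \<longleftrightarrow>
     subgroup G HomeoS1 \<and> subgroup H HomeoS1 \<and> k > 0 \<and>
     (\<exists>R\<in>carrier HomeoS1.
        (\<exists>\<rho>\<in>SO2R. group.ord HomeoS1 \<rho> = k \<and>
           (\<exists>c\<in>carrier HomeoS1. R = c \<otimes>\<^bsub>HomeoS1\<^esub> \<rho> \<otimes>\<^bsub>HomeoS1\<^esub> inv\<^bsub>HomeoS1\<^esub> c)) \<and>
        (\<forall>g\<in>G. R \<otimes>\<^bsub>HomeoS1\<^esub> g = g \<otimes>\<^bsub>HomeoS1\<^esub> R) \<and>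
        (let \<Gamma> = generate HomeoS1 {R} in
         \<exists>\<phi>. homeomorphic_map (orbit_space \<Gamma>) (top_of_set S1) \<phi> \<and>
             orientation_preserving (\<lambda>x. \<phi> (circle_orbit \<Gamma> x)) \<and>
             H = {h \<in> carrier HomeoS1. \<exists>g\<in>G. \<forall>A\<in>circle_orbits \<Gamma>. h (\<phi> A) = \<phi> (g ` A)}))"

definition interpolates_HomeoS1 :: "(complex \<Rightarrow> complex) set \<Rightarrow> bool" where
  "interpolates_HomeoS1 G \<longleftrightarrow>
     (\<forall>f\<in>carrier HomeoS1. \<forall>X. finite X \<and> X \<subseteq> S1 \<longrightarrow> (\<exists>g\<in>G. \<forall>x\<in>X. g x = f x))"

end

theory Submission
  imports Defs
begin

text \<open>
  The group is replaced by the group \<open>L\<close> of all lifts of its elements to the line, and \<open>L\<close> by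
  the normal subgroup \<open>A\<close> of all elements which are joined to the identity by a compact connected
  set; a nonconstant path makes \<open>A\<close> nontrivial and then transitive on the line. Connectedness by
  compact sets, in place of path connectedness, is inherited by point stabilizers: by a mountain
  climbing argument a connection between two elements fixing a point can be replaced by one
  through elements fixing that point.

  If \<open>A\<close> acts freely, then it is conjugate to the group of translations by Hoelder's theorem, and
  so is \<open>L\<close>. Otherwise the map from a point to the next common fixed point of its stabilizer commutes
  with \<open>L\<close> and is a root of the full turn, of order \<open>k\<close>; dividing the circle by it reduces the
  theorem to \<open>k = 1\<close>, where point stabilizers have only the obvious common fixed points. Then by
  induction \<open>A\<close> is transitive on cyclically ordered \<open>n\<close>-tuples, unless the stabilizer of some
  tuple acts freely on the rest of the circle. The latter can occur only for pairs, because
  homeomorphisms with interlacing fixed points cross too often. In this case point stabilizers are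
  sharply two-transitive on the complementary interval, hence conjugate to the affine group of
  the line, and together with an element exchanging \<open>0\<close> and \<open>\<infinity>\<close> they generate the Moebius group.

  The alternatives exclude each other since the groups differ in whether they are commutative,
  whether the stabilizer of a point moves all other points, and whether the number of fixed points
  of nontrivial elements is bounded.
\<close>

text \<open>The obstacle is that paths are too rigid for stabilizers. Climbing a continuous profile
  from both ends at equal height need not be possible along paths; what always exists is a connected
  set of pairs of equal height. Compact sets crossed by chains of arbitrarily small mesh are a form
  of connectedness that survives this, and a combinatorial lemma on a finite grid is enough to
  produce the pairs. Compactness is used a second time: it replaces continuous local sections of the
  orbit maps. Points converging to \<open>x\<close> are reached from \<open>x\<close>, along a
  subsequence, by elements converging to the identity, so that every equivariant map is continuous.
  The passage to lifts is forced by order: next fixed points, comparison of two elements and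
  Hoelder's theorem make sense on the line only, and prescribing the image of one lifted point
  removes the ambiguity by full turns. Lifts form a type of their own, so that group cancellation,
  limits and compactness come from type classes.\<close>

typedef lift = "{f :: real \<Rightarrow> real. strict_mono f \<and> continuous_on UNIV f \<and>
    (\<forall>x. f (x + 2 * pi) = f x + 2 * pi)}"
  morphisms ap Lift
  by (rule exI [of _ "\<lambda>x. x"]) (auto simp: strict_mono_def)

lemma ap_strict_mono: "strict_mono (ap f)"
  and ap_continuous_on_UNIV: "continuous_on UNIV (ap f)"
  and ap_add_2pi [simp]: "ap f (x + 2 * pi) = ap f x + 2 * pi"
  using ap [of f] by auto

lemma ap_continuous_on [continuous_intros]:
  "continuous_on S g \<Longrightarrow> continuous_on S (\<lambda>x. ap f (g x))"
  using ap_continuous_on_UNIV continuous_on_compose2 by blast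

lemma ap_less_iff [simp]: "ap f x < ap f y \<longleftrightarrow> x < y"
  by (simp add: ap_strict_mono strict_mono_less)

lemma ap_le_iff [simp]: "ap f x \<le> ap f y \<longleftrightarrow> x \<le> y"
  by (simp add: ap_strict_mono strict_mono_less_eq)

lemma ap_eq_iff [simp]: "ap f x = ap f y \<longleftrightarrow> x = y"
  by (simp add: ap_strict_mono strict_mono_eq)

lemma lift_eqI: "(\<And>x. ap f x = ap g x) \<Longrightarrow> f = g"
  by (metis ap_inject ext)

lemma ap_Lift:
  assumes "strict_mono f" "continuous_on UNIV f" "\<And>x. f (x + 2 * pi) = f x + 2 * pi"
  shows "ap (Lift f) = f"
  using assms by (simp add: Lift_inverse)

lemma ap_add_int [simp]: "ap f (x + 2 * pi * of_int m) = ap f x + 2 * pi * of_int m"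
proof -
  have nat: "ap f (x + 2 * pi * real n) = ap f x + 2 * pi * real n" for x n
  proof (induction n)
    case (Suc n)
    have "x + 2 * pi * real (Suc n) = (x + 2 * pi * real n) + 2 * pi"
      by (simp add: algebra_simps)
    then have "ap f (x + 2 * pi * real (Suc n)) = ap f (x + 2 * pi * real n) + 2 * pi"
      by (simp only: ap_add_2pi)
    then show ?case
      using Suc by (simp add: algebra_simps)
  qed simp
  show ?thesis
  proof (cases "m \<ge> 0")
    case True
    then show ?thesis using nat [of x "nat m"] by simp
  next
    case False
    then show ?thesis
      using nat [of "x + 2 * pi * of_int m" "nat (- m)"] by simp
  qed
qed

lemma ap_surj: "surj (ap f)"
proof -
  have "\<exists>x. y = ap f x" for y
  proof -
    obtain m :: nat where m: "\<bar>y - ap f 0\<bar> \<le> real m"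
      using real_arch_simple by blast
    have "1 * real m \<le> 2 * pi * real m"
      using pi_ge_two by (intro mult_right_mono) auto
    then have "ap f (- (2 * pi * real m)) \<le> y" "y \<le> ap f (2 * pi * real m)"
      using m ap_add_int [of f 0 "int m"] ap_add_int [of f 0 "- int m"] by auto
    then obtain x where "ap f x = y"
      using IVT' [of "ap f" _ y] continuous_on_subset [OF ap_continuous_on_UNIV]
      by (metis ap_le_iff order_trans subset_UNIV)
    then show ?thesis by blast
  qed
  then show ?thesis by (auto simp: surj_def)
qed

section \<open>The topological group of lifts\<close>

instantiation lift :: group_add
begin

definition zero_lift :: lift where "zero_lift = Lift (\<lambda>x. x)"
text \<open>Addition is not commutative. As \<open>f - g\<close> is \<open>f\<close> after the
  inverse of \<open>g\<close>, the conjugate of \<open>g\<close> by \<open>c\<close> reads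
  \<open>c + g - c\<close>; normality and conjugacy appear below in this form.\<close>

definition plus_lift :: "lift \<Rightarrow> lift \<Rightarrow> lift" where "plus_lift f g = Lift (\<lambda>x. ap f (ap g x))"
definition uminus_lift :: "lift \<Rightarrow> lift" where "uminus_lift f = Lift (inv_into UNIV (ap f))"
definition minus_lift :: "lift \<Rightarrow> lift \<Rightarrow> lift" where "minus_lift f g = f + - g"

lemma ap_zero [simp]: "ap 0 x = x"
  unfolding zero_lift_def by (subst ap_Lift) (auto simp: strict_mono_def)

lemma ap_plus [simp]: "ap (f + g) x = ap f (ap g x)"
  unfolding plus_lift_def
  by (subst ap_Lift) (auto simp: strict_mono_def intro!: continuous_intros)

lemma ap_uminus_inv: "ap (- f) = inv_into UNIV (ap f)"
proof -
  have r: "ap f (inv_into UNIV (ap f) y) = y" for y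
    by (simp add: ap_surj surj_f_inv_f)
  have "strict_mono (inv_into UNIV (ap f))"
    by (rule strict_monoI) (metis ap_less_iff r)
  moreover from this have "continuous_on UNIV (inv_into UNIV (ap f))"
  proof -
    have "range (inv_into UNIV (ap f)) = UNIV"
      by (simp add: ap_strict_mono inj_imp_surj_inv strict_mono_imp_inj_on)
    then show ?thesis
      using \<open>strict_mono (inv_into UNIV (ap f))\<close> continuous_onI_mono [of "inv_into UNIV (ap f)" UNIV]
      by (simp add: strict_mono_less_eq)
  qed
  moreover have "inv_into UNIV (ap f) (x + 2 * pi) = inv_into UNIV (ap f) x + 2 * pi" for x
    by (metis ap_add_2pi ap_eq_iff r)
  ultimately show ?thesis
    unfolding uminus_lift_def by (rule ap_Lift)
qed

lemma ap_ap_uminus [simp]: "ap f (ap (- f) x) = x"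
  by (simp add: ap_uminus_inv ap_surj surj_f_inv_f)

lemma ap_uminus_ap [simp]: "ap (- f) (ap f x) = x"
  by (metis ap_ap_uminus ap_eq_iff)

instance
  by standard (auto intro!: lift_eqI simp: minus_lift_def)

end

lemma ap_uminus_eq_iff: "ap (- f) x = y \<longleftrightarrow> x = ap f y"
  by auto

lemma ap_minus [simp]: "ap (f - g) x = ap f (ap (- g) x)"
  by (simp only: minus_lift_def ap_plus)

lemma reduce_2pi:
  obtains m :: int where "0 \<le> x - 2 * pi * of_int m" "x - 2 * pi * of_int m < 2 * pi"
proof -
  define m where "m = \<lfloor>x / (2 * pi)\<rfloor>"
  have "of_int m \<le> x / (2 * pi)" "x / (2 * pi) < of_int m + 1"
    unfolding m_def by linarith+
  then have "2 * pi * of_int m \<le> x" "x < 2 * pi * (of_int m + 1)"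
    by (simp_all add: field_simps)
  then show ?thesis using that [of m] by (simp add: algebra_simps)
qed

instantiation lift :: metric_space
begin

text \<open>By periodicity one period gives the supremum over the line, so this is uniform distance.
  Continuity of inversion is derived below from the uniform continuity of
  \<open>- f\<close>.\<close>

definition dist_lift :: "lift \<Rightarrow> lift \<Rightarrow> real" where
  "dist_lift f g = (SUP x\<in>{0..2 * pi}. \<bar>ap f x - ap g x\<bar>)"

definition uniformity_lift :: "(lift \<times> lift) filter" where
  "uniformity_lift = (INF e\<in>{0 <..}. principal {(x, y). dist x y < e})"

definition open_lift :: "lift set \<Rightarrow> bool" where
  "open_lift U \<longleftrightarrow> (\<forall>x\<in>U. eventually (\<lambda>(x', y). x' = x \<longrightarrow> y \<in> U) uniformity)"

lemma lift_bdd: "bdd_above ((\<lambda>x. \<bar>ap f x - ap g x\<bar>) ` {0..2 * pi})"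
  by (intro bounded_imp_bdd_above compact_imp_bounded compact_continuous_image continuous_intros)
    auto

lemma abs_ap_diff_le_dist: "\<bar>ap f x - ap g x\<bar> \<le> dist f g"
proof -
  obtain m :: int where m: "0 \<le> x - 2 * pi * of_int m" "x - 2 * pi * of_int m < 2 * pi"
    by (rule reduce_2pi)
  define y where "y = x - 2 * pi * of_int m"
  have "\<bar>ap f y - ap g y\<bar> \<le> dist f g"
    unfolding dist_lift_def using m lift_bdd by (intro cSUP_upper) (auto simp: y_def)
  moreover have "x = y + 2 * pi * of_int m"
    by (simp add: y_def)
  ultimately show ?thesis
    by simp
qed

lemma lift_dist_leI: "(\<And>x. \<bar>ap f x - ap g x\<bar> \<le> e) \<Longrightarrow> dist f g \<le> e"
  unfolding dist_lift_def by (intro cSUP_least) auto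

instance
proof
  fix f g h :: lift
  show "dist f g = 0 \<longleftrightarrow> f = g"
  proof
    assume "dist f g = 0"
    then have "\<bar>ap f x - ap g x\<bar> \<le> 0" for x
      by (metis abs_ap_diff_le_dist)
    then show "f = g"
      by (intro lift_eqI) (metis abs_le_zero_iff right_minus_eq)
  next
    assume "f = g"
    then have "dist f g \<le> 0" by (intro lift_dist_leI) auto
    moreover have "dist f g \<ge> 0"
      using abs_ap_diff_le_dist [of f 0 g] by linarith
    ultimately show "dist f g = 0" by linarith
  qed
  show "dist f g \<le> dist f h + dist g h"
  proof (rule lift_dist_leI)
    show "\<bar>ap f x - ap g x\<bar> \<le> dist f h + dist g h" for x
      using abs_ap_diff_le_dist [of f x h] abs_ap_diff_le_dist [of g x h] by linarith
  qed
qed (rule uniformity_lift_def open_lift_def)+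

end

lemma ap_uniformly_continuous:
  assumes "e > 0"
  obtains d where "d > 0" "\<And>x y. \<bar>x - y\<bar> < d \<Longrightarrow> \<bar>ap f x - ap f y\<bar> < e"
proof -
  \<comment> \<open>The margin 1 keeps \<open>y\<close> in the interval when \<open>x\<close> is
    moved into one period, provided that \<open>\<bar>x - y\<bar> < 1\<close>.\<close>
  have "uniformly_continuous_on {-1..2 * pi + 1} (ap f)"
    by (intro compact_uniformly_continuous continuous_intros) auto
  then obtain d where d: "d > 0"
    "\<And>x y. x \<in> {-1..2 * pi + 1} \<Longrightarrow> y \<in> {-1..2 * pi + 1} \<Longrightarrow> dist y x < d \<Longrightarrow> dist (ap f y) (ap f x) < e"
    unfolding uniformly_continuous_on_def using assms by metis
  show ?thesis
  proof
    show "min d 1 > 0" using d by simp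
    fix x y :: real assume xy: "\<bar>x - y\<bar> < min d 1"
    obtain m :: int where m: "0 \<le> x - 2 * pi * of_int m" "x - 2 * pi * of_int m < 2 * pi"
      by (rule reduce_2pi)
    define x' y' where "x' = x - 2 * pi * of_int m" and "y' = y - 2 * pi * of_int m"
    have "\<bar>ap f x' - ap f y'\<bar> < e"
      using d(2) [of y' x'] xy m by (auto simp: x'_def y'_def dist_real_def abs_if split: if_splits)
    moreover have "x = x' + 2 * pi * of_int m" "y = y' + 2 * pi * of_int m"
      by (simp_all add: x'_def y'_def)
    ultimately show "\<bar>ap f x - ap f y\<bar> < e" by simp
  qed
qed

lemma tendsto_liftI:
  assumes "\<And>e. e > 0 \<Longrightarrow> \<forall>\<^sub>F n in F. \<forall>x. \<bar>ap (f n) x - ap l x\<bar> \<le> e"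
  shows "(f \<longlongrightarrow> l) F"
proof (rule tendstoI)
  fix e :: real assume "e > 0"
  then have "\<forall>\<^sub>F n in F. \<forall>x. \<bar>ap (f n) x - ap l x\<bar> \<le> e / 2"
    by (intro assms) simp
  then show "\<forall>\<^sub>F n in F. dist (f n) l < e"
  proof eventually_elim
    case (elim n)
    then have "dist (f n) l \<le> e / 2" by (intro lift_dist_leI) blast
    then show ?case using \<open>e > 0\<close> by simp
  qed
qed

lemma tendsto_ap [tendsto_intros]:
  assumes f: "(f \<longlongrightarrow> l) F" and g: "(g \<longlongrightarrow> a) F"
  shows "((\<lambda>n. ap (f n) (g n)) \<longlongrightarrow> ap l a) F"
proof (rule tendstoI)
  fix e :: real assume "e > 0"
  then obtain d where d: "d > 0" "\<And>x y. \<bar>x - y\<bar> < d \<Longrightarrow> \<bar>ap l x - ap l y\<bar> < e / 2"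
    using ap_uniformly_continuous [of "e / 2"] by auto
  have "\<forall>\<^sub>F n in F. dist (f n) l < e / 2" "\<forall>\<^sub>F n in F. dist (g n) a < d"
    using tendstoD [OF f, of "e / 2"] tendstoD [OF g, of d] \<open>e > 0\<close> d(1) by simp_all
  then show "\<forall>\<^sub>F n in F. dist (ap (f n) (g n)) (ap l a) < e"
  proof eventually_elim
    case (elim n)
    then show ?case
      using d(2) [of "g n" a] abs_ap_diff_le_dist [of "f n" "g n" l]
      unfolding dist_real_def by linarith
  qed
qed

instance lift :: topological_group_add
proof
  fix f g :: lift
  show "((\<lambda>x. fst x + snd x) \<longlongrightarrow> f + g) (nhds f \<times>\<^sub>F nhds g)"
  proof (rule tendsto_liftI)
    fix e :: real assume "e > 0"
    then obtain d where d: "d > 0" "\<And>x y. \<bar>x - y\<bar> < d \<Longrightarrow> \<bar>ap f x - ap f y\<bar> < e / 2"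
      using ap_uniformly_continuous [of "e / 2"] by auto
    have "\<forall>\<^sub>F u in nhds f. dist u f < e / 2" "\<forall>\<^sub>F v in nhds g. dist v g < d"
      using \<open>e > 0\<close> d(1) unfolding eventually_nhds_metric
      by (metis half_gt_zero)+
    then have "\<forall>\<^sub>F z in nhds f \<times>\<^sub>F nhds g. dist (fst z) f < e / 2 \<and> dist (snd z) g < d"
      using eventually_prodI by force
    then show "\<forall>\<^sub>F z in nhds f \<times>\<^sub>F nhds g. \<forall>x. \<bar>ap (fst z + snd z) x - ap (f + g) x\<bar> \<le> e"
    proof eventually_elim
      case (elim z)
      show ?case
      proof
        fix x
        have "\<bar>ap (fst z) (ap (snd z) x) - ap f (ap (snd z) x)\<bar> < e / 2"
          using elim abs_ap_diff_le_dist le_less_trans by blast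
        moreover have "\<bar>ap f (ap (snd z) x) - ap f (ap g x)\<bar> < e / 2"
          using elim abs_ap_diff_le_dist [of "snd z" x g] by (intro d) linarith
        ultimately show "\<bar>ap (fst z + snd z) x - ap (f + g) x\<bar> \<le> e"
          unfolding ap_plus by linarith
      qed
    qed
  qed
  show "(uminus \<longlongrightarrow> - f) (nhds f)"
  proof (rule tendsto_liftI)
    fix e :: real assume "e > 0"
    then obtain d where d: "d > 0" "\<And>x y. \<bar>x - y\<bar> < d \<Longrightarrow> \<bar>ap (- f) x - ap (- f) y\<bar> < e"
      using ap_uniformly_continuous [of e] by auto
    have "\<forall>\<^sub>F u in nhds f. dist u f < d"
      using d(1) by (auto simp: eventually_nhds_metric)
    then show "\<forall>\<^sub>F u in nhds f. \<forall>x. \<bar>ap (- u) x - ap (- f) x\<bar> \<le> e"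
    proof eventually_elim
      case (elim u)
      show ?case
      proof
        fix x
        \<comment> \<open>Since \<open>ap u y = x\<close>, the point \<open>ap f y\<close> is within
          \<open>d\<close> of \<open>x\<close>; applying \<open>- f\<close> compares
          \<open>y\<close> with \<open>ap (- f) x\<close>.\<close>
        define y where "y = ap (- u) x"
        have "\<bar>ap f y - x\<bar> < d"
          using elim abs_ap_diff_le_dist [of u y f] by (simp add: y_def abs_minus_commute)
        from d(2) [OF this] show "\<bar>ap (- u) x - ap (- f) x\<bar> \<le> e"
          by (simp add: y_def)
      qed
    qed
  qed
qed

lemma tendsto_ap_const [tendsto_intros]: "(f \<longlongrightarrow> l) F \<Longrightarrow> ((\<lambda>n. ap (f n) x) \<longlongrightarrow> ap l x) F"
  by (rule tendsto_ap [OF _ tendsto_const])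

lemma tendsto_minus_lift [tendsto_intros]:
  fixes l m :: lift
  assumes "(f \<longlongrightarrow> l) F" "(g \<longlongrightarrow> m) F"
  shows "((\<lambda>n. f n - g n) \<longlongrightarrow> l - m) F"
  unfolding minus_lift_def by (rule tendsto_add [OF assms(1) tendsto_minus [OF assms(2)]])

section \<open>Subgroups connected through compact well-chained sets\<close>

definition add_subgroup :: "'a::group_add set \<Rightarrow> bool" where
  "add_subgroup A \<longleftrightarrow> 0 \<in> A \<and> (\<forall>a\<in>A. \<forall>b\<in>A. a - b \<in> A)"

lemma add_subgroupD:
  assumes "add_subgroup A"
  shows "0 \<in> A" "a \<in> A \<Longrightarrow> - a \<in> A" "a \<in> A \<Longrightarrow> b \<in> A \<Longrightarrow> a + b \<in> A" "a \<in> A \<Longrightarrow> b \<in> A \<Longrightarrow> a - b \<in> A"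
proof -
  have 0: "0 \<in> A" and d: "\<And>a b. a \<in> A \<Longrightarrow> b \<in> A \<Longrightarrow> a - b \<in> A"
    using assms by (auto simp: add_subgroup_def)
  have m: "- a \<in> A" if "a \<in> A" for a
    using d [OF 0 that] by simp
  show "0 \<in> A" "a \<in> A \<Longrightarrow> - a \<in> A" "a \<in> A \<Longrightarrow> b \<in> A \<Longrightarrow> a - b \<in> A"
    using 0 d m by blast+
  show "a \<in> A \<Longrightarrow> b \<in> A \<Longrightarrow> a + b \<in> A"
    using d [of a "- b"] m by simp
qed

text \<open>The closure is reflexive on the whole type: even a point outside \<open>S\<close> is
  chained to itself, so membership of end points is stated separately.\<close>

definition chain :: "real \<Rightarrow> 'a::metric_space set \<Rightarrow> ('a \<times> 'a) set" where
  "chain e S = {(p, q). p \<in> S \<and> q \<in> S \<and> dist p q < e}\<^sup>*"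

definition well_chained :: "'a::metric_space set \<Rightarrow> 'a \<Rightarrow> 'a \<Rightarrow> bool" where
  "well_chained S p q \<longleftrightarrow> (\<forall>e>0. (p, q) \<in> chain e S)"

text \<open>For a compact set, being well-chained means lying in one connected component.\<close>

definition cc :: "lift set \<Rightarrow> bool" where
  "cc A \<longleftrightarrow> add_subgroup A \<and>
     (\<forall>a\<in>A. \<exists>C\<subseteq>A. compact C \<and> 0 \<in> C \<and> a \<in> C \<and> well_chained C 0 a)"

definition stab :: "lift set \<Rightarrow> real \<Rightarrow> lift set" where
  "stab A x = {a \<in> A. ap a x = x}"

lemma cc_add_subgroup: "cc A \<Longrightarrow> add_subgroup A"
  by (simp add: cc_def)

lemma add_subgroup_stab: "add_subgroup A \<Longrightarrow> add_subgroup (stab A x)"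
  unfolding add_subgroup_def stab_def by auto (metis ap_uminus_ap)

lemma chain_step: "(p, q) \<in> chain e S \<Longrightarrow> q \<in> S \<Longrightarrow> q' \<in> S \<Longrightarrow> dist q q' < e \<Longrightarrow> (p, q') \<in> chain e S"
  unfolding chain_def by (rule rtrancl_into_rtrancl) auto

lemma chain_refl: "(p, p) \<in> chain e S"
  by (simp add: chain_def)

text \<open>A limit point of \<open>P\<close> lies in \<open>K\<close> and within \<open>e\<close>
  of a point of \<open>P\<close>, so the gap forces it into \<open>P\<close>.\<close>

lemma compact_gap:
  assumes "compact K" "P \<subseteq> K" "e > 0" and gap: "\<And>p q. p \<in> P \<Longrightarrow> q \<in> K - P \<Longrightarrow> e \<le> dist p q"
  shows "compact P"
proof -
  have "x \<in> P" if x: "x \<in> closure P" for x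
  proof (rule ccontr)
    assume "x \<notin> P"
    moreover have "x \<in> K"
      using that closure_minimal [OF \<open>P \<subseteq> K\<close>] \<open>compact K\<close> compact_imp_closed by blast
    moreover obtain p where "p \<in> P" "dist p x < e"
      using x \<open>e > 0\<close> by (meson closure_approachable)
    ultimately show False using gap by fastforce
  qed
  then have "closed P" by (metis closed_closure closure_subset subset_antisym subsetI)
  then show ?thesis
    using assms(1,2) by (metis compact_Int_closed inf.absorb_iff2)
qed

text \<open>Disjoint compact sets have positive distance \<open>d\<close>, and a chain of mesh
  \<open>d\<close> cannot pass from one to the other.\<close>

lemma well_chained_not_separated:
  assumes "well_chained C p q" "compact W" "compact V" "W \<inter> V = {}" "C \<subseteq> W \<union> V" "p \<in> W" "q \<in> V"
  shows False
proof -
  obtain d where d: "d > 0" "\<And>x y. x \<in> W \<Longrightarrow> y \<in> V \<Longrightarrow> d \<le> dist x y"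
  proof -
    obtain w where w: "w \<in> W" "\<And>x. x \<in> W \<Longrightarrow> infdist w V \<le> infdist x V"
    proof -
      have "continuous_on W (\<lambda>x. infdist x V)"
        by (intro continuous_on_infdist continuous_on_id)
      then have "\<exists>w\<in>W. \<forall>x\<in>W. infdist w V \<le> infdist x V"
        using \<open>p \<in> W\<close> by (intro continuous_attains_inf assms(2)) auto
      then show ?thesis using that by blast
    qed
    have "w \<notin> V" using w assms by blast
    then have "infdist w V > 0"
      using \<open>q \<in> V\<close> by (intro infdist_pos_not_in_closed compact_imp_closed assms(3)) auto
    moreover have "infdist w V \<le> dist x y" if "x \<in> W" "y \<in> V" for x y
      using w(2) [OF that(1)] infdist_le [OF that(2), of x] by linarith
    ultimately show ?thesis using that by blast
  qed
  have "(p, q) \<in> chain d C"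
    using assms(1) d(1) by (simp add: well_chained_def)
  then have "q \<in> W"
    unfolding chain_def using \<open>p \<in> W\<close>
  proof (induction rule: rtrancl_induct)
    case (step y z)
    then have "y \<in> W" "z \<in> C" "dist y z < d" by auto
    then show ?case using d(2) [of y z] assms(5) by force
  qed
  then show False using assms by blast
qed

lemma compact_Collect_le:
  fixes f g :: "'a::t2_space \<Rightarrow> real"
  assumes "compact S" "continuous_on S f" "continuous_on S g"
  shows "compact {x \<in> S. f x \<le> g x}"
proof -
  have "closed {x \<in> S. f x \<le> g x}"
    using assms by (intro continuous_on_closed_Collect_le compact_imp_closed)
  then have "compact (S \<inter> {x \<in> S. f x \<le> g x})"
    by (rule compact_Int_closed [OF assms(1)])
  then show ?thesis by (simp add: Int_def)
qed

lemma well_chained_ivt: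
  fixes u :: "'a::metric_space \<Rightarrow> real"
  assumes "well_chained C p q" "compact C" "continuous_on C u" "p \<in> C" "q \<in> C" "u p \<le> y" "y \<le> u q"
  shows "\<exists>c\<in>C. u c = y"
proof (rule ccontr)
  assume neg: "\<not> ?thesis"
  have "compact {c \<in> C. u c \<le> y}" "compact {c \<in> C. y \<le> u c}"
    using assms by (auto intro!: compact_Collect_le)
  moreover have "{c \<in> C. u c \<le> y} \<inter> {c \<in> C. y \<le> u c} = {}"
    using neg by force
  ultimately show False
    using well_chained_not_separated [OF assms(1), of "{c \<in> C. u c \<le> y}" "{c \<in> C. y \<le> u c}"] assms
    by force
qed

text \<open>The discrete form of the remark that a path from \<open>Z1\<close> to \<open>Z2\<close>
  has an excursion between them on one side of the zero set. Otherwise the points reachable from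
  \<open>Z1\<close> on either side and the remaining points would separate \<open>C\<close>: both
  parts are compact by \<open>compact_gap\<close>, and the two sides meet in zeros only, which are
  all in \<open>Z1\<close> or \<open>Z2\<close>.\<close>

lemma chain_excursion:
  fixes u :: "'a::metric_space \<Rightarrow> real"
  assumes wc: "well_chained C p q" and C: "compact C" and u: "continuous_on C u"
    and Z: "{c \<in> C. u c = 0} = Z1 \<union> Z2" "p \<in> Z1" "q \<in> Z2" and "e > 0"
  shows "\<exists>s\<in>{1, -1}. \<exists>a\<in>Z1. \<exists>b\<in>Z2. (a, b) \<in> chain e {c \<in> C. 0 \<le> s * u c}"
proof (rule ccontr)
  assume neg: "\<not> ?thesis"
  define K where "K s = {c \<in> C. 0 \<le> s * u c}" for s
  define P where "P s = {c \<in> K s. \<exists>a\<in>Z1. (a, c) \<in> chain e (K s)}" for s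
  have K: "compact (K s)" for s
    unfolding K_def using C u by (intro compact_Collect_le continuous_intros)
  have gap: "e \<le> dist x y" if "x \<in> P s" "y \<in> K s - P s" for s x y
    using that chain_step [of _ x e "K s" y] unfolding P_def by force
  have P: "compact (P s)" for s
    using gap \<open>e > 0\<close> by (intro compact_gap [OF K [of s], of _ e]) (auto simp: P_def)
  have KP: "compact (K s - P s)" for s
  proof (rule compact_gap [OF K [of s] _ \<open>e > 0\<close>])
    show "e \<le> dist p q" if "p \<in> K s - P s" "q \<in> K s - (K s - P s)" for p q
      using gap [of q s p] that by (auto simp: dist_commute)
  qed blast
  have Z1P: "c \<in> P s" if "c \<in> Z1" for c s
  proof -
    have "c \<in> {c \<in> C. u c = 0}" using that Z by blast
    then have "c \<in> K s" by (simp add: K_def)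
    then show ?thesis using that chain_refl unfolding P_def by blast
  qed
  have Z2P: "c \<notin> P s" if "c \<in> Z2" "s = 1 \<or> s = - 1" for c s
  proof
    assume "c \<in> P s"
    then obtain a where "a \<in> Z1" "(a, c) \<in> chain e {c \<in> C. 0 \<le> s * u c}"
      by (auto simp: P_def K_def)
    then show False using neg that by blast
  qed
  have "(P 1 \<union> P (-1)) \<inter> ((K 1 - P 1) \<union> (K (-1) - P (-1))) = {}"
  proof -
    have "c \<in> Z1 \<or> c \<in> Z2" if "c \<in> K 1" "c \<in> K (-1)" for c
      using that Z by (auto simp: K_def)
    moreover have "P s \<subseteq> K s" for s by (auto simp: P_def)
    ultimately show ?thesis using Z1P Z2P by blast
  qed
  moreover have "C \<subseteq> (P 1 \<union> P (-1)) \<union> ((K 1 - P 1) \<union> (K (-1) - P (-1)))"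
    by (auto simp: K_def)
  moreover have "p \<in> P 1 \<union> P (-1)"
    using Z Z1P by blast
  moreover have "q \<in> (K 1 - P 1) \<union> (K (-1) - P (-1))"
    using Z Z2P by (auto simp: K_def)
  ultimately show False
    by (rule well_chained_not_separated [OF wc compact_Un [OF P P] compact_Un [OF KP KP]])
qed

text \<open>A discrete form of the mountain climbers' theorem. The square grid is mapped to the triangle
  of pairs of indices \<open>i \<le> j\<close>, its bottom edge collapsing to the corner \<open>(0, n)\<close> and its top
  edge going to the diagonal, and Kuhn's combinatorial lemma is applied there.\<close>

lemma mountain_climbers:
  fixes u :: "'a::metric_space \<Rightarrow> real"
  assumes ch: "(a, b) \<in> chain e K" and aK: "a \<in> K"
    and min: "\<And>c. c \<in> K \<Longrightarrow> u a \<le> u c" "\<And>c. c \<in> K \<Longrightarrow> u b \<le> u c"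
    and diag: "\<And>c. c \<in> K \<Longrightarrow> P c c" and nP: "\<not> P a b"
  shows "\<exists>p\<in>K. \<exists>q\<in>K. \<forall>R \<in> {\<lambda>p q. u p \<le> u q, \<lambda>p q. u q \<le> u p, P, \<lambda>p q. \<not> P p q}.
       \<exists>p'\<in>K. \<exists>q'\<in>K. dist p p' \<le> 2 * e \<and> dist q q' \<le> 2 * e \<and> R p' q'"
proof -
  obtain n where "(a, b) \<in> {(p, q). p \<in> K \<and> q \<in> K \<and> dist p q < e} ^^ n"
    using ch rtrancl_imp_relpow unfolding chain_def by blast
  then obtain f where f: "f 0 = a" "f n = b" "\<And>i. i < n \<Longrightarrow> f i \<in> K \<and> f (Suc i) \<in> K \<and> dist (f i) (f (Suc i)) < e"
    unfolding relpow_fun_conv by auto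
  have "a \<noteq> b" using diag nP aK by blast
  then have "n > 0" using f by (cases n) auto
  then have e: "e > 0" using f(3) [of 0] by (meson dist_not_less_zero linorder_not_le order_le_less_trans zero_le_dist)
  have fK: "f i \<in> K" if "i \<le> n" for i
    using f \<open>n > 0\<close> that by (cases "i = n") (metis Suc_pred lessI, metis le_neq_implies_less)
  \<comment> \<open>The indices \<open>S\<close> and \<open>T\<close> below change by at most 2
    within one cell of the grid; this is the origin of the factor 2.\<close>
  have dle: "dist (f i) (f j) \<le> 2 * e" if "i \<le> n" "j \<le> n" "i \<le> j + 2" "j \<le> i + 2" for i j
  proof -
    have *: "dist (f i) (f j) \<le> 2 * e" if h: "i \<le> j" "j \<le> n" "j \<le> i + 2" for i j
    proof -
      consider "j = i" | "j = Suc i" | "j = Suc (Suc i)" using h by linarith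
      then show ?thesis
      proof cases
        case 3
        then show ?thesis
          using f(3) [of i] f(3) [of "Suc i"] h dist_triangle [of "f i" "f j" "f (Suc i)"] by simp
      qed (use e f(3) [of i] h in auto)
    qed
    show ?thesis
      using * [of i j] * [of j i] that by (cases "i \<le> j") (auto simp: dist_commute)
  qed
  \<comment> \<open>The grid point \<open>(x, y)\<close> stands for the indices at distance
    \<open>n - y\<close> to either side of \<open>x\<close>, cut off at 0 and \<open>n\<close>
    (subtraction on naturals truncates). So \<open>y = 0\<close> gives the pair
    \<open>(0, n)\<close> and \<open>y = n\<close> the diagonal.\<close>
  define S where "S x y = x - (n - y)" for x y :: nat
  define T where "T x y = min n (x + (n - y))" for x y :: nat
  \<comment> \<open>Label 0 compares heights, label 1 tests \<open>P\<close>. On the sides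
    \<open>x 0 = 0\<close> and \<open>x 0 = n\<close> the value demanded by Kuhn's lemma is imposed;
    it agrees with the heights there, because the first climber is at \<open>a\<close>, respectively
    the second at \<open>b\<close>, both minimal.\<close>
  define label where "label x i = (if i = 0 then (if x 0 = 0 then 0 else if x 0 = n then 1
      else if u (f (S (x 0) (x 1))) \<le> u (f (T (x 0) (x 1))) then 0 else 1)
     else (if P (f (S (x 0) (x 1))) (f (T (x 0) (x 1))) then 1 else (0::nat)))" for x :: "nat \<Rightarrow> nat" and i :: nat
  have ST: "S x y \<le> n" "T x y \<le> n" if "x \<le> n" for x y
    using that by (auto simp: S_def T_def)
  have less2: "i = 0 \<or> i = 1" if "i < 2" for i :: nat using that by linarith
  obtain q where q: "\<And>i. i < 2 \<Longrightarrow> q i < n" and "\<forall>i<2. \<exists>r s. (\<forall>j<2. q j \<le> r j \<and> r j \<le> q j + 1) \<and>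
      (\<forall>j<2. q j \<le> s j \<and> s j \<le> q j + 1) \<and> label r i \<noteq> label s i"
  proof (rule kuhn_lemma [of n 2 label])
    show "\<forall>x. (\<forall>i<2. x i \<le> n) \<longrightarrow> (\<forall>i<2. label x i = 0 \<or> label x i = 1)"
      by (simp add: label_def)
    have "label x i = 0" if "\<forall>i<2. x i \<le> n" "i < 2" "x i = 0" for x i
    proof (cases "i = 0")
      case False
      then have "x 0 \<le> n" "x 1 = 0" "i = 1" using that less2 by auto
      then have "S (x 0) (x 1) = 0" "T (x 0) (x 1) = n" by (simp_all add: S_def T_def)
      then show ?thesis using \<open>i = 1\<close> nP f by (simp add: label_def)
    qed (use that in \<open>simp add: label_def\<close>)
    then show "\<forall>x. (\<forall>i<2. x i \<le> n) \<longrightarrow> (\<forall>i<2. x i = 0 \<longrightarrow> label x i = 0)"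
      by blast
    have "label x i = 1" if "\<forall>i<2. x i \<le> n" "i < 2" "x i = n" for x i
    proof (cases "i = 0")
      case False
      then have "x 0 \<le> n" "x 1 = n" "i = 1" using that less2 by auto
      then have "S (x 0) (x 1) = x 0" "T (x 0) (x 1) = x 0" by (simp_all add: S_def T_def)
      then show ?thesis using \<open>i = 1\<close> diag fK \<open>x 0 \<le> n\<close> by (simp add: label_def)
    qed (use that \<open>n > 0\<close> in \<open>simp add: label_def\<close>)
    then show "\<forall>x. (\<forall>i<2. x i \<le> n) \<longrightarrow> (\<forall>i<2. x i = n \<longrightarrow> label x i = 1)"
      by blast
  qed (use \<open>n > 0\<close> in auto)
  then have cell: "\<exists>r s. (\<forall>j<2. q j \<le> r j \<and> r j \<le> q j + 1) \<and>
      (\<forall>j<2. q j \<le> s j \<and> s j \<le> q j + 1) \<and> label r i \<noteq> label s i" if "i < 2" for i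
    using that by blast
  let ?p = "f (S (q 0) (q 1))" and ?q = "f (T (q 0) (q 1))"
  have ncl: "\<exists>p'\<in>K. \<exists>q'\<in>K. dist ?p p' \<le> 2 * e \<and> dist ?q q' \<le> 2 * e \<and> R p' q'"
    if r: "\<forall>j<2. q j \<le> r j \<and> r j \<le> q j + 1" and R: "R (f (S (r 0) (r 1))) (f (T (r 0) (r 1)))" for r R
  proof -
    have b: "q 0 < n" "q 1 < n" "q 0 \<le> r 0" "r 0 \<le> q 0 + 1" "q 1 \<le> r 1" "r 1 \<le> q 1 + 1"
      using r q by auto
    have l: "S (r 0) (r 1) \<le> n" "T (r 0) (r 1) \<le> n" "S (q 0) (q 1) \<le> n" "T (q 0) (q 1) \<le> n"
      using b by (auto intro!: ST)
    moreover have "S (q 0) (q 1) \<le> S (r 0) (r 1) + 2" "S (r 0) (r 1) \<le> S (q 0) (q 1) + 2"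
      "T (q 0) (q 1) \<le> T (r 0) (r 1) + 2" "T (r 0) (r 1) \<le> T (q 0) (q 1) + 2"
      using b unfolding S_def T_def by linarith+
    ultimately have "dist ?p (f (S (r 0) (r 1))) \<le> 2 * e" "dist ?q (f (T (r 0) (r 1))) \<le> 2 * e"
      by (auto intro!: dle)
    then show ?thesis using R l fK by blast
  qed
  have lab01: "label x i = 0 \<or> label x i = 1" for x i by (simp add: label_def)
  have split: "\<exists>r s. (\<forall>j<2. q j \<le> r j \<and> r j \<le> q j + 1) \<and> (\<forall>j<2. q j \<le> s j \<and> s j \<le> q j + 1) \<and>
      label r i = 0 \<and> label s i = 1" if i: "i < 2" for i
  proof -
    obtain r s where rs: "\<forall>j<2. q j \<le> r j \<and> r j \<le> q j + 1" "\<forall>j<2. q j \<le> s j \<and> s j \<le> q j + 1"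
      "label r i \<noteq> label s i"
      using cell [OF i] by blast
    show ?thesis
    proof (cases "label r i = 0")
      case True
      then have "label s i = 1" using lab01 [of s i] rs(3) by auto
      then show ?thesis using True rs by blast
    next
      case False
      then have "label r i = 1" "label s i = 0" using lab01 [of r i] lab01 [of s i] rs(3) by auto
      then show ?thesis using rs by blast
    qed
  qed
  have in_n: "r 0 \<le> n" if "\<forall>j<2. q j \<le> r j \<and> r j \<le> q j + 1" for r
    using that q [of 0] by force
  have u0: "u (f (S (r 0) (r 1))) \<le> u (f (T (r 0) (r 1)))" if "label r 0 = 0" "r 0 \<le> n" for r
  proof (cases "r 0 = 0")
    case True
    then have "S (r 0) (r 1) = 0" by (simp add: S_def)
    moreover have "u a \<le> u (f (T (r 0) (r 1)))"
      by (intro min(1) fK ST(2) that(2))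
    ultimately show ?thesis unfolding f(1) [symmetric] by simp
  qed (use that(1) in \<open>simp add: label_def split: if_splits\<close>)
  have u1: "u (f (T (r 0) (r 1))) \<le> u (f (S (r 0) (r 1)))" if "label r 0 = 1" "r 0 \<le> n" for r
  proof (cases "r 0 = n")
    case True
    then have T: "T (r 0) (r 1) = n" by (simp add: T_def)
    have "f (T (r 0) (r 1)) = b" unfolding T by (rule f(2))
    moreover have "u b \<le> u (f (S (r 0) (r 1)))"
      by (intro min(2) fK ST(1) that(2))
    ultimately show ?thesis by (simp only:)
  next
    case False
    show ?thesis
    proof (rule ccontr)
      assume "\<not> ?thesis"
      then have "label r 0 = 0" using False unfolding label_def by (auto simp del: One_nat_def)
      then show False using that(1) by simp
    qed
  qed
  show ?thesis
  proof (rule bexI [of _ ?p], rule bexI [of _ ?q], rule ballI)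
    show "?p \<in> K" "?q \<in> K" using q [of 0] by (auto intro!: fK ST)
    fix R assume R: "R \<in> {\<lambda>p q. u p \<le> u q, \<lambda>p q. u q \<le> u p, P, \<lambda>p q. \<not> P p q}"
    obtain r0 s0 where 0: "\<forall>j<2. q j \<le> r0 j \<and> r0 j \<le> q j + 1" "\<forall>j<2. q j \<le> s0 j \<and> s0 j \<le> q j + 1"
      "label r0 0 = 0" "label s0 0 = 1"
      using split [of 0] by auto
    obtain r1 s1 where 1: "\<forall>j<2. q j \<le> r1 j \<and> r1 j \<le> q j + 1" "\<forall>j<2. q j \<le> s1 j \<and> s1 j \<le> q j + 1"
      "label r1 1 = 0" "label s1 1 = 1"
      using split [of 1] by auto
    have nPr: "\<not> P (f (S (r1 0) (r1 1))) (f (T (r1 0) (r1 1)))"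
      using 1(3) by (auto simp: label_def split: if_splits)
    have Ps: "P (f (S (s1 0) (s1 1))) (f (T (s1 0) (s1 1)))"
    proof (rule ccontr)
      assume "\<not> ?thesis"
      then have "label s1 1 = 0" by (simp add: label_def)
      then show False using 1(4) by simp
    qed
    from R consider "R = (\<lambda>p q. u p \<le> u q)" | "R = (\<lambda>p q. u q \<le> u p)" | "R = P" | "R = (\<lambda>p q. \<not> P p q)"
      by blast
    then show "\<exists>p'\<in>K. \<exists>q'\<in>K. dist ?p p' \<le> 2 * e \<and> dist ?q q' \<le> 2 * e \<and> R p' q'"
    proof cases
      case 1 then show ?thesis using ncl [OF 0(1), of R] u0 [OF 0(3) in_n [OF 0(1)]] by simp
    next
      case 2 then show ?thesis using ncl [OF 0(2), of R] u1 [OF 0(4) in_n [OF 0(2)]] by simp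
    next
      case 3 then show ?thesis using ncl [OF 1(2), of R] Ps by simp
    next
      case 4 then show ?thesis using ncl [OF 1(1), of R] nPr by simp
    qed
  qed
qed

lemma compact_triple_products:
  fixes C :: "lift set"
  assumes "compact C"
  shows "compact {a - b + c | a b c. a \<in> C \<and> b \<in> C \<and> c \<in> C}"
proof -
  have "continuous_on (C \<times> C \<times> C) (\<lambda>(a, b, c). a - b + c)"
    unfolding continuous_on_def case_prod_beta by (intro ballI tendsto_intros)
  then have "compact ((\<lambda>(a, b, c). a - b + c) ` (C \<times> C \<times> C))"
    using assms by (intro compact_continuous_image compact_Times)
  moreover have "(\<lambda>(a, b, c). a - b + c) ` (C \<times> C \<times> C) = {a - b + c | a b c. a \<in> C \<and> b \<in> C \<and> c \<in> C}"
    by force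
  ultimately show ?thesis by simp
qed

lemma continuous_on_eval: "continuous_on S (\<lambda>a. ap a x)"
  unfolding continuous_on_def by (auto intro!: tendsto_intros)

lemma closed_fixing: "closed {a. ap a x = x}"
  by (rule closed_Collect_eq [OF continuous_on_eval continuous_on_const])

lemma compact_bounded_distance_limit:
  fixes p :: "nat \<Rightarrow> 'a::metric_space"
  assumes "p \<longlonglongrightarrow> l" "e \<longlonglongrightarrow> (0::real)" "\<And>n. dist (p n) (p' n) \<le> e n"
  shows "p' \<longlonglongrightarrow> l"
proof -
  have "(\<lambda>n. dist (p n) (p' n)) \<longlonglongrightarrow> 0"
    by (rule tendsto_sandwich [OF _ _ tendsto_const assms(2)]) (auto simp: assms(3))
  from tendsto_add [OF this iffD1 [OF tendsto_dist_iff assms(1)]]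
  have "(\<lambda>n. dist (p n) (p' n) + dist (p n) l) \<longlonglongrightarrow> 0" by simp
  moreover have "dist (p' n) l \<le> dist (p n) (p' n) + dist (p n) l" for n
    using dist_triangle [of "p' n" l "p n"] by (simp add: dist_commute)
  ultimately have "(\<lambda>n. dist (p' n) l) \<longlonglongrightarrow> 0"
    by (intro tendsto_sandwich [where f = "\<lambda>_. 0" and g = "\<lambda>n. dist (p' n) l", OF _ _ tendsto_const]) auto
  then show ?thesis by (rule iffD2 [OF tendsto_dist_iff])
qed

text \<open>If two elements of a compact well-chained set \<open>C\<close> agree at \<open>x\<close> with the identity, climbing the
  function \<open>c \<mapsto> c x\<close> simultaneously from both ends produces a chain of elements \<open>a - b + c\<close>
  which fix \<open>x\<close>.\<close>

lemma well_chained_stab: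
  fixes C :: "lift set"
  assumes C: "compact C" "0 \<in> C" "h \<in> C" and wc: "well_chained C 0 h" and hx: "ap h x = x"
  defines "M \<equiv> {a - b + c | a b c. a \<in> C \<and> b \<in> C \<and> c \<in> C} \<inter> {a. ap a x = x}"
  shows "well_chained M 0 h"
proof (rule ccontr)
  assume "\<not> well_chained M 0 h"
  then obtain e0 where e0: "e0 > 0" "(0, h) \<notin> chain e0 M"
    by (auto simp: well_chained_def)
  define u where "u c = ap c x - x" for c
  define M1 where "M1 = {m \<in> M. (0, m) \<in> chain e0 M}"
  define Z1 where "Z1 = {c \<in> C. u c = 0 \<and> c \<in> M1}"
  define Z2 where "Z2 = {c \<in> C. u c = 0 \<and> c \<notin> M1}"
  have M: "compact M"
    unfolding M_def by (intro compact_Int_closed compact_triple_products C closed_fixing)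
  have CM: "c \<in> M" if "c \<in> C" "u c = 0" for c
  proof -
    have "c = c - 0 + 0" by simp
    then show ?thesis unfolding M_def using that C by (force simp: u_def)
  qed
  have cu: "continuous_on S u" for S
    unfolding u_def by (intro continuous_intros continuous_on_eval)
  have sep: "e0 \<le> dist p q" if "p \<in> M1" "q \<in> M" "q \<notin> M1" for p q
    using that chain_step [of 0 p e0 M q] by (auto simp: M1_def not_le [symmetric])
  have 0: "0 \<in> Z1" using C CM [of 0] chain_refl by (auto simp: Z1_def M1_def u_def)
  have h: "h \<in> Z2" using e0 C hx by (auto simp: Z2_def M1_def u_def)
  have Z: "{c \<in> C. u c = 0} = Z1 \<union> Z2" by (auto simp: Z1_def Z2_def)
  define e where "e k = 1 / real (Suc k)" for k
  have epos: "e k > 0" for k by (simp add: e_def)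
  \<comment> \<open>If \<open>p\<close> and \<open>q\<close> have equal height, then
    \<open>a - p + q\<close> fixes \<open>x\<close>, hence lies in \<open>M\<close>. At
    \<open>p = q\<close> it equals \<open>a\<close>, in \<open>M1\<close>; at \<open>p = a\<close>,
    \<open>q = b\<close> it equals \<open>b\<close>, outside \<open>M1\<close>. The climbers
    therefore meet a place where \<open>P\<close> changes.\<close>
  define P where "P a p q \<longleftrightarrow> (\<exists>m\<in>M1. dist (a - p + q) m < e0 / 2)" for a p q
  define near where "near k p q R \<longleftrightarrow> (\<exists>p'\<in>C. \<exists>q'\<in>C. dist p p' \<le> 2 * e k \<and> dist q q' \<le> 2 * e k \<and> R p' q')"
    for k and p q :: lift and R
  \<comment> \<open>For mesh \<open>e k\<close> there is a pair near which both height inequalities,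
    \<open>P\<close> and its negation all occur. The limit over \<open>k\<close> then has equal
    heights and gives an element of \<open>M\<close> that is close to \<open>M1\<close> but not in
    it.\<close>
  have "\<exists>s a p q. s \<in> {1, -1} \<and> a \<in> Z1 \<and> p \<in> C \<and> q \<in> C \<and> near k p q (\<lambda>p q. s * u p \<le> s * u q) \<and>
      near k p q (\<lambda>p q. s * u q \<le> s * u p) \<and> near k p q (P a) \<and> near k p q (\<lambda>p q. \<not> P a p q)" for k
  proof -
    obtain s a b where s: "s \<in> {1, -1}" and ab: "a \<in> Z1" "b \<in> Z2" "(a, b) \<in> chain (e k) {c \<in> C. 0 \<le> s * u c}"
      using chain_excursion [OF wc C(1) cu Z 0 h epos] by blast
    let ?K = "{c \<in> C. 0 \<le> s * u c}"
    have aK: "a \<in> ?K" using ab by (auto simp: Z1_def)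
    have min: "s * u a \<le> s * u c" "s * u b \<le> s * u c" if "c \<in> ?K" for c
      using ab that by (auto simp: Z1_def Z2_def)
    have diag: "P a c c" if "c \<in> ?K" for c
      using ab e0 by (auto simp: P_def Z1_def intro!: bexI [of _ a])
    have "\<not> P a a b"
    proof
      assume "P a a b"
      then obtain m where m: "m \<in> M1" "dist b m < e0 / 2" by (auto simp: P_def)
      have "e0 \<le> dist m b"
        using ab CM by (intro sep m) (auto simp: Z2_def)
      then show False using m e0 by (simp add: dist_commute)
    qed
    from mountain_climbers [of a b "e k" ?K "\<lambda>c. s * u c" "P a", OF ab(3) aK min diag this]
    obtain p q where pq: "p \<in> ?K" "q \<in> ?K" and *:
      "\<forall>R \<in> {\<lambda>p q. s * u p \<le> s * u q, \<lambda>p q. s * u q \<le> s * u p, P a, \<lambda>p q. \<not> P a p q}.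
       \<exists>p'\<in>?K. \<exists>q'\<in>?K. dist p p' \<le> 2 * e k \<and> dist q q' \<le> 2 * e k \<and> R p' q'"
      by blast
    have "near k p q R" if "R \<in> {\<lambda>p q. s * u p \<le> s * u q, \<lambda>p q. s * u q \<le> s * u p, P a, \<lambda>p q. \<not> P a p q}" for R
      using bspec [OF * that] unfolding near_def by blast
    then show ?thesis using s ab(1) pq by blast
  qed
  then obtain s a p q where sapq: "\<And>k. s k \<in> {1, -1::real}" "\<And>k. a k \<in> Z1" "\<And>k. p k \<in> C" "\<And>k. q k \<in> C"
    and nr: "\<And>k. near k (p k) (q k) (\<lambda>p q. s k * u p \<le> s k * u q)"
      "\<And>k. near k (p k) (q k) (\<lambda>p q. s k * u q \<le> s k * u p)"
      "\<And>k. near k (p k) (q k) (P (a k))" "\<And>k. near k (p k) (q k) (\<lambda>p q. \<not> P (a k) p q)"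
    by metis
  have "seq_compact (C \<times> C \<times> C)"
    using C(1) by (intro compact_imp_seq_compact compact_Times)
  moreover have "\<forall>k. (a k, p k, q k) \<in> C \<times> C \<times> C"
    using sapq by (auto simp: Z1_def)
  ultimately have "\<exists>l\<in>C \<times> C \<times> C. \<exists>r. strict_mono r \<and> ((\<lambda>k. (a k, p k, q k)) \<circ> r) \<longlonglongrightarrow> l"
    by (rule iffD1 [OF seq_compact_def, THEN spec, THEN mp])
  then obtain l r where l: "l \<in> C \<times> C \<times> C" and r: "strict_mono r"
    and "((\<lambda>k. (a k, p k, q k)) \<circ> r) \<longlonglongrightarrow> l"
    by blast
  then have lim: "(\<lambda>k. (a (r k), p (r k), q (r k))) \<longlonglongrightarrow> l"
    by (simp add: comp_def)
  obtain a' p' q' where l': "l = (a', p', q')" by (cases l)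
  have lims: "(\<lambda>k. a (r k)) \<longlonglongrightarrow> a'" "(\<lambda>k. p (r k)) \<longlonglongrightarrow> p'" "(\<lambda>k. q (r k)) \<longlonglongrightarrow> q'"
    using tendsto_fst [OF lim] tendsto_fst [OF tendsto_snd [OF lim]] tendsto_snd [OF tendsto_snd [OF lim]]
    by (simp_all add: l')
  have "e \<longlonglongrightarrow> 0"
    unfolding e_def using LIMSEQ_inverse_real_of_nat by (simp add: inverse_eq_divide)
  then have er: "(\<lambda>k. 2 * e (r k)) \<longlonglongrightarrow> 0"
    using LIMSEQ_subseq_LIMSEQ [OF _ r, of e 0] by (intro tendsto_mult_right_zero) (simp add: comp_def)
  have close: "\<exists>x y. (\<forall>k. x k \<in> C \<and> y k \<in> C \<and> R (r k) (x k) (y k)) \<and> x \<longlonglongrightarrow> p' \<and> y \<longlonglongrightarrow> q'"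
    if R: "\<And>k. near k (p k) (q k) (R k)" for R
  proof -
    have "\<exists>x y. x \<in> C \<and> y \<in> C \<and> dist (p (r k)) x \<le> 2 * e (r k) \<and> dist (q (r k)) y \<le> 2 * e (r k) \<and> R (r k) x y" for k
      using R [of "r k"] unfolding near_def by blast
    then obtain x y where xy: "\<And>k. x k \<in> C" "\<And>k. y k \<in> C" "\<And>k. dist (p (r k)) (x k) \<le> 2 * e (r k)"
      "\<And>k. dist (q (r k)) (y k) \<le> 2 * e (r k)" "\<And>k. R (r k) (x k) (y k)"
      by metis
    have "x \<longlonglongrightarrow> p'" "y \<longlonglongrightarrow> q'"
      using compact_bounded_distance_limit [OF lims(2) er xy(3)]
        compact_bounded_distance_limit [OF lims(3) er xy(4)] by auto
    then show ?thesis using xy by blast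
  qed
  have ulim: "(\<lambda>k. u (X k)) \<longlonglongrightarrow> u L" if "X \<longlonglongrightarrow> L" for X L
    unfolding u_def using that by (intro tendsto_intros)
  obtain x1 y1 where 1: "\<And>k. s (r k) * u (x1 k) \<le> s (r k) * u (y1 k)" "x1 \<longlonglongrightarrow> p'" "y1 \<longlonglongrightarrow> q'"
    using close [OF nr(1)] by blast
  obtain x2 y2 where 2: "\<And>k. s (r k) * u (y2 k) \<le> s (r k) * u (x2 k)" "x2 \<longlonglongrightarrow> p'" "y2 \<longlonglongrightarrow> q'"
    using close [OF nr(2)] by blast
  \<comment> \<open>The side \<open>s\<close> of the excursion may vary with \<open>k\<close>; the
    product of the two differences does not see this sign, and its limit is a square.\<close>
  have "(\<lambda>k. (u (y1 k) - u (x1 k)) * (u (y2 k) - u (x2 k))) \<longlonglongrightarrow> (u q' - u p') * (u q' - u p')"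
    by (intro tendsto_intros ulim 1 2)
  moreover have "(u (y1 k) - u (x1 k)) * (u (y2 k) - u (x2 k)) \<le> 0" for k
    using 1(1) [of k] 2(1) [of k] sapq(1) [of "r k"] by (auto simp: mult_le_0_iff)
  ultimately have "(u q' - u p') * (u q' - u p') \<le> 0"
    by (intro LIMSEQ_le_const2) auto
  then have upq: "u q' = u p'"
    by (metis eq_iff_diff_eq_0 mult_le_0_iff order_antisym)
  have "ap a' x = x"
  proof -
    have "u (a (r k)) = 0" for k using sapq by (auto simp: Z1_def)
    then have "u a' = 0" using LIMSEQ_unique [OF ulim [OF lims(1)]] by simp
    then show ?thesis by (simp add: u_def)
  qed
  moreover have "ap q' x = ap p' x" using upq by (simp add: u_def)
  ultimately have "ap (a' - p' + q') x = x" by simp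
  then have mM: "a' - p' + q' \<in> M"
    using l unfolding M_def l' by blast
  obtain x3 y3 where 3: "\<And>k. P (a (r k)) (x3 k) (y3 k)" "x3 \<longlonglongrightarrow> p'" "y3 \<longlonglongrightarrow> q'"
    using close [of "\<lambda>k. P (a k)", OF nr(3)] by blast
  obtain x4 y4 where 4: "\<And>k. \<not> P (a (r k)) (x4 k) (y4 k)" "x4 \<longlonglongrightarrow> p'" "y4 \<longlonglongrightarrow> q'"
    using close [of "\<lambda>k p q. \<not> P (a k) p q", OF nr(4)] by blast
  have ev: "\<exists>k. dist (a (r k) - x k + y k) (a' - p' + q') < e0 / 2" if "x \<longlonglongrightarrow> p'" "y \<longlonglongrightarrow> q'" for x y
  proof -
    have "(\<lambda>k. a (r k) - x k + y k) \<longlonglongrightarrow> a' - p' + q'"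
      by (intro tendsto_intros lims that)
    from tendstoD [OF this, of "e0 / 2"] e0 show ?thesis
      by (auto dest: eventually_happens)
  qed
  obtain k where k: "dist (a (r k) - x4 k + y4 k) (a' - p' + q') < e0 / 2"
    using ev [OF 4(2,3)] by blast
  have nM1: "a' - p' + q' \<notin> M1" using k 4(1) [of k] by (auto simp: P_def)
  obtain k' where "dist (a (r k') - x3 k' + y3 k') (a' - p' + q') < e0 / 2"
    using ev [OF 3(2,3)] by blast
  moreover obtain m where m: "m \<in> M1" "dist (a (r k') - x3 k' + y3 k') m < e0 / 2"
    using 3(1) [of k'] unfolding P_def by blast
  ultimately have "dist m (a' - p' + q') < e0"
    using dist_triangle_half_r by blast
  then show False using sep [OF m(1) mM nM1] by simp
qed

theorem cc_stab:
  assumes "cc A"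
  shows "cc (stab A x)"
  unfolding cc_def
proof (intro conjI ballI)
  have A: "add_subgroup A" using assms by (rule cc_add_subgroup)
  then show "add_subgroup (stab A x)" by (rule add_subgroup_stab)
  fix h assume "h \<in> stab A x"
  then have h: "h \<in> A" "ap h x = x" by (auto simp: stab_def)
  then obtain C where C: "C \<subseteq> A" "compact C" "0 \<in> C" "h \<in> C" "well_chained C 0 h"
    using assms unfolding cc_def by blast
  define M where "M = {a - b + c | a b c. a \<in> C \<and> b \<in> C \<and> c \<in> C} \<inter> {a. ap a x = x}"
  have mem: "c \<in> M" if "c \<in> C" "ap c x = x" for c
  proof -
    have "c = c - 0 + 0" by simp
    then show ?thesis unfolding M_def using that C by force
  qed
  have "M \<subseteq> stab A x"
  proof
    fix m assume "m \<in> M"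
    then obtain a b c where "a \<in> C" "b \<in> C" "c \<in> C" "m = a - b + c" "ap m x = x"
      unfolding M_def by blast
    moreover from this have "m \<in> A"
      using C(1) by (auto intro!: add_subgroupD(3,4) [OF A])
    ultimately show "m \<in> stab A x" by (simp add: stab_def)
  qed
  moreover have "compact M"
    unfolding M_def by (intro compact_Int_closed compact_triple_products C closed_fixing)
  moreover have "well_chained M 0 h"
    using well_chained_stab [OF C(2,3,4,5) h(2)] unfolding M_def .
  ultimately show "\<exists>M\<subseteq>stab A x. compact M \<and> 0 \<in> M \<and> h \<in> M \<and> well_chained M 0 h"
    using mem [OF C(3) ap_zero] mem [OF C(4) h(2)] by blast
qed

lemma cc_stab_finite:
  assumes "cc A" "finite X"
  shows "cc {a \<in> A. \<forall>x\<in>X. ap a x = x}"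
  using assms(2)
proof (induction X rule: finite_induct)
  case (insert x X)
  have eq: "{a \<in> A. \<forall>y\<in>insert x X. ap a y = y} = stab {a \<in> A. \<forall>x\<in>X. ap a x = x} x"
    by (auto simp: stab_def)
  show ?case unfolding eq by (rule cc_stab [OF insert.IH])
qed (use assms(1) in simp)

text \<open>The point is that one compact \<open>C\<close> serves all \<open>x\<close> and
  \<open>y\<close>, so that sequences of elements chosen in it have convergent subsequences. It is
  the connecting set of \<open>a\<close> together with its inverses.\<close>

lemma cc_between_compact:
  assumes "cc A" "a \<in> A"
  shows "\<exists>C\<subseteq>A. compact C \<and> (\<forall>x y. x \<le> y \<and> y \<le> ap a x \<longrightarrow> (\<exists>c\<in>C. ap c x = y)) \<and>
    (\<forall>x y. ap (- a) x \<le> y \<and> y \<le> x \<longrightarrow> (\<exists>c\<in>C. ap c x = y))"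
proof -
  obtain C where C: "C \<subseteq> A" "compact C" "0 \<in> C" "a \<in> C" "well_chained C 0 a"
    using assms unfolding cc_def by blast
  have cm: "continuous_on C (uminus :: lift \<Rightarrow> lift)"
    unfolding continuous_on_def by (auto intro!: tendsto_intros)
  have 1: "C \<union> uminus ` C \<subseteq> A"
    using C(1) add_subgroupD(2) [OF cc_add_subgroup [OF assms(1)]] by auto
  have 2: "compact (C \<union> uminus ` C)"
    using C(2) cm by (intro compact_Un compact_continuous_image)
  have 3: "\<exists>c\<in>C \<union> uminus ` C. ap c x = y" if "x \<le> y" "y \<le> ap a x" for x y
    using well_chained_ivt [OF C(5,2) continuous_on_eval [of _ x] C(3,4)] that by auto
  have 4: "\<exists>c\<in>C \<union> uminus ` C. ap c x = y" if "ap (- a) x \<le> y" "y \<le> x" for x y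
  proof -
    have "continuous_on C (\<lambda>c. - ap (- c) x)"
      unfolding continuous_on_def by (auto intro!: tendsto_intros)
    from well_chained_ivt [OF C(5,2) this C(3,4), of "- y"] that
    show ?thesis by auto
  qed
  show ?thesis
    by (rule exI [of _ "C \<union> uminus ` C"]) (use 1 2 3 4 in blast)
qed

lemma cc_between:
  assumes "cc A" "a \<in> A" "x \<le> y" "y \<le> ap a x"
  shows "\<exists>b\<in>A. ap b x = y"
proof -
  obtain C where "C \<subseteq> A" "\<forall>x y. x \<le> y \<and> y \<le> ap a x \<longrightarrow> (\<exists>c\<in>C. ap c x = y)"
    using cc_between_compact [OF assms(1,2)] by blast
  then show ?thesis using assms(3,4) by blast
qed

text \<open>A sequential substitute for openness of the orbit map. Elements of a compact set carry
  \<open>x\<close> to the points \<open>X n\<close>; a subsequence of them converges to some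
  \<open>l\<close> fixing \<open>x\<close>, and subtracting \<open>l\<close> makes the limit 0
  without changing the images of \<open>x\<close>.\<close>

lemma cc_local_section:
  assumes "cc A" "a \<in> A" "ap a x \<noteq> x" "X \<longlonglongrightarrow> x"
  obtains s b where "strict_mono (s :: nat \<Rightarrow> nat)" "\<And>n. b n \<in> A" "\<And>n. ap (b n) x = X (s n)" "b \<longlonglongrightarrow> 0"
proof -
  note A = cc_add_subgroup [OF assms(1)]
  obtain a' where a': "a' \<in> A" "ap a' x > x"
  proof (cases "ap a x > x")
    case False
    then have "ap (- a) x > x" using assms(3)
      by (metis ap_less_iff ap_uminus_ap not_less_iff_gr_or_eq)
    then show ?thesis using that add_subgroupD(2) [OF A assms(2)] by blast
  qed (use assms that in blast)
  obtain C where C: "C \<subseteq> A" "compact C" "\<forall>x y. x \<le> y \<and> y \<le> ap a' x \<longrightarrow> (\<exists>c\<in>C. ap c x = y)"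
    "\<forall>x y. ap (- a') x \<le> y \<and> y \<le> x \<longrightarrow> (\<exists>c\<in>C. ap c x = y)"
    using cc_between_compact [OF assms(1) a'(1)] by blast
  have lt: "ap (- a') x < x" using a'(2) by (metis ap_less_iff ap_ap_uminus)
  have "\<forall>\<^sub>F n in sequentially. X n < ap a' x" "\<forall>\<^sub>F n in sequentially. ap (- a') x < X n"
    using order_tendstoD [OF assms(4)] a'(2) lt by auto
  then have "\<forall>\<^sub>F n in sequentially. \<exists>c\<in>C. ap c x = X n"
  proof eventually_elim
    case (elim n)
    then show ?case using C(3) [rule_format, of x "X n"] C(4) [rule_format, of x "X n"] by (cases "x \<le> X n") auto
  qed
  then obtain N where N: "\<And>n. n \<ge> N \<Longrightarrow> \<exists>c\<in>C. ap c x = X n"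
    by (auto simp: eventually_sequentially)
  then have "\<exists>c\<in>C. ap c x = X (n + N)" for n by simp
  then obtain c where c: "\<And>n. c n \<in> C" "\<And>n. ap (c n) x = X (n + N)" by metis
  obtain l r where l: "l \<in> C" "strict_mono r" "(c \<circ> r) \<longlonglongrightarrow> l"
    using compact_imp_seq_compact [OF C(2)] c(1) unfolding seq_compact_def by metis
  have "(\<lambda>k. X (r k + N)) \<longlonglongrightarrow> x"
    using LIMSEQ_subseq_LIMSEQ [OF LIMSEQ_ignore_initial_segment [OF assms(4), of N] l(2)]
    by (simp add: comp_def)
  moreover have "(\<lambda>k. X (r k + N)) \<longlonglongrightarrow> ap l x"
    using tendsto_ap_const [OF l(3), of x] by (simp add: c(2) comp_def)
  ultimately have lx: "ap l x = x" using LIMSEQ_unique by blast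
  show ?thesis
  proof (rule that)
    show "strict_mono (\<lambda>k. r k + N)" using l(2) by (simp add: strict_mono_def)
    show "c (r k) - l \<in> A" for k using C(1) c(1) l(1) add_subgroupD(4) [OF A] by blast
    show "ap (c (r k) - l) x = X (r k + N)" for k
    proof -
      have "ap (- l) x = x" by (simp add: ap_uminus_eq_iff lx)
      then show ?thesis by (simp add: c(2))
    qed
    show "(\<lambda>k. c (r k) - l) \<longlonglongrightarrow> 0"
      using tendsto_minus_lift [OF l(3) tendsto_const [of l]] by (simp add: comp_def)
  qed
qed

text \<open>If the orbit of \<open>x\<close> did not reach \<open>y\<close>, then by
  \<open>cc_between\<close> it would be bounded by \<open>y\<close>, and its supremum would be a
  common fixed point in \<open>I\<close>.\<close>

lemma cc_transitive:
  assumes "cc A" "is_interval I" "x \<in> I" "y \<in> I" and mv: "\<And>z. z \<in> I \<Longrightarrow> \<exists>a\<in>A. ap a z \<noteq> z"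
  shows "\<exists>a\<in>A. ap a x = y"
proof -
  note A = cc_add_subgroup [OF assms(1)]
  have *: "\<exists>a\<in>A. ap a x = y" if "x \<in> I" "y \<in> I" "x \<le> y" for x y
  proof (rule ccontr)
    assume neg: "\<not> ?thesis"
    define Or where "Or = (\<lambda>a. ap a x) ` A"
    have lt: "ap a x < y" if "a \<in> A" for a
      using cc_between [OF assms(1) that \<open>x \<le> y\<close>] neg not_le by blast
    have xO: "x \<in> Or" unfolding Or_def using add_subgroupD(1) [OF A] by (metis ap_zero image_eqI)
    have bdd: "bdd_above Or" unfolding Or_def using lt by (intro bdd_aboveI [of _ y]) force
    have sI: "Sup Or \<in> I"
    proof -
      have "x \<le> Sup Or" "Sup Or \<le> y"
        using xO bdd lt by (auto intro!: cSup_upper cSup_least simp: Or_def less_imp_le)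
      then show ?thesis using assms(2) that unfolding is_interval_1 by blast
    qed
    have le: "ap a (Sup Or) \<le> Sup Or" if "a \<in> A" for a
    proof (rule ccontr)
      assume "\<not> ?thesis"
      then have "ap (- a) (Sup Or) < Sup Or" by (metis ap_ap_uminus ap_less_iff not_le)
      then obtain b where b: "b \<in> A" "ap (- a) (Sup Or) < ap b x"
        using less_cSup_iff [OF _ bdd] xO unfolding Or_def by auto
      then have "Sup Or < ap (a + b) x" by (metis ap_ap_uminus ap_less_iff ap_plus)
      moreover have "ap (a + b) x \<le> Sup Or"
        using b that add_subgroupD(3) [OF A] bdd by (intro cSup_upper) (auto simp: Or_def simp del: ap_plus)
      ultimately show False by simp
    qed
    obtain a where a: "a \<in> A" "ap a (Sup Or) \<noteq> Sup Or" using mv [OF sI] by blast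
    have "ap (- a) (Sup Or) \<le> Sup Or" using le a add_subgroupD(2) [OF A] by blast
    then have "Sup Or \<le> ap a (Sup Or)" by (metis ap_ap_uminus ap_le_iff)
    then show False using le [OF a(1)] a(2) by simp
  qed
  show ?thesis
  proof (cases "x \<le> y")
    case False
    then obtain a where "a \<in> A" "ap a y = x" using * [of y x] assms by auto
    then show ?thesis using add_subgroupD(2) [OF A] by (metis ap_uminus_ap)
  qed (use * assms in blast)
qed

text \<open>Points \<open>X n\<close> tending to \<open>x\<close> are \<open>ap (b n) x\<close> with
  \<open>b\<close> tending to 0 along a subsequence, and then
  \<open>r (X n) = ap (b n) (r x)\<close> tends to \<open>r x\<close>.\<close>

lemma cc_equivariant_isCont:
  fixes r :: "real \<Rightarrow> real"
  assumes "cc A" "a \<in> A" "ap a x \<noteq> x" and eq: "\<And>b. b \<in> A \<Longrightarrow> r (ap b x) = ap b (r x)"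
  shows "isCont r x"
proof (rule ccontr)
  assume "\<not> isCont r x"
  then obtain e where e: "e > 0" "\<And>d. d > 0 \<Longrightarrow> \<exists>y. \<bar>y - x\<bar> < d \<and> \<not> \<bar>r y - r x\<bar> < e"
    unfolding continuous_at_eps_delta dist_real_def by auto
  have "\<exists>y. \<bar>y - x\<bar> < 1 / real (Suc n) \<and> \<not> \<bar>r y - r x\<bar> < e" for n
    by (rule e(2)) simp
  then obtain X where X: "\<And>n. \<bar>X n - x\<bar> < 1 / real (Suc n)" "\<And>n. \<not> \<bar>r (X n) - r x\<bar> < e"
    by metis
  have "(\<lambda>n. \<bar>X n - x\<bar>) \<longlonglongrightarrow> 0"
    by (rule tendsto_sandwich [OF _ _ tendsto_const LIMSEQ_inverse_real_of_nat])
      (auto simp: inverse_eq_divide less_imp_le [OF X(1)] simp del: of_nat_Suc)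
  then have "X \<longlonglongrightarrow> x" by (metis LIM_zero_cancel tendsto_rabs_zero_iff)
  then obtain s b where b: "strict_mono (s :: nat \<Rightarrow> nat)" "\<And>n. b n \<in> A" "\<And>n. ap (b n) x = X (s n)" "b \<longlonglongrightarrow> 0"
    using cc_local_section [OF assms(1-3)] by metis
  have "(\<lambda>n. r (X (s n))) \<longlonglongrightarrow> r x"
    using tendsto_ap_const [OF b(4), of "r x"] eq b(2,3) by (simp flip: b(3))
  from tendstoD [OF this e(1)] obtain n where "\<bar>r (X (s n)) - r x\<bar> < e"
    by (auto simp: dist_real_def dest: eventually_happens)
  then show False using X(2) by blast
qed

section \<open>Groups acting freely and transitively on an interval\<close>

lemma strict_mono_int_floor:
  fixes f :: "int \<Rightarrow> real"
  assumes f: "strict_mono f" and lo: "f a \<le> w" and hi: "w < f b"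
  obtains n where "f n \<le> w" "w < f (n + 1)"
proof -
  define S where "S = {n \<in> {a..b}. f n \<le> w}"
  have ab: "a < b" using lo hi f by (meson linorder_not_less order_le_less_trans strict_mono_less_eq)
  have "S \<subseteq> {a..b}" by (auto simp: S_def)
  then have S: "finite S" by (rule finite_subset) simp
  have "a \<in> S" using ab lo by (auto simp: S_def)
  define m where "m = Max S"
  have m: "m \<in> S" unfolding m_def using S \<open>a \<in> S\<close> by (intro Max_in) auto
  have "m \<noteq> b" using m hi by (auto simp: S_def)
  then have "m + 1 \<in> {a..b}" using m by (auto simp: S_def)
  moreover have "m + 1 \<notin> S"
  proof
    assume "m + 1 \<in> S"
    then have "m + 1 \<le> m" unfolding m_def using S by (intro Max_ge) auto
    then show False by simp
  qed
  ultimately have "w < f (m + 1)" by (auto simp: S_def)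
  then show ?thesis using m that by (auto simp: S_def)
qed

primrec nmul :: "nat \<Rightarrow> 'a::group_add \<Rightarrow> 'a" where
  "nmul 0 g = 0"
| "nmul (Suc n) g = g + nmul n g"

definition zmul :: "int \<Rightarrow> 'a::group_add \<Rightarrow> 'a" where
  "zmul n g = (if n \<ge> 0 then nmul (nat n) g else - nmul (nat (- n)) g)"

lemma nmul_Suc2: "nmul (Suc n) g = nmul n g + g"
proof (induction n)
  case (Suc n)
  have "nmul (Suc (Suc n)) g = g + (nmul n g + g)" by (simp only: nmul.simps(2) [of "Suc n"] Suc)
  also have "\<dots> = nmul (Suc n) g + g" by (simp only: nmul.simps add.assoc)
  finally show ?case .
qed simp

lemma nmul_commute: "nmul n g + g = g + nmul n g"
  using nmul_Suc2 [of n g] by simp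

lemma zmul_0 [simp]: "zmul 0 g = 0"
  by (simp add: zmul_def)

lemma zmul_of_nat: "zmul (int n) g = nmul n g"
  by (simp add: zmul_def)

lemma zmul_Suc: "zmul (n + 1) g = zmul n g + g"
proof (cases "n \<ge> 0")
  case True
  then have "nat (n + 1) = Suc (nat n)" by simp
  then show ?thesis using True by (simp add: zmul_def nmul_commute)
next
  case False
  define k where "k = nat (- n - 1)"
  have k: "n = - int (Suc k)" using False by (simp add: k_def)
  have nat: "nat (- n) = Suc k" by (simp add: k)
  have "zmul n g = - nmul k g + - g"
    unfolding zmul_def nat using False by (simp add: minus_add)
  moreover have "zmul (n + 1) g = - nmul k g"
  proof -
    have e: "n + 1 = - int k" by (simp add: k)
    show ?thesis unfolding e zmul_def by (cases "k = 0") auto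
  qed
  ultimately show ?thesis by (simp add: add.assoc)
qed

lemma zmul_add: "zmul (m + n) g = zmul m g + zmul n g"
proof (induction n rule: int_induct [where k = 0])
  case (step1 i)
  have "zmul (m + (i + 1)) g = zmul (m + i) g + g"
    using zmul_Suc [of "m + i" g] by (simp add: add.assoc)
  then show ?case using step1 by (simp add: zmul_Suc add.assoc)
next
  case (step2 i)
  have "zmul (m + i) g = zmul (m + (i - 1)) g + g" "zmul i g = zmul (i - 1) g + g"
    using zmul_Suc [of "m + (i - 1)" g] zmul_Suc [of "i - 1" g] by simp_all
  then have "zmul (m + (i - 1)) g + g = (zmul m g + zmul (i - 1) g) + g"
    using step2 by (simp add: add.assoc)
  then show ?case by simp
qed simp

lemma zmul_1 [simp]: "zmul 1 g = g"
  using zmul_Suc [of 0 g] by simp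

lemma zmul_minus: "zmul (- n) g = - zmul n g"
proof -
  have "zmul (- n) g + zmul n g = 0" using zmul_add [of "- n" n g] by simp
  then show ?thesis by (simp add: eq_neg_iff_add_eq_0)
qed

lemma nmul_add: "nmul (m + n) g = nmul m g + nmul n g"
  by (induction m) (simp_all add: add.assoc)

lemma nmul_mem: "add_subgroup B \<Longrightarrow> g \<in> B \<Longrightarrow> nmul n g \<in> B"
  by (induction n) (simp_all add: add_subgroupD)

lemma zmul_mem: "add_subgroup B \<Longrightarrow> g \<in> B \<Longrightarrow> zmul n g \<in> B"
  by (simp add: zmul_def nmul_mem add_subgroupD)

text \<open>Homogenization of a quasi-additive function, as for rotation numbers:
  \<open>f (j * k)\<close> differs from \<open>j * f k\<close> by at most \<open>j\<close>, so every
  \<open>(f k - 1) / k\<close> lies below every \<open>(f j + 1) / j\<close>, and a supremum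
  separates the two families.\<close>

lemma quasi_additive_slope:
  fixes f :: "nat \<Rightarrow> real"
  assumes q: "\<And>m n. \<bar>f (m + n) - f m - f n\<bar> \<le> 1"
  shows "\<exists>L. \<forall>k. \<bar>f k - real k * L\<bar> \<le> 1"
proof -
  have mul: "\<bar>f (j * k) - real j * f k\<bar> \<le> real j" if "j \<ge> 1" for j k
    using that
  proof (induction j rule: dec_induct)
    case (step j)
    have "f (Suc j * k) - real (Suc j) * f k = (f (k + j * k) - f k - f (j * k)) + (f (j * k) - real j * f k)"
      by (simp add: algebra_simps)
    then show ?case using q [of k "j * k"] step.IH by linarith
  qed simp
  have key: "(f k - 1) / real k \<le> (f j + 1) / real j" if "j \<ge> 1" "k \<ge> 1" for j k
  proof -
    have "real j * f k - real j \<le> real k * f j + real k"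
      using mul [OF that(1), of k] mul [OF that(2), of j] by (simp add: mult.commute abs_le_iff)
    then show ?thesis using that by (simp add: field_simps)
  qed
  define L where "L = (SUP k\<in>{1..}. (f k - 1) / real k)"
  have bdd: "bdd_above ((\<lambda>k. (f k - 1) / real k) ` {1..})"
    using key [of 1] by (intro bdd_aboveI2 [where M = "f 1 + 1"]) auto
  have "\<bar>f k - real k * L\<bar> \<le> 1" if "k \<ge> 1" for k
  proof -
    have "(f k - 1) / real k \<le> L" unfolding L_def using that by (intro cSUP_upper bdd) auto
    moreover have "L \<le> (f k + 1) / real k" unfolding L_def using key that by (intro cSUP_least) auto
    ultimately show ?thesis using that by (simp add: field_simps abs_le_iff)
  qed
  moreover have "\<bar>f 0\<bar> \<le> 1" using q [of 0 0] by simp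
  ultimately show ?thesis
    by (intro exI [of _ L]) (metis One_nat_def Suc_leI diff_zero mult_zero_left not_gr_zero of_nat_0)
qed

lemma zero_if_multiples_bounded:
  fixes x c :: real
  assumes "\<And>k::nat. real k * \<bar>x\<bar> \<le> c"
  shows "x = 0"
proof (rule ccontr)
  assume "x \<noteq> 0"
  then obtain k :: nat where "c < real k * \<bar>x\<bar>" using reals_Archimedean3 [of "\<bar>x\<bar>"] by auto
  then show False using assms [of k] by simp
qed

text \<open>Hoelder's theorem: such a group is ordered and Archimedean, hence abelian and conjugate to
  the group of translations of the line.\<close>

locale free_transitive =
  fixes B :: "lift set" and I :: "real set"
  assumes subgroup: "add_subgroup B"
    and open_I: "open I" and interval_I: "is_interval I" and nonempty_I: "I \<noteq> {}"
    and invariant: "b \<in> B \<Longrightarrow> z \<in> I \<Longrightarrow> ap b z \<in> I"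
    and transitive: "z \<in> I \<Longrightarrow> w \<in> I \<Longrightarrow> \<exists>b\<in>B. ap b z = w"
    and free: "b \<in> B \<Longrightarrow> z \<in> I \<Longrightarrow> ap b z = z \<Longrightarrow> b = 0"
begin

lemmas mem [simp] = add_subgroupD [OF subgroup] nmul_mem [OF subgroup] zmul_mem [OF subgroup]

lemma between: "x \<in> I \<Longrightarrow> y \<in> I \<Longrightarrow> x \<le> z \<Longrightarrow> z \<le> y \<Longrightarrow> z \<in> I"
  using interval_I unfolding is_interval_1 by blast

lemma eq_if_agree:
  assumes "b \<in> B" "c \<in> B" "z \<in> I" "ap b z = ap c z"
  shows "b = c"
proof -
  have "ap (- c + b) z = z" using assms(4) by simp
  then have "- c + b = 0" using assms mem by (intro free [of _ z]) auto
  then show ?thesis by (metis add.right_neutral add_minus_cancel)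
qed

text \<open>By the intermediate value theorem a change of order would make the two elements agree
  somewhere, hence be equal by freeness. So comparison at one point makes \<open>B\<close> an
  ordered group.\<close>

lemma less_everywhere:
  assumes bc: "b \<in> B" "c \<in> B" and z: "z \<in> I" and w: "w \<in> I" and lt: "ap b z < ap c z"
  shows "ap b w < ap c w"
proof (rule ccontr)
  assume neg: "\<not> ap b w < ap c w"
  let ?g = "\<lambda>x. ap c x - ap b x"
  have "connected (?g ` I)"
    using interval_I by (intro connected_continuous_image continuous_intros)
      (auto simp: is_interval_connected_1)
  then have "is_interval (?g ` I)" by (simp add: is_interval_connected_1)
  moreover have "?g z \<in> ?g ` I" "?g w \<in> ?g ` I" "?g w \<le> 0" "0 \<le> ?g z"
    using z w lt neg by auto
  ultimately have "0 \<in> ?g ` I" unfolding is_interval_1 by blast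
  then obtain v where "v \<in> I" "ap b v = ap c v" by auto
  then have "b = c" using eq_if_agree bc by blast
  then show False using lt by simp
qed

lemma le_everywhere:
  assumes "b \<in> B" "c \<in> B" "z \<in> I" "w \<in> I" "ap b z \<le> ap c z"
  shows "ap b w \<le> ap c w"
  using less_everywhere [OF assms(2,1,4,3)] assms(5) by (meson linorder_not_less)

definition base :: real where "base = (SOME z. z \<in> I)"

lemma base [simp]: "base \<in> I"
  unfolding base_def using nonempty_I by (simp add: some_in_eq)

definition pos :: "lift \<Rightarrow> bool" where "pos b \<longleftrightarrow> b \<in> B \<and> base < ap b base"

lemma pos_moves: "pos b \<Longrightarrow> z \<in> I \<Longrightarrow> z < ap b z"
  using less_everywhere [of 0 b base z] mem by (simp add: pos_def)

lemma posI: "b \<in> B \<Longrightarrow> z \<in> I \<Longrightarrow> z < ap b z \<Longrightarrow> pos b"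
  using less_everywhere [of 0 b z base] mem by (simp add: pos_def)

text \<open>A bounded increasing orbit of \<open>g\<close> would converge to a fixed point of
  \<open>g\<close> in \<open>I\<close>.\<close>

lemma archimedean:
  assumes g: "pos g" and z: "z \<in> I" and w: "w \<in> I"
  shows "\<exists>n. w < ap (nmul n g) z"
proof (rule ccontr)
  assume "\<not> ?thesis"
  then have le: "ap (nmul n g) z \<le> w" for n by (simp add: not_less)
  have gB: "g \<in> B" using g by (simp add: pos_def)
  have inI: "ap (nmul n g) z \<in> I" for n using gB mem z by (intro invariant) auto
  let ?s = "\<lambda>n. ap (nmul n g) z"
  have inc: "incseq ?s"
  proof (rule incseq_SucI)
    show "?s n \<le> ?s (Suc n)" for n using pos_moves [OF g inI [of n]] by simp
  qed
  obtain l where l: "?s \<longlonglongrightarrow> l" "\<forall>n. ?s n \<le> l"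
    by (rule incseq_convergent [OF inc, of w]) (use le in auto)
  have "l \<le> w" by (rule LIMSEQ_le_const2 [OF l(1)]) (use le in auto)
  then have "l \<in> I" using l(2) [rule_format, of 0] z w by (intro between [OF z w]) auto
  have "(\<lambda>n. ?s (Suc n)) \<longlonglongrightarrow> ap g l"
    using tendsto_ap [OF tendsto_const l(1), of g] by simp
  moreover have "(\<lambda>n. ?s (Suc n)) \<longlonglongrightarrow> l" using l(1) by (rule LIMSEQ_Suc)
  ultimately have "ap g l = l" using LIMSEQ_unique by blast
  then show False using pos_moves [OF g \<open>l \<in> I\<close>] by simp
qed

lemma zmul_strict_mono:
  assumes "pos g" shows "strict_mono (\<lambda>n. ap (zmul n g) base)"
proof (rule strict_monoI)
  fix m n :: int assume "m < n"
  have "pos g" "g \<in> B" using assms by (auto simp: pos_def)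
  have step: "base < ap (nmul (Suc k) g) base" for k
  proof (induction k)
    case (Suc k)
    have "ap (nmul (Suc k) g) base \<in> I" using \<open>g \<in> B\<close> mem by (intro invariant) auto
    from less_trans [OF Suc pos_moves [OF assms this]] show ?case by simp
  qed (use assms in \<open>simp add: pos_def\<close>)
  define k where "k = nat (n - m - 1)"
  have k: "n = m + int (Suc k)" using \<open>m < n\<close> by (simp add: k_def)
  have "zmul n g = zmul m g + nmul (Suc k) g"
    by (simp only: k zmul_add zmul_of_nat)
  then show "ap (zmul m g) base < ap (zmul n g) base" using step [of k] by simp
qed

lemma floor_exists:
  assumes g: "pos g" and b: "b \<in> B"
  shows "\<exists>n. ap (zmul n g) base \<le> ap b base \<and> ap b base < ap (zmul (n + 1) g) base"
proof -
  have bI: "ap b base \<in> I" using b by (intro invariant) auto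
  obtain n where n: "ap b base < ap (nmul n g) base" using archimedean [OF g base bI] by blast
  obtain m where m: "base < ap (nmul m g) (ap b base)" using archimedean [OF g bI base] by blast
  have "ap (- nmul m g) base < ap b base" using m by (metis ap_less_iff ap_uminus_ap)
  then have lo: "ap (zmul (- int m) g) base \<le> ap b base" by (simp add: zmul_minus zmul_of_nat)
  have hi: "ap b base < ap (zmul (int n) g) base" using n by (simp add: zmul_of_nat)
  show ?thesis using strict_mono_int_floor [OF zmul_strict_mono [OF g] lo hi] by metis
qed

definition flr :: "lift \<Rightarrow> lift \<Rightarrow> int" where
  "flr g b = (SOME n. ap (zmul n g) base \<le> ap b base \<and> ap b base < ap (zmul (n + 1) g) base)"

lemma flr:
  assumes "pos g" "b \<in> B"
  shows "ap (zmul (flr g b) g) base \<le> ap b base" "ap b base < ap (zmul (flr g b + 1) g) base"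
  using someI_ex [OF floor_exists [OF assms]] unfolding flr_def by auto

text \<open>Integer parts in units of \<open>g\<close> add up with an error of at most one unit; the
  2 appears because the upper bound is strict.\<close>

lemma flr_add_bounds:
  assumes g: "pos g" and b: "b \<in> B" and c: "c \<in> B"
  shows "ap (zmul (flr g b + flr g c) g) base \<le> ap (b + c) base"
    "ap (b + c) base < ap (zmul (flr g b + flr g c + 2) g) base"
proof -
  have gB: "g \<in> B" using g by (simp add: pos_def)
  have "ap (zmul (flr g b + flr g c) g) base = ap (zmul (flr g b) g) (ap (zmul (flr g c) g) base)"
    by (simp add: zmul_add)
  also have "\<dots> \<le> ap (zmul (flr g b) g) (ap c base)"
    using flr(1) [OF g c] by simp
  also have "\<dots> \<le> ap b (ap c base)"
    by (rule le_everywhere [OF _ b base _ flr(1) [OF g b]]) (use gB c mem invariant in auto)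
  finally show "ap (zmul (flr g b + flr g c) g) base \<le> ap (b + c) base" by simp
  have "ap b (ap c base) < ap (zmul (flr g b + 1) g) (ap c base)"
    by (rule less_everywhere [OF b _ base _ flr(2) [OF g b]]) (use gB c mem invariant in auto)
  also have "\<dots> < ap (zmul (flr g b + 1) g) (ap (zmul (flr g c + 1) g) base)"
    using flr(2) [OF g c] by simp
  also have "\<dots> = ap (zmul ((flr g b + 1) + (flr g c + 1)) g) base"
    by (simp only: zmul_add ap_plus)
  also have "(flr g b + 1) + (flr g c + 1) = flr g b + flr g c + 2" by simp
  finally show "ap (b + c) base < ap (zmul (flr g b + flr g c + 2) g) base" by simp
qed

text \<open>Choose \<open>e\<close> strictly between 0 and \<open>c\<close>. If \<open>e + e\<close>
  exceeds \<open>c\<close>, then \<open>d = - e + c\<close> is smaller than \<open>e\<close>, and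
  \<open>d + d\<close> is below \<open>e + d = c\<close>.\<close>

lemma halving:
  assumes c: "pos c"
  obtains d where "pos d" "ap (d + d) base \<le> ap c base"
proof -
  have cB: "c \<in> B" "ap c base \<in> I" using c invariant by (auto simp: pos_def)
  have lt: "base < ap c base" using c by (simp add: pos_def)
  then have "(base + ap c base) / 2 \<in> I" by (intro between [OF base cB(2)]) (auto simp: field_simps)
  then obtain e where e: "e \<in> B" "ap e base = (base + ap c base) / 2" using transitive base by blast
  have e': "base < ap e base" "ap e base < ap c base" using e(2) lt by auto
  show ?thesis
  proof (cases "ap (e + e) base \<le> ap c base")
    case True
    then show ?thesis using that e(1) e'(1) by (auto simp: pos_def)
  next
    case False
    define d where "d = - e + c"
    have dB: "d \<in> B" using e(1) cB mem by (auto simp: d_def)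
    have ed: "ap e (ap d base) = ap c base" by (simp add: d_def)
    have "base < ap d base" using e'(2) ed by (metis ap_less_iff)
    moreover have "ap e (ap d base) < ap e (ap e base)" using False ed by simp
    then have lt: "ap d base < ap e base" by simp
    have "ap d (ap d base) < ap e (ap d base)"
      by (rule less_everywhere [OF dB e(1) base _ lt]) (use dB invariant in auto)
    ultimately show ?thesis using that [of d] dB ed by (auto simp: pos_def)
  qed
qed

text \<open>If \<open>b + a\<close> exceeded \<open>a + b\<close> by a positive \<open>c\<close>,
  take \<open>d\<close> with \<open>d + d\<close> at most \<open>c\<close>. Measured in units of
  \<open>d\<close>, both sums lie in the same interval of length 2, so \<open>c\<close> would be
  less than \<open>d + d\<close>.\<close>

lemma commute:
  assumes a: "a \<in> B" and b: "b \<in> B"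
  shows "a + b = b + a"
proof -
  have False if a: "a \<in> B" and b: "b \<in> B" and lt: "ap (a + b) base < ap (b + a) base" for a b
  proof -
    define c where "c = (b + a) - (a + b)"
    have cB: "c \<in> B" unfolding c_def using a b by simp
    have cab: "ap c (ap (a + b) base) = ap (b + a) base"
      by (simp add: c_def minus_add)
    have abI: "ap (a + b) base \<in> I" using a b mem by (intro invariant) auto
    have "pos c" by (rule posI [OF cB abI]) (use lt cab in simp)
    then obtain d where d: "pos d" "ap (d + d) base \<le> ap c base" by (rule halving)
    then have dB: "d \<in> B" by (simp add: pos_def)
    let ?n = "flr d a + flr d b"
    have nI: "ap (zmul ?n d) base \<in> I" using dB mem by (intro invariant) auto
    have "ap c (ap (zmul ?n d) base) \<le> ap c (ap (a + b) base)"
      using flr_add_bounds(1) [OF d(1) a b] by (simp del: ap_plus)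
    also have "\<dots> < ap (zmul (flr d b + flr d a + 2) d) base"
      unfolding cab by (rule flr_add_bounds(2) [OF d(1) b a])
    also have "flr d b + flr d a + 2 = 1 + 1 + ?n" by simp
    also have "ap (zmul (1 + 1 + ?n) d) base = ap (d + d) (ap (zmul ?n d) base)"
      by (simp only: zmul_add zmul_1 ap_plus)
    finally have "ap c base < ap (d + d) base"
      by (rule less_everywhere [OF cB _ nI base, rotated]) (use dB mem in auto)
    then show False using d(2) by simp
  qed
  then have "\<not> ap (a + b) base < ap (b + a) base" "\<not> ap (b + a) base < ap (a + b) base"
    using a b by blast+
  then have "ap (a + b) base = ap (b + a) base" by linarith
  then show ?thesis using a b mem by (intro eq_if_agree [OF _ _ base]) auto
qed

lemma nmul_distrib:
  assumes "a \<in> B" "b \<in> B"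
  shows "nmul k (a + b) = nmul k a + nmul k b"
proof (induction k)
  case (Suc k)
  have "a + (b + (nmul k a + nmul k b)) = a + ((b + nmul k a) + nmul k b)" by (simp add: add.assoc)
  also have "b + nmul k a = nmul k a + b" using assms mem by (intro commute) auto
  finally show ?case using Suc by (simp add: add.assoc)
qed simp

text \<open>\<open>\<tau>\<close> is the homogenized integer part in units of a positive
  \<open>g\<close>, additive because \<open>B\<close> is commutative; \<open>\<phi> w\<close> is
  \<open>\<tau>\<close> of the element carrying \<open>base\<close> to \<open>w\<close>.\<close>

lemma translation_coordinate:
  obtains \<phi> \<tau> where "strict_mono_on I \<phi>" "\<phi> ` I = UNIV"
    "\<And>b z. b \<in> B \<Longrightarrow> z \<in> I \<Longrightarrow> \<phi> (ap b z) = \<phi> z + \<tau> b" "\<And>s::real. \<exists>b\<in>B. \<tau> b = s"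
proof -
  obtain e where e: "e > 0" "ball base e \<subseteq> I" using open_I base open_contains_ball by blast
  then have "base + e / 2 \<in> I" by (auto simp: dist_real_def)
  then obtain g where gB: "g \<in> B" "ap g base = base + e / 2" using transitive base by blast
  then have g: "pos g" using e by (simp add: pos_def)
  define f where "f b = real_of_int (flr g b)" for b
  have q: "\<bar>f (b + c) - f b - f c\<bar> \<le> 1" if "b \<in> B" "c \<in> B" for b c
  proof -
    have bc: "b + c \<in> B" using that by simp
    note sm = strict_mono_less [OF zmul_strict_mono [OF g]]
    have "flr g b + flr g c < flr g (b + c) + 1"
      using flr_add_bounds(1) [OF g that] flr(2) [OF g bc] sm [of "flr g b + flr g c"] by (meson order_le_less_trans)
    moreover have "flr g (b + c) < flr g b + flr g c + 2"
      using flr_add_bounds(2) [OF g that] flr(1) [OF g bc] sm [of "flr g (b + c)"] by (meson order_le_less_trans)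
    ultimately show ?thesis unfolding f_def by linarith
  qed
  have "\<exists>L. \<forall>k. \<bar>f (nmul k b) - real k * L\<bar> \<le> 1" if b: "b \<in> B" for b
    by (rule quasi_additive_slope) (use q b mem in \<open>simp add: nmul_add\<close>)
  then obtain \<tau> where \<tau>: "\<And>b k. b \<in> B \<Longrightarrow> \<bar>f (nmul k b) - real k * \<tau> b\<bar> \<le> 1"
    by metis
  have add: "\<tau> (b + c) = \<tau> b + \<tau> c" if bc: "b \<in> B" "c \<in> B" for b c
  proof -
    \<comment> \<open>The defect of additivity is multiplied by \<open>k\<close>, while only four
      errors of at most 1 accumulate.\<close>
    have "real k * \<bar>\<tau> (b + c) - \<tau> b - \<tau> c\<bar> \<le> 4" for k
    proof -
      have "\<bar>f (nmul k b + nmul k c) - f (nmul k b) - f (nmul k c)\<bar> \<le> 1"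
        using bc mem by (intro q) auto
      moreover have "\<bar>f (nmul k b + nmul k c) - real k * \<tau> (b + c)\<bar> \<le> 1"
        using \<tau> [of "b + c" k] bc mem by (simp add: nmul_distrib)
      moreover note \<tau> [OF bc(1), of k] \<tau> [OF bc(2), of k]
      ultimately have "\<bar>real k * \<tau> (b + c) - real k * \<tau> b - real k * \<tau> c\<bar> \<le> 4" by linarith
      moreover have "real k * \<tau> (b + c) - real k * \<tau> b - real k * \<tau> c = real k * (\<tau> (b + c) - \<tau> b - \<tau> c)"
        by (simp add: algebra_simps)
      ultimately show ?thesis by (simp add: abs_mult)
    qed
    then show ?thesis using zero_if_multiples_bounded by fastforce
  qed
  have \<tau>pos: "\<tau> b > 0" if b: "pos b" for b
  proof -
    have bB: "b \<in> B" using b by (simp add: pos_def)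
    \<comment> \<open>An integer part of at least 4, less the error 1 of the homogenization, leaves
      \<open>real k * \<tau> b\<close> positive.\<close>
    have "ap (zmul 4 g) base \<in> I" using gB mem by (intro invariant) auto
    then obtain k where k: "ap (zmul 4 g) base < ap (nmul k b) base" using archimedean [OF b base] by blast
    have "nmul k b \<in> B" using bB by simp
    then have "ap (zmul 4 g) base < ap (zmul (flr g (nmul k b) + 1) g) base"
      using k flr(2) [OF g] by (meson order_less_trans)
    then have "4 < flr g (nmul k b) + 1" using strict_mono_less [OF zmul_strict_mono [OF g]] by blast
    then have "f (nmul k b) \<ge> 4" unfolding f_def by linarith
    then have "real k * \<tau> b \<ge> 3" using \<tau> [OF bB, of k] by linarith
    then show ?thesis by (smt (verit) mult_nonneg_nonpos of_nat_0_le_iff)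
  qed
  have "0 \<in> B" by simp
  then have \<tau>0: "\<tau> 0 = 0" using add [of 0 0] by simp
  have \<tau>m: "\<tau> (- b) = - \<tau> b" if "b \<in> B" for b
    using add [of "- b" b] that mem \<tau>0 by auto
  have small: "\<exists>d. pos d \<and> \<tau> d < \<epsilon>" if "\<epsilon> > 0" for \<epsilon>
  proof -
    have "\<exists>d. pos d \<and> \<tau> d \<le> \<tau> g / 2 ^ n" for n :: nat
    proof (induction n)
      case 0
      then show ?case using g by auto
    next
      case (Suc n)
      then obtain c where c: "pos c" "\<tau> c \<le> \<tau> g / 2 ^ n" by blast
      obtain d where d: "pos d" "ap (d + d) base \<le> ap c base" using halving [OF c(1)] by blast
      have B: "d \<in> B" "c \<in> B" using c d by (auto simp: pos_def)
      have "\<tau> (d + d) \<le> \<tau> c"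
      proof (cases "ap (d + d) base = ap c base")
        case True
        then have "d + d = c" using B mem by (intro eq_if_agree [OF _ _ base]) auto
        then show ?thesis by simp
      next
        case False
        then have "ap (d + d) base < ap (c - (d + d)) (ap (d + d) base)" using d(2) by (simp add: minus_add)
        moreover have "ap (d + d) base \<in> I" using B mem by (intro invariant) auto
        ultimately have "pos (c - (d + d))" using B mem by (intro posI) auto
        then have "0 < \<tau> (c - (d + d))" by (rule \<tau>pos)
        moreover have "\<tau> (c - (d + d) + (d + d)) = \<tau> (c - (d + d)) + \<tau> (d + d)" using B mem by (intro add) auto
        ultimately show ?thesis by simp
      qed
      then have "2 * \<tau> d \<le> \<tau> g / 2 ^ n" using add [OF B(1) B(1)] c(2) by simp
      then show ?case using d(1) by (intro exI [of _ d]) (simp add: field_simps)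
    qed
    moreover obtain n :: nat where "\<tau> g / \<epsilon> < 2 ^ n" using real_arch_pow [of 2] by auto
    ultimately show ?thesis using that by (metis divide_less_eq le_less_trans mult.commute zero_less_numeral zero_less_power pos_divide_less_eq)
  qed
  define el where "el w = (SOME b. b \<in> B \<and> ap b base = w)" for w
  have el: "el w \<in> B" "ap (el w) base = w" if "w \<in> I" for w
    using someI_ex [of "\<lambda>b. b \<in> B \<and> ap b base = w"] transitive [OF base that] unfolding el_def by auto
  define \<phi> where "\<phi> w = \<tau> (el w)" for w
  have eq: "\<phi> (ap b z) = \<phi> z + \<tau> b" if b: "b \<in> B" "z \<in> I" for b z
  proof -
    have bz: "ap b z \<in> I" using b invariant by blast
    have "el (ap b z) = b + el z"
      using el [OF bz] el [OF b(2)] b mem by (intro eq_if_agree [OF _ _ base]) auto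
    then show ?thesis using add [OF b(1) el(1) [OF b(2)]] by (simp add: \<phi>_def)
  qed
  have mono: "\<phi> w < \<phi> w'" if w: "w \<in> I" "w' \<in> I" "w < w'" for w w'
  proof -
    obtain b where b: "b \<in> B" "ap b w = w'" using transitive w by blast
    then have "pos b" using w by (intro posI) auto
    then show ?thesis using eq [OF b(1) w(1)] \<tau>pos b(2) by simp
  qed
  have "t \<in> \<phi> ` I" for t
  proof -
    define S where "S = {w \<in> I. \<phi> w < t}"
    have \<tau>n: "\<tau> (nmul n g) = real n * \<tau> g" for n
      using gB mem by (induction n) (auto simp: \<tau>0 add algebra_simps)
    obtain n :: nat where n: "\<bar>t - \<phi> base\<bar> < real n * \<tau> g"
      using reals_Archimedean3 [OF \<tau>pos [OF g]] by blast
    define lo hi where "lo = ap (- nmul n g) base" and "hi = ap (nmul n g) base"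
    have lohi: "lo \<in> I" "hi \<in> I" unfolding lo_def hi_def using gB mem by (auto intro!: invariant)
    have "\<phi> lo = \<phi> base - real n * \<tau> g" "\<phi> hi = \<phi> base + real n * \<tau> g"
      unfolding lo_def hi_def using eq [of "- nmul n g" base] eq [of "nmul n g" base] gB mem \<tau>m \<tau>n by auto
    then have \<phi>lh: "\<phi> lo < t" "t < \<phi> hi" using n by auto
    have ub: "w \<le> v" if "w \<in> S" "v \<in> I" "t \<le> \<phi> v" for w v
      using mono [of v w] that by (force simp: S_def)
    have S: "lo \<in> S" "bdd_above S"
      using lohi \<phi>lh ub by (auto simp: S_def intro!: bdd_aboveI [of _ hi])
    have sI: "Sup S \<in> I"
      using S lohi \<phi>lh ub by (intro between [OF lohi]) (auto intro!: cSup_upper cSup_least)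
    \<comment> \<open>Otherwise a positive \<open>d\<close> with \<open>\<tau> d\<close> below the
      difference would move the supremum to a larger element of \<open>S\<close>, or back to a
      smaller upper bound.\<close>
    have "\<phi> (Sup S) = t"
    proof (rule ccontr)
      assume "\<not> ?thesis"
      then obtain d where d: "pos d" "\<tau> d < \<bar>\<phi> (Sup S) - t\<bar>" using small [of "\<bar>\<phi> (Sup S) - t\<bar>"] by auto
      have dB: "d \<in> B" "- d \<in> B" using d mem by (auto simp: pos_def)
      show False
      proof (cases "\<phi> (Sup S) < t")
        case True
        then have "ap d (Sup S) \<in> S" using eq [OF dB(1) sI] d dB invariant sI by (auto simp: S_def)
        then have "ap d (Sup S) \<le> Sup S" using S by (intro cSup_upper) auto
        then show False using pos_moves [OF d(1) sI] by simp
      next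
        case False
        then have "t \<le> \<phi> (ap (- d) (Sup S))" using eq [OF dB(2) sI] d \<tau>m dB by simp
        then have "Sup S \<le> ap (- d) (Sup S)"
          using S ub [OF _ invariant [OF dB(2) sI]] by (intro cSup_least) auto
        moreover have "ap (- d) (Sup S) < ap d (ap (- d) (Sup S))"
          using invariant [OF dB(2) sI] by (rule pos_moves [OF d(1)])
        ultimately show False by simp
      qed
    qed
    then show ?thesis using sI by blast
  qed
  then have surj: "\<phi> ` I = UNIV" by blast
  have "\<exists>b\<in>B. \<tau> b = s" for s
  proof -
    obtain z w where zw: "z \<in> I" "w \<in> I" "\<phi> z = 0" "\<phi> w = s" using surj by (metis UNIV_I imageE)
    then obtain b where "b \<in> B" "ap b z = w" using transitive by blast
    then show ?thesis using eq [of b z] zw by auto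
  qed
  then show ?thesis using that [of \<phi> \<tau>] mono surj eq by (simp add: strict_mono_on_def)
qed

end

section \<open>Fixed points of point stabilizers\<close>

definition shift :: "real \<Rightarrow> lift" where "shift s = Lift (\<lambda>x. x + s)"

lemma ap_shift [simp]: "ap (shift s) x = x + s"
  unfolding shift_def by (subst ap_Lift) (auto simp: strict_mono_def intro!: continuous_intros)

lemma shift_2pi_commute: "shift (2 * pi) + g = g + shift (2 * pi)"
  by (rule lift_eqI) simp

lemma ap_nmul: "ap (nmul n g) x = (ap g ^^ n) x"
  by (induction n) simp_all

text \<open>Stated for an interval because it is applied twice: to \<open>A\<close> on the whole
  line, and to the elements fixing a tuple on one complementary interval.\<close>

locale gap_action =
  fixes B :: "lift set" and I :: "real set"
  assumes cc_B: "cc B" and open_I: "open I" and interval_I: "is_interval I"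
    and invariant: "b \<in> B \<Longrightarrow> z \<in> I \<Longrightarrow> ap b z \<in> I"
    and transitive: "z \<in> I \<Longrightarrow> w \<in> I \<Longrightarrow> \<exists>b\<in>B. ap b z = w"
    and moved: "\<exists>z\<in>I. \<exists>w\<in>I. z < w \<and> (\<exists>b\<in>stab B z. ap b w \<noteq> w)"
begin

lemmas subgroup = cc_add_subgroup [OF cc_B]

lemmas mem [simp] = add_subgroupD [OF subgroup]

lemma between: "x \<in> I \<Longrightarrow> y \<in> I \<Longrightarrow> x \<le> z \<Longrightarrow> z \<le> y \<Longrightarrow> z \<in> I"
  using interval_I unfolding is_interval_1 by blast

definition fx :: "real \<Rightarrow> real set" where
  "fx z = {w \<in> I. \<forall>b\<in>stab B z. ap b w = w}"

lemma fx_self: "z \<in> I \<Longrightarrow> z \<in> fx z"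
  by (simp add: fx_def stab_def)

lemma fx_mono: "w \<in> fx z \<Longrightarrow> fx w \<subseteq> fx z"
  unfolding fx_def stab_def by auto

text \<open>The normalizer of \<open>B\<close>, as far as it preserves \<open>I\<close>. The map
  \<open>nx\<close> has to commute with all of it, in particular with the full turn and with the
  whole group of lifts.\<close>

definition symmetry :: "lift \<Rightarrow> bool" where
  "symmetry g \<longleftrightarrow> (\<forall>b\<in>B. g + b - g \<in> B \<and> - g + b + g \<in> B) \<and> (\<forall>z\<in>I. ap g z \<in> I \<and> ap (- g) z \<in> I)"

lemma symmetry_uminus: "symmetry g \<Longrightarrow> symmetry (- g)"
  unfolding symmetry_def by (auto simp: minus_lift_def simp del: add_uminus_conv_diff)

lemma symmetry_mem: "b \<in> B \<Longrightarrow> symmetry b"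
  unfolding symmetry_def by (simp add: invariant)

lemma fx_symmetry1:
  assumes g: "symmetry g" and w: "w \<in> fx z"
  shows "ap g w \<in> fx (ap g z)"
proof -
  have "ap b (ap g w) = ap g w" if b: "b \<in> B" "ap b (ap g z) = ap g z" for b
  proof -
    have "- g + b + g \<in> B" using g b by (simp add: symmetry_def)
    moreover have "ap (- g + b + g) z = z" using b by simp
    ultimately have "- g + b + g \<in> stab B z" by (simp only: stab_def mem_Collect_eq)
    then have "ap (- g + b + g) w = w" using w unfolding fx_def by blast
    then have "ap g (ap (- g) (ap b (ap g w))) = ap g w" by simp
    then show ?thesis by simp
  qed
  then show ?thesis using w g by (simp add: fx_def stab_def symmetry_def)
qed

lemma fx_symmetry: "symmetry g \<Longrightarrow> ap g w \<in> fx (ap g z) \<longleftrightarrow> w \<in> fx z"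
  using fx_symmetry1 [of g w z] fx_symmetry1 [OF symmetry_uminus, of g "ap g w" "ap g z"] by auto

lemma closed_fixing_all: "closed {w. \<forall>b\<in>S. ap b w = w}"
proof -
  have "{w. \<forall>b\<in>S. ap b w = w} = (\<Inter>b\<in>S. {w. ap b w = w})" by auto
  moreover have "closed {w. ap b w = w}" for b
    by (intro closed_Collect_eq continuous_intros)
  ultimately show ?thesis by (simp add: closed_INT)
qed

text \<open>Let \<open>a\<close> be the last point of \<open>fx z0\<close> up to a moved point
  \<open>w0\<close>. Then \<open>a < w0\<close>, and \<open>fx a\<close>, being part of
  \<open>fx z0\<close>, has no point between them; transitivity carries this gap from
  \<open>a\<close> to any \<open>z\<close>.\<close>

lemma right_gap:
  assumes z: "z \<in> I"
  shows "\<exists>v>z. \<forall>w. z < w \<longrightarrow> w < v \<longrightarrow> w \<notin> fx z"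
proof -
  obtain z0 w0 b where zw: "z0 \<in> I" "w0 \<in> I" "z0 < w0" "b \<in> stab B z0" "ap b w0 \<noteq> w0"
    using moved by blast
  define S where "S = {w \<in> fx z0. w \<le> w0}"
  define a where "a = Sup S"
  have S: "z0 \<in> S" "bdd_above S" using zw fx_self by (auto simp: S_def intro!: bdd_aboveI [of _ w0])
  have a: "z0 \<le> a" "a \<le> w0" unfolding a_def
    using S by (auto simp: S_def intro!: cSup_upper cSup_least)
  then have aI: "a \<in> I" using between [OF zw(1,2)] by blast
  have "a \<in> closure S" unfolding a_def using S by (intro closure_contains_Sup) auto
  moreover have "closure S \<subseteq> {w. \<forall>b\<in>stab B z0. ap b w = w}"
    by (intro closure_minimal closed_fixing_all) (auto simp: S_def fx_def)
  ultimately have afx: "a \<in> fx z0" using aI by (auto simp: fx_def)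
  then have "a < w0" using a zw by (cases "a = w0") (auto simp: fx_def)
  have "w \<notin> fx a" if "a < w" "w < w0" for w
  proof
    assume "w \<in> fx a"
    then have "w \<in> S" using fx_mono [OF afx] that by (auto simp: S_def)
    then have "w \<le> a" unfolding a_def using S by (intro cSup_upper) auto
    then show False using that by simp
  qed
  then have gap: "\<forall>w. a < w \<longrightarrow> w < w0 \<longrightarrow> w \<notin> fx a" by blast
  obtain c where c: "c \<in> B" "ap c a = z" using transitive aI z by blast
  show ?thesis
  proof (intro exI conjI allI impI)
    show "z < ap c w0" using \<open>a < w0\<close> c by auto
    fix w assume w: "z < w" "w < ap c w0"
    have "ap (- c) z < ap (- c) w" "ap (- c) w < ap (- c) (ap c w0)"
      using w by (simp_all only: ap_less_iff)
    moreover have "ap (- c) z = a" using c by auto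
    ultimately have "a < ap (- c) w" "ap (- c) w < w0" by simp_all
    then have "ap (- c) w \<notin> fx a" using gap by blast
    then have "ap c (ap (- c) w) \<notin> fx (ap c a)" using fx_symmetry symmetry_mem c(1) by blast
    then show "w \<notin> fx z" using c by simp
  qed
qed

end

locale gap_action_next = gap_action +
  assumes next_exists: "\<exists>z\<in>I. \<exists>w\<in>fx z. z < w"
begin

lemma next_nonempty: "z \<in> I \<Longrightarrow> \<exists>w\<in>fx z. z < w"
proof -
  assume z: "z \<in> I"
  obtain z0 w0 where 0: "z0 \<in> I" "w0 \<in> fx z0" "z0 < w0" using next_exists by blast
  obtain b where b: "b \<in> B" "ap b z0 = z" using transitive 0 z by blast
  then have "ap b w0 \<in> fx z" "z < ap b w0" using fx_symmetry1 [OF symmetry_mem [OF b(1)] 0(2)] 0(3) by auto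
  then show ?thesis by blast
qed

definition nx :: "real \<Rightarrow> real" where "nx z = Inf {w \<in> fx z. z < w}"

lemma nx:
  assumes z: "z \<in> I"
  shows "nx z \<in> fx z" "z < nx z" "\<And>w. w \<in> fx z \<Longrightarrow> z < w \<Longrightarrow> nx z \<le> w"
proof -
  let ?S = "{w \<in> fx z. z < w}"
  have bdd: "bdd_below ?S" by (intro bdd_belowI [of _ z]) auto
  obtain w0 where w0: "w0 \<in> ?S" using next_nonempty [OF z] by blast
  show le: "nx z \<le> w" if "w \<in> fx z" "z < w" for w
    unfolding nx_def using that bdd by (intro cInf_lower) auto
  obtain v where v: "v > z" "\<forall>w. z < w \<longrightarrow> w < v \<longrightarrow> w \<notin> fx z" using right_gap [OF z] by blast
  have "v \<le> nx z" unfolding nx_def using w0 v(2) by (intro cInf_greatest) force+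
  then show "z < nx z" using v(1) by simp
  have "w0 \<in> I" using w0 by (simp add: fx_def)
  then have "nx z \<in> I" using le w0 \<open>z < nx z\<close> by (intro between [OF z \<open>w0 \<in> I\<close>]) auto
  moreover have "nx z \<in> closure ?S" unfolding nx_def using w0 bdd by (intro closure_contains_Inf) auto
  moreover have "closure ?S \<subseteq> {w. \<forall>b\<in>stab B z. ap b w = w}"
    by (intro closure_minimal closed_fixing_all) (auto simp: fx_def)
  ultimately show "nx z \<in> fx z" by (auto simp: fx_def)
qed

lemma nx_in: "z \<in> I \<Longrightarrow> nx z \<in> I"
  using nx(1) by (auto simp: fx_def)

lemma nx_symmetry:
  assumes g: "symmetry g" and z: "z \<in> I"
  shows "nx (ap g z) = ap g (nx z)"
proof (rule antisym)
  have gz: "ap g z \<in> I" using g z by (simp add: symmetry_def)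
  show "nx (ap g z) \<le> ap g (nx z)"
    using nx(3) [OF gz] nx(1,2) [OF z] fx_symmetry1 [OF g] by simp
  have "ap (- g) (nx (ap g z)) \<in> fx z" using fx_symmetry1 [OF symmetry_uminus [OF g] nx(1) [OF gz]] by simp
  moreover have "ap g z < ap g (ap (- g) (nx (ap g z)))" using nx(2) [OF gz] by simp
  then have "z < ap (- g) (nx (ap g z))" by (simp only: ap_less_iff)
  ultimately have "nx z \<le> ap (- g) (nx (ap g z))" using nx(3) [OF z] by blast
  then have "ap g (nx z) \<le> ap g (ap (- g) (nx (ap g z)))" by (simp only: ap_le_iff)
  then show "ap g (nx z) \<le> nx (ap g z)" by simp
qed

lemma nx_isCont: "z \<in> I \<Longrightarrow> isCont nx z"
proof -
  assume z: "z \<in> I"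
  obtain b where "b \<in> B" "ap b z = nx z" using transitive [OF z nx_in [OF z]] by blast
  then show ?thesis
    using nx(2) [OF z] nx_symmetry [OF symmetry_mem z]
    by (intro cc_equivariant_isCont [OF cc_B]) auto
qed

text \<open>With a common value \<open>w\<close>, the stabilizer of \<open>z1\<close>, which is
  transitive between \<open>z1\<close> and \<open>w\<close>, would make \<open>nx\<close> constantly
  equal to \<open>w\<close> there. By continuity \<open>nx w = w\<close>, which is
  impossible.\<close>

lemma nx_inj_less:
  assumes z: "z1 \<in> I" "z2 \<in> I" "z1 < z2"
  shows "nx z1 \<noteq> nx z2"
proof
  assume eq: "nx z1 = nx z2"
  define w where "w = nx z1"
  have w: "w \<in> I" "z1 < w" "z2 < w" unfolding w_def using nx_in [OF z(1)] nx(2) [OF z(1)] nx(2) [OF z(2)] eq by simp_all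
  have const: "nx y = w" if y: "z1 < y" "y < w" for y
  proof -
    have "\<exists>h\<in>stab B z1. ap h z2 = y"
    proof (rule cc_transitive [of _ "{z1<..<w}"])
      show "\<exists>a\<in>stab B z1. ap a v \<noteq> v" if "v \<in> {z1<..<w}" for v
      proof -
        have "v \<in> I" using that z(1) w(1) by (intro between [OF z(1) w(1)]) auto
        moreover have "v \<notin> fx z1" using nx(3) [OF z(1), of v] that by (auto simp: w_def)
        ultimately show ?thesis by (auto simp: fx_def)
      qed
    qed (use y z w in \<open>auto intro: cc_stab cc_B simp: is_interval_oo\<close>)
    then obtain h where h: "h \<in> B" "ap h z1 = z1" "ap h z2 = y" by (auto simp: stab_def)
    have "nx y = ap h (nx z2)" using nx_symmetry [OF symmetry_mem [OF h(1)] z(2)] h(3) by simp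
    also have "\<dots> = ap h (nx z1)" using eq by simp
    also have "\<dots> = nx z1" using nx_symmetry [OF symmetry_mem [OF h(1)] z(1)] h(2) by simp
    finally show ?thesis by (simp add: w_def)
  qed
  \<comment> \<open>The denominator starts at 2 so that all points lie strictly between
    \<open>z1\<close> and \<open>w\<close>.\<close>
  define X where "X n = w - (w - z1) / real (n + 2)" for n
  have "(\<lambda>n. 1 / real (Suc (Suc n))) \<longlonglongrightarrow> 0"
    using LIMSEQ_Suc [OF LIMSEQ_inverse_real_of_nat] by (simp only: inverse_eq_divide)
  from tendsto_diff [OF tendsto_const tendsto_mult [OF tendsto_const this]]
  have "(\<lambda>n. w - (w - z1) * (1 / real (Suc (Suc n)))) \<longlonglongrightarrow> w - (w - z1) * 0" .
  then have "X \<longlonglongrightarrow> w" by (simp add: X_def [abs_def])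
  then have "(\<lambda>n. nx (X n)) \<longlonglongrightarrow> nx w" by (rule isCont_tendsto_compose [OF nx_isCont [OF w(1)]])
  moreover have "nx (X n) = w" for n
  proof (rule const)
    have "(w - z1) / real (n + 2) < (w - z1) / 1" using w by (intro divide_strict_left_mono) auto
    then show "z1 < X n" by (simp add: X_def)
    show "X n < w" using w by (simp add: X_def)
  qed
  ultimately have "nx w = w" by (simp add: LIMSEQ_const_iff)
  then show False using nx(2) [OF w(1)] by simp
qed

lemma nx_inj: "z1 \<in> I \<Longrightarrow> z2 \<in> I \<Longrightarrow> nx z1 = nx z2 \<Longrightarrow> z1 = z2"
  using nx_inj_less by (metis linorder_less_linear)

text \<open>An element fixing \<open>nx z\<close> commutes with the injective \<open>nx\<close>, so
  it fixes \<open>z\<close>. Hence \<open>fx\<close> is constant along the iterates of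
  \<open>nx\<close>.\<close>

lemma stab_nx:
  assumes z: "z \<in> I" shows "stab B (nx z) = stab B z"
proof
  show "stab B z \<subseteq> stab B (nx z)" using nx(1) [OF z] by (auto simp: stab_def fx_def)
  show "stab B (nx z) \<subseteq> stab B z"
  proof
    fix b assume "b \<in> stab B (nx z)"
    then have b: "b \<in> B" "ap b (nx z) = nx z" by (auto simp: stab_def)
    then have "nx (ap b z) = nx z" using nx_symmetry [OF symmetry_mem z] by simp
    then have "ap b z = z" using nx_inj z invariant b by blast
    then show "b \<in> stab B z" using b by (simp add: stab_def)
  qed
qed

lemma iterate_in: "z \<in> I \<Longrightarrow> (nx ^^ n) z \<in> I"
  by (induction n) (auto intro: nx_in)

lemma stab_iterate: "z \<in> I \<Longrightarrow> stab B ((nx ^^ n) z) = stab B z"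
  by (induction n) (auto simp: stab_nx iterate_in)

lemma fx_iterate: "z \<in> I \<Longrightarrow> fx ((nx ^^ n) z) = fx z"
  by (simp add: fx_def stab_iterate)

lemma iterate_unbounded:
  assumes z: "z \<in> I" and y: "y \<in> I"
  shows "\<exists>n. y < (nx ^^ n) z"
proof (rule ccontr)
  assume "\<not> ?thesis"
  then have le: "(nx ^^ n) z \<le> y" for n by (simp add: not_less)
  let ?s = "\<lambda>n. (nx ^^ n) z"
  have inc: "incseq ?s"
  proof (rule incseq_SucI)
    show "?s n \<le> ?s (Suc n)" for n using nx(2) [OF iterate_in [OF z, of n]] by simp
  qed
  obtain l where l: "?s \<longlonglongrightarrow> l" "\<forall>n. ?s n \<le> l"
    by (rule incseq_convergent [OF inc, of y]) (use le in auto)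
  have "l \<le> y" by (rule LIMSEQ_le_const2 [OF l(1)]) (use le in auto)
  then have lI: "l \<in> I" using l(2) [rule_format, of 0] by (intro between [OF z y]) auto
  have "(\<lambda>n. ?s (Suc n)) \<longlonglongrightarrow> nx l"
    using isCont_tendsto_compose [OF nx_isCont [OF lI] l(1)] by simp
  moreover have "(\<lambda>n. ?s (Suc n)) \<longlonglongrightarrow> l" using l(1) by (rule LIMSEQ_Suc)
  ultimately have "nx l = l" using LIMSEQ_unique by blast
  then show False using nx(2) [OF lI] by simp
qed

text \<open>The point \<open>w\<close> lies between two consecutive iterates. As \<open>fx\<close>
  is the same for all of them, minimality of \<open>nx\<close> makes it equal to the lower
  one.\<close>

lemma fx_is_iterate:
  assumes z: "z \<in> I" and w: "w \<in> fx z" "z \<le> w"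
  shows "\<exists>n. w = (nx ^^ n) z"
proof -
  have wI: "w \<in> I" using w by (simp add: fx_def)
  define n where "n = (LEAST n. w < (nx ^^ n) z)"
  have n: "w < (nx ^^ n) z" unfolding n_def using iterate_unbounded [OF z wI] by (rule LeastI_ex)
  then have "n \<noteq> 0" using w(2) by (cases n) auto
  then obtain m where m: "n = Suc m" using not0_implies_Suc by blast
  have "\<not> w < (nx ^^ m) z" using not_less_Least [of m "\<lambda>n. w < (nx ^^ n) z"] m n_def by simp
  moreover have "\<not> (nx ^^ m) z < w"
    using nx(3) [OF iterate_in [OF z, of m], of w] fx_iterate [OF z] w(1) n m by auto
  ultimately have "w = (nx ^^ m) z" by simp
  then show ?thesis by blast
qed

end

text \<open>The group of all lifts of a transitive circle group, with its well-chained part.\<close>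

locale circle_group =
  fixes L A :: "lift set"
  assumes subgroup_L: "add_subgroup L" and cc_A: "cc A" and A_subset: "A \<subseteq> L"
    and normal: "g \<in> L \<Longrightarrow> a \<in> A \<Longrightarrow> g + a - g \<in> A"
    and transitive_A: "\<exists>a\<in>A. ap a x = y"
begin

lemma normal': "g \<in> L \<Longrightarrow> a \<in> A \<Longrightarrow> - g + a + g \<in> A"
  using normal [of "- g" a] add_subgroupD(2) [OF subgroup_L] by simp

text \<open>\<open>\<rho>\<close> is the map \<open>nx\<close> for \<open>A\<close> on the line. It
  exists since the stabilizer of \<open>x0\<close> also fixes \<open>x0 + 2 * pi\<close>; this point
  is therefore some iterate, and its index is \<open>k\<close>.\<close>

lemma deck_root:
  assumes a: "a \<in> A" "a \<noteq> 0" "ap a x0 = x0"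
  obtains \<rho> k where "k \<ge> 1" "nmul k \<rho> = shift (2 * pi)" "\<And>g. g \<in> L \<Longrightarrow> \<rho> + g = g + \<rho>"
    "\<And>x. x < ap \<rho> x" "\<And>x y. x < y \<Longrightarrow> y < ap \<rho> x \<Longrightarrow> \<exists>a\<in>stab A x. ap a y \<noteq> y"
proof -
  obtain w where w: "ap a w \<noteq> w" using a(2) lift_eqI [of a 0] by auto
  obtain m :: nat where m: "x0 - w < real m * (2 * pi)"
    using reals_Archimedean3 [of "2 * pi"] by auto
  \<comment> \<open>A translate, by full turns, of a point moved by \<open>a\<close>, far enough to
    the right of \<open>x0\<close>.\<close>
  define w0 where "w0 = w + 2 * pi * of_int (int m)"
  have "ap a w0 = ap a w + 2 * pi * of_int (int m)" unfolding w0_def by (rule ap_add_int)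
  then have w0: "x0 < w0" "ap a w0 \<noteq> w0" using m w unfolding w0_def by (simp_all add: algebra_simps)
  interpret gap_action A UNIV
    by unfold_locales (use cc_A transitive_A w0 a in \<open>auto simp: stab_def\<close>)
  have "x0 + 2 * pi \<in> fx x0" by (simp add: fx_def stab_def)
  interpret gap_action_next A UNIV
  proof
    show "\<exists>z\<in>UNIV. \<exists>w\<in>fx z. z < w"
      using \<open>x0 + 2 * pi \<in> fx x0\<close> by (intro bexI [of _ x0] bexI [of _ "x0 + 2 * pi"]) auto
  qed
  have sym_L: "symmetry g" if "g \<in> L" for g
    using that normal normal' by (auto simp: symmetry_def)
  have sym_T: "symmetry (shift (2 * pi))"
  proof -
    have "shift (2 * pi) + b - shift (2 * pi) = b" "- shift (2 * pi) + b + shift (2 * pi) = b" for b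
    proof -
      show "shift (2 * pi) + b - shift (2 * pi) = b"
        unfolding shift_2pi_commute by simp
      have "- shift (2 * pi) + (b + shift (2 * pi)) = b"
        unfolding shift_2pi_commute [symmetric] by simp
      then show "- shift (2 * pi) + b + shift (2 * pi) = b" by (simp add: add.assoc)
    qed
    then show ?thesis by (simp add: symmetry_def)
  qed
  have per: "nx (x + 2 * pi) = nx x + 2 * pi" for x
    using nx_symmetry [OF sym_T] by simp
  have cont: "continuous_on S nx" for S
    using nx_isCont by (auto intro!: continuous_at_imp_continuous_on)
  have per': "nx (x + 2 * pi * real n) = nx x + 2 * pi * real n" for x n
  proof (induction n)
    case (Suc n)
    have "nx (x + 2 * pi * real (Suc n)) = nx ((x + 2 * pi * real n) + 2 * pi)" by (simp add: algebra_simps)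
    also have "\<dots> = nx (x + 2 * pi * real n) + 2 * pi" by (rule per)
    finally show ?case using Suc by (simp add: algebra_simps)
  qed simp
  have mono: "strict_mono nx"
  proof (rule strict_monoI)
    fix x y :: real assume xy: "x < y"
    obtain n :: nat where n: "y - x < real n * (2 * pi)"
      using reals_Archimedean3 [of "2 * pi"] by auto
    \<comment> \<open>Continuity and injectivity give strict monotonicity between \<open>x\<close>
      and \<open>b\<close>; comparing the values at these translates shows that it is
      increasing.\<close>
    define b where "b = x + 2 * pi * real n"
    have b: "y < b" using n by (simp add: b_def algebra_simps)
    have inj: "inj_on nx {x..b}" using nx_inj by (auto simp: inj_on_def)
    have "nx x < nx b" using per' [of x n] b xy by (simp add: b_def)
    then show "nx x < nx y"
      using continuous_inj_imp_mono [OF xy b cont inj] by auto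
  qed
  define \<rho> where "\<rho> = Lift nx"
  have \<rho>: "ap \<rho> = nx" unfolding \<rho>_def by (rule ap_Lift [OF mono cont per])
  have comm: "\<rho> + g = g + \<rho>" if "symmetry g" for g
    by (rule lift_eqI) (use nx_symmetry [OF that] \<rho> in simp)
  have "x0 + 2 * pi \<in> fx x0" by fact
  then obtain k where k: "x0 + 2 * pi = (nx ^^ k) x0"
    using fx_is_iterate [of x0 "x0 + 2 * pi"] by auto
  have "k \<noteq> 0" using k by (cases k) auto
  have commk: "nmul k \<rho> + g = g + nmul k \<rho>" if "symmetry g" for g
    using comm [OF that] by (induction k) (simp_all add: add.assoc, metis add.assoc)
  have "nmul k \<rho> = shift (2 * pi)"
  proof (rule lift_eqI)
    fix x
    \<comment> \<open>Both sides commute with the transitive \<open>A\<close>, so their agreement at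
      \<open>x0\<close> spreads to every \<open>x\<close>.\<close>
    obtain b where b: "b \<in> A" "ap b x0 = x" using transitive_A by blast
    have "ap (nmul k \<rho>) x = ap (nmul k \<rho> + b) x0" using b by simp
    also have "\<dots> = ap (b + nmul k \<rho>) x0" using commk [OF symmetry_mem [OF b(1)]] by simp
    also have "\<dots> = x + 2 * pi" using b k by (simp add: ap_nmul \<rho> flip: k)
    finally show "ap (nmul k \<rho>) x = ap (shift (2 * pi)) x" by simp
  qed
  moreover have "\<exists>a\<in>stab A x. ap a y \<noteq> y" if "x < y" "y < ap \<rho> x" for x y
    using nx(3) [of x y] that by (auto simp: fx_def \<rho>)
  moreover have "x < ap \<rho> x" for x using nx(2) [of x] by (simp add: \<rho>)
  ultimately show ?thesis using that [of k \<rho>] \<open>k \<noteq> 0\<close> comm [OF sym_L] by simp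
qed

end

section \<open>Cyclically ordered tuples\<close>

text \<open>A cyclically ordered \<open>n\<close>-tuple of points of the circle is represented by the increasing
  enumeration of its preimage on the line.\<close>

definition cyc :: "nat \<Rightarrow> (int \<Rightarrow> real) \<Rightarrow> bool" where
  "cyc n x \<longleftrightarrow> strict_mono x \<and> (\<forall>i. x (i + int n) = x i + 2 * pi)"

lemma cycD: "cyc n x \<Longrightarrow> i < j \<Longrightarrow> x i < x j" "cyc n x \<Longrightarrow> x (i + int n) = x i + 2 * pi"
  by (auto simp: cyc_def strict_mono_def)

lemma cyc_less_iff: "cyc n x \<Longrightarrow> x i < x j \<longleftrightarrow> i < j"
  by (simp add: cyc_def strict_mono_less)

lemma cyc_pos: "cyc n x \<Longrightarrow> 1 \<le> n"
  using cycD(2) [of n x 0] by (cases n) auto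

lemma cyc_mult: "cyc n x \<Longrightarrow> x (i + int n * m) = x i + 2 * pi * of_int m"
proof (induction m rule: int_induct [where k = 0])
  case (step1 m)
  then show ?case using cycD(2) [of n x "i + int n * m"] by (simp add: algebra_simps)
next
  case (step2 m)
  then show ?case using cycD(2) [of n x "i + int n * (m - 1)"] by (simp add: algebra_simps)
qed simp

lemma cyc_shift: "cyc n x \<Longrightarrow> cyc n (\<lambda>i. x (i + j))"
  unfolding cyc_def strict_mono_def by (auto simp: algebra_simps) (metis add.assoc add.commute)

lemma cyc_image: "cyc n x \<Longrightarrow> cyc n (\<lambda>i. ap g (x i))"
  by (simp add: cyc_def strict_mono_def)

lemma cyc_locate:
  assumes x: "cyc n x"
  obtains j where "x j \<le> z" "z < x (j + 1)"
proof -
  obtain m :: nat where m: "\<bar>z - x 0\<bar> < real m * (2 * pi)"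
    using reals_Archimedean3 [of "2 * pi"] by auto
  have "x (int n * int m) = x 0 + 2 * pi * real m" "x (int n * (- int m)) = x 0 - 2 * pi * real m"
    using cyc_mult [OF x, of 0 "int m"] cyc_mult [OF x, of 0 "- int m"] by simp_all
  then have "x (int n * (- int m)) \<le> z" "z < x (int n * int m)"
    using m by (simp_all add: algebra_simps)
  moreover have "strict_mono x" using x by (simp add: cyc_def)
  ultimately show ?thesis using strict_mono_int_floor that by metis
qed

lemma cyc_locate_between:
  assumes x: "cyc n x" and z: "z \<notin> range x"
  obtains j where "x j < z" "z < x (j + 1)"
proof -
  obtain j where j: "x j \<le> z" "z < x (j + 1)" using cyc_locate [OF x] by blast
  then have "x j < z" using z by (metis order_le_less rangeI)
  then show ?thesis using j that by blast
qed

lemma cyc_gap_not_range: "cyc n x \<Longrightarrow> x j < z \<Longrightarrow> z < x (j + 1) \<Longrightarrow> z \<notin> range x"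
  by (auto simp: cyc_less_iff)

lemma strict_mono_int_stepI:
  fixes f :: "int \<Rightarrow> real"
  assumes "\<And>i. f i < f (i + 1)"
  shows "strict_mono f"
proof (rule strict_monoI)
  fix i j :: int assume "i < j"
  then show "f i < f j"
  proof (induction j rule: int_gr_induct)
    case (step j)
    then show ?case using assms [of j] by linarith
  qed (rule assms)
qed

text \<open>The new point goes between \<open>x (- 1)\<close> and \<open>x 0\<close> and gets index
  0; its translates get the multiples of \<open>n + 1\<close>. At the other indices the value of
  \<open>x\<close> is read after discounting the translates passed, whence
  \<open>k - 1 - k div (int n + 1)\<close>.\<close>

definition ins :: "nat \<Rightarrow> (int \<Rightarrow> real) \<Rightarrow> real \<Rightarrow> int \<Rightarrow> real" where
  "ins n x z k = (if (int n + 1) dvd k then z + 2 * pi * of_int (k div (int n + 1))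
     else x (k - 1 - k div (int n + 1)))"

lemma ins_cases:
  assumes n: "n \<ge> 1"
  obtains m where "k = (int n + 1) * m" "ins n x z k = z + 2 * pi * of_int m"
  | m j where "0 \<le> j" "j < int n" "k = (int n + 1) * m + (j + 1)" "ins n x z k = x (j + int n * m)"
proof -
  define m r where "m = k div (int n + 1)" and "r = k mod (int n + 1)"
  have k: "k = (int n + 1) * m + r" by (simp add: m_def r_def)
  have r: "0 \<le> r" "r < int n + 1"
    unfolding r_def using pos_mod_bound [of "int n + 1" k] pos_mod_sign [of "int n + 1" k] by linarith+
  have dvd: "(int n + 1) dvd k \<longleftrightarrow> r = 0" by (simp add: r_def dvd_eq_mod_eq_0)
  show ?thesis
  proof (cases "r = 0")
    case True
    then have "(int n + 1) dvd k" using dvd by blast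
    then have "ins n x z k = z + 2 * pi * of_int m" by (simp only: ins_def m_def if_True)
    moreover have "k = (int n + 1) * m" using k True by simp
    ultimately show ?thesis using that(1) by blast
  next
    case False
    have "k - 1 - m = (r - 1) + int n * m" using k by (simp add: algebra_simps)
    moreover have "\<not> (int n + 1) dvd k" using dvd False by blast
    then have "ins n x z k = x (k - 1 - m)" by (simp only: ins_def m_def if_False)
    ultimately have "ins n x z k = x ((r - 1) + int n * m)" by (simp only:)
    moreover have "k = (int n + 1) * m + ((r - 1) + 1)" using k by simp
    moreover have "0 \<le> r - 1" "r - 1 < int n" using r False by auto
    ultimately show ?thesis using that(2) by blast
  qed
qed

lemma ins_mult: "ins n x z ((int n + 1) * m) = z + 2 * pi * of_int m"
proof -
  have "(int n + 1) * m div (int n + 1) = m" by (rule nonzero_mult_div_cancel_left) linarith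
  then show ?thesis by (simp add: ins_def)
qed

lemma ins_other:
  assumes "0 \<le> j" "j < int n"
  shows "ins n x z ((int n + 1) * m + (j + 1)) = x (j + int n * m)"
proof -
  have q: "((int n + 1) * m + (j + 1)) div (int n + 1) = m"
    using assms by (intro int_div_pos_eq [of _ _ _ "j + 1"]) auto
  have r: "((int n + 1) * m + (j + 1)) mod (int n + 1) = j + 1"
    using assms by (intro int_mod_pos_eq [of _ _ m]) auto
  have "\<not> (int n + 1) dvd ((int n + 1) * m + (j + 1))"
    unfolding dvd_eq_mod_eq_0 r using assms by simp
  moreover have "((int n + 1) * m + (j + 1)) - 1 - m = j + int n * m" by (simp add: algebra_simps)
  ultimately show ?thesis by (simp only: ins_def q if_False)
qed

lemma ins_values:
  assumes "n \<ge> 1"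
  shows "ins n x z 0 = z" "ins n x z 1 = x 0" "ins n x z (- 1) = x (- 1)"
proof -
  show "ins n x z 0 = z" using ins_mult [of n x z 0] by simp
  show "ins n x z 1 = x 0" using ins_other [of 0 n x z 0] assms by simp
  have "(int n + 1) * (- 1) + (int n - 1 + 1) = - 1" "int n - 1 + int n * (- 1) = - 1" by simp_all
  then show "ins n x z (- 1) = x (- 1)" using ins_other [of "int n - 1" n x z "- 1"] assms by simp
qed

lemma cyc_ins:
  assumes x: "cyc n x" and z: "x (- 1) < z" "z < x 0"
  shows "cyc (n + 1) (ins n x z)"
proof -
  have n: "n \<ge> 1" using cyc_pos [OF x] .
  have step: "ins n x z k < ins n x z (k + 1)" for k
  proof (cases rule: ins_cases [OF n, of k x z])
    case (1 m)
    have "ins n x z (k + 1) = x (0 + int n * m)" using 1 n ins_other [of 0 n x z m] by simp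
    then show ?thesis using 1 z cyc_mult [OF x, of 0 m] by simp
  next
    case (2 m j)
    show ?thesis
    proof (cases "j + 1 = int n")
      case True
      have "k + 1 = (int n + 1) * (m + 1)" using 2 True by (simp add: algebra_simps)
      then have "ins n x z (k + 1) = z + 2 * pi * of_int (m + 1)" using ins_mult by metis
      moreover have "j + int n * m = - 1 + int n * (m + 1)" using True by (simp add: algebra_simps)
      then have "ins n x z k = x (- 1) + 2 * pi * of_int (m + 1)" using 2 cyc_mult [OF x, of "- 1" "m + 1"] by simp
      ultimately show ?thesis using z by simp
    next
      case False
      have "k + 1 = (int n + 1) * m + ((j + 1) + 1)" using 2 by simp
      moreover have "ins n x z ((int n + 1) * m + ((j + 1) + 1)) = x ((j + 1) + int n * m)"
        using 2 False by (intro ins_other) auto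
      ultimately have "ins n x z (k + 1) = x ((j + 1) + int n * m)" by (simp only:)
      then show ?thesis using 2 cycD(1) [OF x] by simp
    qed
  qed
  have "ins n x z (k + int (n + 1)) = ins n x z k + 2 * pi" for k
  proof (cases rule: ins_cases [OF n, of k x z])
    case (1 m)
    have "k + int (n + 1) = (int n + 1) * (m + 1)" using 1 by (simp add: algebra_simps)
    then have "ins n x z (k + int (n + 1)) = z + 2 * pi * of_int (m + 1)" using ins_mult by metis
    then show ?thesis using 1 by (simp add: algebra_simps)
  next
    case (2 m j)
    have "k + int (n + 1) = (int n + 1) * (m + 1) + (j + 1)" using 2 by (simp add: algebra_simps)
    then have "ins n x z (k + int (n + 1)) = x (j + int n * (m + 1))" using ins_other 2 by metis
    then show ?thesis using 2 cyc_mult [OF x, of j "m + 1"] cyc_mult [OF x, of j m] by (simp add: algebra_simps)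
  qed
  then show ?thesis using strict_mono_int_stepI [of "ins n x z", OF step] by (simp add: cyc_def)
qed

lemma range_ins:
  assumes x: "cyc n x"
  shows "range (ins n x z) = range x \<union> range (\<lambda>m. z + 2 * pi * of_int m)"
proof -
  have n: "n \<ge> 1" using cyc_pos [OF x] .
  have "ins n x z k \<in> range x \<union> range (\<lambda>m. z + 2 * pi * of_int m)" for k
    by (cases rule: ins_cases [OF n, of k x z]) auto
  moreover have "z + 2 * pi * of_int m \<in> range (ins n x z)" for m
    using ins_mult by (metis rangeI)
  moreover have "x i \<in> range (ins n x z)" for i
  proof -
    have "i = i mod int n + int n * (i div int n)" by simp
    moreover have "0 \<le> i mod int n" "i mod int n < int n" using n by simp_all
    ultimately show ?thesis using ins_other by (metis rangeI)
  qed
  ultimately show ?thesis by blast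
qed

lemma cyc_Suc_cases:
  assumes y: "cyc (n + 1) y" and n: "n \<ge> 1"
  obtains x z where "cyc n x" "x (- 1) < z" "z < x 0" "y = ins n x z"
proof -
  \<comment> \<open>Index \<open>i\<close> of the shorter tuple skips the multiples of
    \<open>n + 1\<close>, at which the removed point \<open>y 0\<close> and its translates
    stand.\<close>
  define x where "x i = y (i + i div int n + 1)" for i
  have sm: "x i < x j" if "i < j" for i j
  proof -
    have "i div int n \<le> j div int n" using that n by (intro zdiv_mono1) auto
    then show ?thesis using that by (simp add: x_def cyc_less_iff [OF y])
  qed
  have per: "x (i + int n) = x i + 2 * pi" for i
  proof -
    have "(i + int n) div int n = i div int n + 1" using n by simp
    then have "(i + int n) + (i + int n) div int n + 1 = (i + i div int n + 1) + int (n + 1)" by simp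
    then show ?thesis unfolding x_def using cycD(2) [OF y] by presburger
  qed
  have x: "cyc n x" using sm per by (simp add: cyc_def strict_mono_def)
  have "(- 1) div int n = - 1" using n by (intro int_div_pos_eq [of _ _ _ "int n - 1"]) auto
  then have x1: "x (- 1) = y (- 1)" by (simp add: x_def)
  have x0: "x 0 = y 1" by (simp add: x_def)
  have "y = ins n x (y 0)"
  proof
    fix k show "y k = ins n x (y 0) k"
    proof (cases rule: ins_cases [OF n, of k x "y 0"])
      case (1 m)
      then show ?thesis using cyc_mult [OF y, of 0 m] by (simp add: add.commute)
    next
      case (2 m j)
      have "(j + int n * m) div int n = m" using 2 by (intro int_div_pos_eq [of _ _ _ j]) auto
      then have kk: "(j + int n * m) + (j + int n * m) div int n + 1 = k" using 2 by (simp add: algebra_simps)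
      show ?thesis unfolding 2(4) x_def kk ..
    qed
  qed
  moreover have "x (- 1) < y 0" "y 0 < x 0" using x1 x0 by (simp_all add: cyc_less_iff [OF y])
  ultimately show ?thesis using that x by blast
qed

lemma ap_ins:
  assumes "\<And>i. ap a (x i) = x' i" "ap a z = z'"
  shows "ap a (ins n x z k) = ins n x' z' k"
  by (cases "(int n + 1) dvd k") (simp_all only: ins_def if_True if_False ap_add_int assms)

lemma cyc_1_iff: "cyc 1 x \<longleftrightarrow> (\<forall>i. x i = x 0 + 2 * pi * of_int i)"
proof
  assume c: "cyc 1 x"
  have "x i = x 0 + 2 * pi * of_int i" for i
    using cyc_mult [OF c, of 0 i] unfolding of_nat_1 mult_1 add_0 .
  then show "\<forall>i. x i = x 0 + 2 * pi * of_int i" by blast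
next
  assume *: "\<forall>i. x i = x 0 + 2 * pi * of_int i"
  have "x i < x j" if "i < j" for i j
    using that *[rule_format, of i] * [rule_format, of j] by simp
  moreover have "x (i + 1) = x i + 2 * pi" for i
    using *[rule_format, of i] * [rule_format, of "i + 1"] by (simp add: algebra_simps)
  ultimately show "cyc 1 x" by (simp add: cyc_def strict_mono_def)
qed

section \<open>The induction on the length of tuples\<close>

locale primitive_group = circle_group +
  assumes primitive: "x < y \<Longrightarrow> y < x + 2 * pi \<Longrightarrow> \<exists>a\<in>stab A x. ap a y \<noteq> y"
begin

lemmas memA [simp] = add_subgroupD [OF cc_add_subgroup [OF cc_A]]

definition fixer :: "(int \<Rightarrow> real) \<Rightarrow> lift set" where
  "fixer x = {a \<in> A. \<forall>i. ap a (x i) = x i}"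

definition only_fixes :: "nat \<Rightarrow> bool" where
  "only_fixes n \<longleftrightarrow> (\<forall>x z. cyc n x \<longrightarrow> z \<notin> range x \<longrightarrow> (\<exists>a\<in>fixer x. ap a z \<noteq> z))"

definition tuple_transitive :: "nat \<Rightarrow> bool" where
  "tuple_transitive n \<longleftrightarrow> (\<forall>x y. cyc n x \<longrightarrow> cyc n y \<longrightarrow> (\<exists>a\<in>A. \<forall>i. ap a (x i) = y i))"

text \<open>The condition concerns \<open>n\<close> points and one more: together with
  \<open>tuple_transitive (n + 1)\<close> it makes the action on tuples of length
  \<open>n + 1\<close> simply transitive.\<close>

definition sharp :: "nat \<Rightarrow> bool" where
  "sharp n \<longleftrightarrow> (\<forall>x z a. cyc n x \<longrightarrow> z \<notin> range x \<longrightarrow> a \<in> fixer x \<longrightarrow> ap a z = z \<longrightarrow> a = 0)"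

lemma cc_fixer:
  assumes x: "cyc n x"
  shows "cc (fixer x)"
proof -
  have n: "n \<ge> 1" using cyc_pos [OF x] .
  have "ap a (x i) = x i" if "\<forall>z\<in>x ` {0..<int n}. ap a z = z" for a i
  proof -
    have i: "i = i mod int n + int n * (i div int n)" by simp
    have "x i = x (i mod int n) + 2 * pi * of_int (i div int n)"
      using cyc_mult [OF x, of "i mod int n" "i div int n"] i by simp
    moreover have "ap a (x (i mod int n)) = x (i mod int n)" using that n by auto
    ultimately show ?thesis by simp
  qed
  then have eq: "fixer x = {a \<in> A. \<forall>z\<in>x ` {0..<int n}. ap a z = z}" by (auto simp: fixer_def)
  show ?thesis unfolding eq by (intro cc_stab_finite cc_A) simp
qed

lemma fixer_ins:
  assumes "cyc n x" shows "fixer (ins n x z) = stab (fixer x) z"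
proof -
  have "(\<forall>i. ap a (ins n x z i) = ins n x z i) \<longleftrightarrow> (\<forall>v\<in>range (ins n x z). ap a v = v)" for a by blast
  also have "\<dots> a \<longleftrightarrow> (\<forall>i. ap a (x i) = x i) \<and> ap a z = z" for a
    unfolding range_ins [OF assms] by (auto dest: spec [of _ "0 :: int"])
  finally show ?thesis by (auto simp: fixer_def stab_def)
qed

lemma fixer_interval_transitive:
  assumes P: "only_fixes n" and x: "cyc n x" and z: "x j < z" "z < x (j + 1)" "x j < w" "w < x (j + 1)"
  shows "\<exists>a\<in>fixer x. ap a z = w"
proof (rule cc_transitive [of _ "{x j<..<x (j + 1)}"])
  show "\<exists>a\<in>fixer x. ap a v \<noteq> v" if "v \<in> {x j<..<x (j + 1)}" for v
    using P x cyc_gap_not_range [OF x, of j v] that unfolding only_fixes_def by auto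
qed (use z cc_fixer [OF x] in \<open>auto simp: is_interval_oo\<close>)

lemma only_fixes_1: "only_fixes 1"
  unfolding only_fixes_def
proof (intro allI impI)
  fix x z assume x: "cyc 1 x" and z: "z \<notin> range x"
  obtain j where j: "x j < z" "z < x (j + 1)" using cyc_locate_between [OF x z] by blast
  have e: "x i = x 0 + 2 * pi * of_int i" for i using x cyc_1_iff by blast
  have "x j < z" "z < x j + 2 * pi" using j e [of j] e [of "j + 1"] by (simp_all add: algebra_simps)
  then obtain a where a: "a \<in> stab A (x j)" "ap a z \<noteq> z" using primitive by blast
  have "ap a (x i) = x i" for i
  proof -
    have "x i = x j + 2 * pi * of_int (i - j)" using e [of i] e [of j] by (simp add: algebra_simps)
    then show ?thesis using a(1) by (simp only: ap_add_int stab_def mem_Collect_eq)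
  qed
  then show "\<exists>a\<in>fixer x. ap a z \<noteq> z" using a by (auto simp: fixer_def stab_def)
qed

lemma tuple_transitive_1: "tuple_transitive 1"
  unfolding tuple_transitive_def
proof (intro allI impI)
  fix x y assume x: "cyc 1 x" and y: "cyc 1 y"
  obtain a where a: "a \<in> A" "ap a (x 0) = y 0" using transitive_A by blast
  have "ap a (x i) = y i" for i
  proof -
    have "x i = x 0 + 2 * pi * of_int i" "y i = y 0 + 2 * pi * of_int i" using x y cyc_1_iff by blast+
    then show ?thesis using a by (simp only: ap_add_int)
  qed
  then show "\<exists>a\<in>A. \<forall>i. ap a (x i) = y i" using a by blast
qed

text \<open>After the shorter tuples are matched, an element fixing the target tuple corrects the
  remaining point inside its complementary interval.\<close>

lemma tuple_transitive_Suc: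
  assumes P: "only_fixes n" and T: "tuple_transitive n" and n: "n \<ge> 1"
  shows "tuple_transitive (n + 1)"
  unfolding tuple_transitive_def
proof (intro allI impI)
  fix X Y assume "cyc (n + 1) X" and "cyc (n + 1) Y"
  then obtain x z y w where X: "cyc n x" "x (- 1) < z" "z < x 0" "X = ins n x z"
    and Y: "cyc n y" "y (- 1) < w" "w < y 0" "Y = ins n y w"
    using cyc_Suc_cases n by metis
  obtain a where a: "a \<in> A" "\<And>i. ap a (x i) = y i" using T X Y unfolding tuple_transitive_def by blast
  have "ap a (x (- 1)) < ap a z" "ap a z < ap a (x 0)" using X by simp_all
  then obtain b where b: "b \<in> fixer y" "ap b (ap a z) = w"
    using fixer_interval_transitive [OF P Y(1), of "- 1" "ap a z" w] Y a by auto
  have "ap (b + a) (x i) = y i" for i using b a by (simp add: fixer_def)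
  then have "ap (b + a) (X k) = Y k" for k unfolding X(4) Y(4) using b by (intro ap_ins) auto
  then show "\<exists>a\<in>A. \<forall>i. ap a (X i) = Y i" using a b by (intro bexI [of _ "b + a"]) (auto simp: fixer_def)
qed

lemma fixer_conj:
  assumes s: "s \<in> A" "\<And>i. ap s (y i) = y' i" and b: "b \<in> fixer y"
  shows "s + b - s \<in> fixer y'"
proof -
  have "ap (s + b - s) (y' i) = y' i" for i
    using b by (simp add: fixer_def flip: s(2))
  then show ?thesis using s b by (simp add: fixer_def)
qed

text \<open>Suppose that both alternatives fail. By transitivity on \<open>(n + 1)\<close>-tuples
  every such tuple has a nontrivial fixer, and some tuple has a further common fixed point. The
  rotations of that tuple bring both facts into one complementary interval, where \<open>nx\<close>
  becomes available; its iterates then accumulate at places which minimality of \<open>nx\<close>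
  forbids.\<close>

lemma sharp_or_only_fixes_Suc:
  assumes P: "only_fixes n" and T: "tuple_transitive n" and n: "n \<ge> 1"
  shows "sharp n \<or> only_fixes (n + 1)"
proof (rule ccontr)
  assume neg: "\<not> ?thesis"
  note T1 = tuple_transitive_Suc [OF P T n]
  have rot: "\<exists>s\<in>A. \<forall>i. ap s (y i) = y (i + j)" if "cyc (n + 1) y" for y j
    using T1 that cyc_shift [OF that] unfolding tuple_transitive_def by blast
  obtain x0 z0 a0 where 0: "cyc n x0" "z0 \<notin> range x0" "a0 \<in> fixer x0" "ap a0 z0 = z0" "a0 \<noteq> 0"
    using neg unfolding sharp_def by blast
  obtain y0 where y0: "cyc (n + 1) y0" "a0 \<in> fixer y0"
  proof -
    obtain j where j: "x0 j < z0" "z0 < x0 (j + 1)" using cyc_locate_between [OF 0(1,2)] by blast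
    define x where "x i = x0 (i + (j + 1))" for i
    have x: "cyc n x" unfolding x_def by (rule cyc_shift [OF 0(1)])
    have "x (- 1) < z0" "z0 < x 0" using j by (simp_all add: x_def add.commute)
    then have "cyc (n + 1) (ins n x z0)" by (rule cyc_ins [OF x])
    moreover have "a0 \<in> fixer (ins n x z0)"
      unfolding fixer_ins [OF x] using 0 by (auto simp: stab_def fixer_def x_def)
    ultimately show ?thesis using that by blast
  qed
  have nontriv: "\<exists>b\<in>fixer y. b \<noteq> 0" if y: "cyc (n + 1) y" for y
  proof -
    obtain s where s: "s \<in> A" "\<And>i. ap s (y0 i) = y i" using T1 y0 y unfolding tuple_transitive_def by blast
    have "s + a0 - s \<in> fixer y" by (rule fixer_conj [OF s y0(2)])
    moreover have "s + a0 - s \<noteq> 0" using 0(5) by (metis add_0_right add_left_cancel diff_eq_eq add_0_left)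
    ultimately show ?thesis by blast
  qed
  \<comment> \<open>All common fixed points, on the whole line. A rotation of the tuple normalizes
    its fixer and so preserves this set.\<close>
  define F where "F y = {w. \<forall>b\<in>fixer y. ap b w = w}" for y
  have F_rot: "ap s w \<in> F y" if s: "s \<in> A" "\<And>i. ap s (y i) = y (i + j)" and w: "w \<in> F y" for s y j w
  proof -
    have "ap b (ap s w) = ap s w" if b: "b \<in> fixer y" for b
    proof -
      have "ap (- s) (y i) = y (i - j)" for i using s(2) [of "i - j"] by (simp add: ap_uminus_eq_iff)
      then have "- s + b - (- s) \<in> fixer y"
        using fixer_conj [of "- s" "\<lambda>i. y (i + j)" y b] s b by (simp add: fixer_def ap_uminus_eq_iff)
      then have "ap (- s + b - (- s)) w = w" using w by (auto simp: F_def simp del: ap_minus)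
      then show ?thesis by (simp add: ap_uminus_eq_iff)
    qed
    then show ?thesis by (simp add: F_def)
  qed
  have move: "\<exists>s\<in>A. (\<forall>i. ap s (y i) = y (i + j)) \<and> (\<forall>w. ap s w \<in> F y \<longleftrightarrow> w \<in> F y)" if y: "cyc (n + 1) y" for y j
  proof -
    obtain s where s: "s \<in> A" "\<forall>i. ap s (y i) = y (i + j)" using rot [OF y] by blast
    have m: "ap (- s) (y i) = y (i + - j)" for i using s(2) [rule_format, of "i - j"] by (simp add: ap_uminus_eq_iff)
    have "w \<in> F y" if "ap s w \<in> F y" for w
      using F_rot [of "- s" y "- j" "ap s w"] m s that by simp
    moreover have "ap s w \<in> F y" if "w \<in> F y" for w
      using F_rot [of s y j w] s that by simp
    ultimately show ?thesis using s by blast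
  qed
  obtain Y w1 where Y: "cyc (n + 1) Y" "w1 \<notin> range Y" "w1 \<in> F Y"
    using neg unfolding only_fixes_def F_def by blast
  obtain x z where x: "cyc n x" "x (- 1) < z" "z < x 0" "Y = ins n x z"
    using cyc_Suc_cases [OF Y(1) n] by blast
  define I where "I = {x (- 1)<..<x 0}"
  define y where "y v = ins n x v" for v
  have yv: "cyc (n + 1) (y v)" "y v 0 = v" "y v 1 = x 0" "fixer (y v) = stab (fixer x) v" if "v \<in> I" for v
    using that cyc_ins [OF x(1)] ins_values [OF n] fixer_ins [OF x(1)] by (auto simp: y_def I_def)
  have zI: "z \<in> I" using x by (simp add: I_def)
  have "\<exists>w\<in>I. z < w \<and> (\<exists>b\<in>stab (fixer x) z. ap b w \<noteq> w)"
  proof -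
    obtain b where b: "b \<in> fixer (y z)" "b \<noteq> 0" using nontriv [OF yv(1) [OF zI]] by blast
    obtain w where w: "ap b w \<noteq> w" using b(2) lift_eqI [of b 0] by auto
    then have wF: "w \<notin> F (y z)" using b by (auto simp: F_def)
    have "w \<notin> range (y z)" using w b by (auto simp: fixer_def)
    then obtain j where j: "y z j < w" "w < y z (j + 1)" using cyc_locate_between [OF yv(1) [OF zI]] by blast
    obtain s where s: "s \<in> A" "\<forall>i. ap s (y z i) = y z (i + - j)" "\<forall>w. ap s w \<in> F (y z) \<longleftrightarrow> w \<in> F (y z)"
      using move [OF yv(1) [OF zI], of "- j"] by blast
    have "ap s (y z j) < ap s w" "ap s w < ap s (y z (j + 1))" using j by simp_all
    then have "z < ap s w" "ap s w < x 0" using s(2) yv zI by simp_all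
    moreover have "ap s w \<notin> F (y z)" using s wF by blast
    ultimately show ?thesis using yv zI by (intro bexI [of _ "ap s w"]) (auto simp: F_def I_def)
  qed
  then interpret gap_action "fixer x" I
  proof unfold_locales
    show "cc (fixer x)" by (rule cc_fixer [OF x(1)])
    show "ap b v \<in> I" if "b \<in> fixer x" "v \<in> I" for b v
    proof -
      have "ap b (x (- 1)) < ap b v" "ap b v < ap b (x 0)" using that by (simp_all add: I_def)
      moreover have "ap b (x (- 1)) = x (- 1)" "ap b (x 0) = x 0" using that by (simp_all add: fixer_def)
      ultimately show ?thesis by (simp add: I_def)
    qed
    show "\<exists>b\<in>fixer x. ap b v = w" if "v \<in> I" "w \<in> I" for v w
      using fixer_interval_transitive [OF P x(1), of "- 1" v w] that by (simp add: I_def)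
    show "\<exists>z\<in>I. \<exists>w\<in>I. z < w \<and> (\<exists>b\<in>stab (fixer x) z. ap b w \<noteq> w)"
      if "\<exists>w\<in>I. z < w \<and> (\<exists>b\<in>stab (fixer x) z. ap b w \<noteq> w)"
      using that zI by blast
  qed (simp_all add: I_def is_interval_oo)
  have fxF: "fx v = F (y v) \<inter> I" if "v \<in> I" for v
    using yv(4) [OF that] by (auto simp: fx_def F_def)
  have "\<exists>w\<in>fx z. z < w"
  proof -
    obtain j where j: "Y j < w1" "w1 < Y (j + 1)" using cyc_locate_between [OF Y(1,2)] by blast
    have YY: "Y = y z" using x by (simp add: y_def)
    obtain s where s: "s \<in> A" "\<forall>i. ap s (Y i) = Y (i + - j)" "\<forall>w. ap s w \<in> F Y \<longleftrightarrow> w \<in> F Y"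
      using move [OF Y(1), of "- j"] by blast
    have "ap s (y z j) < ap s w1" "ap s w1 < ap s (y z (j + 1))" using j YY by simp_all
    then have "z < ap s w1" "ap s w1 < x 0" using s(2) [unfolded YY] yv zI by simp_all
    moreover have "ap s w1 \<in> F (y z)" using s(3) Y(3) YY by simp
    ultimately show ?thesis using fxF [OF zI] zI by (intro bexI [of _ "ap s w1"]) (auto simp: I_def)
  qed
  then interpret gap_action_next "fixer x" I
    by unfold_locales (use zI in blast)
  \<comment> \<open>The iterates of \<open>nx\<close> at \<open>v\<close> belong to
    \<open>F (y v)\<close> and accumulate at the right end \<open>x 0\<close>. The rotation taking
    \<open>v\<close> to \<open>x 0\<close> transfers this accumulation to \<open>v\<close>,
    approached from the left.\<close>
  have acc: "\<exists>f\<in>F (y v). u < f \<and> f < v" if v: "v \<in> I" and u: "u < v" for u v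
  proof -
    obtain s where s: "s \<in> A" "\<forall>i. ap s (y v i) = y v (i + 1)" "\<forall>w. ap s w \<in> F (y v) \<longleftrightarrow> w \<in> F (y v)"
      using move [OF yv(1) [OF v], of 1] by blast
    have sv: "ap s v = x 0" using s(2) [rule_format, of 0] yv v by simp
    define t where "t = (max (ap s u) v + x 0) / 2"
    have "ap s u < x 0" using u sv by (metis ap_less_iff)
    then have t: "v < t" "ap s u < t" "t < x 0" using v by (auto simp: t_def I_def)
    then have "t \<in> I" using v by (simp add: I_def)
    then obtain m where m: "t < (nx ^^ m) v" using iterate_unbounded v by blast
    have fI: "(nx ^^ m) v \<in> I" by (rule iterate_in [OF v])
    have "(nx ^^ m) v \<in> fx v" using fx_self [OF fI] fx_iterate [OF v] by simp
    then have fF: "(nx ^^ m) v \<in> F (y v)" using fxF [OF v] by blast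
    define f where "f = ap (- s) ((nx ^^ m) v)"
    have sf: "ap s f = (nx ^^ m) v" by (simp add: f_def)
    have "ap s u < (nx ^^ m) v" "(nx ^^ m) v < x 0" using m t fI by (simp_all add: I_def)
    then have "ap s u < ap s f" "ap s f < ap s v" by (simp_all only: sf sv)
    then have "u < f" "f < v" by (simp_all only: ap_less_iff)
    moreover have "f \<in> F (y v)" using s(3) [rule_format, of f] fF unfolding sf by blast
    ultimately show ?thesis by blast
  qed
  \<comment> \<open>For \<open>v = nx z\<close> the set \<open>F (y v)\<close> coincides with
    \<open>F (y z)\<close>, because \<open>z\<close> and \<open>nx z\<close> have the same
    stabilizer; so a common fixed point lies strictly between \<open>z\<close> and
    \<open>nx z\<close>.\<close>
  have "nx z \<in> I" "z < nx z" using nx_in nx(2) zI by blast+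
  then obtain f where f: "f \<in> F (y (nx z))" "z < f" "f < nx z" using acc by blast
  have "f \<in> F (y z)" using f(1) yv(4) \<open>nx z \<in> I\<close> zI stab_nx [OF zI] by (simp add: F_def)
  moreover have "f \<in> I" using f \<open>nx z \<in> I\<close> zI by (auto simp: I_def)
  ultimately have "f \<in> fx z" using fxF [OF zI] by blast
  then show False using nx(3) [OF zI, of f] f by simp
qed

end

section \<open>Sharply two-transitive actions on an interval\<close>

lemma LIMSEQ_decseq_bounded:
  fixes X :: "nat \<Rightarrow> real"
  assumes "\<And>n. X (Suc n) \<le> X n" "\<And>n. c \<le> X n"
  obtains l where "X \<longlonglongrightarrow> l" "c \<le> l" "\<And>n. l \<le> X n"
proof -
  have "decseq X" using assms(1) by (rule decseq_SucI)
  then obtain l where l: "X \<longlonglongrightarrow> l" "\<forall>n. l \<le> X n"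
    using decseq_convergent [of X c] assms(2) by auto
  moreover have "c \<le> l" by (rule LIMSEQ_le_const [OF l(1)]) (use assms(2) in auto)
  ultimately show ?thesis using that by blast
qed

text \<open>The model is the orientation-preserving affine group of the line: nontrivial elements
  fix at most one point, stabilizers are transitive on each half line, and by
  \<open>opposite\<close> a map expanding on the right of its centre also expands on the
  left.\<close>

locale affine_action =
  fixes B :: "lift set" and I :: "real set"
  assumes cc_B: "cc B" and open_I: "open I" and interval_I: "is_interval I" and nonempty_I: "I \<noteq> {}"
    and invariant: "b \<in> B \<Longrightarrow> z \<in> I \<Longrightarrow> ap b z \<in> I"
    and transitive: "z \<in> I \<Longrightarrow> w \<in> I \<Longrightarrow> \<exists>b\<in>B. ap b z = w"
    and two_points: "b \<in> B \<Longrightarrow> y \<in> I \<Longrightarrow> z \<in> I \<Longrightarrow> y \<noteq> z \<Longrightarrow> ap b y = y \<Longrightarrow> ap b z = z \<Longrightarrow> b = 0"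
    and stab_transitive: "y \<in> I \<Longrightarrow> z \<in> I \<Longrightarrow> w \<in> I \<Longrightarrow> (y < z \<and> y < w \<or> z < y \<and> w < y) \<Longrightarrow>
      \<exists>b\<in>stab B y. ap b z = w"
    and opposite: "b \<in> stab B y \<Longrightarrow> y \<in> I \<Longrightarrow> z \<in> I \<Longrightarrow> w \<in> I \<Longrightarrow> z < y \<Longrightarrow> y < w \<Longrightarrow> w < ap b w \<Longrightarrow> ap b z < z"
begin

lemmas subgroup = cc_add_subgroup [OF cc_B]

lemmas mem [simp] = add_subgroupD [OF subgroup]

lemma between: "x \<in> I \<Longrightarrow> y \<in> I \<Longrightarrow> x \<le> z \<Longrightarrow> z \<le> y \<Longrightarrow> z \<in> I"
  using interval_I unfolding is_interval_1 by blast

lemma ex_greater: "y \<in> I \<Longrightarrow> \<exists>z\<in>I. y < z"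
  and ex_less: "y \<in> I \<Longrightarrow> \<exists>z\<in>I. z < y"
proof -
  assume "y \<in> I"
  then obtain e where "e > 0" "ball y e \<subseteq> I" using open_I open_contains_ball by blast
  then have "y + e / 2 \<in> I" "y - e / 2 \<in> I" "y < y + e / 2" "y - e / 2 < y" by (auto simp: dist_real_def)
  then show "\<exists>z\<in>I. y < z" "\<exists>z\<in>I. z < y" by blast+
qed

text \<open>With this, Hoelder's theorem turns the homotheties with a given centre into a
  commutative Archimedean group.\<close>

lemma free_right:
  assumes y: "y \<in> I"
  shows "free_transitive (stab B y) (I \<inter> {y<..})"
proof
  show "add_subgroup (stab B y)" by (intro add_subgroup_stab subgroup)
  show "open (I \<inter> {y<..})" using open_I by (intro open_Int) auto
  show "is_interval (I \<inter> {y<..})" using interval_I by (intro is_interval_Int) (simp_all add: is_interval_oi)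
  show "I \<inter> {y<..} \<noteq> {}" using ex_greater [OF y] by auto
  show "ap b z \<in> I \<inter> {y<..}" if "b \<in> stab B y" "z \<in> I \<inter> {y<..}" for b z
  proof -
    have "ap b y < ap b z" using that by simp
    moreover have "ap b y = y" using that by (simp add: stab_def)
    ultimately have "y < ap b z" by linarith
    then show ?thesis using that invariant by (simp add: stab_def)
  qed
  show "\<exists>b\<in>stab B y. ap b z = w" if "z \<in> I \<inter> {y<..}" "w \<in> I \<inter> {y<..}" for z w
    using that y by (intro stab_transitive) auto
  show "b = 0" if "b \<in> stab B y" "z \<in> I \<inter> {y<..}" "ap b z = z" for b z
    using that y by (intro two_points [of b y z]) (auto simp: stab_def)
qed

lemma stab_commute: "y \<in> I \<Longrightarrow> a \<in> stab B y \<Longrightarrow> b \<in> stab B y \<Longrightarrow> a + b = b + a"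
  using free_transitive.commute [OF free_right] .

text \<open>The counterpart of a homothety with centre \<open>y\<close> and factor greater than
  1.\<close>

definition expands :: "lift \<Rightarrow> real \<Rightarrow> bool" where
  "expands d y \<longleftrightarrow> d \<in> stab B y \<and> (\<forall>v\<in>I. (y < v \<longrightarrow> v < ap d v) \<and> (v < y \<longrightarrow> ap d v < v))"

lemma expandsI_right:
  assumes d: "d \<in> stab B y" and y: "y \<in> I" and z: "z \<in> I" "y < z" "z < ap d z"
  shows "expands d y"
proof -
  interpret F: free_transitive "stab B y" "I \<inter> {y<..}" by (rule free_right [OF y])
  have "v < ap d v" if "v \<in> I" "y < v" for v
    using F.less_everywhere [of 0 d z v] d z that F.mem(1) by simp
  then show ?thesis using opposite [OF d y _ z(1) _ z(2,3)] d by (simp add: expands_def)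
qed

lemma stab_uminus: "d \<in> stab B y \<Longrightarrow> - d \<in> stab B y"
  using add_subgroup_stab [OF subgroup] add_subgroupD(2) by blast

lemma expands_or_uminus:
  assumes d: "d \<in> stab B y" "d \<noteq> 0" and y: "y \<in> I"
  shows "expands d y \<or> expands (- d) y"
proof -
  obtain w where w: "w \<in> I" "y < w" using ex_greater [OF y] by blast
  have "ap d w \<noteq> w" using two_points [of d y w] d y w by (auto simp: stab_def)
  then consider "w < ap d w" | "ap d w < w" by linarith
  then show ?thesis
  proof cases
    case 2
    then have "ap (- d) (ap d w) < ap (- d) w" by (simp only: ap_less_iff)
    then show ?thesis using expandsI_right [OF stab_uminus [OF d(1)] y w] by simp
  qed (use expandsI_right [OF d(1) y w] in blast)
qed

lemma expands_exists:
  assumes y: "y \<in> I" shows "\<exists>d. expands d y"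
proof -
  obtain z where z: "z \<in> I" "y < z" using ex_greater [OF y] by blast
  obtain w where w: "w \<in> I" "z < w" using ex_greater [OF z(1)] by blast
  obtain d where "d \<in> stab B y" "ap d z = w" using stab_transitive [OF y z(1) w(1)] z w by auto
  then show ?thesis using expandsI_right y z w by blast
qed

lemma stab_conj: "h \<in> B \<Longrightarrow> d \<in> stab B p \<Longrightarrow> h + d - h \<in> stab B (ap h p)"
  by (simp add: stab_def)

lemma expands_conj:
  assumes "h \<in> B" "p \<in> I" and d: "expands d p"
  shows "expands (h + d - h) (ap h p)"
proof -
  obtain w where w: "w \<in> I" "p < w" using ex_greater [OF assms(2)] by blast
  then have "w < ap d w" using d by (simp add: expands_def)
  then show ?thesis
    using stab_conj [OF assms(1)] d w assms invariant
    by (intro expandsI_right [of _ _ "ap h w"]) (auto simp: expands_def)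
qed

lemma expands_cases:
  assumes "expands d p" "v \<in> I"
  shows "p < v \<Longrightarrow> v < ap d v" "v < p \<Longrightarrow> ap d v < v" "ap d p = p" "d \<in> B"
  using assms by (auto simp: expands_def stab_def)

text \<open>For an expanding \<open>d\<close> fixing \<open>p\<close>, all conjugates of \<open>d\<close> fixing \<open>y\<close> coincide, and
  the value of this conjugate at a given point determines \<open>y\<close>.\<close>

lemma conj_difference_no_fixed_point:
  assumes d: "expands d p" and p: "p \<in> I" and h: "h \<in> B" "ap h p \<noteq> p" and w: "w \<in> I"
  shows "ap (h + d - h - d) w \<noteq> w"
proof
  assume fixw: "ap (h + d - h - d) w = w"
  define e where "e = h + d - h"
  define y where "y = ap h p"
  define v where "v = ap (- d) w"
  have yI: "y \<in> I" and e: "expands e y"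
    using invariant h p expands_conj [OF h(1) p d] by (simp_all add: y_def e_def)
  have dB: "d \<in> B" "d \<in> stab B p" using d by (simp_all add: expands_def stab_def)
  have vI: "v \<in> I" unfolding v_def using w dB by (intro invariant) auto
  have ev: "ap e v = ap d v" using fixw by (simp add: e_def v_def)
  have yp: "y \<noteq> p" using h by (simp add: y_def)
  note dd = expands_cases [OF d vI] and ee = expands_cases [OF e vI]
  \<comment> \<open>If both centres lie on one side of \<open>v\<close>, some \<open>k\<close>
    fixing \<open>v\<close> carries \<open>p\<close> to \<open>y\<close>. Commutativity of the
    stabilizer of \<open>p\<close> makes \<open>e\<close> the conjugate of \<open>d\<close> by
    \<open>k\<close>, so \<open>k\<close> fixes \<open>ap d v\<close> as well as \<open>v\<close>
    and is 0.\<close>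
  have same: False if ord: "p < v \<and> y < v \<or> v < p \<and> v < y"
  proof -
    obtain k where k: "k \<in> stab B v" "ap k p = y" using stab_transitive [OF vI p yI] ord by blast
    then have kB: "k \<in> B" "ap k v = v" by (auto simp: stab_def)
    have "- k + h \<in> stab B p" using kB h k by (auto simp: stab_def ap_uminus_eq_iff y_def)
    then have "(- k + h) + d = d + (- k + h)" using stab_commute [OF p] dB by blast
    then have "k + ((- k + h) + d) = k + (d + (- k + h))" by simp
    then have hd: "h + d = k + d - k + h" by (simp add: add.assoc [symmetric] add_diff_eq)
    have "e = k + d - k"
    proof (rule lift_eqI)
      fix v
      have "ap e v = ap (h + d) (ap (- h) v)" by (simp add: e_def)
      also have "\<dots> = ap (k + d - k + h) (ap (- h) v)" by (simp only: hd)
      finally show "ap e v = ap (k + d - k) v" by simp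
    qed
    then have "ap k (ap d v) = ap d v" using ev kB by (metis ap_minus ap_plus ap_uminus_ap)
    moreover have "ap d v \<noteq> v" using dd that by auto
    moreover have "ap d v \<in> I" using invariant dB vI by blast
    ultimately have "k = 0" using two_points [of k v "ap d v"] kB vI by auto
    then show False using k yp by simp
  qed
  \<comment> \<open>In the remaining positions \<open>v\<close> is one centre, or lies between them;
    then \<open>d\<close> and \<open>e\<close> move it in different ways.\<close>
  show False
  proof (cases "p < v")
    case True
    then show False using same ev dd ee yp by (cases "y < v"; cases "y = v") auto
  next
    case False
    then show False using same ev dd ee yp by (cases "p = v"; cases "y < v"; cases "y = v") auto
  qed
qed

definition trans :: "lift set" where
  "trans = {b \<in> B. b = 0 \<or> (\<forall>z\<in>I. ap b z \<noteq> z)}"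

lemma trans_uminus: "f \<in> trans \<Longrightarrow> - f \<in> trans"
  by (auto simp: trans_def ap_uminus_eq_iff)

text \<open>In the affine group the quotient of two homotheties with equal factor is a translation;
  here it is \<open>h + d - h - d\<close>. Since \<open>d\<close> fixes \<open>p\<close>, its value
  at \<open>p\<close> is that of the conjugate of \<open>d\<close>. A centre to the left of
  \<open>p\<close> makes this value larger than \<open>p\<close>, and a further conjugation by an
  element fixing \<open>p\<close> adjusts it to \<open>q\<close>.\<close>

lemma trans_transitive_less:
  assumes p: "p \<in> I" and q: "q \<in> I" and pq: "p < q"
  shows "\<exists>f\<in>trans. ap f p = q"
proof -
  obtain d where d: "expands d p" using expands_exists [OF p] by blast
  have dB: "d \<in> B" "ap d p = p" using expands_cases [OF d p] by auto
  obtain y1 where y1: "y1 \<in> I" "y1 < p" using ex_less [OF p] by blast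
  obtain h1 where h1: "h1 \<in> B" "ap h1 p = y1" using transitive p y1 by blast
  have e1: "expands (h1 + d - h1) y1" using expands_conj [OF h1(1) p d] h1(2) by simp
  define q1 where "q1 = ap (h1 + d - h1) p"
  have q1: "p < q1" "q1 \<in> I" unfolding q1_def
    using expands_cases(1) [OF e1 p y1(2)] invariant [OF expands_cases(4) [OF e1 p] p] by blast+
  obtain k where k: "k \<in> stab B p" "ap k q1 = q" using stab_transitive [OF p q1(2) q] q1 pq by auto
  then have kB: "k \<in> B" "ap (- k) p = p" by (auto simp: stab_def ap_uminus_eq_iff)
  define h where "h = k + h1"
  have hB: "h \<in> B" using kB h1 by (simp add: h_def)
  have "ap k y1 < ap k p" using y1 by simp
  moreover have "ap k p = p" "ap h p = ap k y1" using h1 k by (auto simp: h_def stab_def)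
  ultimately have hp: "ap h p \<noteq> p" by linarith
  have hdh: "h + d - h = k + (h1 + d - h1) - k"
    by (rule lift_eqI) (simp add: h_def minus_add)
  have "ap (h + d - h - d) p = ap k (ap (h1 + d - h1) (ap (- k) (ap (- d) p)))"
    by (simp add: h_def minus_add)
  also have "ap (- d) p = p" using dB by (simp add: ap_uminus_eq_iff)
  also have "ap (- k) p = p" by (rule kB(2))
  also have "ap k (ap (h1 + d - h1) p) = q" using k(2) unfolding q1_def .
  finally have "ap (h + d - h - d) p = q" .
  moreover have "h + d - h - d \<in> trans"
    unfolding trans_def using conj_difference_no_fixed_point [OF d p hB hp] hB dB by simp
  ultimately show ?thesis by blast
qed

lemma trans_transitive:
  assumes p: "p \<in> I" and q: "q \<in> I"
  shows "\<exists>f\<in>trans. ap f p = q"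
proof -
  consider "p < q" | "q < p" | "p = q" by linarith
  then show ?thesis
  proof cases
    case 2
    then obtain f where "f \<in> trans" "ap f q = p" using trans_transitive_less p q by blast
    then show ?thesis using trans_uminus by (metis ap_uminus_ap)
  next
    case 3
    then show ?thesis by (intro bexI [of _ 0]) (auto simp: trans_def)
  qed (use trans_transitive_less p q in blast)
qed

text \<open>A local section at \<open>y\<close> corrects the elements to fix \<open>y\<close>; a
  second one, in the stabilizer of \<open>y\<close>, has the same values at \<open>q\<close>. As
  that stabilizer acts freely to the right of \<open>y\<close>, it consists of the same
  elements.\<close>

lemma tendsto_zero_if_two_points:
  assumes y: "y \<in> I" and q: "q \<in> I" "y < q" and c: "\<And>n. c n \<in> B"
    and lim: "(\<lambda>n. ap (c n) y) \<longlonglongrightarrow> y" "(\<lambda>n. ap (c n) q) \<longlonglongrightarrow> q"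
  obtains s where "strict_mono (s :: nat \<Rightarrow> nat)" "(\<lambda>n. c (s n)) \<longlonglongrightarrow> 0"
proof -
  obtain b0 where b0: "b0 \<in> B" "ap b0 y = q" using transitive y q by blast
  then have "ap b0 y \<noteq> y" using q by simp
  obtain s1 b where s1: "strict_mono (s1 :: nat \<Rightarrow> nat)" "\<And>n. b n \<in> B" "\<And>n. ap (b n) y = ap (c (s1 n)) y" "b \<longlonglongrightarrow> 0"
    using cc_local_section [OF cc_B b0(1) \<open>ap b0 y \<noteq> y\<close> lim(1)] by metis
  define d where "d n = - b n + c (s1 n)" for n
  have dB: "d n \<in> stab B y" for n
    using s1 c by (simp add: d_def stab_def flip: s1(3))
  have "(\<lambda>n. ap (c (s1 n)) q) \<longlonglongrightarrow> q" using LIMSEQ_subseq_LIMSEQ [OF lim(2) s1(1)] by (simp add: comp_def)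
  then have "(\<lambda>n. ap (- b n) (ap (c (s1 n)) q)) \<longlonglongrightarrow> ap (- 0) q"
    by (intro tendsto_intros s1(4))
  then have dq: "(\<lambda>n. ap (d n) q) \<longlonglongrightarrow> q" by (simp add: d_def)
  obtain e where e: "expands e y" using expands_exists [OF y] by blast
  then have e': "e \<in> stab B y" "ap e q \<noteq> q" using expands_cases(1) [OF e q(1)] q by (auto simp: expands_def)
  obtain s2 b' where s2: "strict_mono (s2 :: nat \<Rightarrow> nat)" "\<And>n. b' n \<in> stab B y" "\<And>n. ap (b' n) q = ap (d (s2 n)) q" "b' \<longlonglongrightarrow> 0"
    using cc_local_section [OF cc_stab [OF cc_B] e' dq] by metis
  have "b' n = d (s2 n)" for n
    by (rule free_transitive.eq_if_agree [OF free_right [OF y] s2(2) dB _ s2(3)]) (use q in auto)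
  then have "c (s1 (s2 n)) = b (s2 n) + b' n" for n by (simp add: d_def)
  moreover have "(\<lambda>n. b (s2 n) + b' n) \<longlonglongrightarrow> 0 + 0"
    using LIMSEQ_subseq_LIMSEQ [OF s1(4) s2(1)] s2(4) by (intro tendsto_add) (simp_all add: comp_def)
  ultimately have "(\<lambda>n. c (s1 (s2 n))) \<longlonglongrightarrow> 0" by simp
  moreover have "strict_mono (\<lambda>n. s1 (s2 n))" using s1(1) s2(1) by (simp add: strict_mono_def)
  ultimately show ?thesis using that by blast
qed

text \<open>Otherwise the conjugates of \<open>f\<close> by powers of \<open>k\<close> would converge, on both sides of \<open>y\<close>,
  to one and the same expanding element, although they move all points to the right.\<close>

lemma translation_below_expansion:
  assumes f: "f \<in> B" "\<And>z. z \<in> I \<Longrightarrow> z < ap f z" and y: "y \<in> I" and k: "expands k y"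
  shows "\<exists>z\<in>I. y < z \<and> ap f z < ap k z"
proof (rule ccontr)
  assume "\<not> ?thesis"
  then have ge: "ap k z \<le> ap f z" if "z \<in> I" "y < z" for z using that by force
  obtain q where q: "q \<in> I" "y < q" using ex_greater [OF y] by blast
  interpret F: free_transitive "stab B y" "I \<inter> {y<..}" by (rule free_right [OF y])
  have kS: "k \<in> stab B y" using k by (simp add: expands_def)
  define K where "K n = nmul n k" for n
  have KS: "K n \<in> stab B y" "- K n \<in> stab B y" for n using kS F.mem by (simp_all add: K_def)
  then have KB: "K n \<in> B" "ap (K n) y = y" "- K n \<in> B" "ap (- K n) y = y" for n by (auto simp: stab_def)
  \<comment> \<open>The conjugates are to converge to an element \<open>k'\<close> fixing
    \<open>y\<close>. Convergence is checked at \<open>y\<close> and at one point \<open>q\<close>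
    to its right.\<close>
  define e where "e n = - K n + f + K n" for n
  have eB: "e n \<in> B" for n using KB f by (simp add: e_def)
  define Q where "Q n = ap (K n) q" for n
  have Q: "Q n \<in> I" "y < Q n" for n
  proof -
    show "Q n \<in> I" unfolding Q_def using invariant KB q by blast
    have "ap (K n) y < ap (K n) q" using q by simp
    then show "y < Q n" by (simp add: KB Q_def)
  qed
  have fQ: "ap f (Q n) \<in> I" "Q n < ap f (Q n)" for n using invariant f Q by blast+
  \<comment> \<open>\<open>M n\<close> agrees with \<open>f\<close> at \<open>Q n\<close>. As it
    commutes with \<open>K n\<close>, it agrees with \<open>e n\<close> at \<open>q\<close>, so
    values of \<open>e n\<close> can be compared inside the ordered stabilizer of
    \<open>y\<close>.\<close>
  have "\<exists>m\<in>stab B y. ap m (Q n) = ap f (Q n)" for n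
    using stab_transitive [OF y Q(1) fQ(1)] Q(2) [of n] fQ(2) [of n] by auto
  then obtain M where M: "\<And>n. M n \<in> stab B y" "\<And>n. ap (M n) (Q n) = ap f (Q n)" by metis
  have eM: "ap (e n) q = ap (M n) q" for n
  proof -
    have "- K n + M n + K n = M n"
      using F.commute [OF M(1) KS(1), of n n] by (metis add.assoc minus_add_cancel)
    moreover have "ap (e n) q = ap (- K n + M n + K n) q"
      using M(2) by (simp add: e_def Q_def)
    ultimately show ?thesis by simp
  qed
  have dec: "ap (e (Suc n)) q \<le> ap (e n) q" for n
  proof -
    \<comment> \<open>\<open>m\<close> fixes \<open>Q n\<close> and moves \<open>y\<close> to the
      right; by \<open>opposite\<close> it does not move \<open>Q (Suc n)\<close> to the right. So
      \<open>M (Suc n)\<close> is at most \<open>M n\<close> at that point, and hence at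
      \<open>q\<close>.\<close>
    define m where "m = - M n + f"
    have MB: "M n \<in> B" "ap (M n) y = y" using M(1) by (auto simp: stab_def)
    have mS: "m \<in> stab B (Q n)" using MB f M(2) by (simp add: m_def stab_def ap_uminus_eq_iff)
    have "ap (- M n) y < ap (- M n) (ap f y)" using f(2) [OF y] by (simp only: ap_less_iff)
    moreover have "ap (- M n) y = y" using MB by (simp add: ap_uminus_eq_iff)
    ultimately have my: "y < ap m y" by (simp add: m_def)
    have QQ: "Q n < Q (Suc n)"
    proof -
      have "Q (Suc n) = ap k (Q n)" by (simp add: Q_def K_def)
      then show ?thesis using expands_cases(1) [OF k Q(1) Q(2)] by simp
    qed
    have "\<not> Q (Suc n) < ap m (Q (Suc n))"
      using opposite [OF mS Q(1) y Q(1) Q(2) QQ] my by auto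
    then have "ap (M n) (ap m (Q (Suc n))) \<le> ap (M n) (Q (Suc n))" by simp
    then have "ap (M (Suc n)) (Q (Suc n)) \<le> ap (M n) (Q (Suc n))" by (simp add: m_def M(2))
    then have "ap (M (Suc n)) q \<le> ap (M n) q"
      by (rule F.le_everywhere [OF M(1) M(1), rotated -1]) (use Q q in auto)
    then show ?thesis by (simp add: eM)
  qed
  have lower: "ap k q \<le> ap (e n) q" for n
  proof -
    have "ap (- K n) (ap k (Q n)) \<le> ap (- K n) (ap f (Q n))" using ge [OF Q] by simp
    moreover have "- K n + k + K n = k"
      using F.commute [OF kS KS(1)] by (metis add.assoc minus_add_cancel)
    then have "ap (- K n) (ap k (Q n)) = ap k q" unfolding Q_def by (metis ap_plus)
    moreover have "ap (e n) q = ap (- K n) (ap f (Q n))" by (simp add: e_def Q_def)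
    ultimately show ?thesis by linarith
  qed
  obtain qs where qs: "(\<lambda>n. ap (e n) q) \<longlonglongrightarrow> qs" "ap k q \<le> qs" "\<And>n. qs \<le> ap (e n) q"
    using LIMSEQ_decseq_bounded [of "\<lambda>n. ap (e n) q" "ap k q"] dec lower by metis
  have "q < qs" using expands_cases(1) [OF k q] qs(2) by simp
  moreover have "qs \<in> I" using qs(3) [of 0] \<open>q < qs\<close> invariant [OF eB q(1)]
    by (intro between [OF q(1) invariant [OF eB [of 0] q(1)]]) auto
  ultimately obtain k' where k': "k' \<in> stab B y" "ap k' q = qs"
    using stab_transitive [OF y q(1) \<open>qs \<in> I\<close>] q by auto
  then have ek': "expands k' y" using expandsI_right [OF k'(1) y q] \<open>q < qs\<close> by simp
  have k'B: "k' \<in> B" "ap k' y = y" using k' by (auto simp: stab_def)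
  have ey: "(\<lambda>n. ap (e n) y) \<longlonglongrightarrow> y"
  proof -
    define X where "X n = ap (- K n) (ap f y)" for n
    have fy: "ap f y \<in> I" "y < ap f y" using invariant f y by blast+
    have XI: "X n \<in> I" "y < X n" for n
    proof -
      show "X n \<in> I" unfolding X_def using invariant KB fy by blast
      have "ap (- K n) y < ap (- K n) (ap f y)" using fy by simp
      then show "y < X n" by (simp add: KB X_def)
    qed
    have XS: "X (Suc n) = ap (- k) (X n)" for n
    proof -
      have "K (Suc n) = K n + k" by (simp add: K_def nmul_commute)
      then show ?thesis by (simp add: X_def minus_add)
    qed
    have "X (Suc n) \<le> X n" for n
    proof -
      have "X (Suc n) \<in> I" "y < X (Suc n)" using XI by blast+
      then have "X (Suc n) < ap k (X (Suc n))" by (rule expands_cases(1) [OF k])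
      then show ?thesis by (simp add: XS)
    qed
    moreover have "y \<le> X n" for n using XI less_imp_le by blast
    ultimately obtain l where l: "X \<longlonglongrightarrow> l" "y \<le> l" "\<And>n. l \<le> X n"
      using LIMSEQ_decseq_bounded [of X y] by metis
    have lI: "l \<in> I" using l XI by (intro between [OF y XI(1) [of 0]]) auto
    have "(\<lambda>n. ap (- k) (X n)) \<longlonglongrightarrow> ap (- k) l" using l(1) by (intro tendsto_intros)
    moreover have "(\<lambda>n. ap (- k) (X n)) \<longlonglongrightarrow> l" using LIMSEQ_Suc [OF l(1)] by (simp add: XS)
    ultimately have "ap (- k) l = l" using LIMSEQ_unique by blast
    then have "l = ap k l" by (simp add: ap_uminus_eq_iff)
    then have "l = y" using expands_cases(1) [OF k lI] l(2) by fastforce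
    moreover have "ap (e n) y = X n" for n by (simp add: e_def KB X_def)
    ultimately show ?thesis using l(1) by simp
  qed
  \<comment> \<open>At \<open>y\<close> and at \<open>q\<close> the maps \<open>e n\<close> tend to
    the values of \<open>k'\<close>, so two-point convergence applies to \<open>c\<close>.\<close>
  define c where "c n = - k' + e n" for n
  have cB: "c n \<in> B" for n using k'B eB by (simp add: c_def)
  have "(\<lambda>n. ap (- k') (ap (e n) y)) \<longlonglongrightarrow> ap (- k') y" "(\<lambda>n. ap (- k') (ap (e n) q)) \<longlonglongrightarrow> ap (- k') qs"
    using ey qs(1) by (intro tendsto_intros; simp)+
  moreover have "ap (- k') y = y" "ap (- k') qs = q" using k' k'B by (simp_all add: ap_uminus_eq_iff)
  ultimately have "(\<lambda>n. ap (c n) y) \<longlonglongrightarrow> y" "(\<lambda>n. ap (c n) q) \<longlonglongrightarrow> q" by (simp_all add: c_def)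
  then obtain s where s: "strict_mono (s :: nat \<Rightarrow> nat)" "(\<lambda>n. c (s n)) \<longlonglongrightarrow> 0"
    by (rule tendsto_zero_if_two_points [OF y q cB])
  obtain z where z: "z \<in> I" "z < y" using ex_less [OF y] by blast
  have "(\<lambda>n. ap k' (ap (c (s n)) z)) \<longlonglongrightarrow> ap k' (ap 0 z)" using s(2) by (intro tendsto_intros)
  \<comment> \<open>\<open>k' + c (s n)\<close> is \<open>e (s n)\<close>, a conjugate of
    \<open>f\<close>, and moves all points of \<open>I\<close> to the right; the expanding limit
    \<open>k'\<close> moves the points left of \<open>y\<close> to the left.\<close>
  moreover have "z \<le> ap k' (ap (c (s n)) z)" for n
  proof -
    have "ap (K (s n)) z < ap f (ap (K (s n)) z)" using f(2) invariant KB z by blast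
    then have "ap (- K (s n)) (ap (K (s n)) z) < ap (- K (s n)) (ap f (ap (K (s n)) z))" by (simp only: ap_less_iff)
    then show ?thesis by (simp add: c_def e_def)
  qed
  ultimately have "z \<le> ap k' z" using LIMSEQ_le_const by fastforce
  then show False using expands_cases(2) [OF ek' z] by simp
qed

text \<open>For \<open>f\<close> moving points to the right, \<open>- k + f\<close> moves
  \<open>y\<close> to the right and \<open>z1\<close> to the left, so it has a fixed point between
  them. Beyond that point \<open>opposite\<close> and \<open>two_points\<close> force motion to the
  left.\<close>

lemma translation_eventually_below:
  assumes f: "f \<in> trans" and y: "y \<in> I" and k: "expands k y"
  shows "\<exists>z1\<in>I. y < z1 \<and> (\<forall>z\<in>I. z1 \<le> z \<longrightarrow> ap f z < ap k z)"
proof (cases "\<exists>z\<in>I. z < ap f z")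
  case True
  then obtain z0 where z0: "z0 \<in> I" "z0 < ap f z0" by blast
  have fB: "f \<in> B" and ff: "\<And>z. z \<in> I \<Longrightarrow> ap f z \<noteq> z" using f z0 by (auto simp: trans_def)
  have pos: "z < ap f z" if z: "z \<in> I" for z
  proof (rule ccontr)
    assume "\<not> z < ap f z"
    then have neg: "ap f z - z \<le> 0" by simp
    have "connected ((\<lambda>x. ap f x - x) ` I)"
      using interval_I by (intro connected_continuous_image continuous_intros) (auto simp: is_interval_connected_1)
    then have "is_interval ((\<lambda>x. ap f x - x) ` I)" by (simp add: is_interval_connected_1)
    moreover have "ap f z - z \<in> (\<lambda>x. ap f x - x) ` I" "ap f z0 - z0 \<in> (\<lambda>x. ap f x - x) ` I" "0 \<le> ap f z0 - z0"
      using z z0 by auto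
    ultimately have "0 \<in> (\<lambda>x. ap f x - x) ` I" using neg unfolding is_interval_1 by blast
    then show False using ff by auto
  qed
  obtain z1 where z1: "z1 \<in> I" "y < z1" "ap f z1 < ap k z1"
    using translation_below_expansion [OF fB pos y k] by blast
  define m where "m = - k + f"
  have kB: "k \<in> B" "ap k y = y" using expands_cases [OF k y] by auto
  have mB: "m \<in> B" using kB fB by (simp add: m_def)
  have km: "ap k (ap m z) = ap f z" for z by (simp add: m_def)
  have "ap k y < ap k (ap m y)" using pos [OF y] kB by (simp add: km)
  then have my: "y < ap m y" by simp
  have "ap k (ap m z1) < ap k z1" using z1 by (simp add: km)
  then have mz1: "ap m z1 < z1" by simp
  have "continuous_on {y..z1} (\<lambda>z. z - ap m z)" by (intro continuous_intros)
  then obtain v where v: "y \<le> v" "v \<le> z1" "v - ap m v = 0"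
    using IVT' [of "\<lambda>z. z - ap m z" y 0 z1] my mz1 z1 by auto
  then have v': "y < v" "v < z1" "ap m v = v" using my mz1 by (auto simp: order_le_less)
  have vI: "v \<in> I" using v' by (intro between [OF y z1(1)]) auto
  have mS: "m \<in> stab B v" using mB v' by (simp add: stab_def)
  have "ap f z < ap k z" if z: "z \<in> I" "z1 \<le> z" for z
  proof -
    have vz: "v < z" using z v' by simp
    have "\<not> z < ap m z" using opposite [OF mS vI y z(1) v'(1) vz] my by auto
    moreover have "ap m z \<noteq> z" using two_points [OF mB vI z(1)] vz v' my by auto
    ultimately have "ap k (ap m z) < ap k z" by simp
    then show ?thesis by (simp add: km)
  qed
  then show ?thesis using z1 by blast
next
  case False
  obtain z1 where z1: "z1 \<in> I" "y < z1" using ex_greater [OF y] by blast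
  have "ap f z < ap k z" if "z \<in> I" "z1 \<le> z" for z
    using expands_cases(1) [OF k that(1)] that z1 False by force
  then show ?thesis using z1 by blast
qed

text \<open>Halve \<open>f + g\<close> in the stabilizer of \<open>y\<close>. Far to the right both
  \<open>f\<close> and \<open>g\<close> lie below the half \<open>e\<close>, so \<open>f + g\<close>
  would lie below \<open>e + e\<close>, which is at most \<open>f + g\<close>.\<close>

lemma trans_add_not_expands:
  assumes f: "f \<in> trans" and g: "g \<in> trans" and y: "y \<in> I"
  shows "\<not> expands (f + g) y"
proof
  assume k: "expands (f + g) y"
  interpret F: free_transitive "stab B y" "I \<inter> {y<..}" by (rule free_right [OF y])
  have kS: "f + g \<in> stab B y" using k by (simp add: expands_def)
  have "F.pos (f + g)" unfolding F.pos_def using kS F.base expands_cases(1) [OF k, of F.base] by auto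
  then obtain e where e: "F.pos e" "ap (e + e) F.base \<le> ap (f + g) F.base" by (rule F.halving)
  have eS: "e \<in> stab B y" using e by (simp add: F.pos_def)
  have ee: "expands e y"
    using expandsI_right [OF eS y, of F.base] F.base e(1) by (auto simp: F.pos_def)
  obtain z1 where z1: "z1 \<in> I" "y < z1" "\<And>z. z \<in> I \<Longrightarrow> z1 \<le> z \<Longrightarrow> ap f z < ap e z"
    using translation_eventually_below [OF f y ee] by blast
  obtain z2 where z2: "z2 \<in> I" "y < z2" "\<And>z. z \<in> I \<Longrightarrow> z2 \<le> z \<Longrightarrow> ap g z < ap e z"
    using translation_eventually_below [OF g y ee] by blast
  define z where "z = max z1 z2"
  have z: "z \<in> I" "y < z" "z1 \<le> z" "z2 \<le> z" using z1 z2 by (auto simp: z_def max_def)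
  have eB: "e \<in> B" using eS by (simp add: stab_def)
  have ez: "ap e z \<in> I" "z < ap e z" using invariant eB z expands_cases(1) [OF ee z(1,2)] by blast+
  have "ap f (ap g z) < ap f (ap e z)" using z2(3) z by simp
  also have "\<dots> < ap e (ap e z)" using z1(3) [OF ez(1)] ez z by simp
  also have "ap e (ap e z) = ap (e + e) z" by simp
  also have "\<dots> \<le> ap (f + g) z"
    by (rule F.le_everywhere [OF _ kS F.base _ e(2)]) (use z eS F.mem in auto)
  finally show False by simp
qed

lemma trans_add:
  assumes f: "f \<in> trans" and g: "g \<in> trans"
  shows "f + g \<in> trans"
proof (rule ccontr)
  have B: "f \<in> B" "g \<in> B" using f g by (auto simp: trans_def)
  assume "f + g \<notin> trans"
  then obtain y where y: "y \<in> I" "ap (f + g) y = y" "f + g \<noteq> 0" using B by (auto simp: trans_def)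
  then have "f + g \<in> stab B y" using B by (simp add: stab_def)
  from expands_or_uminus [OF this y(3) y(1)] show False
    using trans_add_not_expands [OF f g y(1)] trans_add_not_expands [OF trans_uminus [OF g] trans_uminus [OF f] y(1)]
    unfolding minus_add by blast
qed

theorem free_transitive_trans: "free_transitive trans I"
proof
  show "add_subgroup trans"
    unfolding add_subgroup_def
  proof (intro conjI ballI)
    show "0 \<in> trans" by (simp add: trans_def)
    show "a - b \<in> trans" if "a \<in> trans" "b \<in> trans" for a b
      using trans_add [OF that(1) trans_uminus [OF that(2)]] by simp
  qed
  show "b = 0" if "b \<in> trans" "z \<in> I" "ap b z = z" for b z using that by (auto simp: trans_def)
qed (use open_I interval_I nonempty_I invariant trans_transitive in \<open>auto simp: trans_def\<close>)

end

section \<open>Sharp transitivity on tuples\<close>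

context primitive_group
begin

text \<open>A homeomorphism moving all points but its \<open>n\<close> fixed points to the right crosses a
  conjugate whose fixed points interlace with its own at \<open>2 n\<close> points.\<close>

lemma sharp_no_positive_element:
  assumes T: "tuple_transitive n" and S: "sharp n" and x: "cyc n x" and f: "f \<in> fixer x"
    and pos: "\<And>z. z \<notin> range x \<Longrightarrow> z < ap f z"
  shows False
proof -
  have n: "n \<ge> 1" using cyc_pos [OF x] .
  \<comment> \<open>The midpoints form a tuple interlacing with \<open>x\<close>; conjugating
    \<open>f\<close> by an element from \<open>x\<close> to \<open>y\<close> gives the second
    homeomorphism \<open>g\<close>.\<close>
  define y where "y i = (x i + x (i + 1)) / 2" for i
  have xy: "x i < y i" "y i < x (i + 1)" for i using cycD(1) [OF x, of i "i + 1"] by (simp_all add: y_def)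
  have y: "cyc n y"
  proof -
    have "y i < y (i + 1)" for i using xy [of i] xy [of "i + 1"] by linarith
    moreover have "y (i + int n) = y i + 2 * pi" for i
    proof -
      have "i + int n + 1 = i + 1 + int n" by simp
      then have "y (i + int n) = (x i + 2 * pi + (x (i + 1) + 2 * pi)) / 2"
        by (simp only: y_def cycD(2) [OF x])
      then show ?thesis unfolding y_def [of i] by (simp add: field_simps)
    qed
    ultimately show ?thesis using strict_mono_int_stepI [of y] by (simp add: cyc_def)
  qed
  obtain a where a: "a \<in> A" "\<And>i. ap a (x i) = y i" using T x y unfolding tuple_transitive_def by blast
  define g where "g = a + f - a"
  have g: "g \<in> fixer y" unfolding g_def by (rule fixer_conj [OF a f])
  have gpos: "w < ap g w" if "w \<notin> range y" for w
  proof -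
    have "ap (- a) w \<notin> range x"
    proof
      assume "ap (- a) w \<in> range x"
      then obtain i where "ap (- a) w = x i" by blast
      then have "w = y i" using a(2) by (simp add: ap_uminus_eq_iff)
      then show False using that by blast
    qed
    then have "ap a (ap (- a) w) < ap a (ap f (ap (- a) w))" using pos by (simp only: ap_less_iff)
    then show ?thesis by (simp add: g_def)
  qed
  define d where "d = - g + f"
  have dfix: "ap d w = w \<longleftrightarrow> ap f w = ap g w" for w
    by (simp add: d_def ap_uminus_eq_iff)
  have fx: "ap f (x i) = x i" and gy: "ap g (y i) = y i" for i using f g by (auto simp: fixer_def)
  have ynr: "y i \<notin> range x" for i by (rule cyc_gap_not_range [OF x xy])
  have xnr: "x (i + 1) \<notin> range y" for i by (rule cyc_gap_not_range [OF y, of i]) (use xy in auto)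
  have sg: "ap f (x i) < ap g (x i)" for i using gpos [OF xnr, of "i - 1"] fx by simp
  have sf: "ap g (y i) < ap f (y i)" for i using pos [OF ynr] gy by simp
  have p_ex: "\<exists>w. x i < w \<and> w < y i \<and> ap d w = w" for i
  proof -
    have "continuous_on {x i..y i} (\<lambda>w. ap f w - ap g w)" by (intro continuous_intros)
    then obtain w where w: "x i \<le> w" "w \<le> y i" "ap f w - ap g w = 0"
      using IVT' [of "\<lambda>w. ap f w - ap g w" "x i" 0 "y i"] sg [of i] sf [of i] xy(1) [of i] by auto
    moreover have "w \<noteq> x i" "w \<noteq> y i" using w(3) sg [of i] sf [of i] by auto
    ultimately show ?thesis using dfix [of w] by (intro exI [of _ w]) auto
  qed
  have "\<exists>w. y 0 < w \<and> w < x 1 \<and> ap d w = w"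
  proof -
    have "continuous_on {y 0..x 1} (\<lambda>w. ap g w - ap f w)" by (intro continuous_intros)
    then obtain w where w: "y 0 \<le> w" "w \<le> x 1" "ap g w - ap f w = 0"
      using IVT' [of "\<lambda>w. ap g w - ap f w" "y 0" 0 "x 1"] sg [of 1] sf [of 0] xy(2) [of 0] by auto
    moreover have "w \<noteq> x 1" "w \<noteq> y 0" using w(3) sg [of 1] sf [of 0] by auto
    ultimately show ?thesis using dfix [of w] by (intro exI [of _ w]) auto
  qed
  then obtain q where q: "y 0 < q" "q < x 1" "ap d q = q" by blast
  obtain p0 where p0: "\<And>i. x i < p0 i" "\<And>i. p0 i < y i" "\<And>i. ap d (p0 i) = p0 i" using p_ex by metis
  \<comment> \<open>The crossings \<open>p0\<close> are chosen independently for each index; they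
    are kept over one period and continued periodically.\<close>
  define p where "p i = p0 (i mod int n) + 2 * pi * of_int (i div int n)" for i
  have pxy: "x i < p i" "p i < y i" for i
  proof -
    have i: "i mod int n + int n * (i div int n) = i" by simp
    have "x i = x (i mod int n) + 2 * pi * of_int (i div int n)"
      "y i = y (i mod int n) + 2 * pi * of_int (i div int n)"
      using cyc_mult [OF x, of "i mod int n" "i div int n"] cyc_mult [OF y, of "i mod int n" "i div int n"]
      unfolding i by simp_all
    then show "x i < p i" "p i < y i" using p0(1,2) [of "i mod int n"] by (simp_all add: p_def)
  qed
  have p: "cyc n p"
  proof -
    have "p i < p (i + 1)" for i using pxy [of i] pxy [of "i + 1"] xy(2) [of i] by linarith
    moreover have "p (i + int n) = p i + 2 * pi" for i
      using n by (simp add: p_def algebra_simps)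
    ultimately show ?thesis using strict_mono_int_stepI [of p] by (simp add: cyc_def)
  qed
  have "d \<in> fixer p"
  proof -
    have "ap d (p i) = p i" for i unfolding p_def by (simp only: ap_add_int p0(3))
    moreover have "d \<in> A" using f g by (simp add: d_def fixer_def)
    ultimately show ?thesis by (simp add: fixer_def)
  qed
  \<comment> \<open>The crossings \<open>p i\<close> and one further crossing \<open>q\<close>
    already contradict sharpness, since \<open>d\<close> fixes all of them.\<close>
  moreover have "q \<notin> range p"
    by (rule cyc_gap_not_range [OF p, of 0]) (use q pxy [of 0] pxy [of 1] in auto)
  ultimately have "d = 0" using S p q(3) unfolding sharp_def by blast
  then have "ap f (x 0) = ap g (x 0)" using dfix by simp
  then show False using sg [of 0] by simp
qed

section \<open>Directions of motion on neighbouring complementary intervals\<close>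

lemma free_transitive_gap:
  assumes P: "only_fixes n" and S: "sharp n" and x: "cyc n x"
  shows "free_transitive (fixer x) {x j<..<x (j + 1)}"
proof
  show "add_subgroup (fixer x)" by (rule cc_add_subgroup [OF cc_fixer [OF x]])
  show "{x j<..<x (j + 1)} \<noteq> {}" using cycD(1) [OF x, of j "j + 1"] by simp
  show "ap b z \<in> {x j<..<x (j + 1)}" if "b \<in> fixer x" "z \<in> {x j<..<x (j + 1)}" for b z
  proof -
    have "ap b (x j) < ap b z" "ap b z < ap b (x (j + 1))" using that by simp_all
    moreover have "ap b (x j) = x j" "ap b (x (j + 1)) = x (j + 1)" using that by (simp_all add: fixer_def)
    ultimately show ?thesis by simp
  qed
  show "\<exists>b\<in>fixer x. ap b z = w" if "z \<in> {x j<..<x (j + 1)}" "w \<in> {x j<..<x (j + 1)}" for z w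
    using fixer_interval_transitive [OF P x, of j z w] that by simp
  show "b = 0" if "b \<in> fixer x" "z \<in> {x j<..<x (j + 1)}" "ap b z = z" for b z
    using S x cyc_gap_not_range [OF x, of j z] that unfolding sharp_def by auto
qed (simp_all add: is_interval_oo)

lemma rotation_exists:
  assumes "tuple_transitive n" "cyc n x"
  obtains s where "s \<in> A" "\<And>i. ap s (x i) = x (i + j)"
  using assms cyc_shift [OF assms(2), of j] unfolding tuple_transitive_def by blast

text \<open>The evaluation map from one complementary interval to the next is equivariant, hence
  continuous, and it is injective, hence monotone.\<close>

lemma same_sign:
  assumes P: "only_fixes n" and S: "sharp n" and x: "cyc n x"
    and f: "f \<in> fixer x" and g: "g \<in> fixer x"
    and p: "x j < p" "p < x (j + 1)" and q: "x (j + 1) < q" "q < x (j + 2)"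
    and fp: "p < ap f p" and fq: "q < ap f q" and gp: "p < ap g p"
  shows "q < ap g q"
proof -
  let ?I = "{x j<..<x (j + 1)}" and ?J = "{x (j + 1)<..<x (j + 1 + 1)}"
  interpret F0: free_transitive "fixer x" ?I by (rule free_transitive_gap [OF P S x])
  interpret F1: free_transitive "fixer x" ?J by (rule free_transitive_gap [OF P S x])
  have pI: "p \<in> ?I" and qJ: "q \<in> ?J" using p q by (auto simp: add.assoc)
  define el where "el z = (SOME b. b \<in> fixer x \<and> ap b p = z)" for z
  have el: "el z \<in> fixer x" "ap (el z) p = z" if "z \<in> ?I" for z
    using someI_ex [of "\<lambda>b. b \<in> fixer x \<and> ap b p = z"] F0.transitive [OF pI that]
    unfolding el_def by auto
  \<comment> \<open>The equivariant map from one interval to the next that sends \<open>p\<close> to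
    \<open>q\<close>. Its direction on the orbit of \<open>p\<close> is already decided by
    \<open>f\<close>.\<close>
  define \<psi> where "\<psi> z = ap (el z) q" for z
  have el_eq: "el (ap b p) = b" if "b \<in> fixer x" for b
    using el [OF F0.invariant [OF that pI]] that by (intro F0.eq_if_agree [OF _ _ pI]) auto
  have \<psi>p: "\<psi> (ap b p) = ap b q" if "b \<in> fixer x" for b
    using el_eq [OF that] by (simp add: \<psi>_def)
  have eq: "\<psi> (ap b z) = ap b (\<psi> z)" if b: "b \<in> fixer x" and z: "z \<in> ?I" for b z
  proof -
    have "\<psi> (ap b z) = \<psi> (ap (b + el z) p)" using el [OF z] by simp
    also have "\<dots> = ap (b + el z) q" using el [OF z] b by (intro \<psi>p) simp
    finally show ?thesis by (simp add: \<psi>_def)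
  qed
  have cont: "isCont \<psi> z" if z: "z \<in> ?I" for z
  proof (rule cc_equivariant_isCont [OF cc_fixer [OF x] f _ eq])
    show "ap f z \<noteq> z" using F0.free [OF f z] fp by auto
  qed (use z in auto)
  have inj: "\<psi> z \<noteq> \<psi> w" if "z \<in> ?I" "w \<in> ?I" "z \<noteq> w" for z w
  proof
    assume "\<psi> z = \<psi> w"
    then have "el z = el w" unfolding \<psi>_def using el that by (intro F1.eq_if_agree [OF _ _ qJ]) auto
    then show False using el that by metis
  qed
  define M where "M = max (ap f p) (ap g p)"
  have fI: "ap f p \<in> ?I" "ap g p \<in> ?I" using F0.invariant f g pI by blast+
  then have MI: "M \<in> ?I" by (auto simp: M_def)
  have sub: "{p..M} \<subseteq> ?I" using MI pI by auto
  have cM: "continuous_on {p..M} \<psi>" using cont sub by (intro continuous_at_imp_continuous_on) auto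
  have iM: "inj_on \<psi> {p..M}" using inj sub by (meson inj_onI subsetD)
  have \<psi>f: "\<psi> p < \<psi> (ap f p)" using \<psi>p [OF f] \<psi>p [OF F0.mem(1)] fq by simp
  have "\<psi> p < \<psi> (ap g p)"
  proof (cases "ap f p = ap g p")
    case False
    then have "ap f p < ap g p \<and> M = ap g p \<or> ap g p < ap f p \<and> M = ap f p"
      unfolding M_def max_def by auto
    then consider "ap f p < ap g p" "M = ap g p" | "ap g p < ap f p" "M = ap f p"
      by blast
    then show ?thesis
    proof cases
      case 1
      then show ?thesis
        using continuous_inj_imp_mono [OF fp, of M \<psi>] cM iM \<psi>f by auto
    next
      case 2
      then show ?thesis
        using continuous_inj_imp_mono [OF gp, of M \<psi>] cM iM \<psi>f by auto
    qed
  qed (use \<psi>f in simp)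
  then show ?thesis using \<psi>p [OF g] \<psi>p [OF F0.mem(1)] by simp
qed

text \<open>If an element moved points to the right in two neighbouring intervals,
  \<open>same_sign\<close> would apply to its conjugates by rotations of the tuple and carry this
  motion from each interval to the next, hence around the circle, against
  \<open>sharp_no_positive_element\<close>.\<close>

lemma opposite_signs:
  assumes P: "only_fixes n" and T: "tuple_transitive n" and S: "sharp n" and x: "cyc n x"
    and f: "f \<in> fixer x" and p: "x j < p" "p < x (j + 1)" and q: "x (j + 1) < q" "q < x (j + 2)"
    and fp: "p < ap f p"
  shows "ap f q < q"
proof (rule ccontr)
  assume neg: "\<not> ap f q < q"
  have n: "n \<ge> 1" using cyc_pos [OF x] .
  have f0: "f \<noteq> 0" using fp by auto
  have sgn: "w < ap f w" if "x i < v" "v < x (i + 1)" "x i < w" "w < x (i + 1)" "v < ap f v" for i v w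
    using free_transitive.less_everywhere [OF free_transitive_gap [OF P S x, of i], of 0 f v w] that f
    by (simp add: fixer_def)
  have "x (j + 1) < x (j + 1 + 1)" using cycD(1) [OF x] by simp
  have "ap f q \<noteq> q" using free_transitive.free [OF free_transitive_gap [OF P S x, of "j + 1"] f, of q] q f0
    by (auto simp: add.assoc)
  then have fq: "q < ap f q" using neg by simp
  have up: "w < ap f w" if "x (j + int k) < w" "w < x (j + int k + 1)" for k w
    using that
  proof (induction k arbitrary: w)
    case 0
    then show ?case using sgn [OF p _ _ fp, of w] by simp
  next
    case (Suc k)
    obtain s where s: "s \<in> A" "\<And>i. ap s (x i) = x (i + int k)"
      using rotation_exists [OF T x] by metis
    define f' where "f' = - s + f + s"
    have f': "f' \<in> fixer x"
    proof -
      have "ap (- s) (x (i + int k)) = x i" for i by (simp add: ap_uminus_eq_iff s(2))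
      then have "ap f' (x i) = x i" for i using f s(2) by (simp add: f'_def fixer_def)
      then show ?thesis using f s(1) by (simp add: f'_def fixer_def)
    qed
    have sp: "x (j + int k) < ap s p" "ap s p < x (j + int k + 1)"
    proof -
      have "ap s (x j) < ap s p" "ap s p < ap s (x (j + 1))" using p by simp_all
      then show "x (j + int k) < ap s p" "ap s p < x (j + int k + 1)" by (simp_all add: s(2) algebra_simps)
    qed
    then have "ap s p < ap f (ap s p)" by (rule Suc.IH)
    then have "ap (- s) (ap s p) < ap (- s) (ap f (ap s p))" by (simp only: ap_less_iff)
    then have f'p: "p < ap f' p" by (simp add: f'_def)
    have "q < ap f' q" by (rule same_sign [OF P S x f f' p q fp fq f'p])
    then have "ap s q < ap s (ap f' q)" by (simp only: ap_less_iff)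
    then have fsq: "ap s q < ap f (ap s q)" by (simp add: f'_def)
    have "ap s (x (j + 1)) < ap s q" "ap s q < ap s (x (j + 2))" using q by simp_all
    moreover have "j + int (Suc k) = j + 1 + int k" "j + int (Suc k) + 1 = j + 2 + int k" by simp_all
    ultimately have "x (j + int (Suc k)) < ap s q" "ap s q < x (j + int (Suc k) + 1)" by (simp_all only: s(2))
    then show ?case using sgn [OF _ _ Suc.prems fsq] by blast
  qed
  have "w < ap f w" if w: "w \<notin> range x" for w
  proof -
    obtain i where i: "x i < w" "w < x (i + 1)" using cyc_locate_between [OF x w] by blast
    \<comment> \<open>\<open>m\<close> full turns raise the index \<open>i\<close> to at least
      \<open>j\<close>, where \<open>up\<close> applies; full turns do not affect the direction of
      motion.\<close>
    define m where "m = \<bar>j - i\<bar>"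
    have "int n * m \<ge> 1 * m" using n by (intro mult_right_mono) (auto simp: m_def)
    then have "j \<le> i + int n * m" by (simp add: m_def)
    then obtain k where k: "i + int n * m = j + int k" using zle_iff_zadd by blast
    have "x (j + int k) < w + 2 * pi * of_int m"
      using i(1) cyc_mult [OF x, of i m] k by simp
    moreover have "w + 2 * pi * of_int m < x (j + int k + 1)"
      using i(2) cyc_mult [OF x, of "i + 1" m] k by (simp add: algebra_simps)
    ultimately have "w + 2 * pi * of_int m < ap f (w + 2 * pi * of_int m)" by (rule up)
    then show ?thesis by simp
  qed
  then show False by (rule sharp_no_positive_element [OF T S x f])
qed

text \<open>For a single point, the neighbouring interval is the same interval one turn later, where
  the motion has the same direction and not the opposite one.\<close>

lemma not_sharp_1: "\<not> sharp 1"
proof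
  assume S: "sharp 1"
  define x where "x i = 2 * pi * of_int i" for i :: int
  have x: "cyc 1 x" unfolding cyc_1_iff by (simp add: x_def)
  have p: "x 0 < pi" "pi < x (0 + 1)" by (simp_all add: x_def)
  have q: "x (0 + 1) < pi + 2 * pi" "pi + 2 * pi < x (0 + 2)" by (simp_all add: x_def)
  have neg: False if "f \<in> fixer x" "pi < ap f pi" for f
    using opposite_signs [OF only_fixes_1 tuple_transitive_1 S x that(1) p q that(2)] that(2)
    unfolding ap_add_2pi by linarith
  have "pi \<notin> range x" using cyc_gap_not_range [OF x p] .
  then obtain f where f: "f \<in> fixer x" "ap f pi \<noteq> pi" using only_fixes_1 x unfolding only_fixes_def by blast
  have "- f \<in> fixer x" using f(1) by (simp add: fixer_def ap_uminus_eq_iff)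
  moreover have "pi < ap (- f) pi" if "ap f pi < pi"
  proof -
    have "ap (- f) (ap f pi) < ap (- f) pi" using that by (simp only: ap_less_iff)
    then show ?thesis by simp
  qed
  ultimately show False using neg f by (metis linorder_less_linear)
qed

text \<open>Inserting \<open>y\<close> into the tuple \<open>x\<close> turns its stabilizer into the
  fixer of an \<open>(m + 1)\<close>-tuple. The two intervals beside \<open>y\<close> are
  neighbours, so \<open>opposite_signs\<close> supplies \<open>opposite\<close>.\<close>

lemma affine_action_gap0:
  assumes P: "only_fixes m" "only_fixes (m + 1)" and T: "tuple_transitive (m + 1)" and S: "sharp (m + 1)"
    and x: "cyc m x"
  shows "affine_action (fixer x) {x (- 1)<..<x 0}"
proof
  have m: "m \<ge> 1" using cyc_pos [OF x] .
  let ?I = "{x (- 1)<..<x 0}"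
  have Y: "cyc (m + 1) (ins m x y)" "fixer (ins m x y) = stab (fixer x) y"
    "ins m x y (- 1) = x (- 1)" "ins m x y 0 = y" "ins m x y 1 = x 0" if "y \<in> ?I" for y
    using cyc_ins [OF x] fixer_ins [OF x] ins_values [OF m] that by auto
  show "cc (fixer x)" by (rule cc_fixer [OF x])
  show "?I \<noteq> {}" using cycD(1) [OF x, of "- 1" 0] by simp
  show "ap b z \<in> ?I" if "b \<in> fixer x" "z \<in> ?I" for b z
  proof -
    have "ap b (x (- 1)) < ap b z" "ap b z < ap b (x 0)" using that by simp_all
    moreover have "ap b (x (- 1)) = x (- 1)" "ap b (x 0) = x 0" using that by (simp_all add: fixer_def)
    ultimately show ?thesis by simp
  qed
  show "\<exists>b\<in>fixer x. ap b z = w" if "z \<in> ?I" "w \<in> ?I" for z w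
    using fixer_interval_transitive [OF P(1) x, of "- 1"] that by simp
  have gapY: "z \<notin> range (ins m x y)" if "y \<in> ?I" "z \<in> ?I" "y \<noteq> z" for y z
  proof (cases "z < y")
    case True
    then show ?thesis using cyc_gap_not_range [OF Y(1) [OF that(1)], of "- 1" z] Y [OF that(1)] that by simp
  next
    case False
    then show ?thesis using cyc_gap_not_range [OF Y(1) [OF that(1)], of 0 z] Y [OF that(1)] that by simp
  qed
  show two: "b = 0" if "b \<in> fixer x" "y \<in> ?I" "z \<in> ?I" "y \<noteq> z" "ap b y = y" "ap b z = z" for b y z
  proof -
    have "b \<in> fixer (ins m x y)" using that Y(2) by (simp add: stab_def)
    then show ?thesis using S Y(1) gapY that unfolding sharp_def by blast
  qed
  show "\<exists>b\<in>stab (fixer x) y. ap b z = w"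
    if "y \<in> ?I" "z \<in> ?I" "w \<in> ?I" "y < z \<and> y < w \<or> z < y \<and> w < y" for y z w
    using fixer_interval_transitive [OF P(2) Y(1) [OF that(1)], of 0 z w]
      fixer_interval_transitive [OF P(2) Y(1) [OF that(1)], of "- 1" z w] Y [OF that(1)] that by auto
  show "ap b z < z" if "b \<in> stab (fixer x) y" "y \<in> ?I" "z \<in> ?I" "w \<in> ?I" "z < y" "y < w" "w < ap b w" for b y z w
  proof (rule ccontr)
    assume neg: "\<not> ap b z < z"
    have b: "b \<in> fixer (ins m x y)" using that Y(2) by simp
    have "ap b z \<noteq> z" using two [of b y z] that by (auto simp: stab_def)
    then have bz: "z < ap b z" using neg by simp
    have "ap b w < w"
      by (rule opposite_signs [OF P(2) T S Y(1) [OF that(2)] b, of "- 1" z])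
        (use that bz Y [OF that(2)] in auto)
    then show False using that by simp
  qed
qed (simp_all add: is_interval_oo)

lemma affine_action_gap:
  assumes "only_fixes m" "only_fixes (m + 1)" and "tuple_transitive (m + 1)" and "sharp (m + 1)"
    and x: "cyc m x"
  shows "affine_action (fixer x) {x j<..<x (j + 1)}"
proof -
  define x' where "x' i = x (i + (j + 1))" for i
  have x': "cyc m x'" unfolding x'_def by (rule cyc_shift [OF x])
  have "fixer x' = fixer x"
  proof -
    have "(\<forall>i. ap a (x' i) = x' i) \<longleftrightarrow> (\<forall>i. ap a (x i) = x i)" for a
      unfolding x'_def by (metis diff_add_cancel)
    then show ?thesis by (simp add: fixer_def)
  qed
  moreover have "x' (- 1) = x j" "x' 0 = x (j + 1)" by (simp_all add: x'_def)
  ultimately show ?thesis using affine_action_gap0 [OF assms(1-4) x'] by simp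
qed

text \<open>For \<open>m \<ge> 2\<close>, stabilizers of points in one complementary interval act without fixed points,
  that is by commuting translations, on another one.\<close>

lemma not_sharp_ge_3:
  assumes P: "only_fixes m" "only_fixes (m + 1)" and T: "tuple_transitive (m + 1)" and S: "sharp (m + 1)"
    and m: "m \<ge> 2"
  shows False
proof -
  define x0 where "x0 i = 2 * pi * of_int i / real m" for i :: int
  have "cyc m x0"
    unfolding cyc_def using m
    by (auto simp: x0_def strict_mono_def field_simps divide_strict_right_mono)
  then obtain x where x: "cyc m x" by blast
  let ?I = "{x (- 1)<..<x (- 1 + 1)}" and ?J = "{x 0<..<x (0 + 1)}"
  interpret AI: affine_action "fixer x" ?I by (rule affine_action_gap [OF P T S x])
  interpret AJ: affine_action "fixer x" ?J by (rule affine_action_gap [OF P T S x])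
  interpret F: free_transitive AJ.trans ?J by (rule AJ.free_transitive_trans)
  \<comment> \<open>As \<open>m\<close> is at least 2, the interval \<open>?J\<close> is unaffected
    by inserting \<open>y\<close> in \<open>?I\<close>. A fixed point of \<open>d\<close> in it
    would be one more than \<open>sharp (m + 1)\<close> admits.\<close>
  have tr: "d \<in> AJ.trans" if d: "d \<in> stab (fixer x) y" and y: "y \<in> ?I" for d y
  proof -
    have Y: "cyc (m + 1) (ins m x y)" by (rule cyc_ins [OF x]) (use y in auto)
    have "1 + int m * 0 = (1::int)" "(int m + 1) * 0 + (1 + 1) = (2::int)" by simp_all
    then have Y12: "ins m x y 1 = x 0" "ins m x y 2 = x 1"
      using ins_values [of m x y] ins_other [of 1 m x y 0] m by auto
    have "d = 0" if w: "w \<in> ?J" "ap d w = w" for w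
    proof -
      have "w \<notin> range (ins m x y)"
        by (rule cyc_gap_not_range [OF Y, of 1]) (use w Y12 in auto)
      moreover have "d \<in> fixer (ins m x y)" unfolding fixer_ins [OF x] by (rule d)
      ultimately show ?thesis using S Y w(2) unfolding sharp_def by blast
    qed
    then show ?thesis using d unfolding AJ.trans_def stab_def by blast
  qed
  obtain y where y: "y \<in> ?I" using AI.nonempty_I by blast
  obtain y' where y': "y' \<in> ?I" "y < y'" using AI.ex_greater [OF y] by blast
  obtain d where d: "AI.expands d y" using AI.expands_exists [OF y] by blast
  obtain d' where d': "AI.expands d' y'" using AI.expands_exists [OF y'(1)] by blast
  have dS: "d \<in> stab (fixer x) y" "d' \<in> stab (fixer x) y'"
    using d d' unfolding AI.expands_def by blast+
  \<comment> \<open>As translations of \<open>?J\<close> they commute, so \<open>d'\<close> fixes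
    \<open>ap d y'\<close> besides its centre \<open>y'\<close>, although \<open>d'\<close> moves
    every other point of \<open>?I\<close>.\<close>
  have "d + d' = d' + d" using F.commute tr dS y y' by blast
  then have "ap (d + d') y' = ap (d' + d) y'" by simp
  then have fixd: "ap d' (ap d y') = ap d y'" using dS(2) by (simp add: stab_def)
  have "y' < ap d y'" using AI.expands_cases(1) [OF d y'] .
  moreover have "ap d y' \<in> ?I" using AI.invariant [OF AI.expands_cases(4) [OF d y] y'(1)] .
  ultimately show False using AI.expands_cases(1) [OF d', of "ap d y'"] fixd by simp
qed

text \<open>Up to the least sharp length the induction step always gives \<open>only_fixes\<close>.
  This least length is neither 1 nor at least 3, so it is 2 if it exists.\<close>

theorem transitive_on_tuples_or_sharp:
  "(\<forall>n\<ge>1. tuple_transitive n) \<or>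
   tuple_transitive 2 \<and> tuple_transitive 3 \<and> sharp 2 \<and> (\<forall>x. affine_action (stab A x) {x<..<x + 2 * pi})"
proof (cases "\<exists>n\<ge>1. sharp n")
  case False
  have "only_fixes n \<and> tuple_transitive n" if "n \<ge> 1" for n
    using that
  proof (induction n rule: dec_induct)
    case base
    then show ?case using only_fixes_1 tuple_transitive_1 by simp
  next
    case (step n)
    then show ?case using sharp_or_only_fixes_Suc [of n] tuple_transitive_Suc [of n] False by auto
  qed
  then show ?thesis by blast
next
  case True
  define n where "n = (LEAST n. n \<ge> 1 \<and> sharp n)"
  have n: "n \<ge> 1" "sharp n" using LeastI_ex [OF True] by (auto simp: n_def)
  have least: "\<not> sharp k" if "k \<ge> 1" "k < n" for k
    using not_less_Least [of k "\<lambda>n. n \<ge> 1 \<and> sharp n"] that by (auto simp: n_def)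
  have PT: "only_fixes k \<and> tuple_transitive k" if "k \<ge> 1" "k \<le> n" for k
    using that
  proof (induction k rule: dec_induct)
    case base
    then show ?case using only_fixes_1 tuple_transitive_1 by simp
  next
    case (step k)
    then have "only_fixes k \<and> tuple_transitive k" "\<not> sharp k" using least [of k] by simp_all
    then show ?case using sharp_or_only_fixes_Suc [of k] tuple_transitive_Suc [of k] step by auto
  qed
  have "n \<noteq> 1" using n not_sharp_1 by auto
  have "n = 2"
  proof (rule ccontr)
    assume "n \<noteq> 2"
    then have "n - 1 \<ge> 2" "n - 1 + 1 = n" using \<open>n \<noteq> 1\<close> n by linarith+
    then show False using not_sharp_ge_3 [of "n - 1"] PT [of "n - 1"] PT [of n] n by simp
  qed
  then have P: "only_fixes 2" "tuple_transitive 2" "sharp 2" using PT [of 2] n by auto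
  moreover have "tuple_transitive 3" using tuple_transitive_Suc [of 2] P by simp
  moreover have "affine_action (stab A x) {x<..<x + 2 * pi}" for x
  proof -
    define X where "X i = x + 2 * pi * of_int i" for i :: int
    have X: "cyc 1 X" unfolding cyc_1_iff by (simp add: X_def)
    have "fixer X = stab A x"
    proof -
      have "(\<forall>i. ap a (X i) = X i) \<longleftrightarrow> ap a x = x" for a
      proof
        assume "\<forall>i. ap a (X i) = X i"
        then have "ap a (X 0) = X 0" by blast
        then show "ap a x = x" by (simp add: X_def)
      next
        assume "ap a x = x"
        then show "\<forall>i. ap a (X i) = X i" by (simp only: X_def ap_add_int simp_thms)
      qed
      then show ?thesis by (simp add: fixer_def stab_def)
    qed
    moreover have "X 0 = x" "X (0 + 1) = x + 2 * pi" by (simp_all add: X_def)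
    moreover have "affine_action (fixer X) {X 0<..<X (0 + 1)}"
      by (rule affine_action_gap [of 1]) (use P X only_fixes_1 in \<open>simp_all add: numeral_2_eq_2\<close>)
    ultimately show ?thesis by simp
  qed
  ultimately show ?thesis by blast
qed

end

section \<open>Lifts and homeomorphisms of the circle\<close>

definition pr :: "lift \<Rightarrow> complex \<Rightarrow> complex" where
  "pr f = (\<lambda>z\<in>S1. cis (ap f (Arg z)))"

lemma S1_cis: "z \<in> S1 \<Longrightarrow> cis (Arg z) = z"
  by (subst cis_Arg) (auto simp: sgn_eq)

lemma cis_eq_iff: "cis s = cis t \<longleftrightarrow> (\<exists>m::int. s = t + 2 * pi * of_int m)"
proof -
  have "cis s = cis t \<longleftrightarrow> sin s = sin t \<and> cos s = cos t" by (auto simp: complex_eq_iff)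
  then show ?thesis unfolding sin_cos_eq_iff by (metis mult.commute mult.left_commute)
qed

lemma cis_add_2pi: "cis (t + 2 * pi) = cis t"
  using cis_eq_iff [of "t + 2 * pi" t] by (metis mult.right_neutral of_int_1)

lemma pr_cis [simp]: "pr f (cis t) = cis (ap f t)"
proof -
  have "cis (Arg (cis t)) = cis t" by (rule S1_cis) simp
  then obtain m :: int where "Arg (cis t) = t + 2 * pi * of_int m" using cis_eq_iff by blast
  then have "ap f (Arg (cis t)) = ap f t + 2 * pi * of_int m" by (simp only: ap_add_int)
  then have "cis (ap f (Arg (cis t))) = cis (ap f t)" using cis_eq_iff by blast
  then show ?thesis by (simp add: pr_def)
qed

lemma S1_funI:
  assumes "f \<in> extensional S1" "g \<in> extensional S1" "\<And>t. f (cis t) = g (cis t)"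
  shows "f = g"
  using assms by (intro extensionalityI [of f S1]) (metis S1_cis)+

lemma pr_extensional: "pr f \<in> extensional S1"
  by (simp add: pr_def)

lemma pr_in_S1: "z \<in> S1 \<Longrightarrow> pr f z \<in> S1"
  by (simp add: pr_def)

lemma pr_add: "pr (f + g) = compose S1 (pr f) (pr g)"
  by (rule S1_funI) (simp_all add: pr_extensional compose_def)

lemma pr_zero: "pr 0 = (\<lambda>z\<in>S1. z)"
  by (rule S1_funI) (simp_all add: pr_extensional)

text \<open>\<open>Arg\<close> jumps in the definition of \<open>pr\<close>, but \<open>f\<close>
  absorbs full turns. Near \<open>z0\<close> the angle can be taken as
  \<open>t0 + Arg (z / z0)\<close>, which is continuous at \<open>z0\<close>.\<close>

lemma continuous_on_pr: "continuous_on S1 (pr f)"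
  unfolding continuous_on_eq_continuous_within
proof
  fix z0 :: complex assume z0: "z0 \<in> S1"
  define t0 where "t0 = Arg z0"
  have z0c: "z0 = cis t0" using S1_cis [OF z0] by (simp add: t0_def)
  have eq: "cis (ap f (t0 + Arg (z / z0))) = pr f z" if z: "z \<in> S1" for z
  proof -
    have "z / z0 \<in> S1" using z z0 by (simp add: norm_divide)
    then have "cis (Arg (z / z0)) = z / z0" by (rule S1_cis)
    moreover have "z0 \<noteq> 0" using z0 by auto
    ultimately have "cis (t0 + Arg (z / z0)) = z" by (simp add: z0c [symmetric] flip: cis_mult)
    then show ?thesis by (metis pr_cis)
  qed
  have "z0 \<noteq> 0" using z0 by auto
  then have d: "isCont (\<lambda>z. z / z0) z0" and A: "isCont Arg (z0 / z0)"
    by (intro continuous_intros continuous_at_Arg; simp)+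
  have "continuous_on UNIV (\<lambda>s. cis (ap f (t0 + s)))"
    by (intro continuous_on_cis continuous_intros)
  then have "isCont (\<lambda>s. cis (ap f (t0 + s))) (Arg (z0 / z0))"
    by (simp add: continuous_on_eq_continuous_at)
  with isCont_o2 [OF d A] have "isCont (\<lambda>z. cis (ap f (t0 + Arg (z / z0)))) z0"
    by (rule isCont_o2)
  then have "continuous (at z0 within S1) (\<lambda>z. cis (ap f (t0 + Arg (z / z0))))"
    by (rule continuous_at_imp_continuous_at_within)
  then show "continuous (at z0 within S1) (pr f)"
    by (rule continuous_transform_within [where \<delta> = 1]) (use z0 eq in auto)
qed

lemma pr_inverse: "z \<in> S1 \<Longrightarrow> pr (- f) (pr f z) = z" "z \<in> S1 \<Longrightarrow> pr f (pr (- f) z) = z"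
  by (metis S1_cis ap_uminus_ap pr_cis) (metis S1_cis ap_ap_uminus pr_cis)

lemma homeomorphism_pr: "homeomorphism S1 S1 (pr f) (pr (- f))"
proof
  show "pr f ` S1 \<subseteq> S1" "pr (- f) ` S1 \<subseteq> S1" using pr_in_S1 by auto
qed (auto simp: continuous_on_pr pr_inverse)

lemma bij_betw_pr: "bij_betw (pr f) S1 S1"
proof (rule bij_betwI [where g = "pr (- f)"])
  show "pr f \<in> S1 \<rightarrow> S1" "pr (- f) \<in> S1 \<rightarrow> S1" by (intro Pi_I pr_in_S1; assumption)+
qed (rule pr_inverse, assumption)+

lemma pr_in_HomeoS1 [simp]: "pr f \<in> carrier HomeoS1"
proof -
  have "orientation_preserving (pr f)"
    unfolding orientation_preserving_def
    by (rule exI [of _ "ap f"]) (simp add: ap_continuous_on_UNIV ap_strict_mono)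
  then show ?thesis
    using homeomorphism_pr [of f] bij_betw_pr by (auto simp: HomeoS1_def Bij_def pr_extensional)
qed

text \<open>A lift rises by some multiple \<open>m\<close> of a turn over one period. Monotonicity
  gives \<open>m \<ge> 1\<close>; for \<open>m \<ge> 2\<close> the value one turn above the start
  would be taken inside the period, against injectivity.\<close>

lemma pr_surj:
  assumes "h \<in> carrier HomeoS1"
  obtains f where "h = pr f"
proof -
  have ext: "h \<in> extensional S1" and bij: "bij_betw h S1 S1" using carrier_HomeoS1_D [OF assms] by auto
  have "orientation_preserving h" using assms by (simp add: HomeoS1_def)
  then obtain F where F: "continuous_on UNIV F" "strict_mono F" "\<And>t. h (cis t) = cis (F t)"
    unfolding orientation_preserving_def by blast
  have "F (t + 2 * pi) = F t + 2 * pi" for t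
  proof -
    have "cis (F (t + 2 * pi)) = cis (F t)" using F(3) cis_add_2pi by metis
    then obtain m :: int where m: "F (t + 2 * pi) = F t + 2 * pi * of_int m" using cis_eq_iff by blast
    have "F t < F (t + 2 * pi)" using F(2) by (simp add: strict_mono_def)
    then have m1: "m \<ge> 1" using m by (simp add: zero_less_mult_iff)
    have "\<not> m \<ge> 2"
    proof
      assume "m \<ge> 2"
      then have "2 * pi * 1 < 2 * pi * of_int m" by (intro mult_strict_left_mono) auto
      then have lt: "F t + 2 * pi < F (t + 2 * pi)" using m by simp
      then obtain s where s: "t \<le> s" "s \<le> t + 2 * pi" "F s = F t + 2 * pi"
        using IVT' [of F t "F t + 2 * pi" "t + 2 * pi"] continuous_on_subset [OF F(1)] by auto
      have "s \<noteq> t" "s \<noteq> t + 2 * pi" using s(3) lt by auto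
      have "cis (F s) = cis (F t)" unfolding s(3) using cis_eq_iff [of "F t + 2 * pi" "F t"] by (metis mult.right_neutral of_int_1)
      then have "h (cis s) = h (cis t)" using F(3) by simp
      then have "cis s = cis t" using bij by (metis bij_betw_def cis_in_S1 inj_onD)
      then obtain k :: int where k: "s = t + 2 * pi * of_int k" using cis_eq_iff by blast
      then have "0 < 2 * pi * of_int k" "2 * pi * of_int k < 2 * pi * 1" using s \<open>s \<noteq> t\<close> \<open>s \<noteq> t + 2 * pi\<close> by linarith+
      then have "0 < k" "k < 1" by (simp_all add: zero_less_mult_iff mult_less_cancel_left)
      then show False by simp
    qed
    then have "m = 1" using m1 by simp
    then show ?thesis using m by simp
  qed
  then have "ap (Lift F) = F" using F by (intro ap_Lift)
  then have "h = pr (Lift F)" using F(3) by (intro S1_funI ext pr_extensional) simp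
  then show ?thesis by (rule that)
qed

lemma HomeoS1_mult: "f \<in> carrier HomeoS1 \<Longrightarrow> g \<in> carrier HomeoS1 \<Longrightarrow> f \<otimes>\<^bsub>HomeoS1\<^esub> g = compose S1 f g"
  by (simp add: HomeoS1_def BijGroup_def)

lemma HomeoS1_one: "\<one>\<^bsub>HomeoS1\<^esub> = pr 0"
  by (simp add: HomeoS1_def BijGroup_def pr_zero)

lemma pr_mult: "pr f \<otimes>\<^bsub>HomeoS1\<^esub> pr g = pr (f + g)"
  by (simp add: HomeoS1_mult pr_add)

lemma pr_inv: "inv\<^bsub>HomeoS1\<^esub> (pr f) = pr (- f)"
  by (rule group.inv_equality [OF group_HomeoS1]) (simp_all add: pr_mult HomeoS1_one)

text \<open>The difference in units of a turn is a continuous function with integer values, so it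
  cannot take the half integer between two of them and is constant.\<close>

lemma pr_eq_iff: "pr f = pr g \<longleftrightarrow> (\<exists>m::int. f = shift (2 * pi * of_int m) + g)"
proof
  assume eq: "pr f = pr g"
  have "\<exists>m::int. ap f t = ap g t + 2 * pi * of_int m" for t
    using eq pr_cis [of f t] pr_cis [of g t] cis_eq_iff by metis
  then obtain m :: "real \<Rightarrow> int" where m: "\<And>t. ap f t = ap g t + 2 * pi * of_int (m t)" by metis
  define u where "u t = (ap f t - ap g t) / (2 * pi)" for t
  have um: "u t = of_int (m t)" for t by (simp add: u_def m)
  have "continuous_on UNIV u" unfolding u_def by (intro continuous_intros) auto
  have "m t = m 0" for t
  proof -
    have "connected (u ` UNIV)" using \<open>continuous_on UNIV u\<close> by (intro connected_continuous_image) auto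
    then have iv: "is_interval (u ` UNIV)" by (simp add: is_interval_connected_1)
    have False if "m a < m b" for a b
    proof -
      have "u a \<le> of_int (m a) + 1 / 2" "of_int (m a) + 1 / 2 \<le> u b"
        using that unfolding um by linarith+
      then have "of_int (m a) + 1 / 2 \<in> u ` UNIV" using iv unfolding is_interval_1 by blast
      then obtain c where "of_int (m a) + 1 / 2 = (of_int (m c) :: real)" using um by auto
      then have "of_int (2 * m a + 1) = (of_int (2 * m c) :: real)" by simp
      then have "2 * m a + 1 = 2 * m c" by (simp only: of_int_eq_iff)
      then show False by presburger
    qed
    then show ?thesis by (metis linorder_less_linear)
  qed
  then have "ap f t = ap g t + 2 * pi * of_int (m 0)" for t using m [of t] by simp
  then have "f = shift (2 * pi * of_int (m 0)) + g" by (intro lift_eqI) simp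
  then show "\<exists>m::int. f = shift (2 * pi * of_int m) + g" by blast
next
  assume "\<exists>m::int. f = shift (2 * pi * of_int m) + g"
  then obtain m :: int where "f = shift (2 * pi * of_int m) + g" by blast
  then have "pr f (cis t) = pr g (cis t)" for t using cis_eq_iff by auto
  then show "pr f = pr g" by (intro S1_funI pr_extensional)
qed

section \<open>Moebius transformations of the circle\<close>

text \<open>For \<open>cmod q < cmod p\<close> this is the normal form of an automorphism of the
  unit disc: the matrices of SU(1,1) up to a positive factor.\<close>

definition mob :: "complex \<Rightarrow> complex \<Rightarrow> complex \<Rightarrow> complex" where
  "mob p q z = (p * z + q) / (cnj q * z + cnj p)"

lemma mob_denominator:
  assumes "cmod q < cmod p" "cmod z \<le> 1" shows "cnj q * z + cnj p \<noteq> 0"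
proof
  assume "cnj q * z + cnj p = 0"
  then have "cnj p = - (cnj q * z)" by (simp add: eq_neg_iff_add_eq_0 add.commute)
  then have "cmod p = cmod q * cmod z" by (metis complex_mod_cnj norm_minus_cancel norm_mult)
  also have "\<dots> \<le> cmod q * 1" using assms(2) by (intro mult_left_mono) auto
  finally show False using assms(1) by simp
qed

lemma norm_mob_identity:
  "(cmod (cnj q * z + cnj p))\<^sup>2 - (cmod (p * z + q))\<^sup>2 = ((cmod p)\<^sup>2 - (cmod q)\<^sup>2) * (1 - (cmod z)\<^sup>2)"
proof -
  have "complex_of_real ((cmod (cnj q * z + cnj p))\<^sup>2 - (cmod (p * z + q))\<^sup>2) =
    complex_of_real (((cmod p)\<^sup>2 - (cmod q)\<^sup>2) * (1 - (cmod z)\<^sup>2))"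
    unfolding of_real_diff of_real_mult complex_norm_square of_real_1
    by (simp add: algebra_simps)
  then show ?thesis by (simp only: of_real_eq_iff)
qed

lemma norm_mob_less:
  assumes pq: "cmod q < cmod p" and z: "cmod z < 1" shows "cmod (mob p q z) < 1"
proof -
  have "(cmod q)\<^sup>2 < (cmod p)\<^sup>2" using pq by (intro power_strict_mono) auto
  moreover have "(cmod z)\<^sup>2 < 1" using z by (simp add: power_less_one_iff)
  ultimately have "0 < ((cmod p)\<^sup>2 - (cmod q)\<^sup>2) * (1 - (cmod z)\<^sup>2)" by simp
  then have "(cmod (p * z + q))\<^sup>2 < (cmod (cnj q * z + cnj p))\<^sup>2" using norm_mob_identity [of q z p] by linarith
  then have "cmod (p * z + q) < cmod (cnj q * z + cnj p)" by (rule power_less_imp_less_base) simp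
  moreover have "0 < cmod (cnj q * z + cnj p)" using mob_denominator [OF pq, of z] z by simp
  ultimately show ?thesis by (simp add: mob_def norm_divide)
qed

lemma norm_mob_eq_1:
  assumes pq: "cmod q < cmod p" and z: "cmod z = 1" shows "cmod (mob p q z) = 1"
proof -
  have "(cmod (p * z + q))\<^sup>2 = (cmod (cnj q * z + cnj p))\<^sup>2" using norm_mob_identity [of q z p] z by simp
  then have "cmod (p * z + q) = cmod (cnj q * z + cnj p)" by (simp add: power2_eq_iff_nonneg)
  moreover have "cnj q * z + cnj p \<noteq> 0" using mob_denominator [OF pq] z by simp
  ultimately show ?thesis by (simp add: mob_def norm_divide)
qed

lemma mob_compose:
  assumes "cmod q' < cmod p'" "cmod z \<le> 1"
  shows "mob p q (mob p' q' z) = mob (p * p' + q * cnj q') (p * q' + q * cnj p') z"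
proof -
  define D where "D = cnj q' * z + cnj p'"
  have D: "D \<noteq> 0" using mob_denominator [OF assms] by (simp add: D_def)
  define N where "N = p' * z + q'"
  have e: "mob p' q' z = N / D" by (simp add: mob_def N_def D_def)
  have "p * (N / D) + q = (p * N + q * D) / D" "cnj q * (N / D) + cnj p = (cnj q * N + cnj p * D) / D"
    using D by (simp_all add: field_simps)
  then have "mob p q (mob p' q' z) = (p * N + q * D) / (cnj q * N + cnj p * D)"
    using D by (simp add: mob_def [of p q] e)
  then show ?thesis by (simp add: mob_def N_def D_def algebra_simps)
qed

lemma mob_compose_norm:
  assumes "cmod q < cmod p" "cmod q' < cmod p'"
  shows "cmod (p * q' + q * cnj p') < cmod (p * p' + q * cnj q')"
proof -
  have "complex_of_real ((cmod (p * p' + q * cnj q'))\<^sup>2 - (cmod (p * q' + q * cnj p'))\<^sup>2)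
    = complex_of_real (((cmod p)\<^sup>2 - (cmod q)\<^sup>2) * ((cmod p')\<^sup>2 - (cmod q')\<^sup>2))"
    unfolding of_real_diff of_real_mult complex_norm_square by (simp add: algebra_simps)
  then have "(cmod (p * p' + q * cnj q'))\<^sup>2 - (cmod (p * q' + q * cnj p'))\<^sup>2
    = ((cmod p)\<^sup>2 - (cmod q)\<^sup>2) * ((cmod p')\<^sup>2 - (cmod q')\<^sup>2)" by (simp only: of_real_eq_iff)
  moreover have "(cmod q)\<^sup>2 < (cmod p)\<^sup>2" "(cmod q')\<^sup>2 < (cmod p')\<^sup>2"
    using assms by (auto intro!: power_strict_mono)
  ultimately have "(cmod (p * q' + q * cnj p'))\<^sup>2 < (cmod (p * p' + q * cnj q'))\<^sup>2"
    by (smt (verit) mult_pos_pos)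
  then show ?thesis by (rule power_less_imp_less_base) simp
qed

lemma mob_inverse:
  assumes "cmod q < cmod p" "cmod z \<le> 1" shows "mob (cnj p) (- q) (mob p q z) = z"
proof -
  have "(cmod p)\<^sup>2 \<noteq> (cmod q)\<^sup>2" using assms by (simp add: power2_eq_iff_nonneg)
  then have "complex_of_real ((cmod p)\<^sup>2) - complex_of_real ((cmod q)\<^sup>2) \<noteq> 0"
    by (metis eq_iff_diff_eq_0 of_real_eq_iff)
  then have "p * cnj p - q * cnj q \<noteq> 0" unfolding complex_norm_square .
  moreover have "mob (cnj p) (- q) (mob p q z) = z * (p * cnj p - q * cnj q) / (p * cnj p - q * cnj q)"
    unfolding mob_compose [OF assms] by (simp add: mob_def algebra_simps)
  ultimately show ?thesis by simp
qed

lemma mob_inverse':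
  assumes "cmod q < cmod p" "cmod z \<le> 1" shows "mob p q (mob (cnj p) (- q) z) = z"
  using mob_inverse [of "- q" "cnj p" z] assms by simp

lemma mob_in_PSL2R:
  assumes pq: "cmod q < cmod p"
  shows "(\<lambda>z\<in>S1. mob p q z) \<in> PSL2R"
proof -
  have "(cmod p)\<^sup>2 \<noteq> (cmod q)\<^sup>2" using assms by (simp add: power2_eq_iff_nonneg)
  then have "complex_of_real ((cmod p)\<^sup>2) - complex_of_real ((cmod q)\<^sup>2) \<noteq> 0"
    by (metis eq_iff_diff_eq_0 of_real_eq_iff)
  then have det: "p * cnj p - q * cnj q \<noteq> 0" unfolding complex_norm_square .
  have "mob p q ` ball 0 1 = ball 0 1"
  proof
    show "mob p q ` ball 0 1 \<subseteq> ball 0 1" using norm_mob_less [OF pq] by auto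
    show "ball 0 1 \<subseteq> mob p q ` ball 0 1"
    proof
      fix w :: complex assume w: "w \<in> ball 0 1"
      then have "mob (cnj p) (- q) w \<in> ball 0 1" using norm_mob_less [of "- q" "cnj p" w] pq by simp
      moreover have "w = mob p q (mob (cnj p) (- q) w)" using mob_inverse' [OF pq, of w] w by simp
      ultimately show "w \<in> mob p q ` ball 0 1" by blast
    qed
  qed
  then show ?thesis unfolding PSL2R_def mob_def using det by blast
qed

text \<open>The bound on the numerator extends by density to the closed disc, and injectivity turns
  it into an equality on the circle. Hence the matrix preserves the form
  \<open>(cmod z)\<^sup>2 - (cmod w)\<^sup>2\<close> up to a factor, and a scalar brings it into the
  shape of \<open>mob\<close>.\<close>

lemma PSL2R_is_mob:
  assumes "g \<in> PSL2R"
  obtains p q where "cmod q < cmod p" "g = (\<lambda>z\<in>S1. mob p q z)"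
proof -
  obtain a b c d where g: "g = (\<lambda>z\<in>S1. (a * z + b) / (c * z + d))" and det: "a * d - b * c \<noteq> 0"
    and im: "(\<lambda>z. (a * z + b) / (c * z + d)) ` ball 0 1 = ball 0 1"
    using assms unfolding PSL2R_def by blast
  have lt: "cmod (a * z + b) < cmod (c * z + d)" if z: "cmod z < 1" "c * z + d \<noteq> 0" for z
  proof -
    have "(a * z + b) / (c * z + d) \<in> ball 0 1" using im z by auto
    then show ?thesis using z by (simp add: norm_divide divide_less_eq)
  qed
  have nz_all: "c * z + d \<noteq> 0 \<and> cmod (a * z + b) \<le> cmod (c * z + d)" if z: "cmod z \<le> 1" for z
  proof -
    \<comment> \<open>At most one pole is removed from the open disc, so the rest is dense in the
      closed disc.\<close>
    let ?N = "{z. cmod z < 1 \<and> c * z + d \<noteq> 0}"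
    have "z \<in> closure ?N"
    proof (rule ccontr)
      assume "z \<notin> closure ?N"
      then obtain e where e: "e > 0" "\<forall>y\<in>?N. \<not> dist y z < e"
        unfolding closure_approachable by blast
      have "z \<in> closure (ball 0 1)" using z by simp
      then obtain v where "v \<in> ball 0 1" "dist v z < e"
        using e(1) unfolding closure_approachable by blast
      then have "v \<in> ball z e \<inter> ball 0 1" by (simp add: dist_commute)
      then have "ball z e \<inter> ball 0 1 \<noteq> {}" by blast
      then have "infinite (ball z e \<inter> ball 0 1)"
        using finite_imp_not_open open_Int open_ball by blast
      moreover have "ball z e \<inter> ball 0 1 \<subseteq> {z. c * z + d = 0}" using e(2) by (auto simp: dist_commute)
      moreover have "finite {z. c * z + d = 0}"
      proof (cases "c = 0")
        case True
        then show ?thesis using det by simp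
      next
        case False
        then have "{z. c * z + d = 0} \<subseteq> {- d / c}" by (auto simp: field_simps eq_neg_iff_add_eq_0)
        then show ?thesis by (rule finite_subset) simp
      qed
      ultimately show False using finite_subset by blast
    qed
    moreover have "closed {z. cmod (a * z + b) \<le> cmod (c * z + d)}"
      by (intro closed_Collect_le continuous_intros)
    then have "closure ?N \<subseteq> {z. cmod (a * z + b) \<le> cmod (c * z + d)}"
      by (rule closure_minimal [rotated]) (use lt less_imp_le in auto)
    ultimately have le: "cmod (a * z + b) \<le> cmod (c * z + d)" by blast
    moreover have "c * z + d \<noteq> 0"
    proof
      assume cd: "c * z + d = 0"
      then have ab: "a * z + b = 0" using le by simp
      have "a * d - b * c = a * (c * z + d) - c * (a * z + b)" by (simp add: algebra_simps)
      then show False using det cd ab by simp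
    qed
    ultimately show ?thesis by blast
  qed
  have inj: "z = z'" if "cmod z \<le> 1" "cmod z' \<le> 1" "(a * z + b) / (c * z + d) = (a * z' + b) / (c * z' + d)" for z z'
  proof -
    have "(a * z + b) * (c * z' + d) = (a * z' + b) * (c * z + d)"
      using that nz_all by (simp add: frac_eq_eq)
    then have "(a * d - b * c) * (z - z') = 0" by (simp add: algebra_simps)
    then show ?thesis using det by simp
  qed
  have unit: "cmod (a * z + b) = cmod (c * z + d)" if z: "cmod z = 1" for z
  proof (rule ccontr)
    assume neq: "\<not> ?thesis"
    have nz: "c * z + d \<noteq> 0" "cmod (a * z + b) \<le> cmod (c * z + d)" using nz_all z by auto
    \<comment> \<open>A boundary point with image inside the disc would share this image with an
      interior point, against injectivity on the closed disc.\<close>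
    then have "(a * z + b) / (c * z + d) \<in> ball 0 1" using neq by (simp add: norm_divide divide_less_eq)
    then obtain z' where z': "z' \<in> ball 0 1" "(a * z + b) / (c * z + d) = (a * z' + b) / (c * z' + d)"
      using im by blast
    then have "z = z'" using inj [of z z'] z by simp
    then show False using z z' by simp
  qed
  have key: "(a * cnj a + b * cnj b - c * cnj c - d * cnj d) + (a * cnj b - c * cnj d) * z + cnj ((a * cnj b - c * cnj d) * z) = 0"
    if z: "cmod z = 1" for z
  proof -
    have "complex_of_real ((cmod (a * z + b))\<^sup>2) = complex_of_real ((cmod (c * z + d))\<^sup>2)" using unit [OF z] by simp
    then have "(a * z + b) * cnj (a * z + b) = (c * z + d) * cnj (c * z + d)" by (simp only: complex_norm_square)
    moreover have "z * cnj z = 1" using z by (metis complex_norm_square of_real_1 one_power2)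
    moreover have "(a * z + b) * cnj (a * z + b) - (c * z + d) * cnj (c * z + d)
      = (a * cnj a - c * cnj c) * (z * cnj z) + b * cnj b - d * cnj d
        + (a * cnj b - c * cnj d) * z + cnj ((a * cnj b - c * cnj d) * z)"
      by (simp add: algebra_simps)
    ultimately show ?thesis by (simp add: algebra_simps)
  qed
  define E where "E = a * cnj b - c * cnj d"
  define K where "K = a * cnj a + b * cnj b - c * cnj c - d * cnj d"
  \<comment> \<open>The identity \<open>key\<close> is a trigonometric polynomial of degree one that
    vanishes on the circle; the values at 1, -1 and \<open>\<i>\<close> determine its
    coefficients.\<close>
  have "K + E + cnj E = 0" "K - E - cnj E = 0" "K + E * \<i> - cnj E * \<i> = 0"
    using key [of 1] key [of "- 1"] key [of \<i>] by (simp_all add: E_def K_def algebra_simps)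
  note KE = this
  have "2 * (E + cnj E) = (K + E + cnj E) - (K - E - cnj E)" by simp
  also have "\<dots> = 0" unfolding KE by simp
  finally have "2 * (E + cnj E) = 0" .
  then have EE: "E + cnj E = 0" by (metis mult_eq_0_iff zero_neq_numeral)
  have "K = (K + E + cnj E) - (E + cnj E)" by simp
  also have "\<dots> = 0" unfolding KE EE by simp
  finally have "K = 0" .
  then have "E * \<i> - cnj E * \<i> = 0" using KE(3) by simp
  then have "E = cnj E" by (metis complex_i_not_zero eq_iff_diff_eq_0 mult_cancel_right)
  then have "E + E = 0" using EE by metis
  then have "E = 0" by simp
  then have E0: "a * cnj b = c * cnj d" by (simp add: E_def)
  have K0: "a * cnj a + b * cnj b = c * cnj c + d * cnj d" using \<open>K = 0\<close> by (simp add: K_def algebra_simps)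
  have "c * 0 + d \<noteq> 0" using nz_all [of 0] by simp
  then have d0: "d \<noteq> 0" by simp
  have R: "(cmod a)\<^sup>2 + (cmod b)\<^sup>2 = (cmod c)\<^sup>2 + (cmod d)\<^sup>2"
  proof -
    have "complex_of_real ((cmod a)\<^sup>2 + (cmod b)\<^sup>2) = complex_of_real ((cmod c)\<^sup>2 + (cmod d)\<^sup>2)"
      using K0 by (simp only: of_real_add complex_norm_square)
    then show ?thesis by (simp only: of_real_eq_iff)
  qed
  have "b / d \<in> ball 0 1"
    using lt [of 0] d0 by (simp add: norm_divide)
  then have bd: "cmod b < cmod d" using d0 by (simp add: norm_divide)
  have N: "cmod a * cmod b = cmod c * cmod d" using E0 by (metis complex_mod_cnj norm_mult)
  \<comment> \<open>The pairs of squared moduli of \<open>a, b\<close> and of \<open>c, d\<close>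
    have equal sum and equal product, so they coincide up to order, and \<open>bd\<close> excludes
    one of the orders.\<close>
  have ad: "cmod a = cmod d"
  proof -
    have "(cmod d)\<^sup>2 * ((cmod a)\<^sup>2 + (cmod b)\<^sup>2) = (cmod c * cmod d)\<^sup>2 + (cmod d)\<^sup>2 * (cmod d)\<^sup>2"
      unfolding R by (simp add: algebra_simps power_mult_distrib)
    also have "(cmod c * cmod d)\<^sup>2 = (cmod a)\<^sup>2 * (cmod b)\<^sup>2" unfolding N [symmetric] by (simp add: power_mult_distrib)
    finally have "((cmod d)\<^sup>2 - (cmod a)\<^sup>2) * ((cmod d)\<^sup>2 - (cmod b)\<^sup>2) = 0" by (simp add: algebra_simps)
    moreover have "(cmod b)\<^sup>2 < (cmod d)\<^sup>2" using bd by (intro power_strict_mono) auto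
    ultimately have "(cmod d)\<^sup>2 = (cmod a)\<^sup>2" unfolding mult_eq_0_iff by linarith
    then show ?thesis by (simp add: power2_eq_iff_nonneg)
  qed
  \<comment> \<open>A scalar multiple of the matrix has the form required by \<^const>\<open>mob\<close>.\<close>
  obtain u where u: "u \<noteq> 0" "u\<^sup>2 = cnj d / a"
  proof -
    have "a \<noteq> 0" using ad d0 by auto
    then have "csqrt (cnj d / a) \<noteq> 0" using d0 by simp
    then show ?thesis using that [of "csqrt (cnj d / a)"] by simp
  qed
  have a0: "a \<noteq> 0" using ad d0 by auto
  have nu: "cmod u = 1"
  proof -
    have "(cmod u)\<^sup>2 = 1" using u(2) ad d0 by (metis complex_mod_cnj divide_self norm_divide norm_eq_zero norm_power)
    then show ?thesis by (simp add: power2_eq_1_iff) (metis norm_ge_zero neg_0_le_iff_le not_one_le_zero)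
  qed
  then have uu: "u * cnj u = 1" by (metis complex_norm_square of_real_1 one_power2)
  have "cnj (u * a) = u * d"
  proof -
    have "u * cnj (u * d) = u * cnj u * cnj d" by simp
    also have "\<dots> = u\<^sup>2 * a" using u(2) uu a0 by simp
    finally have "u * cnj (u * d) = u * (u * a)" by (simp add: power2_eq_square)
    then have "cnj (u * d) = u * a" using u(1) by simp
    then show ?thesis by (metis complex_cnj_cnj)
  qed
  moreover have "cnj (u * b) = u * c"
  proof -
    have "(u * a) * cnj (u * b) = (u * cnj u) * (a * cnj b)" by (simp add: mult_ac)
    also have "\<dots> = (u * c) * cnj (u * d)" unfolding E0 by (simp add: mult_ac)
    also have "cnj (u * d) = u * a" using \<open>cnj (u * a) = u * d\<close> by (metis complex_cnj_cnj)
    finally have "(u * a) * cnj (u * b) = (u * a) * (u * c)" by (simp add: mult_ac)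
    then show ?thesis using u(1) a0 by simp
  qed
  ultimately have "mob (u * a) (u * b) z = (a * z + b) / (c * z + d)" for z
  proof -
    have "mob (u * a) (u * b) z = (u * (a * z + b)) / (u * (c * z + d))"
      unfolding mob_def \<open>cnj (u * a) = u * d\<close> \<open>cnj (u * b) = u * c\<close> by (simp add: algebra_simps)
    then show ?thesis using u(1) by simp
  qed
  moreover have "cmod (u * b) < cmod (u * a)" using nu bd ad by (simp add: norm_mult)
  ultimately show ?thesis using that [of "u * b" "u * a"] g by simp
qed

text \<open>Fixed points are roots of the quadratic
  \<open>cnj q * z\<^sup>2 + (cnj p - p) * z - q\<close>, which vanishes identically if it has three
  roots.\<close>

lemma mob_three_fixed_points:
  assumes fixed: "\<And>z. z \<in> {z1, z2, z3} \<Longrightarrow> mob p q z = z" and z: "z1 \<in> S1" "z2 \<in> S1" "z3 \<in> S1"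
    and dist: "z1 \<noteq> z2" "z1 \<noteq> z3" "z2 \<noteq> z3" and pq: "cmod q < cmod p" and w: "w \<in> S1"
  shows "mob p q w = w"
proof -
  have e: "cnj q * z\<^sup>2 + (cnj p - p) * z - q = 0" if "z \<in> {z1, z2, z3}" for z
  proof -
    have "z \<in> S1" using that z by auto
    then have "cnj q * z + cnj p \<noteq> 0" using mob_denominator [OF pq] by simp
    then have "p * z + q = z * (cnj q * z + cnj p)" using fixed [OF that] by (simp add: mob_def divide_eq_eq)
    then show ?thesis by (simp add: algebra_simps power2_eq_square)
  qed
  have "(z1 - z2) * (cnj q * (z1 + z2) + (cnj p - p)) = 0" "(z1 - z3) * (cnj q * (z1 + z3) + (cnj p - p)) = 0"
    using e [of z1] e [of z2] e [of z3] by (simp_all add: algebra_simps power2_eq_square)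
  then have l: "cnj q * (z1 + z2) + (cnj p - p) = 0" "cnj q * (z1 + z3) + (cnj p - p) = 0" using dist by simp_all
  have "cnj q * (z2 - z3) = (cnj q * (z1 + z2) + (cnj p - p)) - (cnj q * (z1 + z3) + (cnj p - p))"
    by (simp add: algebra_simps)
  also have "\<dots> = 0" unfolding l by simp
  finally have "cnj q * (z2 - z3) = 0" .
  then have q0: "q = 0" using dist by simp
  then have pp: "cnj p = p" using l by simp
  have "p \<noteq> 0" using pq by auto
  then show ?thesis using q0 pp by (simp add: mob_def)
qed

lemma mob_agree:
  assumes pq: "cmod q < cmod p" "cmod q' < cmod p'" and z: "z1 \<in> S1" "z2 \<in> S1" "z3 \<in> S1"
    and dist: "z1 \<noteq> z2" "z1 \<noteq> z3" "z2 \<noteq> z3"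
    and agree: "\<And>z. z \<in> {z1, z2, z3} \<Longrightarrow> mob p q z = mob p' q' z" and w: "w \<in> S1"
  shows "mob p q w = mob p' q' w"
proof -
  let ?P = "cnj p * p' + (- q) * cnj q'" and ?Q = "cnj p * q' + (- q) * cnj p'"
  have c: "mob (cnj p) (- q) (mob p' q' z) = mob ?P ?Q z" if "z \<in> S1" for z
    using that by (intro mob_compose pq) simp
  have PQ: "cmod ?Q < cmod ?P" by (rule mob_compose_norm) (use pq in simp_all)
  have "mob ?P ?Q w = w"
  proof (rule mob_three_fixed_points [OF _ z dist PQ w])
    fix z assume zz: "z \<in> {z1, z2, z3}"
    then have "z \<in> S1" using z by auto
    then show "mob ?P ?Q z = z" using c agree [OF zz] mob_inverse [OF pq(1), of z] by simp
  qed
  then have "mob p q (mob (cnj p) (- q) (mob p' q' w)) = mob p q w" using c [OF w] by simp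
  then show ?thesis using mob_inverse' [OF pq(1), of "mob p' q' w"] norm_mob_eq_1 [OF pq(2), of w] w by simp
qed

text \<open>With \<open>w = q / p\<close> and \<open>D = 1 + cnj w * z\<close>, the map is
  \<open>(p / cnj p) * z * (cnj D / D)\<close> on the circle. Since \<open>D\<close> has positive
  real part, its argument is continuous and periodic, which gives an explicit lift.\<close>

lemma mob_lift:
  assumes pq: "cmod q < cmod p"
  obtains f where "pr f = (\<lambda>z\<in>S1. mob p q z)"
proof -
  define w where "w = q / p"
  have p0: "p \<noteq> 0" using pq by auto
  have w: "cmod w < 1" using pq p0 by (simp add: w_def norm_divide)
  define D where "D t = 1 + cnj w * cis t" for t
  have ReD: "Re (D t) > 0" for t
  proof -
    have "cmod (cnj w * cis t) < 1" using w by (simp add: norm_mult)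
    then have "\<bar>Re (cnj w * cis t)\<bar> < 1" using abs_Re_le_cmod le_less_trans by blast
    then show ?thesis by (simp add: D_def)
  qed
  have Dnp: "D t \<notin> \<real>\<^sub>\<le>\<^sub>0" for t using ReD [of t] by (simp add: complex_nonpos_Reals_iff)
  have D0: "D t \<noteq> 0" for t using ReD [of t] by auto
  define F where "F t = 2 * Arg p + t - 2 * Arg (D t)" for t
  have rot: "u / cnj u = cis (2 * Arg u)" if "u \<noteq> 0" for u
  proof -
    have u: "u = cmod u * cis (Arg u)" using that by (simp add: cis_Arg sgn_eq)
    have "cnj u = cmod u * cis (- Arg u)" by (subst u) (simp add: cis_cnj)
    then have "u / cnj u = cis (Arg u) / cis (- Arg u)" using u that by (metis (no_types) mult_divide_mult_cancel_left norm_eq_zero of_real_eq_0_iff)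
    then show ?thesis by (simp add: cis_divide)
  qed
  have FF: "cis (F t) = mob p q (cis t)" for t
  proof -
    have "cis (F t) = cis (2 * Arg p) * cis t * cis (- (2 * Arg (D t)))" by (simp add: F_def cis_mult)
    also have "cis (- (2 * Arg (D t))) = cnj (cis (2 * Arg (D t)))" by (simp add: cis_cnj)
    also have "\<dots> = cnj (D t) / D t" unfolding rot [OF D0, symmetric] by simp
    also have "cis (2 * Arg p) = p / cnj p" by (rule rot [OF p0, symmetric])
    also have "p / cnj p * cis t * (cnj (D t) / D t) = (p * (cis t * cnj (D t))) / (cnj p * D t)" by simp
    also have "p * (cis t * cnj (D t)) = p * cis t + q"
      using p0 by (simp add: D_def w_def algebra_simps cis_cnj cis_mult)
    also have "cnj p * D t = cnj q * cis t + cnj p" using p0 by (simp add: D_def w_def algebra_simps)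
    finally show ?thesis by (simp add: mob_def)
  qed
  have cont: "continuous_on S F" for S
    unfolding F_def D_def using Dnp unfolding D_def
    by (intro continuous_intros continuous_on_compose2 [OF continuous_on_Arg, of "- \<real>\<^sub>\<le>\<^sub>0"]) auto
  have per: "F (t + 2 * pi) = F t + 2 * pi" for t by (simp add: F_def D_def cis_add_2pi)
  have inj: "F s \<noteq> F t" if "s \<noteq> t" for s t
  proof
    assume "F s = F t"
    then have e: "mob p q (cis s) = mob p q (cis t)" by (metis FF)
    have i: "mob (cnj p) (- q) (mob p q (cis u)) = cis u" for u by (rule mob_inverse [OF pq]) simp
    have "cis s = cis t" using i [of s] unfolding e i by (rule sym)
    then obtain m :: int where m: "s = t + 2 * pi * of_int m" using cis_eq_iff by blast
    then have "cis s = cis t" using cis_eq_iff by blast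
    then have "F s - F t = s - t" by (simp add: F_def D_def)
    then show False using \<open>F s = F t\<close> that by simp
  qed
  have pern: "F (t + 2 * pi * real n) = F t + 2 * pi * real n" for t n
  proof -
    have "cis (t + 2 * pi * real n) = cis t" using cis_eq_iff by (metis of_int_of_nat_eq)
    then show ?thesis by (simp add: F_def D_def)
  qed
  have mono: "strict_mono F"
  proof (rule strict_monoI)
    fix s t :: real assume st: "s < t"
    obtain n :: nat where n: "t - s < real n * (2 * pi)" using reals_Archimedean3 [of "2 * pi"] by auto
    define b where "b = s + 2 * pi * real n"
    have b: "t < b" using n by (simp add: b_def algebra_simps)
    have "F s < F b" using pern [of s n] b st by (simp add: b_def)
    moreover have "inj_on F {s..b}" using inj by (auto simp: inj_on_def)
    ultimately show "F s < F t" using continuous_inj_imp_mono [OF st b cont] by auto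
  qed
  have "ap (Lift F) = F" using mono cont per by (intro ap_Lift)
  then have "pr (Lift F) = (\<lambda>z\<in>S1. mob p q z)"
    using FF by (intro S1_funI pr_extensional) auto
  then show ?thesis by (rule that)
qed

section \<open>Coordinates for the rotation and Moebius cases\<close>

text \<open>Monotone solutions of Cauchy's functional equation are squeezed between integer
  multiples of \<open>f 1\<close>, with an error that stays bounded after multiplication by
  \<open>k\<close>.\<close>

lemma additive_strict_mono_linear:
  fixes f :: "real \<Rightarrow> real"
  assumes add: "\<And>s t. f (s + t) = f s + f t" and mono: "strict_mono f"
  shows "f t = t * f 1"
proof -
  have 0: "f 0 = 0" using add [of 0 0] by simp
  have m: "f (- t) = - f t" for t using add [of t "- t"] 0 by simp
  have n: "f (real k * t) = real k * f t" for k t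
    by (induction k) (simp_all add: 0 add algebra_simps)
  have i: "f (of_int k) = of_int k * f 1" for k
  proof (cases "k \<ge> 0")
    case True
    then show ?thesis using n [of "nat k" 1] by simp
  next
    case False
    then show ?thesis using n [of "nat (- k)" 1] m [of "of_int (- k)"] by simp
  qed
  have f1: "f 1 > 0" using mono 0 by (metis strict_mono_less zero_less_one)
  have "real k * \<bar>f t - t * f 1\<bar> \<le> f 1" for k
  proof -
    define j where "j = \<lfloor>real k * t\<rfloor>"
    have j: "of_int j \<le> real k * t" "real k * t \<le> of_int (j + 1)" unfolding j_def by linarith+
    then have "f (of_int j) \<le> f (real k * t)" "f (real k * t) \<le> f (of_int (j + 1))"
      using mono by (simp_all add: strict_mono_less_eq)
    then have a: "of_int j * f 1 \<le> real k * f t" "real k * f t \<le> (of_int j + 1) * f 1"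
      unfolding i n by simp_all
    have b: "of_int j * f 1 \<le> real k * t * f 1" "real k * t * f 1 \<le> (of_int j + 1) * f 1"
      using j f1 by (simp_all add: mult_le_cancel_right)
    have "\<bar>real k * f t - real k * t * f 1\<bar> \<le> f 1" using a b by (simp add: algebra_simps abs_le_iff)
    moreover have "\<bar>real k * f t - real k * t * f 1\<bar> = real k * \<bar>f t - t * f 1\<bar>"
      by (simp add: abs_mult right_diff_distrib [symmetric] mult.assoc)
    ultimately show ?thesis by simp
  qed
  then show ?thesis using zero_if_multiples_bounded by fastforce
qed

lemma shift_add: "shift s + shift t = shift (s + t)"
  by (rule lift_eqI) simp

lemma shift_uminus: "- shift s = shift (- s)"
  by (rule lift_eqI) (simp add: ap_uminus_eq_iff)

lemma shift_0: "shift 0 = 0"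
  by (rule lift_eqI) simp

lemma conj_add: "(c + g - c) + (c + h - c) = c + (g + h) - (c :: lift)"
  by (rule lift_eqI) simp

lemma conj_uminus: "- (c + g - c) = c + - g - (c :: lift)"
  by (rule lift_eqI) (simp add: ap_uminus_eq_iff)

text \<open>Hoelder's coordinate for \<open>A\<close>, rescaled, is itself a lift. Elements of
  \<open>L\<close> normalize the translations, hence are affine in it, and commuting with the full
  turn makes their slope 1.\<close>

theorem free_circle_group_conj_rotations:
  assumes "circle_group L A" and free: "\<And>a x. a \<in> A \<Longrightarrow> ap a x = x \<Longrightarrow> a = 0"
  obtains c where "\<And>g. g \<in> L \<Longrightarrow> \<exists>s. c + g - c = shift s" "\<And>s. \<exists>g\<in>L. c + g - c = shift s"
proof -
  interpret circle_group L A by fact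
  interpret F: free_transitive A UNIV
    by unfold_locales (use cc_add_subgroup [OF cc_A] transitive_A free in auto)
  obtain \<phi> \<tau> where \<phi>: "strict_mono_on UNIV \<phi>" "\<phi> ` UNIV = UNIV"
    "\<And>b z. b \<in> A \<Longrightarrow> z \<in> UNIV \<Longrightarrow> \<phi> (ap b z) = \<phi> z + \<tau> b" "\<And>s::real. \<exists>b\<in>A. \<tau> b = s"
    using F.translation_coordinate by blast
  have mono: "strict_mono \<phi>" using \<phi>(1) by simp
  \<comment> \<open>The coordinate rises by this constant over every turn;
    \<open>k = 2 * pi / D\<close> then normalizes it to degree one.\<close>
  define D where "D = \<phi> (2 * pi) - \<phi> 0"
  have D: "\<phi> (x + 2 * pi) = \<phi> x + D" for x
  proof -
    obtain a where a: "a \<in> A" "ap a 0 = x" using transitive_A by blast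
    have "\<phi> (x + 2 * pi) = \<phi> (ap a (0 + 2 * pi))" using a(2) by (simp only: ap_add_2pi)
    also have "\<dots> = \<phi> (2 * pi) + \<tau> a" using \<phi>(3) [OF a(1)] by simp
    also have "\<phi> x = \<phi> 0 + \<tau> a" using \<phi>(3) [OF a(1), of 0] a(2) by simp
    ultimately show ?thesis by (simp add: D_def)
  qed
  have Dpos: "D > 0" unfolding D_def using mono by (simp add: strict_mono_less)
  define k where "k = 2 * pi / D"
  have k: "k > 0" using Dpos by (simp add: k_def)
  have "continuous_on UNIV \<phi>"
    using \<phi>(2) mono by (intro continuous_onI_mono) (auto simp: strict_mono_less_eq)
  then have "continuous_on UNIV (\<lambda>x. k * \<phi> x)" by (intro continuous_intros)
  moreover have "strict_mono (\<lambda>x. k * \<phi> x)" using mono k by (simp add: strict_mono_def)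
  moreover have "k * \<phi> (x + 2 * pi) = k * \<phi> x + 2 * pi" for x
  proof -
    have "k * D = 2 * pi" using Dpos by (simp add: k_def)
    then show ?thesis by (simp only: D distrib_left)
  qed
  ultimately have cap: "ap (Lift (\<lambda>x. k * \<phi> x)) = (\<lambda>x. k * \<phi> x)" by (intro ap_Lift)
  define c where "c = Lift (\<lambda>x. k * \<phi> x)"
  have c: "ap c x = k * \<phi> x" for x using cap by (simp add: c_def)
  have cA: "c + a - c = shift (k * \<tau> a)" if "a \<in> A" for a
  proof (rule lift_eqI)
    fix x
    have "ap (c + a - c) x = k * \<phi> (ap a (ap (- c) x))" by (simp add: c)
    also have "\<dots> = k * \<phi> (ap (- c) x) + k * \<tau> a" using \<phi>(3) [OF that] by (simp add: distrib_left)
    also have "k * \<phi> (ap (- c) x) = x" using c [of "ap (- c) x"] by simp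
    finally show "ap (c + a - c) x = ap (shift (k * \<tau> a)) x" by simp
  qed
  have all: "\<exists>a\<in>A. c + a - c = shift s" for s
  proof -
    obtain a where "a \<in> A" "\<tau> a = s / k" using \<phi>(4) by blast
    then show ?thesis using cA [of a] k by (intro bexI [of _ a]) auto
  qed
  have "\<exists>s. c + g - c = shift s" if g: "g \<in> L" for g
  proof -
    define h where "h = c + g - c"
    have norm: "\<exists>u. \<forall>t. ap h (t + s) = ap h t + u" for s
    proof -
      obtain a where a: "a \<in> A" "c + a - c = shift s" using all by blast
      have gag: "g + a - g \<in> A" using normal g a by blast
      have "h + shift s = shift (k * \<tau> (g + a - g)) + h"
        unfolding a(2) [symmetric] cA [OF gag, symmetric] h_def by (rule lift_eqI) simp
      then have "ap (h + shift s) t = ap (shift (k * \<tau> (g + a - g)) + h) t" for t by simp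
      then show ?thesis by (intro exI [of _ "k * \<tau> (g + a - g)"]) simp
    qed
    define f where "f t = ap h t - ap h 0" for t
    have add: "f (s + t) = f s + f t" for s t
    proof -
      obtain u where "\<And>r. ap h (r + t) = ap h r + u" using norm by blast
      from this [of s] this [of 0] show ?thesis by (simp add: f_def)
    qed
    have "strict_mono f" by (simp add: f_def strict_mono_def)
    note lin = additive_strict_mono_linear [OF add this]
    have "f (2 * pi) = 2 * pi" using ap_add_2pi [of h 0] by (simp add: f_def)
    then have "f 1 = 1" using lin [of "2 * pi"] by simp
    then have ht: "ap h t = t + ap h 0" for t using lin [of t] by (simp add: f_def)
    have "h = shift (ap h 0)" by (rule lift_eqI) (unfold ap_shift, rule ht)
    then show ?thesis unfolding h_def by blast
  qed
  then show ?thesis using that [of c] all A_subset by blast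
qed

lemma extend_to_lift:
  assumes mono: "strict_mono_on {-pi<..<pi} \<psi>" and onto: "\<psi> ` {-pi<..<pi} = {-pi<..<pi}"
  obtains c where "ap c (- pi) = - pi" "\<And>y. y \<in> {-pi<..<pi} \<Longrightarrow> ap c y = \<psi> y"
proof -
  \<comment> \<open>\<open>m y\<close> counts turns relative to the fundamental domain from
    \<open>- pi\<close> (included) to \<open>pi\<close>, and \<open>r y\<close> is the
    representative in it. The end point \<open>- pi\<close> is fixed by decree in
    \<open>\<psi>'\<close>.\<close>
  define m where "m y = \<lfloor>(y + pi) / (2 * pi)\<rfloor>" for y
  define r where "r y = y - 2 * pi * of_int (m y)" for y
  define \<psi>' where "\<psi>' u = (if u = - pi then - pi else \<psi> u)" for u
  define F where "F y = \<psi>' (r y) + 2 * pi * of_int (m y)" for y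
  have r: "- pi \<le> r y" "r y < pi" for y
  proof -
    have "of_int (m y) \<le> (y + pi) / (2 * pi)" "(y + pi) / (2 * pi) < of_int (m y) + 1"
      unfolding m_def by linarith+
    then show "- pi \<le> r y" "r y < pi" by (simp_all add: r_def field_simps)
  qed
  have m_unique: "m (u + 2 * pi * of_int k) = k" if "- pi \<le> u" "u < pi" for u k
  proof -
    have "(u + 2 * pi * of_int k + pi) / (2 * pi) = (u + pi) / (2 * pi) + of_int k" by (simp add: field_simps)
    moreover have "0 \<le> (u + pi) / (2 * pi)" "(u + pi) / (2 * pi) < 1" using that by (simp_all add: field_simps)
    ultimately show ?thesis unfolding m_def by linarith
  qed
  have F_val: "F (u + 2 * pi * of_int k) = \<psi>' u + 2 * pi * of_int k" if "- pi \<le> u" "u < pi" for u k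
    using m_unique [OF that, of k] by (simp add: F_def r_def)
  have \<psi>'b: "- pi \<le> \<psi>' u" "\<psi>' u < pi" if "- pi \<le> u" "u < pi" for u
  proof -
    have "\<psi> u \<in> {-pi<..<pi}" if "u \<in> {-pi<..<pi}" using that onto by blast
    then show "- pi \<le> \<psi>' u" "\<psi>' u < pi" using that by (force simp: \<psi>'_def)+
  qed
  have \<psi>'m: "\<psi>' u < \<psi>' v" if "- pi \<le> u" "u < v" "v < pi" for u v
  proof (cases "u = - pi")
    case True
    have "\<psi> v \<in> {-pi<..<pi}" using that onto by force
    then show ?thesis using True that by (simp add: \<psi>'_def)
  next
    case False
    then show ?thesis using that mono by (auto simp: \<psi>'_def strict_mono_on_def)
  qed
  have yr: "y = r y + 2 * pi * of_int (m y)" for y by (simp add: r_def)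
  have sm: "strict_mono F"
  proof (rule strict_monoI)
    fix y z :: real assume yz: "y < z"
    have "(y + pi) / (2 * pi) \<le> (z + pi) / (2 * pi)" using yz by (simp add: divide_right_mono)
    then have "m y \<le> m z" unfolding m_def by (rule floor_mono)
    then consider "m y = m z" | "m y + 1 \<le> m z" by linarith
    then show "F y < F z"
    proof cases
      case 1
      then have "r y < r z" using yz by (simp add: r_def)
      then show ?thesis using \<psi>'m [OF r(1) _ r(2)] 1 by (simp add: F_def)
    next
      case 2
      have "2 * pi * (of_int (m y) + 1) \<le> 2 * pi * of_int (m z)"
        using 2 by (intro mult_left_mono) (linarith, simp)
      then show ?thesis
        using \<psi>'b(2) [OF r, of y] \<psi>'b(1) [OF r, of z] by (simp add: F_def algebra_simps)
    qed
  qed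
  have surj: "\<exists>y. F y = w" for w
  proof -
    obtain u where u: "- pi \<le> u" "u < pi" "\<psi>' u = r w"
    proof (cases "r w = - pi")
      case True
      then show ?thesis using that [of "- pi"] by (simp add: \<psi>'_def)
    next
      case False
      then have "r w \<in> \<psi> ` {-pi<..<pi}" unfolding onto using r [of w] by auto
      then obtain v where "v \<in> {-pi<..<pi}" "r w = \<psi> v" by blast
      then show ?thesis using that [of v] by (simp add: \<psi>'_def)
    qed
    then have "F (u + 2 * pi * of_int (m w)) = w" using F_val yr [of w] by simp
    then show ?thesis by blast
  qed
  have cont: "continuous_on UNIV F"
  proof (rule continuous_onI_mono)
    have "F ` UNIV = UNIV" using surj by (metis surjI)
    then show "open (F ` UNIV)" by simp
  qed (use sm in \<open>simp add: strict_mono_less_eq\<close>)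
  have per: "F (y + 2 * pi) = F y + 2 * pi" for y
  proof -
    have "y + 2 * pi = r y + 2 * pi * of_int (m y + 1)" using yr [of y] by (simp add: algebra_simps)
    then have "F (y + 2 * pi) = \<psi>' (r y) + 2 * pi * of_int (m y + 1)" using F_val [OF r] by metis
    then show ?thesis by (simp add: F_def algebra_simps)
  qed
  have "ap (Lift F) = F" by (rule ap_Lift [OF sm cont per])
  moreover have "F y = \<psi>' y" if "- pi \<le> y" "y < pi" for y using F_val [OF that, of 0] by simp
  ultimately show ?thesis using that [of "Lift F"] by (simp add: \<psi>'_def)
qed

definition cyc_of :: "nat \<Rightarrow> (nat \<Rightarrow> real) \<Rightarrow> int \<Rightarrow> real" where
  "cyc_of n v i = v (nat (i mod int n)) + 2 * pi * of_int (i div int n)"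

lemma cyc_of_value: "j < n \<Longrightarrow> cyc_of n v (int j) = v j"
  by (simp add: cyc_of_def)

lemma cyc_cyc_of:
  assumes n: "n \<ge> 1" and step: "\<And>j. Suc j < n \<Longrightarrow> v j < v (Suc j)" and last: "v (n - 1) < v 0 + 2 * pi"
  shows "cyc n (cyc_of n v)"
proof -
  have "cyc_of n v i < cyc_of n v (i + 1)" for i
  proof -
    define j where "j = nat (i mod int n)"
    have j: "int j = i mod int n" "j < n" using n by (simp_all add: j_def nat_less_iff)
    have i: "i = int j + int n * (i div int n)" by (simp add: j(1))
    show ?thesis
    proof (cases "Suc j < n")
      case True
      have "(i + 1) div int n = i div int n" "(i + 1) mod int n = int (Suc j)"
        using i True by (intro int_div_pos_eq [of _ _ _ "int (Suc j)"] int_mod_pos_eq [of _ _ "i div int n"]; simp)+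
      then have "cyc_of n v (i + 1) = v (Suc j) + 2 * pi * of_int (i div int n)" by (simp only: cyc_of_def nat_int)
      then show ?thesis using step [OF True] by (simp add: cyc_of_def j_def)
    next
      case False
      then have jn: "Suc j = n" using j by simp
      then have "i + 1 = int n * (i div int n + 1) + 0" using i by (simp add: algebra_simps)
      then have "(i + 1) div int n = i div int n + 1" "(i + 1) mod int n = 0"
        using n by (intro int_div_pos_eq [of _ _ _ 0] int_mod_pos_eq [of _ _ "i div int n + 1"]; simp)+
      then have "cyc_of n v (i + 1) = v 0 + 2 * pi * of_int (i div int n + 1)" by (simp only: cyc_of_def nat_0)
      moreover have "cyc_of n v i = v (n - 1) + 2 * pi * of_int (i div int n)"
      proof -
        have "n - 1 = j" using jn by simp
        then show ?thesis by (simp only: cyc_of_def j_def [symmetric])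
      qed
      ultimately show ?thesis using last by (simp add: algebra_simps)
    qed
  qed
  moreover have "cyc_of n v (i + int n) = cyc_of n v i + 2 * pi" for i
    using n by (simp add: cyc_of_def algebra_simps)
  ultimately show ?thesis using strict_mono_int_stepI by (simp add: cyc_def)
qed

lemma cyc_triple:
  assumes "u0 < u1" "u1 < u2" "u2 < u0 + 2 * pi"
  obtains x where "cyc 3 x" "x 0 = u0" "x 1 = u1" "x 2 = u2"
proof -
  define v where "v j = (if j = 0 then u0 else if j = 1 then u1 else u2)" for j :: nat
  have "cyc 3 (cyc_of 3 v)"
  proof (rule cyc_cyc_of)
    show "v j < v (Suc j)" if "Suc j < 3" for j
    proof -
      have "j = 0 \<or> j = 1" using that by linarith
      then show ?thesis using assms by (auto simp: v_def)
    qed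
  qed (use assms in \<open>auto simp: v_def\<close>)
  moreover have "cyc_of 3 v 0 = u0" "cyc_of 3 v 1 = u1" "cyc_of 3 v 2 = u2"
    using cyc_of_value [of 0 3 v] cyc_of_value [of 1 3 v] cyc_of_value [of 2 3 v] by (simp_all add: v_def)
  ultimately show ?thesis using that by blast
qed

text \<open>\<open>\<alpha>\<close> will be the coordinate form of an element exchanging 0 and
  infinity; \<open>scale\<close> says that it conjugates homotheties fixing 0 to such homotheties.
  The factors \<open>\<sigma>\<close> are multiplicative, decreasing and an involution, so they are
  reciprocals.\<close>

lemma inversion_unique:
  fixes \<alpha> :: "real \<Rightarrow> real"
  assumes neg: "\<And>t. t > 0 \<Longrightarrow> \<alpha> t < 0" and pos: "\<And>t. t < 0 \<Longrightarrow> \<alpha> t > 0"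
    and inv: "\<And>t. t \<noteq> 0 \<Longrightarrow> \<alpha> (\<alpha> t) = \<mu> * t"
    and scale: "\<And>l. l > 0 \<Longrightarrow> \<exists>s>0. \<forall>t. t \<noteq> 0 \<longrightarrow> \<alpha> (l * t) = s * \<alpha> t"
    and mono: "\<And>s t. 0 < s \<Longrightarrow> s < t \<Longrightarrow> \<alpha> s < \<alpha> t" and one: "\<alpha> 1 = - 1" and t: "t \<noteq> 0"
  shows "\<alpha> t = - 1 / t"
proof -
  obtain \<sigma> where \<sigma>: "\<And>l. l > 0 \<Longrightarrow> \<sigma> l > 0" "\<And>l t. l > 0 \<Longrightarrow> t \<noteq> 0 \<Longrightarrow> \<alpha> (l * t) = \<sigma> l * \<alpha> t"
    using scale by metis
  have p: "\<alpha> l = - \<sigma> l" if "l > 0" for l using \<sigma>(2) [OF that, of 1] one by simp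
  have m1: "\<alpha> (- 1) = \<mu>" using inv [of 1] one by simp
  then have \<mu>: "\<mu> > 0" using pos [of "- 1"] by simp
  have n: "\<alpha> (- l) = \<sigma> l * \<mu>" if "l > 0" for l using \<sigma>(2) [OF that, of "- 1"] m1 by simp
  have ss: "\<sigma> (\<sigma> l) = l" if l: "l > 0" for l
  proof -
    have "\<mu> * l = \<alpha> (- \<sigma> l)" using inv [of l] p [OF l] l by simp
    also have "\<dots> = \<sigma> (\<sigma> l) * \<mu>" by (rule n [OF \<sigma>(1) [OF l]])
    finally show ?thesis using \<mu> by simp
  qed
  have smul: "\<sigma> (k * l) = \<sigma> k * \<sigma> l" if "k > 0" "l > 0" for k l
    using \<sigma>(2) [OF that(1), of l] p [of "k * l"] p [OF that(2)] that by simp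
  have anti: "\<sigma> l < \<sigma> k" if "0 < k" "k < l" for k l
    using mono [OF that] p [of k] p [of l] that by simp
  have s1: "\<sigma> l = 1 / l" if l: "l > 0" for l
  proof -
    \<comment> \<open>Both \<open>g\<close> and its square are fixed by the decreasing function
      \<open>\<sigma>\<close>, so they are equal and \<open>g = 1\<close>.\<close>
    define g where "g = l * \<sigma> l"
    have g0: "g > 0" using l \<sigma>(1) by (simp add: g_def)
    have gg: "\<sigma> g = g" using smul [OF l \<sigma>(1) [OF l]] ss [OF l] by (simp add: g_def)
    have g2: "\<sigma> (g * g) = g * g" using smul [OF g0 g0] gg by simp
    have "\<not> g < g * g" using anti [of g "g * g"] g0 gg g2 by auto
    moreover have "\<not> g * g < g" using anti [of "g * g" g] g0 gg g2 by auto
    ultimately have "g * g = g" by linarith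
    then have "g = 1" using g0 by simp
    then show ?thesis using l by (simp add: g_def field_simps)
  qed
  have "\<mu> = 1"
  proof -
    have "\<alpha> \<mu> = - \<mu>" using inv [of "- 1"] m1 by simp
    then have "1 / \<mu> = \<mu>" using p [OF \<mu>] s1 [OF \<mu>] by simp
    then have "\<mu>\<^sup>2 = 1" using \<mu> by (simp add: field_simps power2_eq_square)
    then show ?thesis using \<mu> by (simp add: power2_eq_1_iff)
  qed
  then show ?thesis using p [of t] n [of "- t"] s1 [of t] s1 [of "- t"] t by (cases "t > 0") auto
qed

section \<open>The Cayley transform of the line, with -1 as the point at infinity\<close>

definition cayley :: "real \<Rightarrow> complex" where
  "cayley t = (1 + \<i> * of_real t) / (1 - \<i> * of_real t)"

lemma cayley_denominator: "1 - \<i> * of_real t \<noteq> 0"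
  by (simp add: complex_eq_iff)

lemma cis_2_arctan: "cis (2 * arctan t) = cayley t"
proof -
  have s: "sqrt (1 + t\<^sup>2) \<noteq> 0" "(sqrt (1 + t\<^sup>2))\<^sup>2 = 1 + t\<^sup>2"
    by (auto simp: add_nonneg_eq_0_iff)
  have c: "cis (arctan t) = (1 + \<i> * of_real t) / of_real (sqrt (1 + t\<^sup>2))"
    by (simp add: complex_eq_iff cos_arctan sin_arctan)
  have "cis (2 * arctan t) = (cis (arctan t))\<^sup>2" by (simp add: power2_eq_square cis_mult)
  also have "\<dots> = (1 + \<i> * of_real t)\<^sup>2 / of_real (1 + t\<^sup>2)"
    unfolding c power_divide of_real_power [symmetric] s(2) ..
  also have "complex_of_real (1 + t\<^sup>2) = (1 + \<i> * of_real t) * (1 - \<i> * of_real t)"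
    by (simp add: algebra_simps power2_eq_square)
  also have "(1 + \<i> * of_real t)\<^sup>2 / ((1 + \<i> * of_real t) * (1 - \<i> * of_real t)) = cayley t"
    using cayley_denominator [of "- t"] by (simp add: cayley_def power2_eq_square)
  finally show ?thesis .
qed

text \<open>These coefficients are what the affine map with slope \<open>l\<close> and offset
  \<open>s\<close> becomes when it is conjugated by the Cayley transform.\<close>

lemma mob_affine_norm:
  assumes "l > 0"
  shows "cmod (1 - of_real l + \<i> * of_real s) < cmod (1 + of_real l + \<i> * of_real s)"
proof -
  have "(cmod (1 - of_real l + \<i> * of_real s))\<^sup>2 < (cmod (1 + of_real l + \<i> * of_real s))\<^sup>2"
    unfolding cmod_power2 using assms by (simp add: power2_eq_square algebra_simps)
  then show ?thesis by (rule power_less_imp_less_base) simp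
qed

lemma mob_affine_cayley:
  assumes "l > 0"
  shows "mob (1 + of_real l + \<i> * of_real s) (1 - of_real l + \<i> * of_real s) (cayley t) = cayley (l * t + s)"
proof -
  define D where "D = 1 - \<i> * complex_of_real t"
  have D: "D \<noteq> 0" using cayley_denominator by (simp add: D_def)
  let ?p = "1 + of_real l + \<i> * of_real s" and ?q = "1 - of_real l + \<i> * of_real s"
  have cay: "cayley t = (1 + \<i> * of_real t) / D" by (simp add: cayley_def D_def)
  have "?p * cayley t + ?q = (?p * (1 + \<i> * of_real t) + ?q * D) / D"
    "cnj ?q * cayley t + cnj ?p = (cnj ?q * (1 + \<i> * of_real t) + cnj ?p * D) / D"
    unfolding cay using D by (simp_all add: field_simps)
  then have "mob ?p ?q (cayley t) = (?p * (1 + \<i> * of_real t) + ?q * D) / (cnj ?q * (1 + \<i> * of_real t) + cnj ?p * D)"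
    using D by (simp add: mob_def)
  also have "?p * (1 + \<i> * of_real t) + ?q * D = 2 * (1 + \<i> * of_real (l * t + s))"
    by (simp add: D_def algebra_simps)
  also have "cnj ?q * (1 + \<i> * of_real t) + cnj ?p * D = 2 * (1 - \<i> * of_real (l * t + s))"
    by (simp add: D_def algebra_simps)
  also have "2 * (1 + \<i> * of_real (l * t + s)) / (2 * (1 - \<i> * of_real (l * t + s))) = cayley (l * t + s)"
    unfolding cayley_def by (rule mult_divide_mult_cancel_left) simp
  finally show ?thesis .
qed

lemma mob_affine_minus_1:
  assumes "l > 0"
  shows "mob (1 + of_real l + \<i> * of_real s) (1 - of_real l + \<i> * of_real s) (- 1) = - 1"
proof -
  have "complex_of_real l \<noteq> 0" using assms by simp
  then show ?thesis by (simp add: mob_def)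
qed

lemma cayley_inversion:
  assumes "t \<noteq> 0" shows "cayley (- 1 / t) = - cayley t"
proof -
  define T where "T = complex_of_real t"
  have T: "T \<noteq> 0" "1 - \<i> * T \<noteq> 0" using assms cayley_denominator by (simp_all add: T_def)
  have "1 + \<i> * of_real (- 1 / t) = - \<i> * (1 + \<i> * T) / T" "1 - \<i> * of_real (- 1 / t) = \<i> * (1 - \<i> * T) / T"
    using T(1) by (simp_all add: T_def field_simps)
  then have "cayley (- 1 / t) = (- \<i> * (1 + \<i> * T) / T) / (\<i> * (1 - \<i> * T) / T)" unfolding cayley_def by simp
  also have "\<dots> = - ((1 + \<i> * T) / (1 - \<i> * T))"
  proof -
    have "(- \<i> * N / T) / (\<i> * M / T) = - (N / M)" if "M \<noteq> 0" for N M
      using that T(1) by (simp add: field_simps)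
    then show ?thesis using T(2) by blast
  qed
  finally show ?thesis by (simp add: cayley_def T_def)
qed

lemma PSL2R_compose:
  assumes "f \<in> PSL2R" "g \<in> PSL2R" shows "compose S1 f g \<in> PSL2R"
proof -
  obtain p q where f: "cmod q < cmod p" "f = (\<lambda>z\<in>S1. mob p q z)" using PSL2R_is_mob [OF assms(1)] by blast
  obtain p' q' where g: "cmod q' < cmod p'" "g = (\<lambda>z\<in>S1. mob p' q' z)" using PSL2R_is_mob [OF assms(2)] by blast
  have "compose S1 f g = (\<lambda>z\<in>S1. mob (p * p' + q * cnj q') (p * q' + q * cnj p') z)"
  proof (rule extensionalityI [of _ S1])
    fix z :: complex assume z: "z \<in> S1"
    then have "g z \<in> S1" using norm_mob_eq_1 [OF g(1)] by (simp add: g(2))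
    then show "compose S1 f g z = (\<lambda>z\<in>S1. mob (p * p' + q * cnj q') (p * q' + q * cnj p') z) z"
      using z mob_compose [OF g(1), of z p q] by (simp add: compose_def f(2) g(2))
  qed (simp_all add: compose_def)
  then show ?thesis using mob_in_PSL2R [OF mob_compose_norm [OF f(1) g(1)]] by simp
qed

lemma id_in_PSL2R: "pr 0 \<in> PSL2R"
proof -
  have "pr 0 = (\<lambda>z\<in>S1. mob 1 0 z)" unfolding pr_zero by (simp add: mob_def)
  then show ?thesis using mob_in_PSL2R [of 0 1] by simp
qed

locale sharp_group = primitive_group +
  assumes deck: "shift (2 * pi * of_int m) \<in> L"
    and triple_transitive: "tuple_transitive 3"
    and affine: "affine_action (stab A (- pi)) {-pi<..<pi}"
begin

lemmas memL [simp] = add_subgroupD [OF subgroup_L]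

text \<open>In Hoelder's coordinate on the circle without one point, elements fixing that point are
  affine, and one element becomes \<open>- 1 / t\<close>. They give all of \<open>L\<close> up to
  full turns. Every Moebius map is attained because it is determined by three points, on which the
  group realizes any cyclically ordered images.\<close>

lemma conj_PSL2R:
  obtains c where "\<And>g. g \<in> L \<Longrightarrow> pr (c + g - c) \<in> PSL2R" "\<And>h. h \<in> PSL2R \<Longrightarrow> \<exists>g\<in>L. pr (c + g - c) = h"
proof -
  let ?I = "{-pi<..<pi}"
  interpret AF: affine_action "stab A (- pi)" ?I by (rule affine)
  interpret F: free_transitive AF.trans ?I by (rule AF.free_transitive_trans)
  obtain \<phi> \<tau> where \<phi>: "strict_mono_on ?I \<phi>" "\<phi> ` ?I = UNIV"
    "\<And>b z. b \<in> AF.trans \<Longrightarrow> z \<in> ?I \<Longrightarrow> \<phi> (ap b z) = \<phi> z + \<tau> b" "\<And>s::real. \<exists>b\<in>AF.trans. \<tau> b = s"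
    using F.translation_coordinate by blast
  define \<theta> where "\<theta> t = (SOME y. y \<in> ?I \<and> \<phi> y = t)" for t
  have \<theta>: "\<theta> t \<in> ?I" "\<phi> (\<theta> t) = t" for t
  proof -
    have "\<exists>y. y \<in> ?I \<and> \<phi> y = t" using \<phi>(2) by (metis UNIV_I imageE)
    from someI_ex [OF this] show "\<theta> t \<in> ?I" "\<phi> (\<theta> t) = t" unfolding \<theta>_def by auto
  qed
  have \<phi>less: "\<phi> y < \<phi> z \<longleftrightarrow> y < z" if "y \<in> ?I" "z \<in> ?I" for y z
    using \<phi>(1) that by (rule strict_mono_on_less)
  have \<phi>inj: "y = z" if "y \<in> ?I" "z \<in> ?I" "\<phi> y = \<phi> z" for y z
    using \<phi>less [of y z] \<phi>less [of z y] that by auto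
  have \<theta>\<phi>: "\<theta> (\<phi> y) = y" if "y \<in> ?I" for y using \<phi>inj [OF \<theta>(1) that] \<theta>(2) by simp
  have \<theta>less: "\<theta> s < \<theta> t \<longleftrightarrow> s < t" for s t using \<phi>less [OF \<theta>(1) \<theta>(1)] \<theta>(2) by simp
  have \<theta>b: "- pi < \<theta> t" "\<theta> t < pi" for t using \<theta>(1) [of t] by auto
  have AL: "a \<in> L" if "a \<in> A" for a using that A_subset by blast
  have fix_pi: "ap g pi = pi" if "ap g (- pi) = - pi" for g
    using ap_add_2pi [of g "- pi"] that by simp
  have pres: "ap g y \<in> ?I" if g: "ap g (- pi) = - pi" and y: "y \<in> ?I" for g y
  proof -
    have "ap g (- pi) < ap g y" "ap g y < ap g pi" using y by simp_all
    then show ?thesis using g fix_pi [OF g] by simp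
  qed
  \<comment> \<open>Conjugation by \<open>g\<close> preserves the translation group
    \<open>AF.trans\<close>, so in the coordinate \<open>g\<close> turns translations into
    translations; a monotone map with this property is affine.\<close>
  have aff: "\<exists>l>0. \<exists>s. \<forall>t. ap g (\<theta> t) = \<theta> (l * t + s)" if g: "g \<in> L" "ap g (- pi) = - pi" for g
  proof -
    define \<psi> where "\<psi> t = \<phi> (ap g (\<theta> t))" for t
    have gI: "ap g (\<theta> t) \<in> ?I" for t by (rule pres [OF g(2) \<theta>(1)])
    have "\<exists>u. \<forall>t. \<psi> (t + s) = \<psi> t + u" for s
    proof -
      obtain f where f: "f \<in> AF.trans" "\<tau> f = s" using \<phi>(4) by blast
      have "f \<in> stab A (- pi)" using f(1) unfolding AF.trans_def by blast
      then have fB: "f \<in> A" "ap f (- pi) = - pi" by (auto simp: stab_def)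
      have gf: "ap (- g) (- pi) = - pi" using g(2) by (simp add: ap_uminus_eq_iff)
      have "g + f - g \<in> AF.trans"
        unfolding AF.trans_def
      proof (intro CollectI conjI)
        have "g + f - g \<in> A" using normal g fB by blast
        moreover have "ap (g + f - g) (- pi) = - pi" using gf fB g by simp
        ultimately show "g + f - g \<in> stab A (- pi)" by (simp add: stab_def)
        show "g + f - g = 0 \<or> (\<forall>z\<in>?I. ap (g + f - g) z \<noteq> z)"
        proof (cases "f = 0")
          case False
          then have nf: "\<forall>z\<in>?I. ap f z \<noteq> z" using f(1) by (simp add: AF.trans_def)
          have "ap (g + f - g) z \<noteq> z" if "z \<in> ?I" for z
          proof
            assume "ap (g + f - g) z = z"
            then have "ap f (ap (- g) z) = ap (- g) z" by (metis ap_minus ap_plus ap_uminus_ap)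
            then show False using nf pres [OF gf that] by blast
          qed
          then show ?thesis by blast
        qed simp
      qed
      then have "\<phi> (ap (g + f - g) (ap g (\<theta> t))) = \<psi> t + \<tau> (g + f - g)" for t
        using \<phi>(3) gI by (simp only: \<psi>_def)
      moreover have "ap f (\<theta> t) = \<theta> (t + s)" for t
      proof -
        have "ap f (\<theta> t) \<in> ?I" using F.invariant f \<theta> by blast
        then show ?thesis using \<phi>inj [OF _ \<theta>(1)] \<phi>(3) [OF f(1) \<theta>(1)] \<theta>(2) f(2) by simp
      qed
      then have "\<phi> (ap (g + f - g) (ap g (\<theta> t))) = \<psi> (t + s)" for t by (simp add: \<psi>_def)
      ultimately show ?thesis by (intro exI [of _ "\<tau> (g + f - g)"]) simp
    qed
    then obtain u where u: "\<And>s t. \<psi> (t + s) = \<psi> t + u s" by metis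
    define f where "f t = \<psi> t - \<psi> 0" for t
    have "f (s + t) = f s + f t" for s t using u [of s t] u [of 0 t] by (simp add: f_def)
    moreover have sm: "strict_mono f"
      using \<phi>less [OF gI gI] \<theta>less by (simp add: f_def \<psi>_def strict_mono_def)
    ultimately have lin: "f t = t * f 1" for t by (rule additive_strict_mono_linear)
    have "f 0 < f 1" using sm by (simp add: strict_mono_less)
    then have "f 1 > 0" by (simp add: f_def)
    moreover have "ap g (\<theta> t) = \<theta> (f 1 * t + \<psi> 0)" for t
    proof (rule \<phi>inj [OF gI \<theta>(1)])
      show "\<phi> (ap g (\<theta> t)) = \<phi> (\<theta> (f 1 * t + \<psi> 0))" using lin [of t] by (simp add: \<theta>(2) f_def \<psi>_def algebra_simps)
    qed
    ultimately show ?thesis by blast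
  qed
  have aff0: "\<exists>l>0. \<forall>t. ap g (\<theta> t) = \<theta> (l * t)" if g: "g \<in> L" "ap g (- pi) = - pi" "ap g (\<theta> 0) = \<theta> 0" for g
  proof -
    obtain l s where ls: "l > 0" "\<forall>t. ap g (\<theta> t) = \<theta> (l * t + s)" using aff [OF g(1,2)] by blast
    have "\<theta> s = \<theta> 0" using ls(2) g(3) by (metis add_0 mult_zero_right)
    then have "s = 0" by (metis \<theta>(2))
    then show ?thesis using ls by auto
  qed
  \<comment> \<open>The element exchanging \<open>0\<close> and \<open>\<infinity>\<close> in the coordinate \<open>\<phi>\<close>.\<close>
  obtain a where a: "a \<in> A" "ap a (- pi) = \<theta> 0" "ap a (\<theta> 0) = pi" "ap a (\<theta> 1) = \<theta> (- 1) + 2 * pi"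
  proof -
    \<comment> \<open>In the coordinate, with \<open>- pi\<close> as infinity, the triples prescribe
      infinity to 0, 0 to infinity and 1 to -1. The last image lies one turn further, to keep the
      cyclic order.\<close>
    have "\<theta> 1 < - pi + 2 * pi" using \<theta>b(2) [of 1] by simp
    then obtain X where X: "cyc 3 X" "X 0 = - pi" "X 1 = \<theta> 0" "X 2 = \<theta> 1"
      using cyc_triple [of "- pi" "\<theta> 0" "\<theta> 1"] \<theta>b \<theta>less by (metis zero_less_one)
    have "pi < \<theta> (- 1) + 2 * pi" "\<theta> (- 1) + 2 * pi < \<theta> 0 + 2 * pi" using \<theta>b(1) [of "- 1"] \<theta>less by simp_all
    then obtain Y where Y: "cyc 3 Y" "Y 0 = \<theta> 0" "Y 1 = pi" "Y 2 = \<theta> (- 1) + 2 * pi"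
      using cyc_triple [of "\<theta> 0" pi "\<theta> (- 1) + 2 * pi"] \<theta>b by metis
    obtain a where "a \<in> A" "\<forall>i. ap a (X i) = Y i" using triple_transitive X Y unfolding tuple_transitive_def by blast
    then show ?thesis using that X Y by metis
  qed
  have api: "ap a pi = \<theta> 0 + 2 * pi" using ap_add_2pi [of a "- pi"] a(2) by simp
  \<comment> \<open>\<open>a\<close> in the coordinate: it carries the right half of the interval
    beyond \<open>pi\<close>, hence the subtraction of a turn.\<close>
  define \<alpha> where "\<alpha> t = (if t < 0 then \<phi> (ap a (\<theta> t)) else \<phi> (ap a (\<theta> t) - 2 * pi))" for t
  have an: "ap a (\<theta> t) = \<theta> (\<alpha> t)" "\<alpha> t > 0" if t: "t < 0" for t
  proof -
    have "ap a (- pi) < ap a (\<theta> t)" "ap a (\<theta> t) < ap a (\<theta> 0)" using \<theta>b \<theta>less t by simp_all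
    then have b: "\<theta> 0 < ap a (\<theta> t)" "ap a (\<theta> t) < pi" by (simp_all only: a)
    then have I: "ap a (\<theta> t) \<in> ?I" using \<theta>b(1) [of 0] by auto
    then show e: "ap a (\<theta> t) = \<theta> (\<alpha> t)" using \<theta>\<phi> t by (simp add: \<alpha>_def)
    show "\<alpha> t > 0" using b(1) unfolding e \<theta>less .
  qed
  have ap': "ap a (\<theta> t) = \<theta> (\<alpha> t) + 2 * pi" "\<alpha> t < 0" if t: "t > 0" for t
  proof -
    have "ap a (\<theta> 0) < ap a (\<theta> t)" "ap a (\<theta> t) < ap a pi" using \<theta>b \<theta>less t by simp_all
    then have b: "pi < ap a (\<theta> t)" "ap a (\<theta> t) < \<theta> 0 + 2 * pi" by (simp_all only: a api)
    then have I: "ap a (\<theta> t) - 2 * pi \<in> ?I" using \<theta>b(2) [of 0] by auto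
    have "\<theta> (\<alpha> t) = ap a (\<theta> t) - 2 * pi" using \<theta>\<phi> [OF I] t by (simp add: \<alpha>_def)
    then show e: "ap a (\<theta> t) = \<theta> (\<alpha> t) + 2 * pi" by simp
    have "\<theta> (\<alpha> t) < \<theta> 0" using b(2) unfolding e by simp
    then show "\<alpha> t < 0" unfolding \<theta>less .
  qed
  have \<alpha>: "\<alpha> t = - 1 / t" if t: "t \<noteq> 0" for t
  proof -
    \<comment> \<open>The square of \<open>a\<close>, less one turn, fixes 0 and infinity, so it is
      a homothety; its factor is the \<open>\<mu>\<close> of the inversion lemma.\<close>
    define m where "m = shift (2 * pi * of_int (- 1)) + (a + a)"
    have mL: "m \<in> L" unfolding m_def using deck [of "- 1"] AL [OF a(1)] by (intro memL) 
    have mf: "ap m (- pi) = - pi" "ap m (\<theta> 0) = \<theta> 0" by (simp_all add: m_def a api)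
    obtain \<mu> where \<mu>: "\<mu> > 0" "\<forall>t. ap m (\<theta> t) = \<theta> (\<mu> * t)" using aff0 [OF mL mf] by blast
    show ?thesis
    proof (rule inversion_unique [of \<alpha> \<mu>])
      show "\<alpha> (\<alpha> t) = \<mu> * t" if "t \<noteq> 0" for t
      proof -
        have "ap (a + a) (\<theta> t) = \<theta> (\<alpha> (\<alpha> t)) + 2 * pi"
        proof (cases "t < 0")
          case True
          then show ?thesis using an [OF True] ap' [of "\<alpha> t"] by simp
        next
          case False
          then have "t > 0" using that by simp
          then show ?thesis using ap' [of t] an [of "\<alpha> t"] by simp
        qed
        then have "ap m (\<theta> t) = \<theta> (\<alpha> (\<alpha> t))" by (simp add: m_def)
        then have "\<theta> (\<alpha> (\<alpha> t)) = \<theta> (\<mu> * t)" using \<mu>(2) by simp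
        then show ?thesis by (metis \<theta>(2))
      qed
      show "\<alpha> s < \<alpha> t" if "0 < s" "s < t" for s t
      proof -
        have "ap a (\<theta> s) < ap a (\<theta> t)" using \<theta>less that by simp
        then have "\<theta> (\<alpha> s) < \<theta> (\<alpha> t)" using ap'(1) that by simp
        then show ?thesis unfolding \<theta>less .
      qed
      show "\<alpha> 1 = - 1"
      proof -
        have "\<theta> (\<alpha> 1) = \<theta> (- 1)" using ap'(1) [of 1] a(4) by simp
        then show ?thesis by (metis \<theta>(2))
      qed
      show "\<exists>s>0. \<forall>t. t \<noteq> 0 \<longrightarrow> \<alpha> (l * t) = s * \<alpha> t" if l: "l > 0" for l
      proof -
        \<comment> \<open>The homothety with factor \<open>l\<close>. Its conjugate by
          \<open>a\<close> again fixes 0 and infinity, so it is a homothety, whose factor is the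
          required \<open>s\<close>.\<close>
        obtain d where d: "d \<in> stab (stab A (- pi)) (\<theta> 0)" "ap d (\<theta> 1) = \<theta> l"
          using AF.stab_transitive [OF \<theta>(1) \<theta>(1) \<theta>(1), of 0 1 l] \<theta>less l by auto
        then have dA: "d \<in> A" "ap d (- pi) = - pi" "ap d (\<theta> 0) = \<theta> 0" by (auto simp: stab_def)
        obtain l' where "\<forall>t. ap d (\<theta> t) = \<theta> (l' * t)" using aff0 [OF AL [OF dA(1)] dA(2,3)] by blast
        moreover from this have "l' = l" using d(2) by (metis \<theta>(2) mult.right_neutral)
        ultimately have dt: "ap d (\<theta> t) = \<theta> (l * t)" for t by simp
        define e where "e = a + d - a"
        have eL: "e \<in> L" using AL a(1) dA(1) by (simp add: e_def)
        have "ap (- a) (\<theta> 0) = - pi" "ap (- a) (- pi) = \<theta> 0 - 2 * pi"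
          using a(2) ap_add_2pi [of a "\<theta> 0 - 2 * pi"] a(3) by (auto simp: ap_uminus_eq_iff)
        moreover have "ap d (\<theta> 0 - 2 * pi) = \<theta> 0 - 2 * pi" "ap a (\<theta> 0 - 2 * pi) = - pi"
          using ap_add_2pi [of d "\<theta> 0 - 2 * pi"] dA(3) ap_add_2pi [of a "\<theta> 0 - 2 * pi"] a(3) by simp_all
        ultimately have ef: "ap e (- pi) = - pi" "ap e (\<theta> 0) = \<theta> 0"
          using dA a by (simp_all add: e_def)
        obtain s where s: "s > 0" "\<forall>t. ap e (\<theta> t) = \<theta> (s * t)" using aff0 [OF eL ef] by blast
        have ead: "ap a (ap d y) = ap e (ap a y)" for y by (simp add: e_def)
        have "\<alpha> (l * t) = s * \<alpha> t" if t: "t \<noteq> 0" for t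
        proof (cases "t < 0")
          case True
          then have lt: "l * t < 0" using l by (simp add: mult_less_0_iff)
          have "\<theta> (\<alpha> (l * t)) = ap a (ap d (\<theta> t))" using an(1) [OF lt] by (simp add: dt)
          also have "\<dots> = \<theta> (s * \<alpha> t)" unfolding ead an(1) [OF True] using s(2) by blast
          finally show ?thesis by (metis \<theta>(2))
        next
          case False
          then have t0: "t > 0" using t by simp
          then have lt: "l * t > 0" using l by simp
          have "\<theta> (\<alpha> (l * t)) + 2 * pi = ap a (ap d (\<theta> t))" using ap'(1) [OF lt] by (simp add: dt)
          also have "\<dots> = \<theta> (s * \<alpha> t) + 2 * pi" unfolding ead ap'(1) [OF t0] ap_add_2pi using s(2) by simp
          finally show ?thesis by (metis \<theta>(2) add_right_cancel)
        qed
        then show ?thesis using s(1) by blast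
      qed
    qed (use an ap' t in auto)
  qed
  \<comment> \<open>\<open>2 * arctan\<close> carries the coordinate line to the angles of the
    circle, where \<open>cis\<close> of it is the Cayley transform.\<close>
  have "strict_mono_on ?I (\<lambda>y. 2 * arctan (\<phi> y))"
  proof (rule strict_mono_onI)
    fix y z assume "y \<in> ?I" "z \<in> ?I" "y < z"
    then have "\<phi> y < \<phi> z" using \<phi>less by blast
    then show "2 * arctan (\<phi> y) < 2 * arctan (\<phi> z)" by (simp add: arctan_less_iff)
  qed
  moreover have "(\<lambda>y. 2 * arctan (\<phi> y)) ` ?I = ?I"
  proof
    show "(\<lambda>y. 2 * arctan (\<phi> y)) ` ?I \<subseteq> ?I"
      using arctan_lbound arctan_ubound by (force simp: field_simps)
    show "?I \<subseteq> (\<lambda>y. 2 * arctan (\<phi> y)) ` ?I"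
    proof
      fix u assume u: "u \<in> ?I"
      then have "2 * arctan (\<phi> (\<theta> (tan (u / 2)))) = u" by (simp add: \<theta>(2) arctan_tan)
      then show "u \<in> (\<lambda>y. 2 * arctan (\<phi> y)) ` ?I" using \<theta>(1) by (metis (no_types, lifting) image_eqI)
    qed
  qed
  ultimately obtain c where c: "ap c (- pi) = - pi" "\<And>y. y \<in> ?I \<Longrightarrow> ap c y = 2 * arctan (\<phi> y)"
    using extend_to_lift by blast
  have c\<theta>: "cis (ap c (\<theta> t)) = cayley t" for t by (simp only: c(2) [OF \<theta>(1)] \<theta>(2) cis_2_arctan)
  have cpi: "ap c pi = pi" by (rule fix_pi [OF c(1)])
  have m1: "cis (- pi) = - 1" "cis pi = - 1" by (simp_all add: complex_eq_iff)
  have points: "z = - 1 \<or> (\<exists>t. z = cis (ap c (\<theta> t)))" if z: "z \<in> S1" for z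
  proof -
    have zA: "z = cis (Arg z)" using S1_cis [OF z] by simp
    have "- pi < Arg z" "Arg z \<le> pi" using Arg_bounded by auto
    then consider "Arg z = pi" | "Arg z \<in> ?I" by (force simp: order_le_less)
    then show ?thesis
    proof cases
      case 1
      then show ?thesis using zA m1 by metis
    next
      case 2
      then have "ap c (\<theta> (tan (Arg z / 2))) = Arg z" by (simp add: c(2) [OF \<theta>(1)] \<theta>(2) arctan_tan)
      then show ?thesis using zA by metis
    qed
  qed
  have prc: "pr (c + g - c) (cis (ap c y)) = cis (ap c (ap g y))" for g y by simp
  have eqI: "pr (c + g - c) = (\<lambda>z\<in>S1. h z)" if "cis (ap c (ap g (- pi))) = h (- 1)"
    "\<And>t. cis (ap c (ap g (\<theta> t))) = h (cayley t)" for g h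
  proof (rule extensionalityI [OF pr_extensional])
    fix z :: complex assume z: "z \<in> S1"
    from points [OF z] show "pr (c + g - c) z = (\<lambda>z\<in>S1. h z) z"
    proof (elim disjE exE)
      assume "z = - 1"
      then have "z = cis (ap c (- pi))" by (simp only: c(1) m1)
      then show ?thesis using prc [of g "- pi"] that(1) \<open>z = - 1\<close> z by simp
    next
      fix t assume t: "z = cis (ap c (\<theta> t))"
      then have "pr (c + g - c) z = h (cayley t)" using prc [of g "\<theta> t"] that(2) by simp
      then show ?thesis using t c\<theta> z by simp
    qed
  qed simp
  have Qfix: "pr (c + g - c) \<in> PSL2R" if g: "g \<in> L" "ap g (- pi) = - pi" for g
  proof -
    obtain l s where ls: "l > 0" "\<forall>t. ap g (\<theta> t) = \<theta> (l * t + s)" using aff [OF g] by blast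
    have "pr (c + g - c) = (\<lambda>z\<in>S1. mob (1 + of_real l + \<i> * of_real s) (1 - of_real l + \<i> * of_real s) z)"
    proof (rule eqI)
      show "cis (ap c (ap g (- pi))) = mob (1 + of_real l + \<i> * of_real s) (1 - of_real l + \<i> * of_real s) (- 1)"
        unfolding mob_affine_minus_1 [OF ls(1)] g(2) c(1) m1 ..
      show "cis (ap c (ap g (\<theta> t))) = mob (1 + of_real l + \<i> * of_real s) (1 - of_real l + \<i> * of_real s) (cayley t)" for t
        unfolding mob_affine_cayley [OF ls(1)] using ls(2) c\<theta> by simp
    qed
    then show ?thesis using mob_in_PSL2R [OF mob_affine_norm [OF ls(1)]] by simp
  qed
  have Qa: "pr (c + a - c) \<in> PSL2R"
  proof -
    \<comment> \<open>In the Cayley coordinate \<open>- 1 / t\<close> is the half turn of the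
      circle, and \<open>mob \<i> 0\<close> multiplies by
      \<open>\<i> / cnj \<i> = - 1\<close>.\<close>
    have "pr (c + a - c) = (\<lambda>z\<in>S1. mob \<i> 0 z)"
    proof (rule eqI)
      show "cis (ap c (ap a (- pi))) = mob \<i> 0 (- 1)" unfolding a(2) c\<theta> by (simp add: mob_def cayley_def)
      show "cis (ap c (ap a (\<theta> t))) = mob \<i> 0 (cayley t)" for t
      proof -
        consider "t = 0" | "t < 0" | "t > 0" by linarith
        then have "cis (ap c (ap a (\<theta> t))) = - cayley t"
        proof cases
          case 1
          then show ?thesis using a(3) cpi m1 by (simp add: cayley_def)
        next
          case 2
          then show ?thesis using an(1) [OF 2] \<alpha> [of t] cayley_inversion [of t] c\<theta> by simp
        next
          case 3
          then show ?thesis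
            using ap'(1) [OF 3] \<alpha> [of t] cayley_inversion [of t] c\<theta> by (simp add: cis_add_2pi)
        qed
        then show ?thesis by (simp add: mob_def)
      qed
    qed
    then show ?thesis using mob_in_PSL2R [of 0 \<i>] by simp
  qed
  have Qshift: "pr (c + shift (2 * pi * of_int m) - c) \<in> PSL2R" for m
  proof -
    have "c + shift (2 * pi * of_int m) - c = shift (2 * pi * of_int m) + 0" by (rule lift_eqI) simp
    then have "pr (c + shift (2 * pi * of_int m) - c) = pr 0" using pr_eq_iff by blast
    then show ?thesis using id_in_PSL2R by simp
  qed
  have Qadd: "pr (c + (f + g) - c) \<in> PSL2R" if "pr (c + f - c) \<in> PSL2R" "pr (c + g - c) \<in> PSL2R" for f g
    unfolding conj_add [symmetric] pr_add using that by (rule PSL2R_compose)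
  have Q: "pr (c + g - c) \<in> PSL2R" if g: "g \<in> L" for g
  proof -
    obtain m :: int where m: "0 \<le> ap g (- pi) + pi - 2 * pi * of_int m" "ap g (- pi) + pi - 2 * pi * of_int m < 2 * pi"
      by (rule reduce_2pi)
    define T where "T = shift (2 * pi * of_int m)"
    define w where "w = ap g (- pi) - 2 * pi * of_int m"
    have TL: "T \<in> L" by (simp add: T_def deck)
    have Tw: "ap (- T) (ap g (- pi)) = w" by (simp add: T_def w_def shift_uminus)
    show ?thesis
    proof (cases "w = - pi")
      case True
      then have "pr (c + (- T + g) - c) \<in> PSL2R" using TL g Tw by (intro Qfix) simp_all
      then have "pr (c + (T + (- T + g)) - c) \<in> PSL2R" by (rule Qadd [OF Qshift [of m, folded T_def]])
      then show ?thesis by simp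
    next
      case False
      then have "w \<in> ?I" using m by (auto simp: w_def)
      then obtain n where n: "n \<in> AF.trans" "ap n (\<theta> 0) = w" using F.transitive \<theta>(1) by blast
      then have "n \<in> stab A (- pi)" unfolding AF.trans_def by blast
      then have nA: "n \<in> A" "ap n (- pi) = - pi" by (auto simp: stab_def)
      \<comment> \<open>\<open>a\<close> sends infinity to 0, \<open>n\<close> sends 0 to
        \<open>w\<close>, and \<open>T\<close> restores the full turns; removing them in reverse
        order leaves an element fixing infinity.\<close>
      define g' where "g' = - a + (- n + (- T + g))"
      have "g' \<in> L" using TL g AL a(1) nA(1) by (simp add: g'_def)
      moreover have "ap (- n) w = \<theta> 0" "ap (- a) (\<theta> 0) = - pi" using n a by (auto simp: ap_uminus_eq_iff)
      then have "ap g' (- pi) = - pi" by (simp add: g'_def Tw)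
      ultimately have "pr (c + g' - c) \<in> PSL2R" by (rule Qfix)
      then have "pr (c + (T + (n + (a + g'))) - c) \<in> PSL2R"
        using Qshift [of m, folded T_def] Qa Qfix [OF AL [OF nA(1)] nA(2)] by (intro Qadd)
      then show ?thesis by (simp add: g'_def)
    qed
  qed
  moreover have "\<exists>g\<in>L. pr (c + g - c) = h" if h: "h \<in> PSL2R" for h
  proof -
    obtain p q where pq: "cmod q < cmod p" "h = (\<lambda>z\<in>S1. mob p q z)" using PSL2R_is_mob [OF h] by blast
    obtain f where f: "pr f = h" using mob_lift [OF pq(1)] pq(2) by metis
    \<comment> \<open>An element of \<open>A\<close> is found that agrees with \<open>h\<close>,
      pulled back by \<open>c\<close>, on three points; both are Moebius maps in the coordinate and
      so equal.\<close>
    obtain X where X: "cyc 3 X" using cyc_triple [of 0 1 2] pi_ge_two by auto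
    define F where "F = - c + f + c"
    obtain g where g: "g \<in> A" "\<And>i. ap g (X i) = ap F (X i)"
      using triple_transitive X cyc_image [OF X, of F] unfolding tuple_transitive_def by metis
    obtain p' q' where pq': "cmod q' < cmod p'" "pr (c + g - c) = (\<lambda>z\<in>S1. mob p' q' z)"
      using PSL2R_is_mob [OF Q [OF AL [OF g(1)]]] by blast
    define Z where "Z i = cis (ap c (X i))" for i
    have ZS: "Z i \<in> S1" for i by (simp add: Z_def)
    have agree: "mob p q (Z i) = mob p' q' (Z i)" for i
    proof -
      have "pr (c + g - c) (Z i) = cis (ap c (ap F (X i)))" unfolding Z_def prc g(2) ..
      also have "\<dots> = pr f (Z i)" by (simp add: F_def Z_def)
      finally show ?thesis using ZS f pq pq' by simp
    qed
    have Zne: "Z i \<noteq> Z j" if "i < j" "j < i + 3" for i j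
    proof
      assume "Z i = Z j"
      then obtain k :: int where k: "ap c (X j) = ap c (X i) + 2 * pi * of_int k" unfolding Z_def using cis_eq_iff by metis
      have "ap c (X j) = ap c (X i + 2 * pi * of_int k)" by (simp only: k ap_add_int)
      then have "X j = X (i + int 3 * k)" using cyc_mult [OF X, of i k] by (simp only: ap_eq_iff)
      then have "j = i + int 3 * k" using X by (simp add: cyc_def strict_mono_eq)
      then show False using that by presburger
    qed
    have "mob p q w = mob p' q' w" if "w \<in> S1" for w
      by (rule mob_agree [OF pq(1) pq'(1) ZS [of 0] ZS [of 1] ZS [of 2]])
        (use agree Zne [of 0 1] Zne [of 0 2] Zne [of 1 2] that in auto)
    then have "pr (c + g - c) = h" unfolding pq'(2) pq(2) by (auto simp: restrict_def)
    then show ?thesis using AL [OF g(1)] by blast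
  qed
  ultimately show ?thesis using that by blast
qed

end

section \<open>From the circle to the line\<close>

definition lifts :: "(complex \<Rightarrow> complex) set \<Rightarrow> lift set" where
  "lifts G = {f. pr f \<in> G}"

lemma mem_lifts [simp]: "f \<in> lifts G \<longleftrightarrow> pr f \<in> G"
  by (simp add: lifts_def)

lemma pr_shift_2pi_add: "pr (shift (2 * pi * of_int m) + g) = pr g"
  using pr_eq_iff by blast

lemma pr_lifts:
  assumes "G \<subseteq> carrier HomeoS1" shows "pr ` lifts G = G"
proof
  show "G \<subseteq> pr ` lifts G"
  proof
    fix g assume g: "g \<in> G"
    then obtain f where "g = pr f" using assms pr_surj by blast
    then show "g \<in> pr ` lifts G" using g by auto
  qed
qed auto

lemma add_subgroupI:
  assumes "0 \<in> L" "\<And>a. a \<in> L \<Longrightarrow> - a \<in> L" "\<And>a b. a \<in> L \<Longrightarrow> b \<in> L \<Longrightarrow> a + b \<in> L"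
  shows "add_subgroup L"
  unfolding add_subgroup_def using assms(1) assms(3) [OF _ assms(2)] by simp

lemma add_subgroup_lifts:
  assumes "subgroup G HomeoS1" shows "add_subgroup (lifts G)"
proof (rule add_subgroupI)
  show "0 \<in> lifts G" using subgroup.one_closed [OF assms] by (simp add: HomeoS1_one)
next
  fix f assume "f \<in> lifts G"
  then have "inv\<^bsub>HomeoS1\<^esub> pr f \<in> G" using subgroup.m_inv_closed [OF assms] by simp
  then show "- f \<in> lifts G" by (simp add: pr_inv)
next
  fix f g assume "f \<in> lifts G" "g \<in> lifts G"
  then have "pr f \<otimes>\<^bsub>HomeoS1\<^esub> pr g \<in> G" using subgroup.m_closed [OF assms] by simp
  then show "f + g \<in> lifts G" by (simp add: pr_mult)
qed

lemma subgroup_pr_image: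
  assumes "add_subgroup L" shows "subgroup (pr ` L) HomeoS1"
proof -
  interpret group HomeoS1 by (rule group_HomeoS1)
  note L = add_subgroupD [OF assms]
  show ?thesis
  proof (rule subgroupI)
    show "pr ` L \<subseteq> carrier HomeoS1" by auto
    show "pr ` L \<noteq> {}" using L(1) by blast
    show "inv\<^bsub>HomeoS1\<^esub> a \<in> pr ` L" if a: "a \<in> pr ` L" for a
    proof -
      obtain f where "f \<in> L" "a = pr f" using a by blast
      then show ?thesis using L(2) by (simp add: pr_inv)
    qed
    show "a \<otimes>\<^bsub>HomeoS1\<^esub> b \<in> pr ` L" if ab: "a \<in> pr ` L" "b \<in> pr ` L" for a b
    proof -
      obtain f g where "f \<in> L" "a = pr f" "g \<in> L" "b = pr g" using ab by blast
      then show ?thesis using L(3) by (simp add: pr_mult)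
    qed
  qed
qed

lemma shift_in_lifts:
  assumes "subgroup G HomeoS1" shows "shift (2 * pi * of_int m) \<in> lifts G"
proof -
  have "pr (shift (2 * pi * of_int m)) = pr 0" using pr_shift_2pi_add [of m 0] by simp
  then show ?thesis using add_subgroupD(1) [OF add_subgroup_lifts [OF assms]] by simp
qed

lemma adjust_lift:
  assumes "pr f (cis x) = cis y"
  obtains f' where "pr f' = pr f" "ap f' x = y"
proof -
  have "cis (ap f x) = cis y" using assms by simp
  then obtain m :: int where m: "ap f x = y + 2 * pi * of_int m" using cis_eq_iff by blast
  show ?thesis
  proof
    show "pr (shift (2 * pi * of_int (- m)) + f) = pr f" by (rule pr_shift_2pi_add)
    show "ap (shift (2 * pi * of_int (- m)) + f) x = y" using m by simp
  qed
qed

lemma conj_HomeoS1_iff: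
  assumes "H \<subseteq> carrier HomeoS1"
  shows "conj_HomeoS1 G H \<longleftrightarrow> (\<exists>c. G = (\<lambda>h. pr (c + h - c)) ` lifts H)"
proof -
  have eq: "pr c <#\<^bsub>HomeoS1\<^esub> H #>\<^bsub>HomeoS1\<^esub> (inv\<^bsub>HomeoS1\<^esub> pr c) = (\<lambda>h. pr (c + h - c)) ` lifts H" for c
  proof -
    have "pr c <#\<^bsub>HomeoS1\<^esub> H #>\<^bsub>HomeoS1\<^esub> (inv\<^bsub>HomeoS1\<^esub> pr c)
        = (\<lambda>h. pr c \<otimes>\<^bsub>HomeoS1\<^esub> h \<otimes>\<^bsub>HomeoS1\<^esub> (inv\<^bsub>HomeoS1\<^esub> pr c)) ` H"
      unfolding l_coset_def r_coset_def by auto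
    also have "\<dots> = (\<lambda>h. pr c \<otimes>\<^bsub>HomeoS1\<^esub> h \<otimes>\<^bsub>HomeoS1\<^esub> (inv\<^bsub>HomeoS1\<^esub> pr c)) ` pr ` lifts H"
      by (simp only: pr_lifts [OF assms])
    also have "\<dots> = (\<lambda>h. pr (c + h - c)) ` lifts H"
      unfolding image_image by (simp only: pr_inv pr_mult minus_lift_def)
    finally show ?thesis .
  qed
  show ?thesis
  proof
    assume "conj_HomeoS1 G H"
    then obtain c where c: "c \<in> carrier HomeoS1" "G = c <#\<^bsub>HomeoS1\<^esub> H #>\<^bsub>HomeoS1\<^esub> (inv\<^bsub>HomeoS1\<^esub> c)"
      unfolding conj_HomeoS1_def by blast
    obtain c' where "c = pr c'" using pr_surj [OF c(1)] by blast
    then show "\<exists>c. G = (\<lambda>h. pr (c + h - c)) ` lifts H" using c(2) eq by blast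
  next
    assume "\<exists>c. G = (\<lambda>h. pr (c + h - c)) ` lifts H"
    then obtain c where "G = (\<lambda>h. pr (c + h - c)) ` lifts H" by blast
    then have "G = pr c <#\<^bsub>HomeoS1\<^esub> H #>\<^bsub>HomeoS1\<^esub> (inv\<^bsub>HomeoS1\<^esub> pr c)" unfolding eq .
    then show "conj_HomeoS1 G H" unfolding conj_HomeoS1_def using pr_in_HomeoS1 by blast
  qed
qed

lemma conj_HomeoS1I:
  assumes G: "G \<subseteq> carrier HomeoS1" and H: "H \<subseteq> carrier HomeoS1"
    and 1: "\<And>g. g \<in> lifts G \<Longrightarrow> pr (c + g - c) \<in> H"
    and 2: "\<And>h. h \<in> H \<Longrightarrow> \<exists>g\<in>lifts G. pr (c + g - c) = h"
  shows "conj_HomeoS1 G H"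
proof -
  have cancel: "- c + (c + g - c) - (- c) = g" for g
    by (rule lift_eqI) simp
  have "G = (\<lambda>h. pr (- c + h - (- c))) ` lifts H"
  proof
    show "G \<subseteq> (\<lambda>h. pr (- c + h - (- c))) ` lifts H"
    proof
      fix g' assume "g' \<in> G"
      then obtain g where g: "g \<in> lifts G" "g' = pr g" using pr_lifts [OF G] by blast
      have "c + g - c \<in> lifts H" using 1 [OF g(1)] by simp
      moreover have "g' = pr (- c + (c + g - c) - (- c))" unfolding cancel by (rule g(2))
      ultimately show "g' \<in> (\<lambda>h. pr (- c + h - (- c))) ` lifts H" by blast
    qed
    show "(\<lambda>h. pr (- c + h - (- c))) ` lifts H \<subseteq> G"
    proof clarify
      fix h assume "h \<in> lifts H"
      then obtain g where g: "g \<in> lifts G" "pr (c + g - c) = pr h" using 2 [of "pr h"] by auto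
      obtain m :: int where "h = shift (2 * pi * of_int m) + (c + g - c)" using g(2) pr_eq_iff by metis
      then have "- c + h - (- c) = shift (2 * pi * of_int m) + g" by (intro lift_eqI) simp
      then have "pr (- c + h - (- c)) = pr g" by (simp only: pr_shift_2pi_add)
      then show "pr (- c + h - (- c)) \<in> G" using g(1) by simp
    qed
  qed
  then show ?thesis unfolding conj_HomeoS1_iff [OF H] by blast
qed

section \<open>The connected part of the group of lifts and its origin in a path\<close>

definition component :: "lift set \<Rightarrow> lift set" where
  "component L = {h. \<exists>C\<subseteq>L. compact C \<and> connected C \<and> 0 \<in> C \<and> h \<in> C}"

text \<open>Being joined by a chain of mesh \<open>e\<close> is an equivalence relation with
  relatively open classes.\<close>

lemma connected_imp_well_chained:
  fixes C :: "'a::metric_space set"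
  assumes "connected C" "p \<in> C" "q \<in> C"
  shows "well_chained C p q"
  unfolding well_chained_def
proof (intro allI impI)
  fix e :: real assume e: "e > 0"
  show "(p, q) \<in> chain e C"
  proof (rule connected_equivalence_relation [OF assms, of "\<lambda>p q. (p, q) \<in> chain e C"])
    show "(y, x) \<in> chain e C" if "(x, y) \<in> chain e C" for x y
    proof -
      have "sym {(p, q). p \<in> C \<and> q \<in> C \<and> dist p q < e}" by (auto simp: sym_def dist_commute)
      then have "sym (chain e C)" unfolding chain_def by (rule sym_rtrancl)
      then show ?thesis using that by (rule symD)
    qed
    show "(x, z) \<in> chain e C" if "(x, y) \<in> chain e C" "(y, z) \<in> chain e C" for x y z
      using that unfolding chain_def by (rule rtrancl_trans)
    show "\<exists>T. openin (top_of_set C) T \<and> a \<in> T \<and> (\<forall>x\<in>T. (a, x) \<in> chain e C)" if "a \<in> C" for a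
      using that e by (intro exI [of _ "C \<inter> ball a e"]) (auto intro: chain_step [OF chain_refl])
  qed
qed

lemma componentI:
  "C \<subseteq> L \<Longrightarrow> compact C \<Longrightarrow> connected C \<Longrightarrow> 0 \<in> C \<Longrightarrow> h \<in> C \<Longrightarrow> h \<in> component L"
  unfolding component_def by blast

lemma component_subset: "component L \<subseteq> L"
  unfolding component_def by blast

lemma component_image:
  assumes h: "h \<in> component L" and \<Phi>: "continuous_on L \<Phi>" "\<Phi> 0 = 0" "\<And>g. g \<in> L \<Longrightarrow> \<Phi> g \<in> L'"
  shows "\<Phi> h \<in> component L'"
proof -
  obtain C where C: "C \<subseteq> L" "compact C" "connected C" "0 \<in> C" "h \<in> C" using h unfolding component_def by blast
  have cont: "continuous_on C \<Phi>" by (rule continuous_on_subset [OF \<Phi>(1) C(1)])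
  show ?thesis
  proof (rule componentI)
    show "\<Phi> ` C \<subseteq> L'" using C \<Phi> by blast
    show "0 \<in> \<Phi> ` C" using C \<Phi>(2) by (metis image_eqI)
  qed (use C cont in \<open>auto intro: compact_continuous_image connected_continuous_image\<close>)
qed

lemma component_add:
  assumes L: "add_subgroup L" and "a \<in> component L" "b \<in> component L"
  shows "a + b \<in> component L"
proof -
  obtain C where C: "C \<subseteq> L" "compact C" "connected C" "0 \<in> C" "a \<in> C" using assms unfolding component_def by blast
  obtain D where D: "D \<subseteq> L" "compact D" "connected D" "0 \<in> D" "b \<in> D" using assms unfolding component_def by blast
  let ?f = "\<lambda>(x, y). x + (y :: lift)"
  have cont: "continuous_on (C \<times> D) ?f" unfolding case_prod_unfold by (intro continuous_intros)
  show ?thesis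
  proof (rule componentI)
    show "?f ` (C \<times> D) \<subseteq> L" using C D add_subgroupD(3) [OF L] by auto
    show "compact (?f ` (C \<times> D))" by (intro compact_continuous_image cont compact_Times C D)
    show "connected (?f ` (C \<times> D))" by (intro connected_continuous_image cont connected_Times C D)
    show "0 \<in> ?f ` (C \<times> D)" using C D by force
    show "a + b \<in> ?f ` (C \<times> D)" using C D by force
  qed
qed

lemma cc_component:
  assumes L: "add_subgroup L" shows "cc (component L)"
  unfolding cc_def
proof (intro conjI ballI)
  show "add_subgroup (component L)"
  proof (rule add_subgroupI)
    show "0 \<in> component L" using add_subgroupD(1) [OF L] by (intro componentI [of "{0}"]) auto
    show "- a \<in> component L" if "a \<in> component L" for a
      by (rule component_image [OF that, of uminus]) (auto intro!: continuous_intros simp: add_subgroupD [OF L])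
  qed (rule component_add [OF L])
  fix a assume "a \<in> component L"
  then obtain C where C: "C \<subseteq> L" "compact C" "connected C" "0 \<in> C" "a \<in> C" unfolding component_def by blast
  have "C \<subseteq> component L" using componentI [OF C(1-4)] by (rule subsetI)
  moreover have "well_chained C 0 a" by (rule connected_imp_well_chained [OF C(3-5)])
  ultimately show "\<exists>C\<subseteq>component L. compact C \<and> 0 \<in> C \<and> a \<in> C \<and> well_chained C 0 a"
    using C by (intro exI [of _ C]) simp
qed

text \<open>A nontrivial \<open>h\<close> moves some point; its conjugates by the transitive group
  \<open>L\<close> move every point, so \<open>cc_transitive\<close> applies on the whole
  line.\<close>

lemma circle_group_component:
  assumes L: "add_subgroup L" and trans: "\<And>x y. \<exists>g\<in>L. ap g x = y" and h: "h \<in> component L" "h \<noteq> 0"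
  shows "circle_group L (component L)"
proof
  show norm: "g + a - g \<in> component L" if g: "g \<in> L" and a: "a \<in> component L" for g a
  proof (rule component_image [OF a, of "\<lambda>a. g + a - g"])
    show "continuous_on L (\<lambda>a. g + a - g)" by (intro continuous_intros)
  qed (use g add_subgroupD [OF L] in auto)
  show "\<exists>a\<in>component L. ap a x = y" for x y
  proof (rule cc_transitive [OF cc_component [OF L], of UNIV])
    show "\<exists>a\<in>component L. ap a z \<noteq> z" for z
    proof -
      obtain w where w: "ap h w \<noteq> w" using h(2) lift_eqI [of h 0] by auto
      obtain g where g: "g \<in> L" "ap g w = z" using trans by blast
      then have wz: "ap (- g) z = w" by (simp add: ap_uminus_eq_iff)
      have "ap (g + h - g) z = ap g (ap h w)" by (simp add: wz)
      then have "ap (g + h - g) z \<noteq> z" using w unfolding g(2) [symmetric] by simp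
      then show ?thesis using norm [OF g(1) h(1)] by blast
    qed
  qed auto
qed (use assms cc_component component_subset in auto)

lemma lifts_transitive:
  assumes G: "subgroup G HomeoS1" and "circle_transitive G"
  shows "\<exists>g\<in>lifts G. ap g x = y"
proof -
  obtain f where f: "f \<in> G" "f (cis x) = cis y" using assms(2) unfolding circle_transitive_def by (metis cis_in_S1)
  then obtain g where g: "f = pr g" using pr_surj subgroup.mem_carrier [OF G] by metis
  obtain g' where "pr g' = pr g" "ap g' x = y" using adjust_lift f g by metis
  then show ?thesis using f g by (intro bexI [of _ g']) auto
qed

lemma dist_cis: "(dist (cis a) (cis b))\<^sup>2 = 2 - 2 * cos (a - b)"
proof -
  have "(dist (cis a) (cis b))\<^sup>2 = (cos a - cos b)\<^sup>2 + (sin a - sin b)\<^sup>2"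
    by (simp only: dist_norm cmod_power2) simp
  also have "\<dots> = ((cos a)\<^sup>2 + (sin a)\<^sup>2) + ((cos b)\<^sup>2 + (sin b)\<^sup>2) - 2 * (cos a * cos b + sin a * sin b)"
    by (simp only: power2_diff) (simp add: algebra_simps)
  finally show ?thesis by (simp add: cos_diff)
qed

text \<open>Distance below 1 keeps the cosine of the displacement positive. Chosen small at 0, the
  displacement can therefore never reach \<open>pi / 2\<close> in absolute value.\<close>

lemma lift_near_identity:
  assumes near: "\<And>z. z \<in> S1 \<Longrightarrow> dist (pr f z) z < 1"
  obtains g where "pr g = pr f" "\<And>x. \<bar>ap g x - x\<bar> < pi / 2"
proof -
  have cos_pos: "cos (ap g x - x) > 0" if "pr g = pr f" for g x
  proof -
    have "dist (cis (ap g x)) (cis x) < 1" using near [of "cis x"] pr_cis [of g x] that by simp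
    then have "(dist (cis (ap g x)) (cis x))\<^sup>2 < 1\<^sup>2" by (intro power_strict_mono) auto
    then show ?thesis unfolding dist_cis by simp
  qed
  define u where "u = Arg (cis (ap f 0))"
  have "cis u = cis (ap f 0)" unfolding u_def by (rule S1_cis) simp
  then have "pr f (cis 0) = cis u" unfolding pr_cis ..
  then obtain g where g: "pr g = pr f" "ap g 0 = u" by (rule adjust_lift)
  have u: "\<bar>u\<bar> \<le> pi" using Arg_bounded [of "cis (ap f 0)"] unfolding u_def by linarith
  have "\<bar>u\<bar> < pi / 2"
  proof (rule ccontr)
    assume "\<not> ?thesis"
    then have "cos \<bar>u\<bar> \<le> cos (pi / 2)" using u by (intro cos_monotone_0_pi_le) auto
    then show False using cos_pos [OF g(1), of 0] g(2) by simp
  qed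
  have "\<bar>ap g x - x\<bar> < pi / 2" for x
  proof (rule ccontr)
    assume neg: "\<not> ?thesis"
    have "\<exists>y. \<bar>ap g y - y\<bar> = pi / 2"
    proof -
      have conn: "connected ((\<lambda>y. \<bar>ap g y - y\<bar>) ` closed_segment 0 x)"
        by (intro connected_continuous_image continuous_intros) auto
      have in_image: "\<bar>ap g 0 - 0\<bar> \<in> (\<lambda>y. \<bar>ap g y - y\<bar>) ` closed_segment 0 x"
        "\<bar>ap g x - x\<bar> \<in> (\<lambda>y. \<bar>ap g y - y\<bar>) ` closed_segment 0 x" by blast+
      have "pi / 2 \<in> (\<lambda>y. \<bar>ap g y - y\<bar>) ` closed_segment 0 x"
      proof (rule connectedD_interval [OF conn in_image])
        show "\<bar>ap g 0 - 0\<bar> \<le> pi / 2" using g(2) \<open>\<bar>u\<bar> < pi / 2\<close> by simp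
        show "pi / 2 \<le> \<bar>ap g x - x\<bar>" using neg by simp
      qed
      then obtain y where "pi / 2 = \<bar>ap g y - y\<bar>" "y \<in> closed_segment 0 x" by (rule imageE)
      then show ?thesis by (intro exI [of _ y]) linarith
    qed
    then obtain y where y: "\<bar>ap g y - y\<bar> = pi / 2" by blast
    have "cos (ap g y - y) = cos \<bar>ap g y - y\<bar>" by simp
    also have "\<dots> = 0" unfolding y by simp
    finally show False using cos_pos [OF g(1), of y] by simp
  qed
  then show ?thesis using that g by blast
qed

text \<open>Two lifts within \<open>pi / 2\<close> of the identity differ by at most
  \<open>pi\<close>, a range in which the chord determines the angle monotonically.\<close>

lemma lift_close:
  assumes e: "e > 0"
  obtains d where "d > 0" "\<And>f g. (\<And>x. \<bar>ap f x - x\<bar> < pi / 2) \<Longrightarrow> (\<And>x. \<bar>ap g x - x\<bar> < pi / 2) \<Longrightarrow>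
    (\<And>z. z \<in> S1 \<Longrightarrow> dist (pr f z) (pr g z) < d) \<Longrightarrow> dist f g \<le> e"
proof -
  define r where "r = min e pi"
  have r: "0 < r" "r \<le> pi" "r \<le> e" using e by (auto simp: r_def)
  have "cos r < cos 0" using r by (intro cos_monotone_0_pi) auto
  then have pos: "2 - 2 * cos r > 0" by simp
  show ?thesis
  proof
    \<comment> \<open>The length of the chord of angle \<open>r\<close> on the unit circle.\<close>
    show "sqrt (2 - 2 * cos r) > 0" using pos by simp
    fix f g assume f: "\<And>x. \<bar>ap f x - x\<bar> < pi / 2" and g: "\<And>x. \<bar>ap g x - x\<bar> < pi / 2"
      and fg: "\<And>z. z \<in> S1 \<Longrightarrow> dist (pr f z) (pr g z) < sqrt (2 - 2 * cos r)"
    show "dist f g \<le> e"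
    proof (rule lift_dist_leI, rule ccontr)
      fix x assume "\<not> \<bar>ap f x - ap g x\<bar> \<le> e"
      then have "r \<le> \<bar>ap f x - ap g x\<bar>" using r by linarith
      moreover have "\<bar>ap f x - ap g x\<bar> \<le> pi" using f [of x] g [of x] by linarith
      ultimately have "cos \<bar>ap f x - ap g x\<bar> \<le> cos r" using r by (intro cos_monotone_0_pi_le) auto
      then have "2 - 2 * cos r \<le> (dist (cis (ap f x)) (cis (ap g x)))\<^sup>2" unfolding dist_cis by simp
      also have "\<dots> < (sqrt (2 - 2 * cos r))\<^sup>2"
        using fg [of "cis x"] by (intro power_strict_mono) auto
      finally show False using pos by simp
    qed
  qed
qed

lemma homeo_dist_upper:
  assumes f: "f \<in> carrier HomeoS1" and g: "g \<in> carrier HomeoS1" and x: "x \<in> S1"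
  shows "dist (f x) (g x) \<le> homeo_dist f g"
proof -
  let ?m = "\<lambda>x. max (dist (f x) (g x)) (dist (inv_into S1 f x) (inv_into S1 g x))"
  have two: "dist a b \<le> 2" if "a \<in> S1" "b \<in> S1" for a b :: complex
    using that norm_triangle_ineq4 [of a b] by (simp add: dist_norm)
  have "bdd_above (?m ` S1)"
  proof (rule bdd_aboveI2)
    fix x :: complex assume "x \<in> S1"
    then have "dist (f x) (g x) \<le> 2" "dist (inv_into S1 f x) (inv_into S1 g x) \<le> 2"
      using carrier_HomeoS1_D(3,4) f g by (blast intro: two)+
    then show "?m x \<le> 2" by simp
  qed
  then have "?m x \<le> homeo_dist f g" unfolding homeo_dist_def using f g cSUP_upper [OF x, of ?m] by simp
  then show ?thesis by simp
qed

text \<open>Only a short piece of the path is lifted, around a time \<open>t0\<close> near which it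
  is not constant: there \<open>\<gamma> r\<close> composed with the inverse of
  \<open>\<gamma> t0\<close> is near the identity and has a distinguished lift, which depends
  continuously on \<open>r\<close>.\<close>

lemma nonconstant_path_component:
  assumes G: "subgroup G HomeoS1" and path: "has_nonconstant_path G"
  obtains h where "h \<in> component (lifts G)" "h \<noteq> 0"
proof -
  interpret M: Metric_space "carrier HomeoS1" homeo_dist by (rule Metric_space_HomeoS1)
  obtain \<gamma> s t where p: "pathin (subtopology HomeoS1_topology G) \<gamma>" and st: "s \<in> {0..1}" "t \<in> {0..1}" "\<gamma> s \<noteq> \<gamma> t"
    using path unfolding has_nonconstant_path_def by blast
  have cm: "continuous_map (top_of_set {0..1}) M.mtopology \<gamma>" and \<gamma>G: "\<gamma> r \<in> G" if "r \<in> {0..1}" for r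
    using p that unfolding pathin_def HomeoS1_topology_def continuous_map_in_subtopology by auto
  then have cm: "continuous_map (top_of_set {0..1}) M.mtopology \<gamma>" using st(1) by blast
  have \<gamma>C: "\<gamma> r \<in> carrier HomeoS1" if "r \<in> {0..1}" for r using \<gamma>G [OF that] subgroup.mem_carrier [OF G] by blast
  have cont: "\<exists>d>0. \<forall>v\<in>{0..1}. \<bar>v - r\<bar> < d \<longrightarrow> homeo_dist (\<gamma> r) (\<gamma> v) < e" if r: "r \<in> {0..1}" and e: "e > 0" for r e
  proof -
    obtain U where U: "openin (top_of_set {0..1}) U" "r \<in> U" "\<forall>v\<in>U. \<gamma> v \<in> M.mball (\<gamma> r) e"
      using cm r e unfolding M.continuous_map_to_metric by (metis topspace_euclidean_subtopology)
    obtain d where "d > 0" "ball r d \<inter> {0..1} \<subseteq> U"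
      using U(1,2) unfolding openin_contains_ball by metis
    moreover have "homeo_dist (\<gamma> r) (\<gamma> v) < e" if "v \<in> U" for v using U(3) that by simp
    ultimately show ?thesis
      by (intro exI [of _ d]) (force simp: dist_real_def abs_minus_commute)
  qed
  \<comment> \<open>A path that is locally constant at every time is constant, by connectedness of
    the interval.\<close>
  obtain t0 where t0: "t0 \<in> {0..1}" "\<And>d. d > 0 \<Longrightarrow> \<exists>v\<in>{0..1}. \<bar>v - t0\<bar> < d \<and> \<gamma> v \<noteq> \<gamma> t0"
  proof (rule ccontr)
    assume "\<not> thesis"
    then have loc: "\<exists>d>0. \<forall>v\<in>{0..1}. \<bar>v - r\<bar> < d \<longrightarrow> \<gamma> v = \<gamma> r" if "r \<in> {0..1}" for r
      using that \<open>\<And>t0. \<lbrakk>t0 \<in> {0..1}; \<And>d. d > 0 \<Longrightarrow> \<exists>v\<in>{0..1}. \<bar>v - t0\<bar> < d \<and> \<gamma> v \<noteq> \<gamma> t0\<rbrakk> \<Longrightarrow> thesis\<close> by blast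
    have "\<gamma> s = \<gamma> t"
    proof (rule connected_equivalence_relation [of "{0..1::real}" s t "\<lambda>x y. \<gamma> x = \<gamma> y"])
      show "\<exists>T. openin (top_of_set {0..1}) T \<and> a \<in> T \<and> (\<forall>x\<in>T. \<gamma> a = \<gamma> x)" if a: "a \<in> {0..1}" for a
      proof -
        obtain d where d: "d > 0" "\<forall>v\<in>{0..1}. \<bar>v - a\<bar> < d \<longrightarrow> \<gamma> v = \<gamma> a" using loc a by blast
        have "\<forall>x\<in>{0..1} \<inter> ball a d. \<gamma> a = \<gamma> x" using d(2) by (simp add: dist_real_def abs_minus_commute)
        moreover have "openin (top_of_set {0..1}) ({0..1} \<inter> ball a d)" by (rule openin_open_Int) simp
        ultimately show ?thesis using d(1) a by (intro exI [of _ "{0..1} \<inter> ball a d"]) simp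
      qed
    qed (use st in auto)
    then show False using st by simp
  qed
  obtain d where d: "d > 0" "\<forall>v\<in>{0..1}. \<bar>v - t0\<bar> < d \<longrightarrow> homeo_dist (\<gamma> t0) (\<gamma> v) < 1" using cont [OF t0(1), of 1] by auto
  obtain t1 where t1: "t1 \<in> {0..1}" "\<bar>t1 - t0\<bar> < d" "\<gamma> t1 \<noteq> \<gamma> t0" using t0(2) d(1) by blast
  define J where "J = closed_segment t0 t1"
  have J: "r \<in> {0..1}" "\<bar>r - t0\<bar> < d" if "r \<in> J" for r
    using that t0(1) t1(1,2) by (auto simp: J_def closed_segment_eq_real_ivl split: if_splits)
  obtain f where f: "\<And>r. r \<in> J \<Longrightarrow> \<gamma> r = pr (f r)"
  proof -
    have "\<exists>f. \<gamma> r = pr f" if "r \<in> J" for r using pr_surj [OF \<gamma>C [OF J(1) [OF that]]] by metis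
    then show thesis using that by metis
  qed
  have Jt: "t0 \<in> J" "t1 \<in> J" by (auto simp: J_def)
  have dist_f: "dist (pr (f r - f t0) z) (pr (f v - f t0) z) \<le> homeo_dist (\<gamma> r) (\<gamma> v)"
    if "r \<in> J" "v \<in> J" "z \<in> S1" for r v z
  proof -
    have w: "pr (- f t0) z \<in> S1" using that(3) by (rule pr_in_S1)
    have e: "pr (f r - f t0) z = pr (f r) (pr (- f t0) z)" for r
      unfolding minus_lift_def pr_add using that(3) by (simp only: compose_def restrict_apply if_True)
    show ?thesis
      unfolding e f [OF that(1), symmetric] f [OF that(2), symmetric]
      by (rule homeo_dist_upper [OF \<gamma>C [OF J(1)] \<gamma>C [OF J(1)] w]) fact+
  qed
  have "\<exists>g. pr g = pr (f r - f t0) \<and> (\<forall>x. \<bar>ap g x - x\<bar> < pi / 2)" if r: "r \<in> J" for r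
  proof -
    have "dist (pr (f r - f t0) z) z < 1" if z: "z \<in> S1" for z
    proof -
      have "dist (pr (f t0 - f t0) z) (pr (f r - f t0) z) \<le> homeo_dist (\<gamma> t0) (\<gamma> r)" by (rule dist_f [OF Jt(1) r z])
      also have "\<dots> < 1" using d(2) J [OF r] by blast
      finally show ?thesis using z by (simp add: pr_zero dist_commute)
    qed
    then show ?thesis using lift_near_identity by metis
  qed
  then obtain g where g: "\<And>r. r \<in> J \<Longrightarrow> pr (g r) = pr (f r - f t0)" "\<And>r x. r \<in> J \<Longrightarrow> \<bar>ap (g r) x - x\<bar> < pi / 2" by metis
  have gcont: "continuous_on J g"
    unfolding continuous_on_iff
  proof (intro ballI allI impI)
    fix r and e :: real assume r: "r \<in> J" and e: "e > 0"
    have e2: "e / 2 > 0" using e by simp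
    obtain \<delta> where \<delta>: "\<delta> > 0" "\<And>f g. (\<And>x. \<bar>ap f x - x\<bar> < pi / 2) \<Longrightarrow> (\<And>x. \<bar>ap g x - x\<bar> < pi / 2) \<Longrightarrow>
      (\<And>z. z \<in> S1 \<Longrightarrow> dist (pr f z) (pr g z) < \<delta>) \<Longrightarrow> dist f g \<le> e / 2" using lift_close [OF e2] by blast
    obtain d where d: "d > 0" "\<forall>v\<in>{0..1}. \<bar>v - r\<bar> < d \<longrightarrow> homeo_dist (\<gamma> r) (\<gamma> v) < \<delta>" using cont [OF J(1) [OF r] \<delta>(1)] by auto
    have "dist (g v) (g r) < e" if v: "v \<in> J" "dist v r < d" for v
    proof -
      have "dist (g r) (g v) \<le> e / 2"
      proof (rule \<delta>(2) [OF g(2) [OF r] g(2) [OF v(1)]])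
        show "dist (pr (g r) z) (pr (g v) z) < \<delta>" if z: "z \<in> S1" for z
        proof -
          have "homeo_dist (\<gamma> r) (\<gamma> v) < \<delta>" using d(2) J(1) [OF v(1)] v(2) by (simp add: dist_real_def)
          then show ?thesis using dist_f [OF r v(1) z] unfolding g(1) [OF r] g(1) [OF v(1)] by linarith
        qed
      qed
      then show ?thesis using e by (simp add: dist_commute)
    qed
    then show "\<exists>d>0. \<forall>x'\<in>J. dist x' r < d \<longrightarrow> dist (g x') (g r) < e" using d(1) by blast
  qed
  have g0: "g t0 = 0"
  proof -
    have "pr (g t0) = pr 0" using g(1) [OF Jt(1)] by simp
    then obtain m :: int where m: "g t0 = shift (2 * pi * of_int m) + 0" using pr_eq_iff by blast
    have "\<bar>2 * pi * of_int m\<bar> < pi / 2" using g(2) [OF Jt(1), of 0] unfolding m by simp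
    then have "pi * (2 * \<bar>of_int m\<bar>) < pi * (1 / 2)" by (simp add: abs_mult)
    then have "2 * \<bar>real_of_int m\<bar> < 1 / 2" by (simp only: mult_less_cancel_left_pos pi_gt_zero)
    then have "m = 0" by linarith
    then show ?thesis using m by (simp add: shift_0)
  qed
  have "g t1 \<noteq> 0"
  proof
    assume "g t1 = 0"
    then have "pr (f t1 - f t0) = pr 0" using g(1) [OF Jt(2)] by simp
    then obtain m :: int where "f t1 - f t0 = shift (2 * pi * of_int m) + 0" using pr_eq_iff by blast
    then have "f t1 = shift (2 * pi * of_int m) + f t0" by (simp add: diff_eq_eq)
    then have "pr (f t1) = pr (f t0)" by (simp only: pr_shift_2pi_add)
    then show False using t1(3) f Jt by simp
  qed
  moreover have "g t1 \<in> component (lifts G)"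
  proof (rule componentI [of "g ` J"])
    have L: "add_subgroup (lifts G)" by (rule add_subgroup_lifts [OF G])
    have fL: "f r \<in> lifts G" if "r \<in> J" for r using \<gamma>G [OF J(1) [OF that]] f [OF that] by simp
    show "g ` J \<subseteq> lifts G"
      using add_subgroupD(4) [OF L fL fL] Jt g(1) by auto
    show "compact (g ` J)" "connected (g ` J)"
      using compact_continuous_image [OF gcont] connected_continuous_image [OF gcont] by (simp_all add: J_def)
    show "0 \<in> g ` J" using g0 Jt by (metis image_eqI)
  qed (use Jt in blast)
  ultimately show ?thesis using that by blast
qed

lemma SO2R_eq: "SO2R = range (\<lambda>s. pr (shift s))"
proof -
  have e: "pr (shift s) = (\<lambda>z\<in>S1. cis s * z)" for s
    by (rule S1_funI) (simp_all add: pr_extensional cis_mult add.commute)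
  have "\<exists>s. u = cis s" if "u \<in> S1" for u using S1_cis [OF that] by metis
  then show ?thesis unfolding SO2R_def e by (force simp del: mem_sphere_0)
qed

lemma SO2R_subset: "SO2R \<subseteq> carrier HomeoS1"
  unfolding SO2R_eq by auto

lemma PSL2R_subset: "PSL2R \<subseteq> carrier HomeoS1"
proof
  fix g assume "g \<in> PSL2R"
  then obtain p q where "cmod q < cmod p" "g = (\<lambda>z\<in>S1. mob p q z)" using PSL2R_is_mob by blast
  then show "g \<in> carrier HomeoS1" using mob_lift pr_in_HomeoS1 by metis
qed

lemma sorted_angles:
  assumes X: "finite X" "X \<subseteq> S1" "X \<noteq> {}"
  obtains n x where "cyc n x" "X \<subseteq> range (\<lambda>i. cis (x i))"
proof -
  define n where "n = card X"
  define as where "as = sorted_list_of_set (Arg ` X)"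
  have as: "sorted as" "distinct as" "set as = Arg ` X" using X(1) by (simp_all add: as_def)
  have len: "length as = card (Arg ` X)" using X(1) by (simp add: as_def)
  have "inj_on Arg X" using S1_cis X(2) by (metis inj_onI subsetD)
  then have len: "length as = n" unfolding len n_def by (rule card_image)
  have n: "n \<ge> 1" using X by (simp add: n_def Suc_le_eq card_gt_0_iff)
  have sw: "sorted_wrt (<) as" using as by (simp add: strict_sorted_iff)
  have bd: "- pi < as ! j" "as ! j \<le> pi" if "j < n" for j
  proof -
    have "as ! j \<in> Arg ` X" using that len as(3) nth_mem by metis
    then show "- pi < as ! j" "as ! j \<le> pi" using Arg_bounded by auto
  qed
  have "cyc n (cyc_of n (\<lambda>j. as ! j))"
  proof (rule cyc_cyc_of [OF n])
    show "as ! j < as ! Suc j" if "Suc j < n" for j using sw that len by (simp add: sorted_wrt_iff_nth_less)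
    show "as ! (n - 1) < as ! 0 + 2 * pi" using bd [of "n - 1"] bd [of 0] n by simp
  qed
  moreover have "X \<subseteq> range (\<lambda>i. cis (cyc_of n (\<lambda>j. as ! j) i))"
  proof
    fix z assume z: "z \<in> X"
    then have "Arg z \<in> set as" using as by simp
    then obtain j where j: "j < n" "as ! j = Arg z" using len by (metis in_set_conv_nth)
    then have "cis (cyc_of n (\<lambda>j. as ! j) (int j)) = z" using z X(2) S1_cis by (auto simp: cyc_of_value)
    then show "z \<in> range (\<lambda>i. cis (cyc_of n (\<lambda>j. as ! j) i))" by (metis rangeI)
  qed
  ultimately show ?thesis using that by blast
qed

theorem primitive_alternative:
  assumes G: "subgroup G HomeoS1" and P: "primitive_group (lifts G) A"
  shows "conj_HomeoS1 G PSL2R \<or> interpolates_HomeoS1 G"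
proof -
  interpret primitive_group "lifts G" A by fact
  consider "\<forall>n\<ge>1. tuple_transitive n"
    | "tuple_transitive 3" "\<forall>x. affine_action (stab A x) {x<..<x+2*pi}"
    using transitive_on_tuples_or_sharp by blast
  then show ?thesis
  proof cases
    case 1
    have "\<exists>g\<in>G. \<forall>x\<in>X. g x = h x" if h: "h \<in> carrier HomeoS1" and X: "finite X" "X \<subseteq> S1" for h X
    proof (cases "X = {}")
      case True
      then show ?thesis using subgroup.one_closed [OF G] by blast
    next
      case False
      obtain f where f: "h = pr f" using pr_surj [OF h] by blast
      obtain n x where x: "cyc n x" "X \<subseteq> range (\<lambda>i. cis (x i))" using sorted_angles [OF X False] by blast
      obtain a where a: "a \<in> A" "\<forall>i. ap a (x i) = ap f (x i)"
        using 1 cyc_pos [OF x(1)] x(1) cyc_image [OF x(1), of f] unfolding tuple_transitive_def by blast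
      have "pr a \<in> G" using a(1) A_subset by auto
      moreover have "pr a z = h z" if z: "z \<in> X" for z
      proof -
        obtain i where "z = cis (x i)" using subsetD [OF x(2) z] by (auto simp: image_iff)
        then show ?thesis using a(2) f by simp
      qed
      ultimately show ?thesis by blast
    qed
    then show ?thesis unfolding interpolates_HomeoS1_def by blast
  next
    case 2
    have aff: "affine_action (stab A (- pi)) {-pi<..<pi}" using 2(2) [rule_format, of "- pi"] by simp
    interpret sharp_group "lifts G" A
    proof (intro sharp_group.intro sharp_group_axioms.intro)
      show "shift (2 * pi * of_int m) \<in> lifts G" for m by (rule shift_in_lifts [OF G])
    qed (fact P 2(1) aff)+
    obtain c where c: "\<And>g. g \<in> lifts G \<Longrightarrow> pr (c + g - c) \<in> PSL2R"
      "\<And>h. h \<in> PSL2R \<Longrightarrow> \<exists>g\<in>lifts G. pr (c + g - c) = h" using conj_PSL2R by blast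
    have "conj_HomeoS1 G PSL2R"
      by (rule conj_HomeoS1I [OF subgroup.subset [OF G] PSL2R_subset c])
    then show ?thesis by blast
  qed
qed

section \<open>Cyclic covers\<close>

lemma nmul_shift: "nmul n (shift s) = shift (real n * s)"
  by (induction n) (simp_all add: shift_0 shift_add algebra_simps)

lemma conj_nmul: "nmul n (c + g - c) = c + nmul n g - (c :: lift)"
proof (induction n)
  case 0
  show ?case by (rule lift_eqI) simp
qed (simp only: nmul.simps conj_add)

lemma nmul_deck_add: "nmul n (shift (2 * pi * of_int m) + f) = shift (2 * pi * of_int (m * int n)) + nmul n f"
proof (rule lift_eqI)
  fix x
  show "ap (nmul n (shift (2 * pi * of_int m) + f)) x = ap (shift (2 * pi * of_int (m * int n)) + nmul n f) x"
  proof (induction n)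
    case (Suc n)
    have "ap (nmul (Suc n) (shift (2 * pi * of_int m) + f)) x
        = ap f (ap (nmul n f) x + 2 * pi * of_int (m * int n)) + 2 * pi * of_int m"
      using Suc by simp
    also have "\<dots> = ap f (ap (nmul n f) x) + 2 * pi * of_int (m * int n) + 2 * pi * of_int m"
      by (simp only: ap_add_int)
    finally show ?case by (simp add: algebra_simps)
  qed simp
qed

text \<open>The lifted covering map is \<open>qq\<close>; \<open>root\<close> lifts the generator of its deck group.\<close>

locale cover =
  fixes k :: nat and c :: lift and G :: "(complex \<Rightarrow> complex) set"
  assumes subgroup_G: "subgroup G HomeoS1" and k: "k > 0"
    and root_commute': "g \<in> lifts G \<Longrightarrow> (- c + shift (2 * pi / real k) + c) + g = g + (- c + shift (2 * pi / real k) + c)"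
begin

definition root :: lift where "root = - c + shift (2 * pi / real k) + c"

definition qq :: "real \<Rightarrow> real" where "qq x = real k * ap c x"

text \<open>This is \<open>qq\<close> after \<open>g\<close> after the inverse of \<open>qq\<close>.
  It has degree one because \<open>g\<close> commutes with \<open>root\<close>, which
  \<open>qq\<close> turns into a full turn.\<close>

definition push :: "lift \<Rightarrow> lift" where
  "push g = Lift (\<lambda>y. qq (ap g (ap (- c) (y / real k))))"

definition base :: "(complex \<Rightarrow> complex) set" where
  "base = (\<lambda>g. pr (push g)) ` lifts G"

lemmas L = add_subgroupD [OF add_subgroup_lifts [OF subgroup_G]]

lemma root_commute: "g \<in> lifts G \<Longrightarrow> ap root (ap g x) = ap g (ap root x)"
proof -
  assume "g \<in> lifts G"
  then have "ap (root + g) x = ap (g + root) x" using root_commute' unfolding root_def by simp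
  then show ?thesis by simp
qed

lemma ap_c_root: "ap c (ap root x) = ap c x + 2 * pi / real k"
  by (simp add: root_def)

lemma root_greater: "x < ap root x"
proof -
  have "ap c x < ap c (ap root x)" unfolding ap_c_root using k by simp
  then show ?thesis by simp
qed

lemma qq_less [simp]: "qq x < qq y \<longleftrightarrow> x < y"
  using k by (simp add: qq_def)

lemma qq_eq [simp]: "qq x = qq y \<longleftrightarrow> x = y"
  using k by (simp add: qq_def)

lemma qq_inverse [simp]: "qq (ap (- c) (y / real k)) = y"
  using k by (simp add: qq_def)

lemma qq_surj: obtains x where "y = qq x"
  using qq_inverse [of y] by metis

lemma qq_root: "qq (ap root x) = qq x + 2 * pi"
proof -
  have "real k * (2 * pi / real k) = 2 * pi" using k by simp
  then show ?thesis unfolding qq_def ap_c_root distrib_left by (simp only:)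
qed

lemma qq_add_int: "qq (x + 2 * pi * of_int m) = qq x + 2 * pi * of_int (int k * m)"
  unfolding qq_def ap_add_int by (simp add: algebra_simps)

lemma continuous_on_qq: "continuous_on S qq"
  unfolding qq_def by (intro continuous_intros)

lemma ap_push:
  assumes g: "g \<in> lifts G" shows "ap (push g) (qq x) = qq (ap g x)"
proof -
  let ?F = "\<lambda>y. qq (ap g (ap (- c) (y / real k)))"
  have "strict_mono ?F" using k by (simp add: strict_mono_def divide_strict_right_mono)
  moreover have "continuous_on UNIV ?F"
    unfolding qq_def by (intro continuous_intros) (use k in auto)
  moreover have "?F (y + 2 * pi) = ?F y + 2 * pi" for y
  proof -
    obtain x where x: "y = qq x" by (rule qq_surj)
    have inv: "ap (- c) (qq z / real k) = z" for z using qq_inverse [of "qq z"] by (simp only: qq_eq)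
    have "?F (y + 2 * pi) = qq (ap g (ap root x))" unfolding x qq_root [symmetric] inv ..
    also have "\<dots> = ?F y + 2 * pi" unfolding root_commute [OF g, symmetric] qq_root x inv ..
    finally show ?thesis .
  qed
  ultimately have "ap (push g) = ?F" unfolding push_def by (rule ap_Lift)
  then have "ap (push g) (qq x) = ?F (qq x)" by simp
  moreover have "ap (- c) (qq x / real k) = x" using qq_inverse [of "qq x"] by (simp only: qq_eq)
  ultimately show ?thesis by simp
qed

lemma qq_lift_eqI: "(\<And>x. ap f (qq x) = ap g (qq x)) \<Longrightarrow> f = g"
  by (rule lift_eqI) (metis qq_surj)

lemma push_add: "f \<in> lifts G \<Longrightarrow> g \<in> lifts G \<Longrightarrow> push (f + g) = push f + push g"
  using L(3) [of f g] by (intro qq_lift_eqI) (simp add: ap_push del: mem_lifts)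

lemma push_0 [simp]: "push 0 = 0"
  using L(1) by (intro qq_lift_eqI) (simp add: ap_push del: mem_lifts)

lemma push_uminus: "f \<in> lifts G \<Longrightarrow> push (- f) = - push f"
proof -
  assume f: "f \<in> lifts G"
  have "push f + push (- f) = 0" using push_add [OF f L(2) [OF f]] by simp
  then show ?thesis by (simp add: minus_unique)
qed

lemma push_nmul: "f \<in> lifts G \<Longrightarrow> nmul n f \<in> lifts G \<and> push (nmul n f) = nmul n (push f)"
  by (induction n) (use L push_add in \<open>auto simp del: mem_lifts\<close>)

lemma push_deck: "push (shift (2 * pi * of_int m)) = shift (2 * pi * of_int (int k * m))"
  using shift_in_lifts [OF subgroup_G, of m]
  by (intro qq_lift_eqI) (simp only: ap_push ap_shift qq_add_int)

lemma push_eq_iff: "f \<in> lifts G \<Longrightarrow> g \<in> lifts G \<Longrightarrow> push f = push g \<longleftrightarrow> f = g"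
  by (metis ap_push qq_eq lift_eqI)

lemma subgroup_base: "subgroup base HomeoS1"
proof -
  have "add_subgroup (push ` lifts G)"
  proof (rule add_subgroupI)
    show "0 \<in> push ` lifts G" using L(1) push_0 by (metis image_eqI)
    show "- a \<in> push ` lifts G" if a: "a \<in> push ` lifts G" for a
    proof -
      obtain f where "f \<in> lifts G" "a = push f" using a by blast
      then show ?thesis using L(2) push_uminus by (metis image_eqI)
    qed
    show "a + b \<in> push ` lifts G" if ab: "a \<in> push ` lifts G" "b \<in> push ` lifts G" for a b
    proof -
      obtain f g where "f \<in> lifts G" "a = push f" "g \<in> lifts G" "b = push g" using ab by blast
      then show ?thesis using L(3) push_add by (metis image_eqI)
    qed
  qed
  then have "subgroup (pr ` push ` lifts G) HomeoS1" by (rule subgroup_pr_image)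
  then show ?thesis unfolding base_def image_image .
qed

lemma push_in_base: "g \<in> lifts G \<Longrightarrow> push g \<in> lifts base"
  by (auto simp: base_def)

lemma lifts_baseE:
  assumes "f \<in> lifts base"
  obtains m :: int and g where "g \<in> lifts G" "f = shift (2 * pi * of_int m) + push g"
proof -
  have "pr f \<in> base" using assms by simp
  then obtain g where g: "g \<in> lifts G" "pr f = pr (push g)" unfolding base_def by blast
  then obtain m :: int where "f = shift (2 * pi * of_int m) + push g" using pr_eq_iff by blast
  then show ?thesis using that g by blast
qed

lemma continuous_on_push: "continuous_on (lifts G) push"
  unfolding continuous_on_iff
proof (intro ballI allI impI)
  fix g and e :: real assume g: "g \<in> lifts G" and e: "e > 0"
  have "continuous_on (lifts G) (\<lambda>h. c + h)" by (intro continuous_intros)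
  moreover have "e / (2 * real k) > 0" using e k by simp
  ultimately obtain d where d: "d > 0" "\<And>h. h \<in> lifts G \<Longrightarrow> dist h g < d \<Longrightarrow> dist (c + h) (c + g) < e / (2 * real k)"
    using g unfolding continuous_on_iff by meson
  have "dist (push h) (push g) < e" if h: "h \<in> lifts G" "dist h g < d" for h
  proof -
    have "dist (push h) (push g) \<le> e / 2"
    proof (rule lift_dist_leI)
      fix y
      obtain x where x: "y = qq x" by (rule qq_surj)
      have "\<bar>ap (push h) y - ap (push g) y\<bar> = real k * \<bar>ap (c + h) x - ap (c + g) x\<bar>"
        unfolding x ap_push [OF h(1)] ap_push [OF g] by (simp add: qq_def abs_mult flip: right_diff_distrib)
      also have "\<dots> \<le> real k * (e / (2 * real k))"
        using abs_ap_diff_le_dist [of "c + h" x "c + g"] d(2) [OF h] by (intro mult_left_mono) auto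
      also have "\<dots> = e / 2" using k by simp
      finally show "\<bar>ap (push h) y - ap (push g) y\<bar> \<le> e / 2" .
    qed
    then show ?thesis using e by linarith
  qed
  then show "\<exists>d>0. \<forall>x'\<in>lifts G. dist x' g < d \<longrightarrow> dist (push x') (push g) < e" using d(1) by blast
qed

lemma cis_qq_cong: "cis x = cis y \<Longrightarrow> cis (qq x) = cis (qq y)"
  using qq_add_int by (metis cis_eq_iff)

lemma cis_qq_ap: "g \<in> lifts G \<Longrightarrow> cis (qq (ap g x)) = cis (qq (ap g y)) \<longleftrightarrow> cis (qq x) = cis (qq y)"
proof -
  have *: "cis (qq (ap g x)) = cis (qq (ap g y))" if g: "g \<in> lifts G" and e: "cis (qq x) = cis (qq y)" for g x y
  proof -
    have "pr (push g) (cis (qq x)) = pr (push g) (cis (qq y))" unfolding e ..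
    then show ?thesis by (simp add: ap_push [OF g])
  qed
  assume g: "g \<in> lifts G"
  show ?thesis
  proof
    assume "cis (qq (ap g x)) = cis (qq (ap g y))"
    from * [OF L(2) [OF g] this] show "cis (qq x) = cis (qq y)" by (simp only: ap_uminus_ap)
  qed (rule * [OF g])
qed

definition fibre :: "real \<Rightarrow> complex set" where
  "fibre t = cis ` {y. cis (qq y) = cis (qq t)}"

lemma fibre_eq_iff: "fibre s = fibre t \<longleftrightarrow> cis (qq s) = cis (qq t)"
proof
  assume "fibre s = fibre t"
  moreover have "cis s \<in> fibre s" by (simp add: fibre_def)
  ultimately have "cis s \<in> fibre t" by simp
  then obtain y where "cis s = cis y" "cis (qq y) = cis (qq t)" by (auto simp: fibre_def)
  then show "cis (qq s) = cis (qq t)" using cis_qq_cong by metis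
qed (simp add: fibre_def)

lemma image_fibre:
  assumes g: "g \<in> lifts G" shows "pr g ` fibre t = fibre (ap g t)"
proof
  show "pr g ` fibre t \<subseteq> fibre (ap g t)"
    using cis_qq_ap [OF g] by (auto simp: fibre_def simp del: mem_lifts)
  show "fibre (ap g t) \<subseteq> pr g ` fibre t"
  proof
    fix z assume "z \<in> fibre (ap g t)"
    then obtain y where y: "z = cis y" "cis (qq y) = cis (qq (ap g t))" by (auto simp: fibre_def)
    have "cis (qq (ap (- g) y)) = cis (qq t)" using cis_qq_ap [OF L(2) [OF g], of y "ap g t"] y(2) by simp
    then have "cis (ap (- g) y) \<in> fibre t" by (auto simp: fibre_def)
    moreover have "z = pr g (cis (ap (- g) y))" using y(1) by simp
    ultimately show "z \<in> pr g ` fibre t" by blast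
  qed
qed

lemma induced_eq_base:
  "{h \<in> carrier HomeoS1. \<exists>f\<in>lifts G. \<forall>t. h (cis (qq t)) = cis (qq (ap f t))} = base"
proof (intro equalityI subsetI)
  fix h assume "h \<in> {h \<in> carrier HomeoS1. \<exists>f\<in>lifts G. \<forall>t. h (cis (qq t)) = cis (qq (ap f t))}"
  then obtain f where h: "h \<in> carrier HomeoS1" and f: "f \<in> lifts G" "\<And>t. h (cis (qq t)) = cis (qq (ap f t))" by blast
  have "h = pr (push f)"
  proof (rule S1_funI [OF carrier_HomeoS1_D(1) [OF h] pr_extensional])
    fix t
    obtain x where x: "t = qq x" by (rule qq_surj)
    show "h (cis t) = pr (push f) (cis t)" unfolding x f(2) pr_cis ap_push [OF f(1)] ..
  qed
  then show "h \<in> base" using f(1) unfolding base_def by blast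
next
  fix h assume "h \<in> base"
  then obtain f where f: "f \<in> lifts G" "h = pr (push f)" unfolding base_def by blast
  have "\<forall>t. h (cis (qq t)) = cis (qq (ap f t))" unfolding f(2) pr_cis ap_push [OF f(1)] by blast
  then show "h \<in> {h \<in> carrier HomeoS1. \<exists>f\<in>lifts G. \<forall>t. h (cis (qq t)) = cis (qq (ap f t))}"
    using f by auto
qed

end

section \<open>Orbits of a conjugated rotation and the quotient circle\<close>

lemma conj_shift_power:
  "pr (c + shift s - c) [^]\<^bsub>HomeoS1\<^esub> (i::int) = pr (c + shift (of_int i * s) - c)"
proof -
  interpret group HomeoS1 by (rule group_HomeoS1)
  have n: "pr (c + shift s - c) [^]\<^bsub>HomeoS1\<^esub> (n::nat) = pr (c + shift (real n * s) - c)" for n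
  proof (induction n)
    case 0
    show ?case by (simp add: shift_0 HomeoS1_one)
  next
    case (Suc n)
    have "real (Suc n) * s = real n * s + s" by (simp add: algebra_simps)
    then have "shift (real (Suc n) * s) = shift (real n * s) + shift s" by (simp only: shift_add)
    then show ?case by (simp only: nat_pow_Suc Suc pr_mult conj_add)
  qed
  show ?thesis
  proof (cases i)
    case (nonneg n)
    then show ?thesis by (simp add: int_pow_int n)
  next
    case (neg n)
    have "pr (c + shift s - c) [^]\<^bsub>HomeoS1\<^esub> i = inv\<^bsub>HomeoS1\<^esub> (pr (c + shift s - c) [^]\<^bsub>HomeoS1\<^esub> (Suc n))"
      unfolding neg by (simp only: int_pow_neg int_pow_int pr_in_HomeoS1)
    also have "\<dots> = pr (c + shift (of_int i * s) - c)"
    proof -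
      have "- (real (Suc n) * s) = of_int i * s" by (simp add: neg algebra_simps)
      then show ?thesis unfolding n pr_inv conj_uminus shift_uminus by (simp only:)
    qed
    finally show ?thesis .
  qed
qed

lemma pr_shift: "pr (shift s) = (\<lambda>z\<in>S1. cis s * z)"
  by (rule S1_funI) (simp_all add: pr_extensional cis_mult add.commute)

lemma ord_rotation:
  "group.ord HomeoS1 (pr (shift s)) = k \<longleftrightarrow> (\<forall>n::nat. (\<exists>m::int. real n * s = 2 * pi * of_int m) \<longleftrightarrow> k dvd n)"
proof -
  interpret group HomeoS1 by (rule group_HomeoS1)
  have "pr (shift s) [^]\<^bsub>HomeoS1\<^esub> n = \<one>\<^bsub>HomeoS1\<^esub> \<longleftrightarrow> (\<exists>m::int. real n * s = 2 * pi * of_int m)" for n :: nat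
  proof -
    have "pr (shift s) [^]\<^bsub>HomeoS1\<^esub> n = pr (shift (real n * s))"
      using conj_shift_power [of 0 s "int n"] by (simp add: int_pow_int)
    moreover have "pr (shift (real n * s)) = pr 0 \<longleftrightarrow> (\<exists>m::int. real n * s = 2 * pi * of_int m)"
    proof
      assume "pr (shift (real n * s)) = pr 0"
      then have "cis (ap (shift (real n * s)) 0) = cis (ap 0 0)" by (metis pr_cis)
      then show "\<exists>m::int. real n * s = 2 * pi * of_int m" unfolding cis_eq_iff by simp
    next
      assume "\<exists>m::int. real n * s = 2 * pi * of_int m"
      then obtain m :: int where "real n * s = 2 * pi * of_int m" by blast
      then show "pr (shift (real n * s)) = pr 0" using pr_shift_2pi_add [of m 0] by simp
    qed
    ultimately show ?thesis by (simp add: HomeoS1_one)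
  qed
  then show ?thesis using ord_unique [OF pr_in_HomeoS1] by simp
qed

text \<open>Exact order \<open>k\<close> makes \<open>s\<close> the fraction \<open>M / k\<close> of
  a turn with \<open>M\<close> prime to \<open>k\<close>; a Bezout identity then expresses every
  \<open>j / k\<close> through multiples of \<open>s\<close> and full turns.\<close>

lemma rotation_angles:
  assumes k: "k > 0" and ord: "\<And>n::nat. (\<exists>m::int. real n * s = 2 * pi * of_int m) \<longleftrightarrow> k dvd n"
  shows "\<exists>j::int. of_int i * s = 2 * pi * of_int j / real k"
    and "\<exists>i m::int. 2 * pi * of_int j / real k = of_int i * s + 2 * pi * of_int m"
proof -
  obtain M :: int where M: "real k * s = 2 * pi * of_int M" using iffD2 [OF ord dvd_refl] by blast
  have s: "s = 2 * pi * of_int M / real k" using M k by (simp add: field_simps)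
  show "\<exists>j::int. of_int i * s = 2 * pi * of_int j / real k"
    by (rule exI [of _ "i * M"]) (simp add: s)
  define d where "d = gcd (int k) M"
  have d: "d > 0" using k by (simp add: d_def)
  obtain k' M' where k': "int k = d * k'" "M = d * M'" unfolding d_def by (metis dvdE gcd_dvd1 gcd_dvd2)
  have k'pos: "k' > 0" using k'(1) k d by (metis of_nat_0_less_iff zero_less_mult_pos)
  have rk: "real k = of_int d * of_int k'" using k'(1) by (metis of_int_mult of_int_of_nat_eq)
  have "real (nat k') * s = of_int k' * (2 * pi * (of_int d * of_int M') / (of_int d * of_int k'))"
    unfolding s rk k'(2) using k'pos by simp
  also have "\<dots> = 2 * pi * of_int M'" using d k'pos by (simp add: field_simps)
  finally have "k dvd nat k'" using ord [of "nat k'"] by blast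
  then have "k \<le> nat k'" using k'pos by (intro dvd_imp_le) auto
  then have "int k \<le> k'" using k'pos by linarith
  then have "d * k' \<le> 1 * k'" using k'(1) by simp
  then have "d = 1" using d k'pos by (simp add: mult_le_cancel_right_pos)
  then obtain u v where uv: "u * int k + v * M = 1" using bezout_int [of "int k" M] by (auto simp: d_def)
  show "\<exists>i m::int. 2 * pi * of_int j / real k = of_int i * s + 2 * pi * of_int m"
  proof (intro exI)
    have "real_of_int (u * int k + v * M) = 1" unfolding uv by simp
    then have "of_int u * real k + of_int v * of_int M = (1::real)" by simp
    then have "2 * pi * of_int j / real k = 2 * pi * of_int j * (of_int u * real k + of_int v * of_int M) / real k" by simp
    also have "\<dots> = of_int (j * v) * s + 2 * pi * of_int (j * u)" using k by (simp add: s field_simps)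
    finally show "2 * pi * of_int j / real k = of_int (j * v) * s + 2 * pi * of_int (j * u)" .
  qed
qed

lemma circle_orbit_rotation:
  assumes k: "k > 0" and ord: "group.ord HomeoS1 (pr (shift s)) = k"
  shows "circle_orbit (generate HomeoS1 {pr (- c + shift s - (- c))}) (cis t)
    = cis ` {y. cis (real k * ap c y) = cis (real k * ap c t)}"
proof -
  interpret group HomeoS1 by (rule group_HomeoS1)
  have o: "(\<exists>m::int. real n * s = 2 * pi * of_int m) \<longleftrightarrow> k dvd n" for n using ord unfolding ord_rotation by blast
  note angles = rotation_angles [OF k o]
  have "circle_orbit (generate HomeoS1 {pr (- c + shift s - (- c))}) (cis t)
      = {pr (- c + shift (of_int i * s) - (- c)) (cis t) | i::int. True}"
  proof -
    have "carrier (HomeoS1\<lparr>carrier := \<Gamma>\<rparr>) = \<Gamma>" for \<Gamma> by simp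
    moreover have "{g (cis t) |g. g \<in> {F i |i. i \<in> UNIV}} = {F i (cis t) |i. True}" for F :: "int \<Rightarrow> complex \<Rightarrow> complex"
      by auto
    ultimately show ?thesis unfolding orbit_def generate_pow [OF pr_in_HomeoS1] conj_shift_power by (simp only:)
  qed
  also have "\<dots> = {cis (ap (- c) (ap c t + of_int i * s)) | i::int. True}" by simp
  also have "\<dots> = cis ` {y. cis (real k * ap c y) = cis (real k * ap c t)}"
  proof (intro equalityI subsetI)
    fix z assume "z \<in> {cis (ap (- c) (ap c t + of_int i * s)) | i::int. True}"
    then obtain i :: int where i: "z = cis (ap (- c) (ap c t + of_int i * s))" by blast
    obtain j :: int where j: "of_int i * s = 2 * pi * of_int j / real k" using angles(1) by blast
    have "real k * (ap c t + of_int i * s) = real k * ap c t + 2 * pi * of_int j" unfolding j using k by (simp add: field_simps)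
    then have "cis (real k * (ap c t + of_int i * s)) = cis (real k * ap c t)" using cis_eq_iff by blast
    then show "z \<in> cis ` {y. cis (real k * ap c y) = cis (real k * ap c t)}" unfolding i by (intro imageI) simp
  next
    fix z assume "z \<in> cis ` {y. cis (real k * ap c y) = cis (real k * ap c t)}"
    then obtain y where y: "z = cis y" "cis (real k * ap c y) = cis (real k * ap c t)" by blast
    then obtain j :: int where "real k * ap c y = real k * ap c t + 2 * pi * of_int j" using cis_eq_iff by blast
    then have cy: "ap c y = ap c t + 2 * pi * of_int j / real k" using k by (simp add: field_simps)
    obtain i m :: int where im: "2 * pi * of_int j / real k = of_int i * s + 2 * pi * of_int m" using angles(2) by blast
    have "ap c y = (ap c t + of_int i * s) + 2 * pi * of_int m" unfolding cy im by simp
    then have "ap (- c) (ap c y) = ap (- c) ((ap c t + of_int i * s) + 2 * pi * of_int m)" by (rule arg_cong)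
    then have "y = ap (- c) (ap c t + of_int i * s) + 2 * pi * of_int m" unfolding ap_add_int ap_uminus_ap .
    then have "z = cis (ap (- c) (ap c t + of_int i * s))" using y(1) cis_eq_iff by blast
    then show "z \<in> {cis (ap (- c) (ap c t + of_int i * s)) | i::int. True}" by blast
  qed
  finally show ?thesis .
qed

lemma S1_range_cis: "S1 = range cis"
proof (intro equalityI subsetI)
  fix z :: complex assume "z \<in> S1"
  then have "z = cis (Arg z)" by (simp only: S1_cis)
  then show "z \<in> range cis" by (rule range_eqI)
qed auto

lemma topspace_orbit_space: "topspace (orbit_space \<Gamma>) = circle_orbits \<Gamma>"
proof -
  have "{x \<in> S1. circle_orbit \<Gamma> x \<in> circle_orbits \<Gamma>} = S1" by (auto simp: orbits_def)
  then have "openin (orbit_space \<Gamma>) (circle_orbits \<Gamma>)" unfolding openin_orbit_space by simp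
  then have "circle_orbits \<Gamma> \<subseteq> topspace (orbit_space \<Gamma>)" by (rule openin_subset)
  moreover have "topspace (orbit_space \<Gamma>) \<subseteq> circle_orbits \<Gamma>"
    using openin_topspace [of "orbit_space \<Gamma>"] unfolding openin_orbit_space by (rule conjunct1)
  ultimately show ?thesis by (rule subset_antisym [rotated])
qed

text \<open>Composed with the projection, \<open>\<phi>\<close> is the \<open>k\<close>-th power of
  \<open>pr c\<close>, a continuous surjection from a compact to a Hausdorff space and so a quotient
  map. Hence \<open>\<phi>\<close> is an injective quotient map.\<close>

lemma (in cover) quotient_homeomorphic:
  assumes orb: "\<And>t. circle_orbit \<Gamma> (cis t) = fibre t"
  obtains \<phi> where "homeomorphic_map (orbit_space \<Gamma>) (top_of_set S1) \<phi>" "\<And>t. \<phi> (fibre t) = cis (qq t)"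
proof -
  define \<phi> where "\<phi> A = cis (qq (SOME t. A = fibre t))" for A
  have \<phi>: "\<phi> (fibre t) = cis (qq t)" for t
  proof -
    have "fibre t = fibre (SOME s. fibre t = fibre s)" by (rule someI [of _ t]) simp
    then show ?thesis unfolding \<phi>_def fibre_eq_iff by simp
  qed
  note S1 = S1_range_cis
  have orbs: "circle_orbits \<Gamma> = range fibre" unfolding orbits_def S1 using orb by auto
  let ?\<pi> = "circle_orbit \<Gamma>"
  have q\<pi>: "quotient_map (top_of_set S1) (orbit_space \<Gamma>) ?\<pi>"
    unfolding quotient_map_def topspace_orbit_space openin_orbit_space topspace_euclidean_subtopology
    by (auto simp: orbits_def)
  have comp: "(\<phi> \<circ> ?\<pi>) z = pr c z ^ k" if z: "z \<in> S1" for z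
  proof -
    have t: "z = cis (Arg z)" using z by (simp only: S1_cis)
    define t where "t = Arg z"
    have t: "z = cis t" unfolding t_def by (rule t)
    show ?thesis unfolding t by (simp only: o_def orb \<phi> qq_def pr_cis Complex.DeMoivre)
  qed
  have cont: "continuous_on S1 (\<phi> \<circ> ?\<pi>)"
  proof (rule continuous_on_eq)
    show "continuous_on S1 (\<lambda>z. pr c z ^ k)" by (intro continuous_on_power continuous_on_pr)
  qed (rule comp [symmetric])
  have onto: "(\<phi> \<circ> ?\<pi>) ` S1 = S1"
  proof
    show "(\<phi> \<circ> ?\<pi>) ` S1 \<subseteq> S1" by (auto simp: S1 orb \<phi>)
    show "S1 \<subseteq> (\<phi> \<circ> ?\<pi>) ` S1"
    proof
      fix z assume "z \<in> S1"
      then obtain t where t: "z = cis t" using S1 by blast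
      obtain x where "t = qq x" by (rule qq_surj)
      then have "z = (\<phi> \<circ> ?\<pi>) (cis x)" using t by (simp add: orb \<phi>)
      then show "z \<in> (\<phi> \<circ> ?\<pi>) ` S1" by (rule image_eqI) simp
    qed
  qed
  have cm: "continuous_map (top_of_set S1) (top_of_set S1) (\<phi> \<circ> ?\<pi>)"
    using cont onto by (auto simp: image_subset_iff_funcset [symmetric])
  have q\<phi>\<pi>: "quotient_map (top_of_set S1) (top_of_set S1) (\<phi> \<circ> ?\<pi>)"
  proof (rule T1_Spaces.continuous_imp_quotient_map [OF cm])
    show "compact_space (top_of_set S1)" by (simp add: compact_space_subtopology)
    show "Hausdorff_space (top_of_set S1)" by (simp add: Hausdorff_space_subtopology)
  qed (use onto in simp)
  have "continuous_map (orbit_space \<Gamma>) (top_of_set S1) \<phi>" by (rule continuous_compose_quotient_map [OF q\<pi> cm])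
  then have "quotient_map (orbit_space \<Gamma>) (top_of_set S1) \<phi>"
    using quotient_map_from_composition [OF quotient_imp_continuous_map [OF q\<pi>] _ q\<phi>\<pi>] by blast
  moreover have "inj_on \<phi> (topspace (orbit_space \<Gamma>))"
    unfolding topspace_orbit_space orbs inj_on_def using \<phi> fibre_eq_iff by auto
  ultimately have "homeomorphic_map (orbit_space \<Gamma>) (top_of_set S1) \<phi>" unfolding homeomorphic_map_def by blast
  then show ?thesis using that \<phi> by blast
qed

lemma (in cover) induced_base:
  assumes orb: "\<And>t. circle_orbit \<Gamma> (cis t) = fibre t" and \<phi>: "\<And>t. \<phi> (fibre t) = cis (qq t)"
  shows "{h \<in> carrier HomeoS1. \<exists>g\<in>G. \<forall>A\<in>circle_orbits \<Gamma>. h (\<phi> A) = \<phi> (g ` A)} = base"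
proof -
  have orbs: "circle_orbits \<Gamma> = range fibre"
    unfolding orbits_def S1_range_cis using orb by auto
  have Gpr: "G = pr ` lifts G" using pr_lifts [OF subgroup.subset [OF subgroup_G]] by simp
  have "(\<exists>g\<in>G. \<forall>A\<in>circle_orbits \<Gamma>. h (\<phi> A) = \<phi> (g ` A)) \<longleftrightarrow> (\<exists>f\<in>lifts G. \<forall>t. h (cis (qq t)) = cis (qq (ap f t)))" for h
  proof -
    have "(\<exists>g\<in>G. \<forall>A\<in>circle_orbits \<Gamma>. h (\<phi> A) = \<phi> (g ` A)) \<longleftrightarrow> (\<exists>f\<in>lifts G. \<forall>t. h (\<phi> (fibre t)) = \<phi> (pr f ` fibre t))"
      unfolding orbs by (subst Gpr) (simp del: mem_lifts)
    also have "\<dots> \<longleftrightarrow> (\<exists>f\<in>lifts G. \<forall>t. h (cis (qq t)) = cis (qq (ap f t)))"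
      by (intro bex_cong refl) (simp only: image_fibre \<phi>)
    finally show ?thesis .
  qed
  then show ?thesis unfolding induced_eq_base [symmetric] by (simp only:)
qed

lemma (in cover) cyclic_cover_base: "cyclic_cover k G base"
proof -
  interpret group HomeoS1 by (rule group_HomeoS1)
  let ?s = "2 * pi / real k"
  define R where "R = pr root"
  have o: "group.ord HomeoS1 (pr (shift ?s)) = k"
    unfolding ord_rotation
  proof (intro allI iffI)
    fix n assume "\<exists>m::int. real n * ?s = 2 * pi * of_int m"
    then obtain m :: int where "real n * ?s = 2 * pi * of_int m" by blast
    then have "real n = of_int m * real k" using k by (simp add: field_simps)
    then have "int n = m * int k" by (metis of_int_eq_iff of_int_mult of_int_of_nat_eq)
    then have "int k dvd int n" by simp
    then show "k dvd n" by simp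
  next
    fix n assume "k dvd n"
    then obtain m where "n = k * m" by blast
    then show "\<exists>m::int. real n * ?s = 2 * pi * of_int m" using k by (intro exI [of _ "int m"]) simp
  qed
  have R: "R = pr (- c + shift ?s - (- c))" by (simp add: R_def root_def)
  have R2: "R = pr (- c) \<otimes>\<^bsub>HomeoS1\<^esub> pr (shift ?s) \<otimes>\<^bsub>HomeoS1\<^esub> inv\<^bsub>HomeoS1\<^esub> (pr (- c))"
    unfolding pr_inv pr_mult by (simp add: R_def root_def)
  have comm: "R \<otimes>\<^bsub>HomeoS1\<^esub> g = g \<otimes>\<^bsub>HomeoS1\<^esub> R" if g: "g \<in> G" for g
  proof -
    obtain f where f: "f \<in> lifts G" "g = pr f" using pr_lifts [OF subgroup.subset [OF subgroup_G]] g by blast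
    have "root + f = f + root" unfolding root_def by (rule root_commute' [OF f(1)])
    then show ?thesis unfolding f(2) R_def pr_mult by simp
  qed
  define \<Gamma> where "\<Gamma> = generate HomeoS1 {R}"
  have orb: "circle_orbit \<Gamma> (cis t) = fibre t" for t
    unfolding \<Gamma>_def R circle_orbit_rotation [OF k o] fibre_def qq_def ..
  obtain \<phi> where \<phi>: "homeomorphic_map (orbit_space \<Gamma>) (top_of_set S1) \<phi>" "\<And>t. \<phi> (fibre t) = cis (qq t)"
    using quotient_homeomorphic [OF orb] by blast
  have op: "orientation_preserving (\<lambda>x. \<phi> (circle_orbit \<Gamma> x))"
    unfolding orientation_preserving_def orb \<phi>(2)
    by (intro exI [of _ qq]) (simp add: continuous_on_qq strict_mono_def)
  have B: "base = {h \<in> carrier HomeoS1. \<exists>g\<in>G. \<forall>A\<in>circle_orbits \<Gamma>. h (\<phi> A) = \<phi> (g ` A)}"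
    by (rule induced_base [OF orb \<phi>(2), symmetric])
  have SO: "pr (shift ?s) \<in> SO2R" unfolding SO2R_eq by blast
  have "\<exists>\<phi>. homeomorphic_map (orbit_space \<Gamma>) (top_of_set S1) \<phi> \<and>
     orientation_preserving (\<lambda>x. \<phi> (circle_orbit \<Gamma> x)) \<and>
     base = {h \<in> carrier HomeoS1. \<exists>g\<in>G. \<forall>A\<in>circle_orbits \<Gamma>. h (\<phi> A) = \<phi> (g ` A)}"
    using \<phi>(1) op B by blast
  moreover have "\<exists>\<rho>\<in>SO2R. group.ord HomeoS1 \<rho> = k \<and>
      (\<exists>c\<in>carrier HomeoS1. R = c \<otimes>\<^bsub>HomeoS1\<^esub> \<rho> \<otimes>\<^bsub>HomeoS1\<^esub> inv\<^bsub>HomeoS1\<^esub> c)"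
    using SO o R2 pr_in_HomeoS1 by blast
  ultimately show ?thesis
    unfolding cyclic_cover_def Let_def \<Gamma>_def
    using subgroup_G subgroup_base k comm pr_in_HomeoS1 [of root] R_def by blast
qed

text \<open>Commuting on the circle means commuting on the line up to \<open>m\<close> turns. Over
  \<open>k\<close> iterations of \<open>r\<close> the defect grows to \<open>m * k\<close> turns,
  but the \<open>k\<close>-th power of \<open>r\<close> is a full turn and commutes exactly.\<close>

lemma commute_exact:
  assumes r: "nmul k r = shift (2 * pi)" "k > 0" and c: "pr (r + f) = pr (f + r)"
  shows "r + f = f + r"
proof -
  obtain m :: int where m: "r + f = shift (2 * pi * of_int m) + (f + r)" using c pr_eq_iff by blast
  have rf: "ap r (ap f x) = ap f (ap r x) + 2 * pi * of_int m" for x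
  proof -
    have "ap (r + f) x = ap (shift (2 * pi * of_int m) + (f + r)) x" unfolding m ..
    then show ?thesis by simp
  qed
  have "ap (nmul n r) (ap f x) = ap f (ap (nmul n r) x) + 2 * pi * of_int (m * int n)" for n x
  proof (induction n)
    case (Suc n)
    have "ap (nmul (Suc n) r) (ap f x) = ap r (ap f (ap (nmul n r) x) + 2 * pi * of_int (m * int n))" using Suc by simp
    also have "\<dots> = ap f (ap r (ap (nmul n r) x)) + 2 * pi * of_int m + 2 * pi * of_int (m * int n)"
      by (simp only: ap_add_int rf)
    finally show ?case by (simp add: algebra_simps)
  qed simp
  from this [of k 0] have "ap f 0 + 2 * pi = ap f (0 + 2 * pi) + 2 * pi * of_int (m * int k)" unfolding r(1) ap_shift .
  then have "m = 0" using r(2) unfolding ap_add_2pi by simp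
  then show ?thesis using m by (simp add: shift_0)
qed

lemma (in cover) nmul_root: "nmul k root = shift (2 * pi)"
proof -
  have "nmul k root = - c + nmul k (shift (2 * pi / real k)) - (- c)"
    unfolding conj_nmul [symmetric] by (simp add: root_def)
  also have "\<dots> = shift (2 * pi)"
  proof (rule lift_eqI)
    fix x
    show "ap (- c + nmul k (shift (2 * pi / real k)) - (- c)) x = ap (shift (2 * pi)) x"
      using k ap_add_2pi [of "- c" "ap c x"] by (simp add: nmul_shift)
  qed
  finally show ?thesis .
qed

lemma coverI:
  assumes "subgroup G HomeoS1" "k > 0" and r: "nmul k r = shift (2 * pi)" "\<And>x. ap c (ap r x) = ap c x + 2 * pi / real k"
    and comm: "\<And>f. f \<in> lifts G \<Longrightarrow> pr r \<otimes>\<^bsub>HomeoS1\<^esub> pr f = pr f \<otimes>\<^bsub>HomeoS1\<^esub> pr r"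
  shows "cover k c G"
proof (rule cover.intro)
  have root: "- c + shift (2 * pi / real k) + c = r"
    by (rule lift_eqI) (simp add: ap_uminus_eq_iff r(2))
  show "- c + shift (2 * pi / real k) + c + g = g + (- c + shift (2 * pi / real k) + c)" if "g \<in> lifts G" for g
    unfolding root using comm [OF that] unfolding pr_mult by (intro commute_exact [OF r(1) assms(2)])
qed fact+

text \<open>The generator may be a rotation through any angle of order \<open>k\<close>, and the
  identification of the quotient is arbitrary. A power of the generator gives a first cover
  \<open>C0\<close>; changing \<open>c\<close> so that \<open>qq\<close> becomes the lift
  \<open>P\<close> of the given projection makes \<open>base\<close> equal to \<open>H\<close>
  itself.\<close>

lemma cyclic_coverE:
  assumes "cyclic_cover k G H"
  obtains c where "cover k c G" "H = cover.base k c G"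
proof -
  interpret HG: group HomeoS1 by (rule group_HomeoS1)
  obtain R \<rho> c0 where G: "subgroup G HomeoS1" "subgroup H HomeoS1" and k: "k > 0" and R: "R \<in> carrier HomeoS1"
    and \<rho>: "\<rho> \<in> SO2R" "group.ord HomeoS1 \<rho> = k"
    and c0: "c0 \<in> carrier HomeoS1" "R = c0 \<otimes>\<^bsub>HomeoS1\<^esub> \<rho> \<otimes>\<^bsub>HomeoS1\<^esub> inv\<^bsub>HomeoS1\<^esub> c0"
    and comm: "\<forall>g\<in>G. R \<otimes>\<^bsub>HomeoS1\<^esub> g = g \<otimes>\<^bsub>HomeoS1\<^esub> R"
    and ex: "\<exists>\<phi>. homeomorphic_map (orbit_space (generate HomeoS1 {R})) (top_of_set S1) \<phi> \<and>
             orientation_preserving (\<lambda>x. \<phi> (circle_orbit (generate HomeoS1 {R}) x)) \<and>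
             H = {h \<in> carrier HomeoS1. \<exists>g\<in>G. \<forall>A\<in>circle_orbits (generate HomeoS1 {R}). h (\<phi> A) = \<phi> (g ` A)}"
    using assms unfolding cyclic_cover_def Let_def by blast
  define \<Gamma> where "\<Gamma> = generate HomeoS1 {R}"
  obtain \<phi> where \<phi>: "homeomorphic_map (orbit_space \<Gamma>) (top_of_set S1) \<phi>"
    "orientation_preserving (\<lambda>x. \<phi> (circle_orbit \<Gamma> x))"
    and H: "H = {h \<in> carrier HomeoS1. \<exists>g\<in>G. \<forall>A\<in>circle_orbits \<Gamma>. h (\<phi> A) = \<phi> (g ` A)}"
    using ex unfolding \<Gamma>_def by blast
  obtain s where s: "\<rho> = pr (shift s)" using \<rho>(1) unfolding SO2R_eq by blast
  obtain c' where c': "c0 = pr c'" using pr_surj [OF c0(1)] by blast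
  define c where "c = - c'"
  have Rc: "R = pr (- c + shift s - (- c))"
    unfolding c0(2) c' s pr_inv pr_mult by (simp add: c_def)
  note o = \<rho>(2) [unfolded s]
  have orb: "circle_orbit \<Gamma> (cis t) = cis ` {y. cis (real k * ap c y) = cis (real k * ap c t)}" for t
    unfolding \<Gamma>_def Rc by (rule circle_orbit_rotation [OF k o])
  interpret C0: cover k c G
  proof (rule coverI [OF G(1) k])
    define r where "r = - c + shift (2 * pi / real k) - (- c)"
    have "nmul k r = - c + shift (2 * pi) - (- c)" unfolding r_def conj_nmul nmul_shift using k by simp
    then show "nmul k r = shift (2 * pi)" 
      using ap_add_2pi [of "- c"] by (intro lift_eqI) simp
    show "ap c (ap r x) = ap c x + 2 * pi / real k" for x by (simp add: r_def)
    fix f assume f: "f \<in> lifts G"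
    have on: "(\<exists>m::int. real n * s = 2 * pi * of_int m) \<longleftrightarrow> k dvd n" for n using o unfolding ord_rotation by blast
    obtain i m :: int where im: "2 * pi * of_int 1 / real k = of_int i * s + 2 * pi * of_int m"
      using rotation_angles(2) [OF k on] by blast
    obtain M :: int where M: "real k * s = 2 * pi * of_int M" using iffD2 [OF on dvd_refl] by blast
    \<comment> \<open>Adding a multiple of \<open>k\<close> makes the exponent nonnegative and
      changes the angle by full turns only.\<close>
    define n where "n = nat (i + int k * \<bar>i\<bar>)"
    have "int k * \<bar>i\<bar> \<ge> 1 * \<bar>i\<bar>" using k by (intro mult_right_mono) auto
    then have n: "int n = i + int k * \<bar>i\<bar>" unfolding n_def by simp
    have "of_int (int n) * s = of_int i * s + of_int \<bar>i\<bar> * (real k * s)" unfolding n by (simp add: algebra_simps)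
    then have rn: "2 * pi / real k = of_int (int n) * s + 2 * pi * of_int (m - \<bar>i\<bar> * M)"
      using im unfolding M by (simp add: algebra_simps)
    have "r = shift (2 * pi * of_int (m - \<bar>i\<bar> * M)) + (- c + shift (of_int (int n) * s) - (- c))"
    proof (rule lift_eqI)
      fix x
      have "ap r x = ap (- c) ((ap c x + of_int (int n) * s) + 2 * pi * of_int (m - \<bar>i\<bar> * M))"
        unfolding r_def rn by (simp add: add.assoc)
      then show "ap r x = ap (shift (2 * pi * of_int (m - \<bar>i\<bar> * M)) + (- c + shift (of_int (int n) * s) - (- c))) x"
        unfolding ap_add_int by simp
    qed
    then have "pr r = R [^]\<^bsub>HomeoS1\<^esub> n"
      unfolding Rc int_pow_int [symmetric] conj_shift_power by (simp only: pr_shift_2pi_add)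
    moreover have "R [^]\<^bsub>HomeoS1\<^esub> n \<otimes>\<^bsub>HomeoS1\<^esub> pr f = pr f \<otimes>\<^bsub>HomeoS1\<^esub> R [^]\<^bsub>HomeoS1\<^esub> n"
      using f comm by (intro HG.group_commutes_pow R) auto
    ultimately show "pr r \<otimes>\<^bsub>HomeoS1\<^esub> pr f = pr f \<otimes>\<^bsub>HomeoS1\<^esub> pr r" by simp
  qed
  have orb0: "circle_orbit \<Gamma> (cis t) = C0.fibre t" for t unfolding orb C0.fibre_def C0.qq_def ..
  obtain P where P: "continuous_on UNIV P" "strict_mono P" "\<And>t. \<phi> (C0.fibre t) = cis (P t)"
    using \<phi>(2) unfolding orientation_preserving_def orb0 by blast
  have less: "P x < P y \<longleftrightarrow> x < y" for x y using P(2) by (rule strict_mono_less)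
  have cisP: "cis (P s) = cis (P t) \<longleftrightarrow> cis (C0.qq s) = cis (C0.qq t)" for s t
  proof -
    have inj: "inj_on \<phi> (circle_orbits \<Gamma>)"
      using homeomorphic_imp_injective_map [OF \<phi>(1)] unfolding topspace_orbit_space .
    have "C0.fibre t \<in> circle_orbits \<Gamma>" for t
      unfolding orbits_def S1_range_cis orb0 [symmetric] by blast
    then have "\<phi> (C0.fibre s) = \<phi> (C0.fibre t) \<longleftrightarrow> C0.fibre s = C0.fibre t" using inj by (simp add: inj_on_eq_iff)
    then show ?thesis unfolding P(3) C0.fibre_eq_iff .
  qed
  have Proot: "P (ap C0.root t) = P t + 2 * pi" for t
  proof -
    have "cis (P (ap C0.root t)) = cis (P t)" unfolding cisP C0.qq_root by (rule cis_add_2pi)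
    then obtain m :: int where m: "P (ap C0.root t) = P t + 2 * pi * of_int m" using cis_eq_iff by blast
    have lt: "P t < P (ap C0.root t)" unfolding less by (rule C0.root_greater)
    then have m1: "m \<ge> 1" unfolding m by (simp add: zero_less_mult_iff)
    \<comment> \<open>Otherwise \<open>P\<close> would reach \<open>P t + 2 * pi\<close> strictly
      between \<open>t\<close> and \<open>ap C0.root t\<close>, where no point of the fibre of
      \<open>t\<close> lies.\<close>
    have "m = 1"
    proof (rule ccontr)
      assume "m \<noteq> 1"
      then have "2 * pi * 1 < 2 * pi * of_int m" using m1 by simp
      then have "P t \<le> P t + 2 * pi" "P t + 2 * pi \<le> P (ap C0.root t)" unfolding m by simp_all
      then obtain y where y: "t \<le> y" "y \<le> ap C0.root t" "P y = P t + 2 * pi"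
        using IVT' [of P t "P t + 2 * pi" "ap C0.root t"] continuous_on_subset [OF P(1)] C0.root_greater [of t] by auto
      have "P t < P y" "P y < P (ap C0.root t)" using y(3) m \<open>2 * pi * 1 < 2 * pi * of_int m\<close> by simp_all
      then have ty: "t < y" "y < ap C0.root t" unfolding less .
      have "cis (P y) = cis (P t)" unfolding y(3) by (rule cis_add_2pi)
      then have "cis (C0.qq y) = cis (C0.qq t)" unfolding cisP .
      then obtain l :: int where l: "C0.qq y = C0.qq t + 2 * pi * of_int l" using cis_eq_iff by blast
      have "C0.qq t < C0.qq y" "C0.qq y < C0.qq (ap C0.root t)" unfolding C0.qq_less by fact+
      then have "0 < 2 * pi * of_int l" "2 * pi * of_int l < 2 * pi * 1" unfolding C0.qq_root l by simp_all
      then have "0 < real_of_int l" "real_of_int l < 1"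
        by (simp_all only: mult_less_cancel_left_pos zero_less_mult_iff pi_gt_zero) auto
      then show False by simp
    qed
    then show ?thesis using m by simp
  qed
  have Pn: "P (ap (nmul n C0.root) t) = P t + 2 * pi * real n" for n t
    by (induction n) (simp_all add: Proot algebra_simps)
  define c1 where "c1 = Lift (\<lambda>t. P t / real k)"
  have c1: "ap c1 t = P t / real k" for t
  proof -
    have "P (t + 2 * pi) / real k = P t / real k + 2 * pi" for t
      using Pn [of k t] k unfolding C0.nmul_root by (simp add: add_divide_distrib)
    moreover have "strict_mono (\<lambda>t. P t / real k)" using k less by (simp add: strict_mono_def divide_strict_right_mono)
    moreover have "continuous_on UNIV (\<lambda>t. P t / real k)" using k by (intro continuous_intros P(1)) auto
    ultimately show ?thesis unfolding c1_def by (subst ap_Lift) auto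
  qed
  have "cover k c1 G"
  proof (rule coverI [OF G(1) k C0.nmul_root])
    show "ap c1 (ap C0.root x) = ap c1 x + 2 * pi / real k" for x unfolding c1 Proot by (rule add_divide_distrib)
    show "pr C0.root \<otimes>\<^bsub>HomeoS1\<^esub> pr f = pr f \<otimes>\<^bsub>HomeoS1\<^esub> pr C0.root" if "f \<in> lifts G" for f
      unfolding pr_mult C0.root_def C0.root_commute' [OF that] ..
  qed
  then interpret C1: cover k c1 G .
  have qq: "C1.qq = P" unfolding C1.qq_def c1 using k by (intro ext) simp
  have fib: "C1.fibre t = C0.fibre t" for t unfolding C1.fibre_def C0.fibre_def qq cisP ..
  have "{h \<in> carrier HomeoS1. \<exists>g\<in>G. \<forall>A\<in>circle_orbits \<Gamma>. h (\<phi> A) = \<phi> (g ` A)} = C1.base"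
    by (rule C1.induced_base) (simp_all only: fib orb0 P(3) qq)
  then show ?thesis using that [OF C1.cover_axioms] H by simp
qed

text \<open>Averaging the iterates of \<open>r\<close> works because \<open>F (ap r x) - F x\<close>
  telescopes to one \<open>k\<close>-th of the displacement of the \<open>k\<close>-th power, which
  is a full turn.\<close>

lemma root_conjugation:
  assumes k: "k > 0" and r: "nmul k r = shift (2 * pi)"
  obtains c where "\<And>x. ap c (ap r x) = ap c x + 2 * pi / real k"
proof -
  define F where "F x = (\<Sum>i<k. ap (nmul i r) x) / real k" for x
  have "strict_mono F"
    using k by (auto simp: strict_mono_def F_def intro!: divide_strict_right_mono sum_strict_mono)
  moreover have "continuous_on UNIV F" unfolding F_def using k by (intro continuous_intros) auto
  moreover have "F (x + 2 * pi) = F x + 2 * pi" for x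
  proof -
    have "(\<Sum>i<k. ap (nmul i r) (x + 2 * pi)) = (\<Sum>i<k. ap (nmul i r) x) + real k * (2 * pi)"
      unfolding ap_add_2pi by (simp add: sum.distrib)
    then show ?thesis unfolding F_def using k by (simp add: add_divide_distrib)
  qed
  ultimately have F: "ap (Lift F) = F" by (rule ap_Lift)
  have "F (ap r x) = F x + 2 * pi / real k" for x
  proof -
    have "(\<Sum>i<k. ap (nmul i r) (ap r x)) = (\<Sum>i<k. ap (nmul (Suc i) r) x)"
      by (simp only: nmul_Suc2 ap_plus)
    also have "\<dots> = (\<Sum>i<Suc k. ap (nmul i r) x) - ap (nmul 0 r) x"
      by (subst sum.lessThan_Suc_shift) simp
    also have "\<dots> = (\<Sum>i<k. ap (nmul i r) x) + 2 * pi" unfolding sum.lessThan_Suc r by simp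
    finally show ?thesis unfolding F_def by (simp add: add_divide_distrib)
  qed
  then show ?thesis using that [of "Lift F"] F by simp
qed

theorem cover_alternative:
  assumes G: "subgroup G HomeoS1" and trans: "circle_transitive G" and path: "has_nonconstant_path G"
  shows "conj_HomeoS1 G SO2R \<or> conj_HomeoS1 G PSL2R \<or> interpolates_HomeoS1 G \<or>
    (\<exists>k>1. \<exists>c. cover k c G \<and> (conj_HomeoS1 (cover.base k c G) PSL2R \<or> interpolates_HomeoS1 (cover.base k c G)))"
proof -
  obtain h where h: "h \<in> component (lifts G)" "h \<noteq> 0" using nonconstant_path_component [OF G path] by blast
  interpret C: circle_group "lifts G" "component (lifts G)"
    by (rule circle_group_component [OF add_subgroup_lifts [OF G] lifts_transitive [OF G trans] h])
  show ?thesis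
  proof (cases "\<forall>a\<in>component (lifts G). \<forall>x. ap a x = x \<longrightarrow> a = 0")
    case True
    then have free: "\<And>a x. a \<in> component (lifts G) \<Longrightarrow> ap a x = x \<Longrightarrow> a = 0" by blast
    obtain c where c: "\<And>g. g \<in> lifts G \<Longrightarrow> \<exists>s. c + g - c = shift s" "\<And>s. \<exists>g\<in>lifts G. c + g - c = shift s"
    proof (rule free_circle_group_conj_rotations [OF C.circle_group_axioms free])
      fix c assume a: "\<And>g. g \<in> lifts G \<Longrightarrow> \<exists>s. c + g - c = shift s" and b: "\<And>s. \<exists>g\<in>lifts G. c + g - c = shift s"
      show thesis by (rule that, erule a, rule b)
    qed
    have "conj_HomeoS1 G SO2R"
    proof (rule conj_HomeoS1I [OF subgroup.subset [OF G] SO2R_subset])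
      show "pr (c + g - c) \<in> SO2R" if "g \<in> lifts G" for g using c(1) [OF that] unfolding SO2R_eq by auto
      show "\<exists>g\<in>lifts G. pr (c + g - c) = h" if h: "h \<in> SO2R" for h
      proof -
        obtain s where s: "h = pr (shift s)" using h unfolding SO2R_eq by blast
        obtain g where "g \<in> lifts G" "c + g - c = shift s" using c(2) by blast
        then show ?thesis unfolding s by (intro bexI [of _ g]) simp_all
      qed
    qed
    then show ?thesis by blast
  next
    case False
    then obtain a x0 where a: "a \<in> component (lifts G)" "a \<noteq> 0" "ap a x0 = x0" by blast
    obtain \<rho> k where k: "k \<ge> 1" "nmul k \<rho> = shift (2 * pi)" and comm: "\<And>g. g \<in> lifts G \<Longrightarrow> \<rho> + g = g + \<rho>"
      and less: "\<And>x. x < ap \<rho> x" and prim: "\<And>x y. x < y \<Longrightarrow> y < ap \<rho> x \<Longrightarrow> \<exists>a\<in>stab (component (lifts G)) x. ap a y \<noteq> y"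
      
    proof (rule C.deck_root [OF a])
      fix k \<rho> assume *: "k \<ge> 1" "nmul k \<rho> = shift (2 * pi)" and a: "\<And>g. g \<in> lifts G \<Longrightarrow> \<rho> + g = g + \<rho>"
        and b: "\<And>x. x < ap \<rho> x" and c: "\<And>x y. x < y \<Longrightarrow> y < ap \<rho> x \<Longrightarrow> \<exists>a\<in>stab (component (lifts G)) x. ap a y \<noteq> y"
      show thesis by (rule that [OF *], erule a, rule b, erule c)
    qed
    show ?thesis
    proof (cases "k = 1")
      case True
      then have "\<rho> = shift (2 * pi)" using k(2) by simp
      then interpret primitive_group "lifts G" "component (lifts G)"
        using prim by unfold_locales simp
      show ?thesis using primitive_alternative [OF G primitive_group_axioms] by blast
    next
      case False
      then have k1: "k > 1" and k0: "k > 0" using k(1) by simp_all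
      obtain c where c: "\<And>x. ap c (ap \<rho> x) = ap c x + 2 * pi / real k" using root_conjugation [OF k0 k(2)] by blast
      interpret V: cover k c G
        by (rule coverI [OF G k0 k(2) c]) (simp only: pr_mult comm)
      have root: "V.root = \<rho>"
        unfolding V.root_def by (rule lift_eqI) (simp add: ap_uminus_eq_iff c)
      \<comment> \<open>The hypotheses descend to the base: connected sets are pushed forward, and
        since \<open>qq\<close> turns \<open>root\<close> into a full turn, \<open>prim\<close>
        becomes primitivity.\<close>
      have comp: "V.push a \<in> component (lifts V.base)" if "a \<in> component (lifts G)" for a
        by (rule component_image [OF that V.continuous_on_push V.push_0 V.push_in_base])
      have hL: "h \<in> lifts G" using h(1) component_subset by blast
      interpret B: circle_group "lifts V.base" "component (lifts V.base)"
      proof (rule circle_group_component [OF add_subgroup_lifts [OF V.subgroup_base]])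
        show "V.push h \<in> component (lifts V.base)" by (rule comp [OF h(1)])
        show "V.push h \<noteq> 0" using V.push_eq_iff [OF hL V.L(1)] h(2) by simp
        show "\<exists>g\<in>lifts V.base. ap g x = y" for x y
        proof -
          obtain x' y' where xy: "x = V.qq x'" "y = V.qq y'" using V.qq_surj by metis
          obtain g where g: "g \<in> lifts G" "ap g x' = y'" using lifts_transitive [OF G trans] by blast
          then show ?thesis using V.ap_push [OF g(1), of x'] V.push_in_base [OF g(1)] xy by (intro bexI [of _ "V.push g"]) simp_all
        qed
      qed
      interpret B: primitive_group "lifts V.base" "component (lifts V.base)"
      proof
        fix x y :: real assume xy: "x < y" "y < x + 2 * pi"
        obtain x' y' where q: "x = V.qq x'" "y = V.qq y'" using V.qq_surj by metis
        have "y' < ap \<rho> x'" using xy(2) unfolding q V.qq_root [symmetric] V.qq_less root .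
        moreover have "x' < y'" using xy(1) unfolding q V.qq_less .
        ultimately obtain a where a: "a \<in> stab (component (lifts G)) x'" "ap a y' \<noteq> y'" using prim by blast
        then have aC: "a \<in> component (lifts G)" "ap a x' = x'" by (simp_all add: stab_def)
        have aL: "a \<in> lifts G" using aC(1) component_subset by blast
        have "V.push a \<in> stab (component (lifts V.base)) x"
          using comp [OF aC(1)] aC(2) V.ap_push [OF aL, of x'] q by (simp add: stab_def)
        moreover have "ap (V.push a) y \<noteq> y" using a(2) V.ap_push [OF aL, of y'] q by simp
        ultimately show "\<exists>a\<in>stab (component (lifts V.base)) x. ap a y \<noteq> y" by blast
      qed
      have "conj_HomeoS1 V.base PSL2R \<or> interpolates_HomeoS1 V.base"
        by (rule primitive_alternative [OF V.subgroup_base B.primitive_group_axioms])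
      then show ?thesis using k1 V.cover_axioms by blast
    qed
  qed
qed

lemma rotation_in_PSL2R: "pr (shift s) \<in> PSL2R"
proof -
  \<comment> \<open>Half the angle, because \<open>mob u 0\<close> multiplies by
    \<open>u / cnj u\<close>, the square of \<open>u\<close>.\<close>
  define u where "u = cis (s / 2)"
  have u: "cnj u = cis (- (s / 2))" by (simp add: u_def cis_cnj)
  have "pr (shift s) = (\<lambda>z\<in>S1. mob u 0 z)"
    unfolding pr_shift
  proof (rule restrict_ext)
    fix z :: complex
    have uu: "u * u = cis s" "cnj u \<noteq> 0" by (simp_all add: u_def cis_mult)
    have uu2: "u * cnj u = 1" by (simp only: complex_norm_square [symmetric] u_def norm_cis) simp
    have "cis s * z * cnj u = u * z * (u * cnj u)" unfolding uu(1) [symmetric] by (simp only: mult_ac)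
    then have "cis s * z * cnj u = u * z" unfolding uu2 by simp
    then have "cis s * z = u * z / cnj u" by (rule iffD2 [OF nonzero_eq_divide_eq [OF uu(2)]])
    then show "cis s * z = mob u 0 z" by (simp add: mob_def)
  qed
  then show ?thesis using mob_in_PSL2R [of 0 u] by (simp add: u_def)
qed

text \<open>The conjugator \<open>c1\<close> makes the covering map the power map and the base the
  Moebius group. Equality with \<open>PSLk2R k\<close>, and not mere inclusion, needs the rotation
  by one \<open>k\<close>-th of a turn in the conjugated group: two maps covering the same Moebius
  map differ by a multiple of it.\<close>

theorem (in cover) conj_PSLk2R:
  assumes "conj_HomeoS1 base PSL2R"
  shows "conj_HomeoS1 G (PSLk2R k)"
proof -
  obtain e where e: "base = (\<lambda>h. pr (e + h - e)) ` lifts PSL2R" using assms unfolding conj_HomeoS1_iff [OF PSL2R_subset] by blast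
  define E where "E y = ap (- e) y" for y
  define c1 where "c1 = Lift (\<lambda>t. E (qq t) / real k)"
  have Er: "E (y + 2 * pi * real n) = E y + 2 * pi * real n" for y n using ap_add_int [of "- e" y "int n"] by (simp add: E_def)
  have c1: "ap c1 t = E (qq t) / real k" for t
  proof -
    have "E (qq (t + 2 * pi)) / real k = E (qq t) / real k + 2 * pi" for t
      using qq_add_int [of t 1] Er [of "qq t" k] k by (simp add: add_divide_distrib)
    moreover have "strict_mono (\<lambda>t. E (qq t) / real k)" using k by (simp add: E_def strict_mono_def divide_strict_right_mono)
    moreover have "continuous_on UNIV (\<lambda>t. E (qq t) / real k)"
      unfolding E_def using k by (intro continuous_intros continuous_on_qq) auto
    ultimately show ?thesis unfolding c1_def by (subst ap_Lift) auto
  qed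
  have c1g: "ap (c1 + g - c1) (y / real k) = E (ap (push g) (ap e y)) / real k" if g: "g \<in> lifts G" for g y
  proof -
    obtain x where x: "ap e y = qq x" by (rule qq_surj)
    then have "y = E (qq x)" unfolding E_def x [symmetric] by simp
    then have "y / real k = ap c1 x" by (simp add: c1)
    then have "ap (c1 + g - c1) (y / real k) = ap c1 (ap g x)" by simp
    then show ?thesis unfolding c1 x ap_push [OF g] .
  qed
  define p where "p g = - e + push g + e" for g
  have c1p: "real k * ap (c1 + g - c1) (y / real k) = ap (p g) y" if "g \<in> lifts G" for g y
    using k unfolding c1g [OF that] by (simp add: p_def E_def)
  have pP: "pr (p g) \<in> PSL2R" if g: "g \<in> lifts G" for g
  proof -
    have "pr (push g) \<in> base" using g unfolding base_def by blast
    then obtain h where h: "h \<in> lifts PSL2R" "pr (push g) = pr (e + h - e)" unfolding e by blast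
    then obtain m :: int where "push g = shift (2 * pi * of_int m) + (e + h - e)" using pr_eq_iff by blast
    then have "p g = shift (2 * pi * of_int m) + h"
      unfolding p_def using ap_add_int [of "- e"] by (intro lift_eqI) simp
    then have "pr (p g) = pr h" by (simp only: pr_shift_2pi_add)
    then show ?thesis using h(1) by simp
  qed
  have p_onto: "\<exists>g\<in>lifts G. pr (p g) = h" if h: "h \<in> PSL2R" for h
  proof -
    have "h \<in> pr ` lifts PSL2R" unfolding pr_lifts [OF PSL2R_subset] by (rule h)
    then obtain f where f: "f \<in> lifts PSL2R" "h = pr f" by blast
    then have "pr (e + f - e) \<in> base" unfolding e by blast
    then obtain g where g: "g \<in> lifts G" "pr (e + f - e) = pr (push g)" unfolding base_def by blast
    then obtain m :: int where "push g = shift (2 * pi * of_int m) + (e + f - e)" using pr_eq_iff by metis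
    then have "p g = shift (2 * pi * of_int m) + f"
      unfolding p_def using ap_add_int [of "- e"] by (intro lift_eqI) simp
    then have "pr (p g) = pr f" by (simp only: pr_shift_2pi_add)
    then show ?thesis using g(1) f(2) by blast
  qed
  define G' where "G' = {f. \<exists>g\<in>lifts G. f = c1 + g - c1}"
  have G'D: "f + f' \<in> G'" if "f \<in> G'" "f' \<in> G'" for f f'
    using that L(3) unfolding G'_def by (auto simp del: mem_lifts simp: conj_add) 
  have G'u: "- f \<in> G'" if f: "f \<in> G'" for f
  proof -
    obtain g where "g \<in> lifts G" "f = c1 + g - c1" using f unfolding G'_def by blast
    then have "- g \<in> lifts G" "- f = c1 + - g - c1" using L(2) by (simp_all only: conj_uminus)
    then show ?thesis unfolding G'_def by blast
  qed
  have deck: "shift (2 * pi * of_int m) \<in> G'" for m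
  proof -
    have "c1 + shift (2 * pi * of_int m) - c1 = shift (2 * pi * of_int m)" by (rule lift_eqI) simp
    then show ?thesis using shift_in_lifts [OF subgroup_G, of m] unfolding G'_def by force
  qed
  have G'n: "nmul n f \<in> G'" if "f \<in> G'" for n f
    using deck [of 0] G'D [OF that] by (induction n) (simp_all add: shift_0)
  \<comment> \<open>A lift of the rotation by \<open>2\<pi>/k\<close> downstairs has as \<open>k\<close>-th power the deck generator, up to full turns.\<close>
  have step: "shift (2 * pi / real k) \<in> G'"
  proof -
    obtain g where g: "g \<in> lifts G" "pr (p g) = pr (shift (2 * pi / real k))"
      using p_onto [OF rotation_in_PSL2R] by blast
    then obtain m :: int where m: "p g = shift (2 * pi * of_int m) + shift (2 * pi / real k)" using pr_eq_iff by blast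
    define v where "v = (2 * pi * of_int m + 2 * pi / real k) / real k"
    have kv: "real k * v = 2 * pi * of_int m + 2 * pi / real k" using k by (simp add: v_def)
    have "c1 + g - c1 = shift v"
    proof (rule lift_eqI)
      fix x
      have "real k * ap (c1 + g - c1) ((real k * x) / real k) = real k * x + 2 * pi / real k + 2 * pi * of_int m"
        unfolding c1p [OF g(1)] m by simp
      then have "real k * ap (c1 + g - c1) x = real k * (x + v)" unfolding distrib_left kv using k by simp
      then show "ap (c1 + g - c1) x = ap (shift v) x" using k by simp
    qed
    then have "shift v \<in> G'" using g(1) unfolding G'_def by force
    then have "nmul k (shift v) \<in> G'" by (rule G'n)
    moreover have "real k * v = 2 * pi / real k + 2 * pi * of_int m" using k by (simp add: v_def)
    ultimately have "shift (2 * pi / real k + 2 * pi * of_int m) \<in> G'" unfolding nmul_shift by (simp only:)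
    then have "shift (2 * pi / real k + 2 * pi * of_int m) + shift (2 * pi * of_int (- m)) \<in> G'" by (intro G'D deck)
    then show ?thesis unfolding shift_add by simp
  qed
  have steps: "shift (2 * pi * of_int j / real k) \<in> G'" for j :: int
  proof (cases j)
    case (nonneg n)
    have "real n * (2 * pi / real k) = 2 * pi * of_int j / real k" by (simp add: nonneg)
    then show ?thesis using G'n [OF step, of n] unfolding nmul_shift by (simp only:)
  next
    case (neg n)
    have "- (real (Suc n) * (2 * pi / real k)) = 2 * pi * of_int j / real k" using k by (simp add: neg field_simps)
    then show ?thesis using G'u [OF G'n [OF step, of "Suc n"]] unfolding nmul_shift shift_uminus by (simp only:)
  qed
  have PSLk: "pr f \<in> PSLk2R k \<longleftrightarrow> (\<exists>g\<in>PSL2R. \<forall>t. cis (real k * ap f t) = g (cis (real k * t)))" for f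
  proof -
    have "(\<forall>z\<in>S1. pr f z ^ k = g (z ^ k)) \<longleftrightarrow> (\<forall>t. cis (real k * ap f t) = g (cis (real k * t)))" for g
      unfolding S1_range_cis by (simp add: Complex.DeMoivre)
    then show ?thesis unfolding PSLk2R_def by simp
  qed
  show ?thesis
  proof (rule conj_HomeoS1I [OF subgroup.subset [OF subgroup_G], of _ c1])
    show "PSLk2R k \<subseteq> carrier HomeoS1" unfolding PSLk2R_def by blast
    show "pr (c1 + g - c1) \<in> PSLk2R k" if g: "g \<in> lifts G" for g
      unfolding PSLk
    proof (intro bexI [of _ "pr (p g)"] pP [OF g] allI)
      fix t
      have "real k * ap (c1 + g - c1) t = ap (p g) (real k * t)" using c1p [OF g, of "real k * t"] k by simp
      then show "cis (real k * ap (c1 + g - c1) t) = pr (p g) (cis (real k * t))" by (simp only: pr_cis)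
    qed
    show "\<exists>g\<in>lifts G. pr (c1 + g - c1) = h" if h: "h \<in> PSLk2R k" for h
    proof -
      have "h \<in> carrier HomeoS1" using h unfolding PSLk2R_def by blast
      then obtain f where f: "h = pr f" using pr_surj by blast
      obtain h0 where h0: "h0 \<in> PSL2R" "\<And>t. cis (real k * ap f t) = h0 (cis (real k * t))" using h unfolding f PSLk by blast
      obtain g where g: "g \<in> lifts G" "pr (p g) = h0" using p_onto [OF h0(1)] by blast
      \<comment> \<open>The deviation of \<open>f\<close> from the element covering the same map
        downstairs. Continuous with values in multiples of a turn, it is constant.\<close>
      define u where "u t = real k * ap f t - ap (p g) (real k * t)" for t
      have uj: "\<exists>j::int. u t = 2 * pi * of_int j" for t
      proof -
        have "cis (real k * ap f t) = cis (ap (p g) (real k * t))" unfolding h0(2) g(2) [symmetric] pr_cis ..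
        then obtain j :: int where "real k * ap f t = ap (p g) (real k * t) + 2 * pi * of_int j" using cis_eq_iff by blast
        then show ?thesis by (auto simp: u_def)
      qed
      have "continuous_on UNIV u" unfolding u_def by (intro continuous_intros)
      have "u constant_on UNIV"
      proof (rule continuous_discrete_range_constant)
        show "continuous_on UNIV u" by fact
        show "\<exists>e>0. \<forall>y. y \<in> UNIV \<and> u y \<noteq> u x \<longrightarrow> e \<le> norm (u y - u x)" for x
        proof (intro exI [of _ "2 * pi"] conjI allI impI)
          fix y assume "y \<in> UNIV \<and> u y \<noteq> u x"
          then have ne: "u y \<noteq> u x" by blast
          obtain i j :: int where ij: "u x = 2 * pi * of_int i" "u y = 2 * pi * of_int j" using uj [of x] uj [of y] by blast
          then have "1 \<le> \<bar>j - i\<bar>" using ne by auto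
          then have "1 \<le> \<bar>real_of_int j - of_int i\<bar>" by linarith
          then have "2 * pi * 1 \<le> 2 * pi * \<bar>real_of_int j - of_int i\<bar>" by (intro mult_left_mono) auto
          also have "\<dots> = norm (u y - u x)" unfolding ij by (simp add: abs_mult flip: right_diff_distrib)
          finally show "2 * pi \<le> norm (u y - u x)" by simp
        qed simp
      qed auto
      then obtain w where w: "\<And>t. u t = w" unfolding constant_on_def by blast
      obtain j :: int where j: "w = 2 * pi * of_int j" using uj [of 0] unfolding w by blast
      have "f = shift (2 * pi * of_int j / real k) + (c1 + g - c1)"
      proof (rule lift_eqI)
        fix t
        have "real k * ap f t = ap (p g) (real k * t) + 2 * pi * of_int j" using w [of t] unfolding u_def j by simp
        also have "ap (p g) (real k * t) = real k * ap (c1 + g - c1) t" using c1p [OF g(1), of "real k * t"] k by simp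
        finally have "real k * ap f t = real k * (ap (c1 + g - c1) t + 2 * pi * of_int j / real k)" using k by (simp add: distrib_left)
        then show "ap f t = ap (shift (2 * pi * of_int j / real k) + (c1 + g - c1)) t" using k by simp
      qed
      moreover have "c1 + g - c1 \<in> G'" using g(1) unfolding G'_def by blast
      ultimately have "f \<in> G'" using G'D [OF steps] by simp
      then show ?thesis unfolding f G'_def by blast
    qed
  qed
qed

section \<open>Mutual exclusion\<close>

lemma cis_neq_near:
  assumes "x \<noteq> y" "x < y + 2 * pi" "y < x + 2 * pi" shows "cis x \<noteq> cis y"
proof
  assume "cis x = cis y"
  then obtain m :: int where m: "x = y + 2 * pi * of_int m" using cis_eq_iff by blast
  then have "2 * pi * of_int m < 2 * pi * 1" "2 * pi * (- 1) < 2 * pi * of_int m" using assms by simp_all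
  then have "real_of_int m < 1" "- 1 < real_of_int m" by (simp_all only: mult_less_cancel_left_pos pi_gt_zero zero_less_mult_iff zero_less_numeral simp_thms)
  then have "m = 0" by linarith
  then show False using m assms(1) by simp
qed

section \<open>Two invariants that distinguish the alternatives\<close>

definition separating :: "lift set \<Rightarrow> bool" where
  "separating L \<longleftrightarrow> (\<forall>x y. x < y \<longrightarrow> y < x + 2 * pi \<longrightarrow> (\<exists>g\<in>L. ap g x = x \<and> ap g y \<noteq> y))"

text \<open>The condition on pairs keeps \<open>X\<close> within one turn, so that fixed points on
  the circle are counted, with one bound for all nontrivial lifts.\<close>

definition few_fixed_points :: "lift set \<Rightarrow> bool" where
  "few_fixed_points L \<longleftrightarrow> (\<exists>n. \<forall>g\<in>L. g \<noteq> 0 \<longrightarrow>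
     (\<forall>X. finite X \<longrightarrow> (\<forall>x\<in>X. ap g x = x) \<longrightarrow> (\<forall>x\<in>X. \<forall>y\<in>X. y < x + 2 * pi) \<longrightarrow> card X \<le> n))"

lemma few_fixed_pointsI:
  assumes "\<And>g X. g \<in> L \<Longrightarrow> g \<noteq> 0 \<Longrightarrow> finite X \<Longrightarrow> \<forall>x\<in>X. ap g x = x \<Longrightarrow>
    \<forall>x\<in>X. \<forall>y\<in>X. y < x + 2 * pi \<Longrightarrow> card X \<le> n"
  shows "few_fixed_points L"
  unfolding few_fixed_points_def by (intro exI ballI impI allI) (rule assms)

lemma few_fixed_pointsE:
  assumes "few_fixed_points L"
  obtains n where "\<And>g X. g \<in> L \<Longrightarrow> g \<noteq> 0 \<Longrightarrow> finite X \<Longrightarrow> \<forall>x\<in>X. ap g x = x \<Longrightarrow>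
    \<forall>x\<in>X. \<forall>y\<in>X. y < x + 2 * pi \<Longrightarrow> card X \<le> n"
proof -
  obtain n where n: "\<forall>g\<in>L. g \<noteq> 0 \<longrightarrow>
     (\<forall>X. finite X \<longrightarrow> (\<forall>x\<in>X. ap g x = x) \<longrightarrow> (\<forall>x\<in>X. \<forall>y\<in>X. y < x + 2 * pi) \<longrightarrow> card X \<le> n)"
    using assms unfolding few_fixed_points_def by (rule exE)
  show ?thesis by (rule that) (rule n [rule_format], assumption+, blast+)
qed

lemma lifts_conj: "lifts ((\<lambda>h. pr (c + h - c)) ` lifts H) = (\<lambda>h. c + h - c) ` lifts H"
proof (intro equalityI subsetI)
  fix f assume "f \<in> lifts ((\<lambda>h. pr (c + h - c)) ` lifts H)"
  then obtain h where h: "h \<in> lifts H" "pr f = pr (c + h - c)" by auto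
  then obtain m :: int where "f = shift (2 * pi * of_int m) + (c + h - c)" using pr_eq_iff by blast
  then have "f = c + (shift (2 * pi * of_int m) + h) - c" by (intro lift_eqI) simp
  moreover have "shift (2 * pi * of_int m) + h \<in> lifts H" using h(1) by (simp add: pr_shift_2pi_add)
  ultimately show "f \<in> (\<lambda>h. c + h - c) ` lifts H" by blast
qed auto

lemma ap_less_turn: "y < x + 2 * pi \<Longrightarrow> ap g y < ap g x + 2 * pi"
  by (simp only: ap_add_2pi [symmetric] ap_less_iff)

lemma separating_conj:
  assumes "separating L" shows "separating ((\<lambda>h. c + h - c) ` L)"
  unfolding separating_def
proof (intro allI impI)
  fix x y :: real assume xy: "x < y" "y < x + 2 * pi"
  have "ap (- c) x < ap (- c) y" "ap (- c) y < ap (- c) x + 2 * pi" using xy ap_less_turn by simp_all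
  then obtain g where g: "g \<in> L" "ap g (ap (- c) x) = ap (- c) x" "ap g (ap (- c) y) \<noteq> ap (- c) y"
    using assms unfolding separating_def by blast
  have "ap (c + g - c) x = x" using g(2) by simp
  moreover have "ap (c + g - c) y \<noteq> y"
  proof
    assume "ap (c + g - c) y = y"
    then have "ap (- c) (ap c (ap g (ap (- c) y))) = ap (- c) y" by simp
    then show False using g(3) by simp
  qed
  ultimately show "\<exists>g\<in>(\<lambda>h. c + h - c) ` L. ap g x = x \<and> ap g y \<noteq> y" using g(1) by blast
qed

lemma few_fixed_points_conj:
  assumes "few_fixed_points L" shows "few_fixed_points ((\<lambda>h. c + h - c) ` L)"
proof -
  obtain n where n: "\<And>g X. g \<in> L \<Longrightarrow> g \<noteq> 0 \<Longrightarrow> finite X \<Longrightarrow> \<forall>x\<in>X. ap g x = x \<Longrightarrow>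
    \<forall>x\<in>X. \<forall>y\<in>X. y < x + 2 * pi \<Longrightarrow> card X \<le> n"
    using few_fixed_pointsE [OF assms] by metis
  show ?thesis
  proof (rule few_fixed_pointsI)
    fix f X assume f: "f \<in> (\<lambda>h. c + h - c) ` L" "f \<noteq> 0"
      and X: "finite X" "\<forall>x\<in>X. ap f x = x" "\<forall>x\<in>X. \<forall>y\<in>X. y < x + 2 * pi"
    obtain g where g: "g \<in> L" "f = c + g - c" using f(1) by blast
    have "card (ap (- c) ` X) \<le> n"
    proof (rule n [OF g(1)])
      show "g \<noteq> 0" using f(2) g(2) by auto
      show "\<forall>x\<in>ap (- c) ` X. ap g x = x"
      proof clarify
        fix x assume "x \<in> X"
        then have "ap c (ap g (ap (- c) x)) = x" using X(2) g(2) by simp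
        then have "ap (- c) (ap c (ap g (ap (- c) x))) = ap (- c) x" by (rule arg_cong)
        then show "ap g (ap (- c) x) = ap (- c) x" unfolding ap_uminus_ap .
      qed
      show "\<forall>x\<in>ap (- c) ` X. \<forall>y\<in>ap (- c) ` X. y < x + 2 * pi"
      proof clarify
        fix x y assume "x \<in> X" "y \<in> X"
        then have "y < x + 2 * pi" using X(3) by simp
        then show "ap (- c) y < ap (- c) x + 2 * pi" by (rule ap_less_turn)
      qed
    qed (use X(1) in simp)
    moreover have "card (ap (- c) ` X) = card X" by (rule card_image) (simp add: inj_on_def)
    ultimately show "card X \<le> n" by simp
  qed
qed

lemma separating_PSL2R: "separating (lifts PSL2R)"
  unfolding separating_def
proof (intro allI impI)
  fix x y :: real assume xy: "x < y" "y < x + 2 * pi"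
  define z w where "z = cis x" and "w = cis y"
  have zw: "z \<noteq> w" unfolding z_def w_def using xy by (intro cis_neq_near) auto
  have z: "cnj z * z = 1" by (simp add: z_def mult.commute [of "cnj _"] complex_norm_square [symmetric])
  have w0: "z \<noteq> 0" by (simp add: z_def)
  \<comment> \<open>A parabolic element with sole fixed point \<open>z\<close>: its fixed point
    equation reduces to \<open>(z - w) * (z - w) = 0\<close>.\<close>
  let ?p = "2 + \<i>" and ?q = "- \<i> * z"
  have pq: "cmod ?q < cmod ?p"
  proof -
    have "(1::real)\<^sup>2 < (cmod ?p)\<^sup>2" unfolding cmod_power2 by simp
    then have "1 < cmod ?p" by (rule power_less_imp_less_base) simp
    then show ?thesis by (simp add: norm_mult z_def)
  qed
  have den: "cnj ?q * v + cnj ?p = \<i> * cnj z * v + (2 - \<i>)" for v by simp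
  have "mob ?p ?q z = z"
  proof -
    have "\<i> * cnj z * z + (2 - \<i>) = \<i> * (cnj z * z) + (2 - \<i>)" by (simp add: mult.assoc)
    also have "\<dots> = 2" unfolding z by simp
    finally have d: "cnj ?q * z + cnj ?p = 2" unfolding den .
    have "?p * z + ?q = 2 * z" by (simp add: algebra_simps)
    then show ?thesis unfolding mob_def d by simp
  qed
  moreover have "mob ?p ?q w \<noteq> w"
  proof
    assume "mob ?p ?q w = w"
    moreover have "cnj ?q * w + cnj ?p \<noteq> 0" using mob_denominator [OF pq, of w] by (simp add: w_def)
    ultimately have "?p * w + ?q = w * (cnj ?q * w + cnj ?p)" by (simp add: mob_def field_simps)
    then have "?p * w + ?q = w * (\<i> * cnj z * w + (2 - \<i>))" unfolding den .
    then have "\<i> * (2 * w) = \<i> * (z + cnj z * w * w)" by (simp add: algebra_simps)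
    then have "2 * w = z + cnj z * w * w" by (simp only: mult_left_cancel [OF complex_i_not_zero])
    then have "z * (2 * w) = z * (z + cnj z * w * w)" by (simp only:)
    then have "z * (2 * w) - z * z = (cnj z * z) * (w * w)" by (simp add: algebra_simps)
    then have "(z - w) * (z - w) = 0" unfolding z by (simp add: algebra_simps)
    then show False using zw by simp
  qed
  moreover obtain f where f: "pr f = (\<lambda>z\<in>S1. mob ?p ?q z)" using mob_lift [OF pq] by blast
  ultimately have fz: "pr f (cis x) = cis x" and fw: "pr f (cis y) \<noteq> cis y" by (simp_all add: z_def w_def)
  obtain f' where f': "pr f' = pr f" "ap f' x = x" using adjust_lift [OF fz] by blast
  have "ap f' y \<noteq> y" using fw unfolding f'(1) [symmetric] pr_cis by auto
  moreover have "f' \<in> lifts PSL2R" unfolding mem_lifts f' f by (rule mob_in_PSL2R [OF pq])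
  ultimately show "\<exists>g\<in>lifts PSL2R. ap g x = x \<and> ap g y \<noteq> y" using f'(2) by blast
qed

lemma few_fixed_points_PSL2R: "few_fixed_points (lifts PSL2R)"
proof (rule few_fixed_pointsI)
  fix f X assume f: "f \<in> lifts PSL2R" "f \<noteq> 0" and X: "finite X" "\<forall>x\<in>X. ap f x = x" "\<forall>x\<in>X. \<forall>y\<in>X. y < x + 2 * pi"
  show "card X \<le> 2"
  proof (rule ccontr)
    assume "\<not> card X \<le> 2"
    then have "3 \<le> card X" by simp
    then obtain Y where "Y \<subseteq> X" "card Y = 3" using obtain_subset_with_card_n by metis
    then obtain a b d where abd: "a \<in> X" "b \<in> X" "d \<in> X" "a \<noteq> b" "a \<noteq> d" "b \<noteq> d" unfolding card_3_iff by blast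
    have "pr f \<in> PSL2R" using f(1) by simp
    then obtain p q where pq: "cmod q < cmod p" "pr f = (\<lambda>z\<in>S1. mob p q z)" using PSL2R_is_mob by blast
    have fixed: "mob p q (cis x) = cis x" if "x \<in> X" for x
    proof -
      have "pr f (cis x) = cis x" using X(2) that by simp
      then show ?thesis unfolding pq(2) by simp
    qed
    have ne: "cis x \<noteq> cis y" if "x \<in> X" "y \<in> X" "x \<noteq> y" for x y using X(3) that by (intro cis_neq_near) auto
    have "mob p q w = w" if w: "w \<in> S1" for w
    proof (rule mob_three_fixed_points [OF _ _ _ _ _ _ _ pq(1) w])
      show "mob p q z = z" if "z \<in> {cis a, cis b, cis d}" for z using that fixed abd by blast
    qed (use ne abd in auto)
    then have "pr f = pr 0" unfolding pq(2) pr_zero by (intro restrict_ext) simp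
    then obtain m :: int where m: "f = shift (2 * pi * of_int m) + 0" using pr_eq_iff by blast
    have "ap f a = a" using X(2) abd(1) by blast
    then have "2 * pi * of_int m = 0" unfolding m by simp
    then show False using f(2) unfolding m by (simp add: shift_0)
  qed
qed

lemma separating_interpolates:
  assumes G: "subgroup G HomeoS1" and I: "interpolates_HomeoS1 G"
  shows "separating (lifts G)"
  unfolding separating_def
proof (intro allI impI)
  fix x y :: real assume xy: "x < y" "y < x + 2 * pi"
  obtain f where f: "ap f x = x" "ap f y \<noteq> y"
    using separating_PSL2R [unfolded separating_def, rule_format, OF xy] by blast
  obtain g0 where g0: "g0 \<in> G" "\<forall>z\<in>{cis x, cis y}. g0 z = pr f z"
    using I pr_in_HomeoS1 [of f] unfolding interpolates_HomeoS1_def by (metis (no_types, lifting) cis_in_S1 empty_subsetI finite.emptyI finite.insertI insert_subset)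
  obtain g1 where g1: "g0 = pr g1" using pr_surj subgroup.mem_carrier [OF G g0(1)] by blast
  have e: "pr g1 (cis x) = cis x" "pr g1 (cis y) = cis (ap f y)" using g0(2) f(1) unfolding g1 by simp_all
  obtain g where g: "pr g = pr g1" "ap g x = x" using adjust_lift [OF e(1)] by blast
  have "ap f x < ap f y" "ap f y < ap f x + 2 * pi" using xy ap_less_turn by simp_all
  then have "cis (ap f y) \<noteq> cis y" using f xy by (intro cis_neq_near) auto
  then have "ap g y \<noteq> y" using e(2) unfolding g(1) [symmetric] pr_cis by auto
  moreover have "g \<in> lifts G" using g0(1) g1 g(1) by simp
  ultimately show "\<exists>g\<in>lifts G. ap g x = x \<and> ap g y \<noteq> y" using g(2) by blast
qed

text \<open>A homeomorphism with more than \<open>n\<close> fixed points is interpolated at them and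
  at one moved point \<open>y\<close>; the latter keeps the interpolating lift from being the
  identity.\<close>

lemma many_fixed_points_interpolates:
  assumes G: "subgroup G HomeoS1" and I: "interpolates_HomeoS1 G"
  shows "\<not> few_fixed_points (lifts G)"
proof
  assume "few_fixed_points (lifts G)"
  from few_fixed_pointsE [OF this]
  obtain n where n: "\<And>g X. g \<in> lifts G \<Longrightarrow> g \<noteq> 0 \<Longrightarrow> finite X \<Longrightarrow> \<forall>x\<in>X. ap g x = x \<Longrightarrow>
    \<forall>x\<in>X. \<forall>y\<in>X. y < x + 2 * pi \<Longrightarrow> card X \<le> n" by metis
  define N where "N = real (Suc n)"
  have N: "N \<ge> 1" by (simp add: N_def)
  \<comment> \<open>The amplitude \<open>1 / (2 * N)\<close> keeps the derivative
    \<open>1 + cos (N * t) / 2\<close> positive.\<close>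
  define F where "F t = t + sin (N * t) / (2 * N)" for t
  have mono: "F a < F b" if "a < b" for a b
  proof (rule DERIV_pos_imp_increasing [OF that])
    fix t
    have "(F has_real_derivative 1 + cos (N * t) / 2) (at t)"
      unfolding F_def using N by (auto intro!: derivative_eq_intros simp: field_simps)
    moreover have "1 + cos (N * t) / 2 > 0" using cos_ge_minus_one [of "N * t"] by linarith
    ultimately show "\<exists>y. (F has_real_derivative y) (at t) \<and> 0 < y" by blast
  qed
  have per: "F (t + 2 * pi) = F t + 2 * pi" for t
  proof -
    have "sin (N * t + 2 * pi * of_int (int (Suc n))) = sin (N * t)"
      by (simp only: sin_add sin_int_2pin cos_int_2pin)
    moreover have "N * (t + 2 * pi) = N * t + 2 * pi * of_int (int (Suc n))" by (simp add: N_def algebra_simps)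
    ultimately show ?thesis unfolding F_def by simp
  qed
  have apF: "ap (Lift F) = F"
    by (rule ap_Lift) (use mono per N in \<open>auto simp: strict_mono_def F_def intro!: continuous_intros\<close>)
  define X where "X = (\<lambda>j. 2 * pi * real j / N) ` {..n}"
  \<comment> \<open>Here the sine has its maximum, and \<open>y\<close> is moved by
    \<open>1 / (2 * N)\<close>.\<close>
  define y where "y = pi / (2 * N)"
  have FX: "F x = x" if "x \<in> X" for x
  proof -
    obtain j where j: "x = 2 * pi * real j / N" using \<open>x \<in> X\<close> by (auto simp: X_def)
    have "N * x = 2 * pi * of_int (int j)" using N by (simp add: j)
    then have "sin (N * x) = 0" by (simp only: sin_int_2pin)
    then show ?thesis by (simp add: F_def)
  qed
  have Fy: "F y = y + 1 / (2 * N)"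
  proof -
    have Ny: "N * y = pi / 2" using N by (simp add: y_def)
    show ?thesis unfolding F_def Ny by simp
  qed
  have Xb: "0 \<le> x" "x < 2 * pi" if "x \<in> X" for x
  proof -
    obtain j where j: "x = 2 * pi * real j / N" "j \<le> n" using \<open>x \<in> X\<close> by (auto simp: X_def)
    show "0 \<le> x" using N by (simp add: j)
    have "2 * pi * real j < 2 * pi * N" using j(2) by (intro mult_strict_left_mono) (auto simp: N_def)
    then show "x < 2 * pi" unfolding j using N by (simp add: divide_less_eq)
  qed
  have cardX: "card X = Suc n"
    unfolding X_def using N by (subst card_image) (auto simp: inj_on_def)
  have X0: "0 \<in> X" unfolding X_def by (rule image_eqI [of _ _ 0]) auto
  have finX: "finite X" by (simp add: X_def)
  have "finite (cis ` insert y X)" "cis ` insert y X \<subseteq> S1" using finX by auto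
  then obtain g0 where g0: "g0 \<in> G" "\<forall>z\<in>cis ` insert y X. g0 z = pr (Lift F) z"
    using I pr_in_HomeoS1 unfolding interpolates_HomeoS1_def by blast
  obtain g1 where g1: "g0 = pr g1" using pr_surj subgroup.mem_carrier [OF G g0(1)] by blast
  have e: "pr g1 (cis x) = cis (F x)" if "x \<in> insert y X" for x using g0(2) that unfolding g1 ball_simps pr_cis apF by blast
  have "pr g1 (cis 0) = cis 0" using e [of 0] X0 FX [OF X0] by simp
  then obtain g where g: "pr g = pr g1" "ap g 0 = 0" by (rule adjust_lift)
  have gL: "g \<in> lifts G" using g0(1) g1 g(1) by simp
  have eg: "cis (ap g x) = cis (F x)" if "x \<in> insert y X" for x using e [OF that] unfolding g(1) [symmetric] pr_cis .
  have "ap g x = x" if x: "x \<in> X" for x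
  proof (rule ccontr)
    assume ne: "ap g x \<noteq> x"
    have "ap g 0 \<le> ap g x" "ap g x < ap g 0 + 2 * pi" using Xb [OF x] ap_less_turn [of x 0 g] by simp_all
    then have "cis (ap g x) \<noteq> cis x" using ne Xb [OF x] g(2) by (intro cis_neq_near) auto
    then show False using eg [of x] FX [OF x] x by simp
  qed
  moreover have "g \<noteq> 0"
  proof
    assume "g = 0"
    then have eq: "cis y = cis (y + 1 / (2 * N))" using eg [of y] Fy by simp
    have "1 / (2 * N) \<le> 1" using N by (simp add: divide_le_eq)
    moreover have "0 < 1 / (2 * N)" using N by simp
    ultimately have "cis y \<noteq> cis (y + 1 / (2 * N))" using pi_ge_two by (intro cis_neq_near) linarith+
    then show False using eq by simp
  qed
  ultimately have "card X \<le> n"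
    using n [OF gL _ finX] Xb by (metis add.commute add_less_le_mono add_0_right)
  then show False using cardX by simp
qed

text \<open>Lifts are torsion-free: a point moved to one side never comes back under
  iteration.\<close>

lemma nmul_neq_0:
  assumes "f \<noteq> (0::lift)" "k > 0" shows "nmul k f \<noteq> 0"
proof -
  obtain y where "ap f y \<noteq> y" using assms(1) lift_eqI [of f 0] by auto
  then consider "y < ap f y" | "ap f y < y" by linarith
  then have "ap (nmul k f) y \<noteq> y"
  proof cases
    case 1
    have "y \<le> ap (nmul n f) y" for n
    proof (induction n)
      case (Suc n)
      then have "ap f y \<le> ap f (ap (nmul n f) y)" by simp
      then show ?case unfolding nmul.simps ap_plus using 1 by linarith
    qed simp
    from this [of "k - 1"] have "ap f y \<le> ap f (ap (nmul (k - 1) f) y)" by simp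
    moreover have e: "nmul k f = f + nmul (k - 1) f" using assms(2) by (cases k) auto
    ultimately show ?thesis unfolding e ap_plus using 1 by linarith
  next
    case 2
    have "ap (nmul n f) y \<le> y" for n
    proof (induction n)
      case (Suc n)
      then have "ap f (ap (nmul n f) y) \<le> ap f y" by simp
      then show ?case unfolding nmul.simps ap_plus using 2 by linarith
    qed simp
    from this [of "k - 1"] have "ap f (ap (nmul (k - 1) f) y) \<le> ap f y" by simp
    moreover have e: "nmul k f = f + nmul (k - 1) f" using assms(2) by (cases k) auto
    ultimately show ?thesis unfolding e ap_plus using 2 by linarith
  qed
  then show ?thesis by auto
qed

text \<open>An element fixing 0 also fixes \<open>ap root 0\<close>, which is less than a full turn
  away.\<close>

lemma (in cover) not_separating:
  assumes "k > 1" shows "\<not> separating (lifts G)"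
proof
  assume s: "separating (lifts G)"
  have "real k * (2 * pi / real k) = 2 * pi" "2 * pi / real k < 2 * pi / 1"
    using assms by (simp, intro divide_strict_left_mono) auto
  then have "ap c (ap root 0) < ap c 0 + 2 * pi" unfolding ap_c_root by simp
  then have "ap c (ap root 0) < ap c (0 + 2 * pi)" unfolding ap_add_2pi .
  then have "ap root 0 < 0 + 2 * pi" by (simp only: ap_less_iff)
  then obtain g where g: "g \<in> lifts G" "ap g 0 = 0" "ap g (ap root 0) \<noteq> ap root 0"
    using s root_greater [of 0] unfolding separating_def by blast
  then show False using root_commute [OF g(1), of 0] by simp
qed

text \<open>Let \<open>f\<close> fix 0 and move 1 to \<open>z\<close>. An element commuting with
  \<open>f\<close> fixes \<open>1\<close> if and only if it fixes \<open>z\<close>, yet separation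
  supplies one that fixes only one of them.\<close>

lemma not_commutative_separating:
  assumes comm: "\<And>f g. f \<in> L \<Longrightarrow> g \<in> L \<Longrightarrow> f + g = g + f" and s: "separating L"
  shows False
proof -
  have comm': "ap f (ap g x) = ap g (ap f x)" if "f \<in> L" "g \<in> L" for f g x
    using comm [OF that] ap_plus by metis
  have turn: "1 < 2 * pi" using pi_ge_two by simp
  then obtain f where f: "f \<in> L" "ap f 0 = 0" "ap f 1 \<noteq> 1"
    using s [unfolded separating_def, rule_format, of 0 1] by auto
  define z where "z = ap f 1"
  have "ap f 0 < ap f 1" "ap f 1 < ap f 0 + 2 * pi" using turn ap_less_turn [of 1 0 f] by simp_all
  then have z: "0 < z" "z < 2 * pi" using f(2) by (simp_all add: z_def)
  show False
  proof (cases "z < 1")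
    case True
    then obtain g where g: "g \<in> L" "ap g z = z" "ap g 1 \<noteq> 1"
      using s [unfolded separating_def, rule_format, of z 1] z turn by auto
    have "ap f (ap g 1) = ap f 1" using comm' [OF f(1) g(1), of 1] g(2) by (simp add: z_def)
    then show False using g(3) by simp
  next
    case False
    then have "1 < z" using f(3) by (simp add: z_def)
    then obtain g where g: "g \<in> L" "ap g 1 = 1" "ap g z \<noteq> z"
      using s [unfolded separating_def, rule_format, of 1 z] z by auto
    then show False using comm' [OF f(1) g(1), of 1] by (simp add: z_def)
  qed
qed

lemma conj_SO2R_commutative:
  assumes "conj_HomeoS1 G SO2R" "f \<in> lifts G" "g \<in> lifts G"
  shows "f + g = g + f"
proof -
  obtain c where c: "G = (\<lambda>h. pr (c + h - c)) ` lifts SO2R" using assms(1) unfolding conj_HomeoS1_iff [OF SO2R_subset] by blast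
  have *: "\<exists>s. f = c + shift s - c" if f: "f \<in> lifts G" for f
  proof -
    obtain h where h: "h \<in> lifts SO2R" "f = c + h - c" using f unfolding c lifts_conj by blast
    obtain s where "pr h = pr (shift s)" using h(1) unfolding mem_lifts SO2R_eq by blast
    then obtain m :: int where "h = shift (2 * pi * of_int m) + shift s" using pr_eq_iff by blast
    then show ?thesis unfolding h(2) shift_add by blast
  qed
  obtain s t where "f = c + shift s - c" "g = c + shift t - c" using * assms(2,3) by metis
  then show ?thesis by (simp only: conj_add shift_add add.commute [of s t])
qed

lemma (in cover) base_commutative:
  assumes comm: "\<And>f g. f \<in> lifts G \<Longrightarrow> g \<in> lifts G \<Longrightarrow> f + g = g + f"
    and "f \<in> lifts base" "g \<in> lifts base"
  shows "f + g = g + f"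
proof -
  obtain i :: int and f' where f: "f' \<in> lifts G" "f = shift (2 * pi * of_int i) + push f'" using lifts_baseE [OF assms(2)] by blast
  obtain j :: int and g' where g: "g' \<in> lifts G" "g = shift (2 * pi * of_int j) + push g'" using lifts_baseE [OF assms(3)] by blast
  have "push f' + push g' = push g' + push f'" using comm [OF f(1) g(1)] push_add [OF f(1) g(1)] push_add [OF g(1) f(1)] by simp
  then have pc: "ap (push f') (ap (push g') x) = ap (push g') (ap (push f') x)" for x by (metis ap_plus)
  show ?thesis unfolding f g by (rule lift_eqI) (simp add: pc)
qed

text \<open>A lift \<open>f\<close> of a base element is a push only up to \<open>m\<close> turns.
  Its \<open>k\<close>-th power is a push, because one turn upstairs covers \<open>k\<close> turns
  downstairs, and it keeps the fixed points of \<open>f\<close>.\<close>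

lemma (in cover) few_fixed_points_base:
  assumes "few_fixed_points (lifts G)" shows "few_fixed_points (lifts base)"
proof -
  obtain n where n: "\<And>g X. g \<in> lifts G \<Longrightarrow> g \<noteq> 0 \<Longrightarrow> finite X \<Longrightarrow> \<forall>x\<in>X. ap g x = x \<Longrightarrow>
    \<forall>x\<in>X. \<forall>y\<in>X. y < x + 2 * pi \<Longrightarrow> card X \<le> n"
    using few_fixed_pointsE [OF assms] by metis
  show ?thesis
  proof (rule few_fixed_pointsI)
    fix f X assume f: "f \<in> lifts base" "f \<noteq> 0" and X: "finite X" "\<forall>x\<in>X. ap f x = x" "\<forall>x\<in>X. \<forall>y\<in>X. y < x + 2 * pi"
    obtain m :: int and g where g: "g \<in> lifts G" "f = shift (2 * pi * of_int m) + push g" using lifts_baseE [OF f(1)] by blast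
    define g' where "g' = shift (2 * pi * of_int m) + nmul k g"
    have g'L: "g' \<in> lifts G"
      unfolding g'_def using L(3) [OF shift_in_lifts [OF subgroup_G]] push_nmul [OF g(1)] by blast
    have pg': "push g' = nmul k f"
      unfolding g'_def g(2) nmul_deck_add
      using push_add [OF shift_in_lifts [OF subgroup_G], of "nmul k g" m] push_nmul [OF g(1), of k] push_deck [of m]
      by (simp add: mult.commute [of m] del: mem_lifts)
    have "push g' \<noteq> 0" unfolding pg' by (rule nmul_neq_0 [OF f(2) k])
    then have g'0: "g' \<noteq> 0" by auto
    let ?r = "\<lambda>u. ap (- c) (u / real k)"
    have "card (?r ` X) \<le> n"
    proof (rule n [OF g'L g'0])
      show "finite (?r ` X)" using X(1) by simp
      show "\<forall>x\<in>?r ` X. ap g' x = x"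
      proof
        fix x assume "x \<in> ?r ` X"
        then obtain u where u: "u \<in> X" "x = ?r u" by blast
        have "ap (nmul i f) u = u" for i using X(2) u(1) by (induction i) auto
        then have "qq (ap g' x) = qq x" using ap_push [OF g'L, of x] pg' u(2) by simp
        then show "ap g' x = x" by simp
      qed
      show "\<forall>x\<in>?r ` X. \<forall>y\<in>?r ` X. y < x + 2 * pi"
      proof clarify
        fix u v assume uv: "u \<in> X" "v \<in> X"
        have "v < u + 2 * pi * 1" using X(3) uv by simp
        also have "\<dots> \<le> u + 2 * pi * real k" using k by (intro add_left_mono mult_left_mono) auto
        also have "\<dots> = qq (?r u + 2 * pi)" using qq_add_int [of "?r u" 1] by simp
        finally have "qq (?r v) < qq (?r u + 2 * pi)" by simp
        then show "?r v < ?r u + 2 * pi" by (simp only: qq_less)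
      qed
    qed
    moreover have "card (?r ` X) = card X" by (rule card_image) (use k in \<open>simp add: inj_on_def\<close>)
    ultimately show "card X \<le> n" by simp
  qed
qed

text \<open>One turn upstairs covers \<open>k\<close> turns downstairs, each of which contains at
  most \<open>n\<close> fixed points.\<close>

lemma (in cover) few_fixed_points_cover:
  assumes "few_fixed_points (lifts base)" shows "few_fixed_points (lifts G)"
proof -
  obtain n where n: "\<And>g X. g \<in> lifts base \<Longrightarrow> g \<noteq> 0 \<Longrightarrow> finite X \<Longrightarrow> \<forall>x\<in>X. ap g x = x \<Longrightarrow>
    \<forall>x\<in>X. \<forall>y\<in>X. y < x + 2 * pi \<Longrightarrow> card X \<le> n"
    using few_fixed_pointsE [OF assms] by metis
  have "card X \<le> k * n" if g: "g \<in> lifts G" "g \<noteq> 0" and X: "finite X" "\<forall>x\<in>X. ap g x = x" "\<forall>x\<in>X. \<forall>y\<in>X. y < x + 2 * pi" for g X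
  proof (cases "X = {}")
    case False
    have pg: "push g \<in> lifts base" "push g \<noteq> 0" using push_in_base [OF g(1)] push_eq_iff [OF g(1) L(1)] g(2) by simp_all
    define a where "a = Min X"
    have a: "a \<in> X" "\<And>x. x \<in> X \<Longrightarrow> a \<le> x" using X(1) False by (simp_all add: a_def)
    define Y where "Y i = {u \<in> qq ` X. qq a + 2 * pi * real i \<le> u \<and> u < qq a + 2 * pi * (real i + 1)}" for i
    have fin: "finite (Y i)" for i using X(1) by (simp add: Y_def)
    have cY: "card (Y i) \<le> n" for i
    proof (rule n [OF pg fin])
      show "\<forall>u\<in>Y i. ap (push g) u = u" using X(2) ap_push [OF g(1)] by (auto simp: Y_def simp del: mem_lifts)
      show "\<forall>u\<in>Y i. \<forall>v\<in>Y i. v < u + 2 * pi"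
      proof (intro ballI)
        fix u v assume "u \<in> Y i" "v \<in> Y i"
        then have "qq a + 2 * pi * real i \<le> u" "v < qq a + 2 * pi * (real i + 1)" by (auto simp: Y_def)
        then show "v < u + 2 * pi" by (simp add: distrib_left)
      qed
    qed
    have "qq ` X \<subseteq> (\<Union>i<k. Y i)"
    proof
      fix u assume u: "u \<in> qq ` X"
      then obtain x where x: "x \<in> X" "u = qq x" by blast
      have "qq x < qq (a + 2 * pi)" using X(3) a(1) x(1) by simp
      moreover have "qq (a + 2 * pi) = qq a + 2 * pi * real k" using qq_add_int [of a 1] by simp
      ultimately have ub: "u < qq a + 2 * pi * real k" unfolding x(2) by linarith
      have "\<not> qq x < qq a" using a(2) [OF x(1)] by simp
      then have lb: "qq a \<le> u" unfolding x(2) by linarith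
      define i where "i = nat \<lfloor>(u - qq a) / (2 * pi)\<rfloor>"
      have "0 \<le> (u - qq a) / (2 * pi)" using lb by simp
      then have i: "real i \<le> (u - qq a) / (2 * pi)" "(u - qq a) / (2 * pi) < real i + 1"
        unfolding i_def by linarith+
      have "(u - qq a) / (2 * pi) < real k" using ub by (simp add: divide_less_eq mult.commute)
      then have "i < k" using i(1) by linarith
      moreover have "u \<in> Y i" using u i by (simp add: Y_def field_simps)
      ultimately show "u \<in> (\<Union>i<k. Y i)" by blast
    qed
    then have "card (qq ` X) \<le> card (\<Union>i<k. Y i)" using fin by (intro card_mono) auto
    also have "\<dots> \<le> (\<Sum>i<k. card (Y i))" by (rule card_UN_le) simp
    also have "\<dots> \<le> (\<Sum>i<k. n)" by (intro sum_mono cY)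
    finally have "card (qq ` X) \<le> k * n" by simp
    moreover have "card (qq ` X) = card X" by (rule card_image) (simp add: inj_on_def)
    ultimately show ?thesis by simp
  qed simp
  then show ?thesis by (rule few_fixed_pointsI)
qed

lemma conj_PSL2R_properties:
  assumes "conj_HomeoS1 G PSL2R" shows "separating (lifts G)" "few_fixed_points (lifts G)"
proof -
  obtain c where c: "G = (\<lambda>h. pr (c + h - c)) ` lifts PSL2R" using assms unfolding conj_HomeoS1_iff [OF PSL2R_subset] by blast
  show "separating (lifts G)" unfolding c lifts_conj by (rule separating_conj [OF separating_PSL2R])
  show "few_fixed_points (lifts G)" unfolding c lifts_conj by (rule few_fixed_points_conj [OF few_fixed_points_PSL2R])
qed

lemma exactly_one_of_five:
  assumes "p0 \<or> p1 \<or> p2 \<or> p3 \<or> p4" and "p0 \<Longrightarrow> \<not> (p1 \<or> p2 \<or> p3 \<or> p4)" and "p1 \<Longrightarrow> \<not> (p2 \<or> p3 \<or> p4)"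
    and "p2 \<Longrightarrow> \<not> (p3 \<or> p4)" and "p3 \<Longrightarrow> \<not> p4"
  shows "\<exists>!i. i < 5 \<and> [p0, p1, p2, p3, p4] ! i"
proof -
  have five: "i < 5 \<and> [p0, p1, p2, p3, p4] ! i \<longleftrightarrow> i = 0 \<and> p0 \<or> i = 1 \<and> p1 \<or> i = 2 \<and> p2 \<or> i = 3 \<and> p3 \<or> i = 4 \<and> p4" for i
    by (auto simp: less_Suc_eq numeral_eq_Suc)
  show ?thesis unfolding five using assms by blast
qed

theorem theorem1p1:
  fixes G :: "(complex \<Rightarrow> complex) set"
  assumes "subgroup G HomeoS1"
    and "circle_transitive G"
    and "has_nonconstant_path G"
  shows "(\<exists>!i. i < 5 \<and>
           [conj_HomeoS1 G SO2R,
            conj_HomeoS1 G PSL2R,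
            interpolates_HomeoS1 G,
            \<exists>k>1. \<exists>H. conj_HomeoS1 H PSL2R \<and> cyclic_cover k G H,
            \<exists>k>1. \<exists>H. subgroup H HomeoS1 \<and> interpolates_HomeoS1 H \<and> cyclic_cover k G H] ! i) \<and>
         ((\<exists>k>1. \<exists>H. conj_HomeoS1 H PSL2R \<and> cyclic_cover k G H) \<longrightarrow>
            (\<exists>k>1. conj_HomeoS1 G (PSLk2R k)))"
proof
  have cover4: "\<exists>k>1. \<exists>c. cover k c G \<and> conj_HomeoS1 (cover.base k c G) PSL2R"
    if "\<exists>k>1. \<exists>H. conj_HomeoS1 H PSL2R \<and> cyclic_cover k G H"
    using that cyclic_coverE by metis
  have cover5: "\<exists>k>1. \<exists>c. cover k c G \<and> interpolates_HomeoS1 (cover.base k c G)"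
    if "\<exists>k>1. \<exists>H. subgroup H HomeoS1 \<and> interpolates_HomeoS1 H \<and> cyclic_cover k G H"
    using that cyclic_coverE by metis
  \<comment> \<open>\<open>separating\<close> sets alternatives 2 and 3 apart from 1, 4 and 5;
    \<open>few_fixed_points\<close> tells 2 from 3 and 4 from 5; commutativity tells 1 from 4 and
    5.\<close>
  have 1: "\<not> separating (lifts G)" if "conj_HomeoS1 G SO2R"
    using not_commutative_separating conj_SO2R_commutative [OF that] by blast
  have 3: "separating (lifts G)" "\<not> few_fixed_points (lifts G)" if "interpolates_HomeoS1 G"
    using separating_interpolates many_fixed_points_interpolates assms(1) that by blast+
  have 4: "\<not> separating (lifts G)" "few_fixed_points (lifts G)" "\<not> conj_HomeoS1 G SO2R"
    if p: "\<exists>k>1. \<exists>H. conj_HomeoS1 H PSL2R \<and> cyclic_cover k G H"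
  proof -
    obtain k c where k1: "k > 1" and V: "cover k c G" and b: "conj_HomeoS1 (cover.base k c G) PSL2R" using cover4 [OF p] by blast
    interpret cover k c G by fact
    show "\<not> separating (lifts G)" by (rule not_separating [OF k1])
    show "few_fixed_points (lifts G)" by (rule few_fixed_points_cover [OF conj_PSL2R_properties(2) [OF b]])
    show "\<not> conj_HomeoS1 G SO2R"
    proof
      assume "conj_HomeoS1 G SO2R"
      note comm = base_commutative [OF conj_SO2R_commutative [OF this]]
      show False by (rule not_commutative_separating [OF comm conj_PSL2R_properties(1) [OF b]])
    qed
  qed
  have 5: "\<not> separating (lifts G)" "\<not> few_fixed_points (lifts G)" "\<not> conj_HomeoS1 G SO2R"
    if p: "\<exists>k>1. \<exists>H. subgroup H HomeoS1 \<and> interpolates_HomeoS1 H \<and> cyclic_cover k G H"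
  proof -
    obtain k c where k1: "k > 1" and V: "cover k c G" and b: "interpolates_HomeoS1 (cover.base k c G)" using cover5 [OF p] by blast
    interpret cover k c G by fact
    show "\<not> separating (lifts G)" by (rule not_separating [OF k1])
    show "\<not> few_fixed_points (lifts G)"
      using few_fixed_points_base many_fixed_points_interpolates [OF subgroup_base b] by blast
    show "\<not> conj_HomeoS1 G SO2R"
    proof
      assume "conj_HomeoS1 G SO2R"
      note comm = base_commutative [OF conj_SO2R_commutative [OF this]]
      show False by (rule not_commutative_separating [OF comm separating_interpolates [OF subgroup_base b]])
    qed
  qed
  have ex: "conj_HomeoS1 G SO2R \<or> conj_HomeoS1 G PSL2R \<or> interpolates_HomeoS1 G \<or>
      (\<exists>k>1. \<exists>H. conj_HomeoS1 H PSL2R \<and> cyclic_cover k G H) \<or>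
      (\<exists>k>1. \<exists>H. subgroup H HomeoS1 \<and> interpolates_HomeoS1 H \<and> cyclic_cover k G H)"
    using cover_alternative [OF assms] cover.cyclic_cover_base cover.subgroup_base by metis
  show "\<exists>!i. i < 5 \<and>
           [conj_HomeoS1 G SO2R,
            conj_HomeoS1 G PSL2R,
            interpolates_HomeoS1 G,
            \<exists>k>1. \<exists>H. conj_HomeoS1 H PSL2R \<and> cyclic_cover k G H,
            \<exists>k>1. \<exists>H. subgroup H HomeoS1 \<and> interpolates_HomeoS1 H \<and> cyclic_cover k G H] ! i"
    by (rule exactly_one_of_five [OF ex]) (use 1 conj_PSL2R_properties [of G] 3 4 5 in argo)+
  show "(\<exists>k>1. \<exists>H. conj_HomeoS1 H PSL2R \<and> cyclic_cover k G H) \<longrightarrow> (\<exists>k>1. conj_HomeoS1 G (PSLk2R k))"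
    using cover4 cover.conj_PSLk2R by metis
qed

end
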